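(* Let $V$ be a finite dimensional $\Gamma$-graded vector space and $N$ a positive integer. Let $\pi_N:\mathrm U(\mathfrak{gl}(V))\to\mathrm{End}_{\mathbb C}(V^{\otimes N})$ be the natural representation and let $\nu_N:\mathbb C\mathrm{Sym}_N\to\mathrm{End}_{\mathbb C}(V^{\otimes N})$ be the representation of the symmetric group determined by the commutative factor. (1) With respect to the joint action of $\mathfrak{gl}(V)$ and $\mathrm{Sym}_N$ there is the multiplicity free decomposition $$V^{\otimes N}=\bigoplus_{\lambda}L_{\lambda^\sharp}\otimes S_\lambda,$$ where the sum is over all partitions $\lambda\vdash N$ with $\lambda_{M_++1}\le M_-$, $S_\lambda$ is the simple $\mathbb C\mathrm{Sym}_N$-module (Specht module) associated with $\lambda$, and $\lambda^\sharp=(\lambda^+,\lambda^-)$ is determined by $\lambda$ as follows: the Young diagram of $\lambda^+$ consists of the first $M_+$ rows of $\lambda$, and the transpose of $\lambda^-$ is the skew diagram $\lambda/\lambda^+$. (2) Consequently, $$\mathrm{End}_{\mathrm{Sym}_N}(V^{\otimes N})=\pi_N(\mathrm U(\mathfrak{gl}(V))),\qquad \mathrm{End}_{\mathfrak{gl}(V)}(V^{\otimes N})=\nu_N(\mathbb C\mathrm{Sym}_N).$$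
   Context: All vector spaces are over $\mathbb C$. $\Gamma$ is an additive abelian group with a commutative factor $\omega:\Gamma\times\Gamma\to\mathbb C^*$, i.e. $\omega(\alpha,\beta)=\omega(\beta,\alpha)^{-1}$ and $\omega$ is multiplicative in each argument. $\Gamma^\pm=\{\alpha:\omega(\alpha,\alpha)=\pm1\}$. $d(x)$ is the degree of a homogeneous element; formulas with $d$ are extended linearly. $V=\bigoplus_\alpha V_\alpha$ finite dimensional, $V_\pm=\bigoplus_{\alpha\in\Gamma^\pm}V_\alpha$, $M_\pm=\dim V_\pm$, $\Gamma_R=\{\alpha:V_\alpha\ne0\}$. $\mathfrak{gl}(V)=\mathrm{End}_{\mathbb C}(V)$ graded by $\mathfrak{gl}(V)_\alpha=\bigoplus_\beta\mathrm{Hom}(V_\beta,V_{\alpha+\beta})$ with bracket $[X,Y]=XY-\omega(d(X),d(Y))YX$. $\mathrm U(\mathfrak{gl}(V))$ is the quotient of the tensor algebra by the relations $XY-\omega(d(X),d(Y))YX=[X,Y]$. It acts on $V^{\otimes N}$ by $X(v_1\otimes\cdots\otimes v_N)=\sum_{j}\omega(d(X),d(v_1)+\cdots+d(v_{j-1}))\,v_1\otimes\cdots\otimes Xv_j\otimes\cdots\otimes v_N$. The transposition $s_i=(i,i+1)$ acts under $\nu_N$ by $v_1\otimes\cdots\otimes v_N\mapsto\omega(d(v_i),d(v_{i+1}))\,v_1\otimes\cdots\otimes v_{i+1}\otimes v_i\otimes\cdots\otimes v_N$. Fix a total order on $\Gamma_R$ with $\Gamma_R\cap\Gamma^+$ preceding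 $\Gamma_R\cap\Gamma^-$, and a homogeneous basis $(b_1,\dots,b_{\dim V})$ of $V$ with weakly increasing degrees. $E_{ab}$ are the matrix units ($E_{ab}b_c=\delta_{bc}b_a$), $\mathfrak h=\sum\mathbb CE_{aa}$, $\mathfrak n=\sum_{a<b}\mathbb CE_{ab}$. A tuple $\mu=(\mu_1,\dots,\mu_{\dim V})$ is identified with the weight $E_{aa}\mapsto\mu_a$; $L_\mu$ is the simple ($\Gamma$-graded) $\mathfrak{gl}(V)$-module generated by a nonzero vector $v$ with $\mathfrak nv=0$, $hv=\mu(h)v$ ($h\in\mathfrak h$). Here $\lambda^+$ is viewed as an $M_+$-tuple and $\lambda^-$ as an $M_-$-tuple. $\mathrm{End}_A$ denotes linear endomorphisms commuting with the action of $A$. *)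

theory Defs
  imports
    Complex_Main
    "HOL-Library.Poly_Mapping"
    "HOL-Library.FuncSet"
    "HOL-Combinatorics.Permutations"
begin

section \<open>Complex vector spaces\<close>

class complex_vector = ab_group_add +
  fixes scaleC :: "complex \<Rightarrow> 'a \<Rightarrow> 'a" (infixr \<open>*\<^sub>C\<close> 75)
  assumes scaleC_add_right: "c *\<^sub>C (x + y) = c *\<^sub>C x + c *\<^sub>C y"
    and scaleC_add_left: "(c + d) *\<^sub>C x = c *\<^sub>C x + d *\<^sub>C x"
    and scaleC_scaleC: "c *\<^sub>C (d *\<^sub>C x) = (c * d) *\<^sub>C x"
    and scaleC_one: "1 *\<^sub>C x = x"

global_interpretation cvec: vector_space "scaleC :: complex \<Rightarrow> 'a::complex_vector \<Rightarrow> 'a"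
  by unfold_locales (rule scaleC_add_right scaleC_add_left scaleC_scaleC scaleC_one)+

instantiation complex :: complex_vector
begin
definition scaleC_complex :: "complex \<Rightarrow> complex \<Rightarrow> complex"
  where "scaleC_complex c x = c * x"
instance by standard (simp_all add: scaleC_complex_def algebra_simps)
end

instantiation poly_mapping :: (type, complex_vector) complex_vector
begin
definition scaleC_poly_mapping :: "complex \<Rightarrow> ('a \<Rightarrow>\<^sub>0 'b) \<Rightarrow> ('a \<Rightarrow>\<^sub>0 'b)"
  where "scaleC_poly_mapping c p = Poly_Mapping.map (scaleC c) p"
lemma lookup_scaleC: "Poly_Mapping.lookup (c *\<^sub>C p) x = c *\<^sub>C Poly_Mapping.lookup p x"
  by (simp add: scaleC_poly_mapping_def Poly_Mapping.map.rep_eq when_def)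
instance
  by standard
    (simp_all add: poly_mapping_eq_iff fun_eq_iff lookup_scaleC lookup_add
      scaleC_add_right scaleC_add_left scaleC_scaleC scaleC_one)
end

text \<open>Linear extension of a map defined on the basis of the free vector space on a type.\<close>

definition lin_ext :: "('x \<Rightarrow> 'b::complex_vector) \<Rightarrow> ('x \<Rightarrow>\<^sub>0 complex) \<Rightarrow> 'b"
  where "lin_ext \<phi> p = (\<Sum>x\<in>Poly_Mapping.keys p. Poly_Mapping.lookup p x *\<^sub>C \<phi> x)"

lemma lin_ext_superset:
  assumes "finite A" "Poly_Mapping.keys p \<subseteq> A"
  shows "lin_ext \<phi> p = (\<Sum>x\<in>A. Poly_Mapping.lookup p x *\<^sub>C \<phi> x)"
  unfolding lin_ext_def
  by (rule sum.mono_neutral_left) (use assms in \<open>auto simp: in_keys_iff\<close>)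

lemma lin_ext_add: "lin_ext \<phi> (p + q) = lin_ext \<phi> p + lin_ext \<phi> q"
proof -
  let ?A = "Poly_Mapping.keys p \<union> Poly_Mapping.keys q"
  have "Poly_Mapping.keys (p + q) \<subseteq> ?A" by (rule Poly_Mapping.keys_add)
  then show ?thesis
    by (simp add: lin_ext_superset[where A = ?A] lookup_add scaleC_add_left sum.distrib)
qed

lemma lin_ext_scale: "lin_ext \<phi> (c *\<^sub>C p) = c *\<^sub>C lin_ext \<phi> p"
proof -
  have "Poly_Mapping.keys (c *\<^sub>C p) \<subseteq> Poly_Mapping.keys p"
    by (auto simp: in_keys_iff lookup_scaleC)
  then show ?thesis
    by (simp add: lin_ext_superset[where A = "Poly_Mapping.keys p"] lookup_scaleC
        scaleC_complex_def scaleC_scaleC cvec.scale_sum_right)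
qed

lemma lin_ext_single: "lin_ext \<phi> (Poly_Mapping.single x 1) = \<phi> x"
  by (simp add: lin_ext_def)

lemma linear_scaleC_iff:
  fixes f :: "'a::complex_vector \<Rightarrow> 'b::complex_vector"
  shows "Vector_Spaces.linear scaleC scaleC f \<longleftrightarrow>
    (\<forall>x y. f (x + y) = f x + f y) \<and> (\<forall>c x. f (c *\<^sub>C x) = c *\<^sub>C f x)"
  by (auto simp: Vector_Spaces.linear_def module_hom_def module_hom_axioms_def
      cvec.module_axioms cvec.vector_space_axioms)

lemma linear_lin_ext: "Vector_Spaces.linear scaleC scaleC (lin_ext \<phi>)"
  by (simp add: linear_scaleC_iff lin_ext_add lin_ext_scale)

definition linear_on :: "'a::complex_vector set \<Rightarrow> ('a \<Rightarrow> 'b::complex_vector) \<Rightarrow> bool"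
  where "linear_on W f \<longleftrightarrow>
    (\<forall>x\<in>W. \<forall>y\<in>W. f (x + y) = f x + f y) \<and> (\<forall>c. \<forall>x\<in>W. f (c *\<^sub>C x) = c *\<^sub>C f x)"

definition End_on :: "'a::complex_vector set \<Rightarrow> ('a \<Rightarrow> 'a) set"
  where "End_on W = {f \<in> W \<rightarrow>\<^sub>E W. linear_on W f}"

definition direct_sum :: "'i set \<Rightarrow> ('i \<Rightarrow> 'a::complex_vector set) \<Rightarrow> 'a set \<Rightarrow> bool"
  where "direct_sum I U W \<longleftrightarrow>
    (\<forall>i\<in>I. cvec.subspace (U i)) \<and>
    W = cvec.span (\<Union>i\<in>I. U i) \<and>
    (\<forall>J f. finite J \<and> J \<subseteq> I \<and> (\<forall>j\<in>J. f j \<in> U j) \<and> (\<Sum>j\<in>J. f j) = 0 \<longrightarrow> (\<forall>j\<in>J. f j = 0))"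

text \<open>The degree-\<open>\<alpha>\<close> component of \<open>x\<close> with respect to a grading \<open>G\<close>.\<close>

definition hpart :: "('g \<Rightarrow> 'a::complex_vector set) \<Rightarrow> 'g \<Rightarrow> 'a \<Rightarrow> 'a"
  where "hpart G \<alpha> x =
    (THE f. (\<forall>\<beta>. f \<beta> \<in> G \<beta>) \<and> finite {\<beta>. f \<beta> \<noteq> 0} \<and> x = (\<Sum>\<beta> | f \<beta> \<noteq> 0. f \<beta>)) \<alpha>"

definition degs :: "('g \<Rightarrow> 'a::complex_vector set) \<Rightarrow> 'g set"
  where "degs G = {\<alpha>. G \<alpha> \<noteq> {0}}"


section \<open>The tensor algebra\<close>

text \<open>The tensor algebra of \<open>'a\<close> is the free vector space on words over \<open>'a\<close> modulo
  multilinearity in each letter.\<close>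

definition tensor_relations :: "('a::complex_vector list \<Rightarrow>\<^sub>0 complex) set"
  where "tensor_relations =
    {Poly_Mapping.single (us @ (a + b) # ws) 1 - Poly_Mapping.single (us @ a # ws) 1
       - Poly_Mapping.single (us @ b # ws) 1 | us a b ws. True} \<union>
    {Poly_Mapping.single (us @ (c *\<^sub>C a) # ws) 1 - c *\<^sub>C Poly_Mapping.single (us @ a # ws) 1
       | us c a ws. True}"

definition tensor_eq ::
  "('a::complex_vector list \<Rightarrow>\<^sub>0 complex) \<Rightarrow> ('a list \<Rightarrow>\<^sub>0 complex) \<Rightarrow> bool"
  where "tensor_eq p q \<longleftrightarrow> p - q \<in> cvec.span tensor_relations"

lemma equivp_span: "equivp (\<lambda>p q. p - q \<in> cvec.span R)"
proof (rule equivpI)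
  show "reflp (\<lambda>p q. p - q \<in> cvec.span R)"
    by (simp add: reflp_def cvec.span_zero)
  show "symp (\<lambda>p q. p - q \<in> cvec.span R)"
    unfolding symp_def by (metis cvec.span_neg minus_diff_eq)
  show "transp (\<lambda>p q. p - q \<in> cvec.span R)"
    unfolding transp_def by (metis cvec.span_add diff_add_cancel add_diff_eq)
qed

lemma diff_span_add:
  assumes "p - p' \<in> cvec.span R" "q - q' \<in> cvec.span R"
  shows "(p + q) - (p' + q') \<in> cvec.span R"
  using cvec.span_add[OF assms] by (simp add: algebra_simps)

lemma diff_span_diff:
  assumes "p - p' \<in> cvec.span R" "q - q' \<in> cvec.span R"
  shows "(p - q) - (p' - q') \<in> cvec.span R"
  using cvec.span_diff[OF assms] by (simp add: algebra_simps)

lemma diff_span_uminus: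
  assumes "p - p' \<in> cvec.span R"
  shows "(- p) - (- p') \<in> cvec.span R"
  using cvec.span_neg[OF assms] by (simp add: algebra_simps)

lemma diff_span_scale:
  assumes "p - p' \<in> cvec.span R"
  shows "c *\<^sub>C p - c *\<^sub>C p' \<in> cvec.span R"
  using cvec.span_scale[OF assms, of c] by (simp add: cvec.scale_right_diff_distrib)

quotient_type (overloaded) 'a tensor = "'a::complex_vector list \<Rightarrow>\<^sub>0 complex" / tensor_eq
  unfolding tensor_eq_def by (rule equivp_span)

instantiation tensor :: (complex_vector) complex_vector
begin
lift_definition zero_tensor :: "'a tensor" is 0 .
lift_definition plus_tensor :: "'a tensor \<Rightarrow> 'a tensor \<Rightarrow> 'a tensor" is "(+)"
  unfolding tensor_eq_def by (rule diff_span_add)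
lift_definition minus_tensor :: "'a tensor \<Rightarrow> 'a tensor \<Rightarrow> 'a tensor" is "(-)"
  unfolding tensor_eq_def by (rule diff_span_diff)
lift_definition uminus_tensor :: "'a tensor \<Rightarrow> 'a tensor" is uminus
  unfolding tensor_eq_def by (rule diff_span_uminus)
lift_definition scaleC_tensor :: "complex \<Rightarrow> 'a tensor \<Rightarrow> 'a tensor" is scaleC
  unfolding tensor_eq_def by (rule diff_span_scale)
instance
  by standard (transfer; simp add: tensor_eq_def cvec.span_zero algebra_simps)+
end

text \<open>\<open>tensor [v\<^sub>1, \<dots>, v\<^sub>k]\<close> is \<open>v\<^sub>1 \<otimes> \<dots> \<otimes> v\<^sub>k\<close>.\<close>

lift_definition tensor :: "'a::complex_vector list \<Rightarrow> 'a tensor"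
  is "\<lambda>vs. Poly_Mapping.single vs 1" .

definition tensor_power :: "nat \<Rightarrow> 'a::complex_vector tensor set"
  where "tensor_power N = cvec.span {tensor vs | vs. length vs = N}"

text \<open>The linear map on the tensor algebra induced by a multilinear map on words.\<close>

definition tensor_lift :: "('a::complex_vector list \<Rightarrow> 'b::complex_vector) \<Rightarrow> 'a tensor \<Rightarrow> 'b"
  where "tensor_lift \<phi> t = lin_ext \<phi> (rep_tensor t)"

definition multilinear :: "('a::complex_vector list \<Rightarrow> 'b::complex_vector) \<Rightarrow> bool"
  where "multilinear \<phi> \<longleftrightarrow>
    (\<forall>us a b ws. \<phi> (us @ (a + b) # ws) = \<phi> (us @ a # ws) + \<phi> (us @ b # ws)) \<and>
    (\<forall>us c a ws. \<phi> (us @ (c *\<^sub>C a) # ws) = c *\<^sub>C \<phi> (us @ a # ws))"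

lemma multilinear_tensor: "multilinear tensor"
  unfolding multilinear_def
proof (intro conjI allI)
  fix us :: "'a list" and a b ws
  show "tensor (us @ (a + b) # ws) = tensor (us @ a # ws) + tensor (us @ b # ws)"
    by transfer
      (unfold tensor_eq_def tensor_relations_def, rule cvec.span_base,
       auto simp: diff_diff_eq)
next
  fix us :: "'a list" and c a ws
  show "tensor (us @ (c *\<^sub>C a) # ws) = c *\<^sub>C tensor (us @ a # ws)"
    by transfer (unfold tensor_eq_def tensor_relations_def, rule cvec.span_base, blast)
qed

lemma lin_ext_tensor_eq:
  assumes "multilinear \<phi>" "tensor_eq p q"
  shows "lin_ext \<phi> p = lin_ext \<phi> q"
proof -
  interpret l: Vector_Spaces.linear scaleC scaleC "lin_ext \<phi>"
    by (rule linear_lin_ext)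
  have "lin_ext \<phi> x = 0" if "x \<in> cvec.span tensor_relations" for x
    using that
  proof (induction rule: cvec.span_induct_alt)
    case base
    show ?case by (rule l.zero)
  next
    case (step c x y)
    have "lin_ext \<phi> x = 0"
      using step(1) assms(1)
      by (auto simp: tensor_relations_def l.diff l.scale lin_ext_single multilinear_def)
    then show ?case using step by (simp add: l.add l.scale)
  qed
  then have "lin_ext \<phi> (p - q) = 0"
    using assms(2) by (simp add: tensor_eq_def)
  then show ?thesis by (simp add: l.diff)
qed

lemma tensor_lift_abs:
  assumes "multilinear \<phi>"
  shows "tensor_lift \<phi> (abs_tensor p) = lin_ext \<phi> p"
  unfolding tensor_lift_def
  by (rule lin_ext_tensor_eq[OF assms])
    (rule Quotient3_rep_abs[OF Quotient3_tensor], simp add: tensor_eq_def cvec.span_zero)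

lemma tensor_lift_tensor: "multilinear \<phi> \<Longrightarrow> tensor_lift \<phi> (tensor vs) = \<phi> vs"
  by (simp add: tensor.abs_eq tensor_lift_abs lin_ext_single)

lemma linear_tensor_lift:
  assumes "multilinear \<phi>"
  shows "Vector_Spaces.linear scaleC scaleC (tensor_lift \<phi>)"
proof -
  have surj: "\<exists>p. t = abs_tensor p" for t :: "'a tensor"
    by (metis Quotient3_abs_rep[OF Quotient3_tensor])
  have "tensor_lift \<phi> (s + t) = tensor_lift \<phi> s + tensor_lift \<phi> t" for s t
    using surj[of s] surj[of t]
    by (auto simp: plus_tensor.abs_eq tensor_lift_abs[OF assms] lin_ext_add)
  moreover have "tensor_lift \<phi> (c *\<^sub>C t) = c *\<^sub>C tensor_lift \<phi> t" for c t
    using surj[of t]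
    by (auto simp: scaleC_tensor.abs_eq tensor_lift_abs[OF assms] lin_ext_scale)
  ultimately show ?thesis
    by (simp add: linear_scaleC_iff)
qed


section \<open>The tensor product of two vector spaces\<close>

definition bilinear_relations :: "('a::complex_vector \<times> 'b::complex_vector \<Rightarrow>\<^sub>0 complex) set"
  where "bilinear_relations =
    {Poly_Mapping.single (a + a', b) 1 - Poly_Mapping.single (a, b) 1
       - Poly_Mapping.single (a', b) 1 | a a' b. True} \<union>
    {Poly_Mapping.single (a, b + b') 1 - Poly_Mapping.single (a, b) 1
       - Poly_Mapping.single (a, b') 1 | a b b'. True} \<union>
    {Poly_Mapping.single (c *\<^sub>C a, b) 1 - c *\<^sub>C Poly_Mapping.single (a, b) 1 | c a b. True} \<union>
    {Poly_Mapping.single (a, c *\<^sub>C b) 1 - c *\<^sub>C Poly_Mapping.single (a, b) 1 | c a b. True}"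

definition tprod_eq ::
  "('a::complex_vector \<times> 'b::complex_vector \<Rightarrow>\<^sub>0 complex) \<Rightarrow> ('a \<times> 'b \<Rightarrow>\<^sub>0 complex) \<Rightarrow> bool"
  where "tprod_eq p q \<longleftrightarrow> p - q \<in> cvec.span bilinear_relations"

quotient_type (overloaded) ('a, 'b) tprod =
  "'a::complex_vector \<times> 'b::complex_vector \<Rightarrow>\<^sub>0 complex" / tprod_eq
  unfolding tprod_eq_def by (rule equivp_span)

instantiation tprod :: (complex_vector, complex_vector) complex_vector
begin
lift_definition zero_tprod :: "('a, 'b) tprod" is 0 .
lift_definition plus_tprod :: "('a, 'b) tprod \<Rightarrow> ('a, 'b) tprod \<Rightarrow> ('a, 'b) tprod" is "(+)"
  unfolding tprod_eq_def by (rule diff_span_add)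
lift_definition minus_tprod :: "('a, 'b) tprod \<Rightarrow> ('a, 'b) tprod \<Rightarrow> ('a, 'b) tprod" is "(-)"
  unfolding tprod_eq_def by (rule diff_span_diff)
lift_definition uminus_tprod :: "('a, 'b) tprod \<Rightarrow> ('a, 'b) tprod" is uminus
  unfolding tprod_eq_def by (rule diff_span_uminus)
lift_definition scaleC_tprod :: "complex \<Rightarrow> ('a, 'b) tprod \<Rightarrow> ('a, 'b) tprod" is scaleC
  unfolding tprod_eq_def by (rule diff_span_scale)
instance
  by standard (transfer; simp add: tprod_eq_def cvec.span_zero algebra_simps)+
end

lift_definition pure_tensor :: "'a::complex_vector \<Rightarrow> 'b::complex_vector \<Rightarrow> ('a, 'b) tprod"
    (infixr \<open>\<otimes>\<close> 70)
  is "\<lambda>a b. Poly_Mapping.single (a, b) 1" .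

text \<open>For subspaces \<open>A\<close> and \<open>B\<close> this span is the image of the injective map from the tensor
  product of \<open>A\<close> and \<open>B\<close> to that of the ambient spaces.\<close>

definition tensor_product ::
    "'a::complex_vector set \<Rightarrow> 'b::complex_vector set \<Rightarrow> ('a, 'b) tprod set"
  where "tensor_product A B = cvec.span {a \<otimes> b | a b. a \<in> A \<and> b \<in> B}"


section \<open>Graded vector spaces and the general linear colour Lie algebra\<close>

definition commutative_factor :: "('g::ab_group_add \<Rightarrow> 'g \<Rightarrow> complex) \<Rightarrow> bool"
  where "commutative_factor \<omega> \<longleftrightarrow>
    (\<forall>\<alpha> \<beta>. \<omega> \<alpha> \<beta> \<noteq> 0) \<and>
    (\<forall>\<alpha> \<beta>. \<omega> \<alpha> \<beta> = inverse (\<omega> \<beta> \<alpha>)) \<and>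
    (\<forall>\<alpha> \<beta> \<gamma>. \<omega> (\<alpha> + \<beta>) \<gamma> = \<omega> \<alpha> \<gamma> * \<omega> \<beta> \<gamma>) \<and>
    (\<forall>\<alpha> \<beta> \<gamma>. \<omega> \<alpha> (\<beta> + \<gamma>) = \<omega> \<alpha> \<beta> * \<omega> \<alpha> \<gamma>)"

definition finite_dim_graded :: "('g \<Rightarrow> 'v::complex_vector set) \<Rightarrow> bool"
  where "finite_dim_graded V \<longleftrightarrow>
    direct_sum UNIV V UNIV \<and> (\<exists>B :: 'v set. finite B \<and> cvec.span B = UNIV)"

definition even_degrees :: "('g::ab_group_add \<Rightarrow> 'g \<Rightarrow> complex) \<Rightarrow> 'g set"
  where "even_degrees \<omega> = {\<alpha>. \<omega> \<alpha> \<alpha> = 1}"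

definition odd_degrees :: "('g::ab_group_add \<Rightarrow> 'g \<Rightarrow> complex) \<Rightarrow> 'g set"
  where "odd_degrees \<omega> = {\<alpha>. \<omega> \<alpha> \<alpha> = - 1}"

definition even_dim :: "('g::ab_group_add \<Rightarrow> 'g \<Rightarrow> complex) \<Rightarrow> ('g \<Rightarrow> 'v::complex_vector set) \<Rightarrow> nat"
  where "even_dim \<omega> V = cvec.dim (cvec.span (\<Union>\<alpha>\<in>even_degrees \<omega>. V \<alpha>))"

definition odd_dim :: "('g::ab_group_add \<Rightarrow> 'g \<Rightarrow> complex) \<Rightarrow> ('g \<Rightarrow> 'v::complex_vector set) \<Rightarrow> nat"
  where "odd_dim \<omega> V = cvec.dim (cvec.span (\<Union>\<alpha>\<in>odd_degrees \<omega>. V \<alpha>))"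

typedef (overloaded) 'v endo = "{f :: 'v::complex_vector \<Rightarrow> 'v. Vector_Spaces.linear scaleC scaleC f}"
  morphisms app_endo Abs_endo
  using cvec.linear_id by blast

setup_lifting type_definition_endo

instantiation endo :: (complex_vector) complex_vector
begin
lift_definition zero_endo :: "'a endo" is "\<lambda>_. 0"
  by (simp add: linear_scaleC_iff algebra_simps)
lift_definition plus_endo :: "'a endo \<Rightarrow> 'a endo \<Rightarrow> 'a endo" is "\<lambda>f g v. f v + g v"
  by (simp add: linear_scaleC_iff algebra_simps)
lift_definition minus_endo :: "'a endo \<Rightarrow> 'a endo \<Rightarrow> 'a endo" is "\<lambda>f g v. f v - g v"
  by (simp add: linear_scaleC_iff algebra_simps)
lift_definition uminus_endo :: "'a endo \<Rightarrow> 'a endo" is "\<lambda>f v. - f v"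
  by (simp add: linear_scaleC_iff algebra_simps)
lift_definition scaleC_endo :: "complex \<Rightarrow> 'a endo \<Rightarrow> 'a endo" is "\<lambda>c f v. c *\<^sub>C f v"
  by (simp add: linear_scaleC_iff algebra_simps)
instance
  by standard (transfer; simp add: fun_eq_iff algebra_simps)+
end

lift_definition comp_endo :: "'v::complex_vector endo \<Rightarrow> 'v endo \<Rightarrow> 'v endo" (infixl \<open>\<circ>\<^sub>e\<close> 55)
  is "\<lambda>f g. f \<circ> g"
  by (rule Vector_Spaces.linear_compose)

definition gl :: "('g::ab_group_add \<Rightarrow> 'v::complex_vector set) \<Rightarrow> 'g \<Rightarrow> 'v endo set"
  where "gl V \<alpha> = {X. \<forall>\<beta>. \<forall>v\<in>V \<beta>. app_endo X v \<in> V (\<alpha> + \<beta>)}"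

text \<open>The bracket of homogeneous elements \<open>X\<close>, \<open>Y\<close> of degrees \<open>\<alpha>\<close>, \<open>\<beta>\<close>.\<close>

definition bracket ::
    "('g::ab_group_add \<Rightarrow> 'g \<Rightarrow> complex) \<Rightarrow> 'g \<Rightarrow> 'g \<Rightarrow> 'v::complex_vector endo \<Rightarrow> 'v endo \<Rightarrow> 'v endo"
  where "bracket \<omega> \<alpha> \<beta> X Y = (X \<circ>\<^sub>e Y) - \<omega> \<alpha> \<beta> *\<^sub>C (Y \<circ>\<^sub>e X)"

text \<open>The enveloping algebra consists of the cosets in the tensor algebra of the two-sided ideal
  generated by the commutation relations; pure tensors spanning the tensor algebra, that ideal
  is the span of the relations multiplied by pure tensors on both sides.\<close>

definition U_ideal ::
    "('g::ab_group_add \<Rightarrow> 'g \<Rightarrow> complex) \<Rightarrow> ('g \<Rightarrow> 'v::complex_vector set) \<Rightarrow> 'v endo tensor set"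
  where "U_ideal \<omega> V = cvec.span
    {tensor (us @ [X, Y] @ ws) - \<omega> \<alpha> \<beta> *\<^sub>C tensor (us @ [Y, X] @ ws)
       - tensor (us @ [bracket \<omega> \<alpha> \<beta> X Y] @ ws) | us ws X Y \<alpha> \<beta>. X \<in> gl V \<alpha> \<and> Y \<in> gl V \<beta>}"

definition U_gl ::
    "('g::ab_group_add \<Rightarrow> 'g \<Rightarrow> complex) \<Rightarrow> ('g \<Rightarrow> 'v::complex_vector set) \<Rightarrow> 'v endo tensor set set"
  where "U_gl \<omega> V = UNIV // {(s, t). s - t \<in> U_ideal \<omega> V}"


section \<open>The two actions on tensor space\<close>

text \<open>Multilinear extension of \<open>F\<close>, where \<open>F \<beta>s vs\<close> is given for words \<open>vs\<close> whose \<open>i\<close>-th letter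
  is homogeneous of degree \<open>\<beta>s ! i\<close>.\<close>

definition extend_homogeneous ::
    "('g \<Rightarrow> 'v::complex_vector set) \<Rightarrow> ('g list \<Rightarrow> 'v list \<Rightarrow> 'b::complex_vector) \<Rightarrow> 'v list \<Rightarrow> 'b"
  where "extend_homogeneous V F vs =
    (\<Sum>\<beta>s | set \<beta>s \<subseteq> degs V \<and> length \<beta>s = length vs. F \<beta>s (map2 (hpart V) \<beta>s vs))"

definition gl_act ::
    "('g::ab_group_add \<Rightarrow> 'g \<Rightarrow> complex) \<Rightarrow> ('g \<Rightarrow> 'v::complex_vector set) \<Rightarrow>
     'v endo \<Rightarrow> 'v tensor \<Rightarrow> 'v tensor"
  where "gl_act \<omega> V X = tensor_lift (\<lambda>vs. \<Sum>\<xi>\<in>degs (gl V). extend_homogeneous V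
    (\<lambda>\<beta>s ws. \<Sum>j<length ws. \<omega> \<xi> (sum_list (take j \<beta>s)) *\<^sub>C
       tensor (ws[j := app_endo (hpart (gl V) \<xi> X) (ws ! j)])) vs)"

text \<open>Tensor positions are numbered from \<open>0\<close>. The value \<open>0\<close> on short words only serves to make
  the map multilinear on all words.\<close>

definition swap_act ::
    "('g::ab_group_add \<Rightarrow> 'g \<Rightarrow> complex) \<Rightarrow> ('g \<Rightarrow> 'v::complex_vector set) \<Rightarrow>
     nat \<Rightarrow> 'v tensor \<Rightarrow> 'v tensor"
  where "swap_act \<omega> V i = tensor_lift (extend_homogeneous V
    (\<lambda>\<beta>s ws. if Suc i < length ws
       then \<omega> (\<beta>s ! i) (\<beta>s ! Suc i) *\<^sub>C tensor (ws[i := ws ! Suc i, Suc i := ws ! i])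
       else 0))"

definition pi_rep ::
    "('g::ab_group_add \<Rightarrow> 'g \<Rightarrow> complex) \<Rightarrow> ('g \<Rightarrow> 'v::complex_vector set) \<Rightarrow> nat \<Rightarrow>
     'v endo tensor set \<Rightarrow> 'v tensor \<Rightarrow> 'v tensor"
  where "pi_rep \<omega> V N u = (\<lambda>x\<in>tensor_power N.
    the_elem ((\<lambda>t. tensor_lift (\<lambda>Xs. foldr (gl_act \<omega> V) Xs x) t) ` u))"

abbreviation Sym :: "nat \<Rightarrow> (nat \<Rightarrow> nat) set"
  where "Sym N \<equiv> {p. p permutes {..<N}}"

text \<open>The unique representation of the symmetric group with the prescribed values on the
  generators \<open>s\<^sub>i\<close>.\<close>

definition nu_sym ::
    "('g::ab_group_add \<Rightarrow> 'g \<Rightarrow> complex) \<Rightarrow> ('g \<Rightarrow> 'v::complex_vector set) \<Rightarrow> nat \<Rightarrow>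
     (nat \<Rightarrow> nat) \<Rightarrow> 'v tensor \<Rightarrow> 'v tensor"
  where "nu_sym \<omega> V N = (THE \<nu>.
    \<nu> \<in> Sym N \<rightarrow>\<^sub>E End_on (tensor_power N) \<and>
    \<nu> id = restrict id (tensor_power N) \<and>
    (\<forall>p\<in>Sym N. \<forall>q\<in>Sym N. \<nu> (p \<circ> q) = compose (tensor_power N) (\<nu> p) (\<nu> q)) \<and>
    (\<forall>i. Suc i < N \<longrightarrow>
       \<nu> (Transposition.transpose i (Suc i)) = restrict (swap_act \<omega> V i) (tensor_power N)))"

definition group_algebra :: "nat \<Rightarrow> ((nat \<Rightarrow> nat) \<Rightarrow>\<^sub>0 complex) set"
  where "group_algebra N = {a. Poly_Mapping.keys a \<subseteq> Sym N}"

definition nu_rep ::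
    "('g::ab_group_add \<Rightarrow> 'g \<Rightarrow> complex) \<Rightarrow> ('g \<Rightarrow> 'v::complex_vector set) \<Rightarrow> nat \<Rightarrow>
     ((nat \<Rightarrow> nat) \<Rightarrow>\<^sub>0 complex) \<Rightarrow> 'v tensor \<Rightarrow> 'v tensor"
  where "nu_rep \<omega> V N a = (\<lambda>x\<in>tensor_power N. lin_ext (\<lambda>p. nu_sym \<omega> V N p x) a)"

definition End_gl ::
    "('g::ab_group_add \<Rightarrow> 'g \<Rightarrow> complex) \<Rightarrow> ('g \<Rightarrow> 'v::complex_vector set) \<Rightarrow> nat \<Rightarrow>
     ('v tensor \<Rightarrow> 'v tensor) set"
  where "End_gl \<omega> V N = {f \<in> End_on (tensor_power N).
    \<forall>X. \<forall>x\<in>tensor_power N. f (gl_act \<omega> V X x) = gl_act \<omega> V X (f x)}"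

definition End_Sym ::
    "('g::ab_group_add \<Rightarrow> 'g \<Rightarrow> complex) \<Rightarrow> ('g \<Rightarrow> 'v::complex_vector set) \<Rightarrow> nat \<Rightarrow>
     ('v tensor \<Rightarrow> 'v tensor) set"
  where "End_Sym \<omega> V N = {f \<in> End_on (tensor_power N).
    \<forall>p\<in>Sym N. \<forall>x\<in>tensor_power N. f (nu_sym \<omega> V N p x) = nu_sym \<omega> V N p (f x)}"

definition tensor_grading ::
    "('g::ab_group_add \<Rightarrow> 'v::complex_vector set) \<Rightarrow> nat \<Rightarrow> 'g \<Rightarrow> 'v tensor set"
  where "tensor_grading V N \<gamma> =
    cvec.span {tensor vs | vs \<beta>s. length vs = N \<and> list_all2 (\<lambda>v \<beta>. v \<in> V \<beta>) vs \<beta>s \<and> sum_list \<beta>s = \<gamma>}"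

definition joint_submodule ::
    "('g::ab_group_add \<Rightarrow> 'g \<Rightarrow> complex) \<Rightarrow> ('g \<Rightarrow> 'v::complex_vector set) \<Rightarrow> nat \<Rightarrow>
     'v tensor set \<Rightarrow> bool"
  where "joint_submodule \<omega> V N W \<longleftrightarrow>
    cvec.subspace W \<and> W \<subseteq> tensor_power N \<and>
    (\<forall>X. \<forall>x\<in>W. gl_act \<omega> V X x \<in> W) \<and> (\<forall>p\<in>Sym N. \<forall>x\<in>W. nu_sym \<omega> V N p x \<in> W)"

definition joint_isomorphic ::
    "('g::ab_group_add \<Rightarrow> 'g \<Rightarrow> complex) \<Rightarrow> ('g \<Rightarrow> 'v::complex_vector set) \<Rightarrow> nat \<Rightarrow>
     'v tensor set \<Rightarrow> 'v tensor set \<Rightarrow> bool"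
  where "joint_isomorphic \<omega> V N W W' \<longleftrightarrow>
    (\<exists>f. linear_on W f \<and> bij_betw f W W' \<and>
      (\<forall>X. \<forall>x\<in>W. f (gl_act \<omega> V X x) = gl_act \<omega> V X (f x)) \<and>
      (\<forall>p\<in>Sym N. \<forall>x\<in>W. f (nu_sym \<omega> V N p x) = nu_sym \<omega> V N p (f x)))"

text \<open>The summands are simple for the joint action and pairwise non-isomorphic.\<close>

definition multiplicity_free_sum ::
    "('g::ab_group_add \<Rightarrow> 'g \<Rightarrow> complex) \<Rightarrow> ('g \<Rightarrow> 'v::complex_vector set) \<Rightarrow> nat \<Rightarrow>
     'i set \<Rightarrow> ('i \<Rightarrow> 'v tensor set) \<Rightarrow> bool"
  where "multiplicity_free_sum \<omega> V N I W \<longleftrightarrow>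
    direct_sum I W (tensor_power N) \<and>
    (\<forall>i\<in>I. joint_submodule \<omega> V N (W i) \<and> W i \<noteq> {0} \<and>
       (\<forall>K\<subseteq>W i. joint_submodule \<omega> V N K \<longrightarrow> K = {0} \<or> K = W i)) \<and>
    (\<forall>i\<in>I. \<forall>j\<in>I. i \<noteq> j \<longrightarrow> \<not> joint_isomorphic \<omega> V N (W i) (W j))"


section \<open>Simple highest weight modules\<close>

definition ordered_homogeneous_basis ::
    "('g::ab_group_add \<Rightarrow> 'g \<Rightarrow> complex) \<Rightarrow> ('g \<Rightarrow> 'v::complex_vector set) \<Rightarrow>
     ('g \<times> 'g) set \<Rightarrow> (nat \<Rightarrow> 'v) \<Rightarrow> bool"
  where "ordered_homogeneous_basis \<omega> V r b \<longleftrightarrow>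
    linear_order_on (degs V) r \<and>
    (\<forall>\<alpha>\<in>degs V \<inter> even_degrees \<omega>. \<forall>\<beta>\<in>degs V \<inter> odd_degrees \<omega>. (\<alpha>, \<beta>) \<in> r) \<and>
    inj_on b {..<cvec.dim (UNIV :: 'v set)} \<and>
    \<not> cvec.dependent (b ` {..<cvec.dim (UNIV :: 'v set)}) \<and>
    cvec.span (b ` {..<cvec.dim (UNIV :: 'v set)}) = UNIV \<and>
    (\<exists>d. (\<forall>a<cvec.dim (UNIV :: 'v set). b a \<in> V (d a)) \<and>
      (\<forall>c<cvec.dim (UNIV :: 'v set). \<forall>a\<le>c. (d a, d c) \<in> r))"

definition matrix_unit :: "(nat \<Rightarrow> 'v::complex_vector) \<Rightarrow> nat \<Rightarrow> nat \<Rightarrow> 'v endo"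
  where "matrix_unit b a c =
    Abs_endo (\<lambda>v. cvec.representation (b ` {..<cvec.dim (UNIV :: 'v set)}) v (b c) *\<^sub>C b a)"

text \<open>Modules \<open>L\<close> over the colour Lie algebra, with grading \<open>G\<close> and action \<open>\<rho>\<close>.\<close>

definition graded_gl_module ::
    "('g::ab_group_add \<Rightarrow> 'g \<Rightarrow> complex) \<Rightarrow> ('g \<Rightarrow> 'v::complex_vector set) \<Rightarrow>
     'l::complex_vector set \<Rightarrow> ('g \<Rightarrow> 'l set) \<Rightarrow> ('v endo \<Rightarrow> 'l \<Rightarrow> 'l) \<Rightarrow> bool"
  where "graded_gl_module \<omega> V L G \<rho> \<longleftrightarrow>
    direct_sum UNIV G L \<and>
    (\<forall>X. linear_on L (\<rho> X) \<and> \<rho> X \<in> L \<rightarrow> L) \<and>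
    (\<forall>x\<in>L. \<forall>X Y. \<rho> (X + Y) x = \<rho> X x + \<rho> Y x) \<and>
    (\<forall>x\<in>L. \<forall>c X. \<rho> (c *\<^sub>C X) x = c *\<^sub>C \<rho> X x) \<and>
    (\<forall>\<alpha> \<beta>. \<forall>X\<in>gl V \<alpha>. \<forall>Y\<in>gl V \<beta>. \<forall>x\<in>L.
       \<rho> (bracket \<omega> \<alpha> \<beta> X Y) x = \<rho> X (\<rho> Y x) - \<omega> \<alpha> \<beta> *\<^sub>C \<rho> Y (\<rho> X x)) \<and>
    (\<forall>\<alpha> \<beta>. \<forall>X\<in>gl V \<alpha>. \<forall>x\<in>G \<beta>. \<rho> X x \<in> G (\<alpha> + \<beta>))"

definition submodule ::
    "'l::complex_vector set \<Rightarrow> ('v::complex_vector endo \<Rightarrow> 'l \<Rightarrow> 'l) \<Rightarrow> 'l set \<Rightarrow> bool"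
  where "submodule L \<rho> K \<longleftrightarrow> cvec.subspace K \<and> K \<subseteq> L \<and> (\<forall>X. \<rho> X ` K \<subseteq> K)"

text \<open>\<open>L\<close> is simple in the category of graded modules.\<close>

definition graded_simple ::
    "'l::complex_vector set \<Rightarrow> ('g::ab_group_add \<Rightarrow> 'l set) \<Rightarrow>
     ('v::complex_vector endo \<Rightarrow> 'l \<Rightarrow> 'l) \<Rightarrow> bool"
  where "graded_simple L G \<rho> \<longleftrightarrow> L \<noteq> {0} \<and>
    (\<forall>K. submodule L \<rho> K \<and> (\<forall>x\<in>K. \<forall>\<alpha>. hpart G \<alpha> x \<in> K) \<longrightarrow> K = {0} \<or> K = L)"

text \<open>\<open>(L, G, \<rho>)\<close> is (a copy of) the simple module with highest weight \<open>\<mu>\<close>.\<close>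

definition simple_highest_weight_module ::
    "('g::ab_group_add \<Rightarrow> 'g \<Rightarrow> complex) \<Rightarrow> ('g \<Rightarrow> 'v::complex_vector set) \<Rightarrow> (nat \<Rightarrow> 'v) \<Rightarrow>
     (nat \<Rightarrow> complex) \<Rightarrow>
     'l::complex_vector set \<Rightarrow> ('g \<Rightarrow> 'l set) \<Rightarrow> ('v endo \<Rightarrow> 'l \<Rightarrow> 'l) \<Rightarrow> bool"
  where "simple_highest_weight_module \<omega> V b \<mu> L G \<rho> \<longleftrightarrow>
    graded_gl_module \<omega> V L G \<rho> \<and> graded_simple L G \<rho> \<and>
    (\<exists>v\<in>L. v \<noteq> 0 \<and>
      (\<forall>c<cvec.dim (UNIV :: 'v set). \<forall>a<c. \<rho> (matrix_unit b a c) v = 0) \<and>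
      (\<forall>a<cvec.dim (UNIV :: 'v set). \<rho> (matrix_unit b a a) v = \<mu> a *\<^sub>C v) \<and>
      (\<forall>K. submodule L \<rho> K \<and> v \<in> K \<longrightarrow> K = L))"


section \<open>Partitions and Specht modules\<close>

text \<open>Parts and cells are numbered from \<open>0\<close>, so \<open>\<lambda>\<^sub>i\<^sub>+\<^sub>1\<close> is \<open>lam i\<close>.\<close>

definition partitions :: "nat \<Rightarrow> (nat \<Rightarrow> nat) set"
  where "partitions N =
    {lam. antimono lam \<and> finite {i. lam i \<noteq> 0} \<and> (\<Sum>i | lam i \<noteq> 0. lam i) = N}"

definition diagram :: "(nat \<Rightarrow> nat) \<Rightarrow> (nat \<times> nat) set"
  where "diagram lam = {(i, j). j < lam i}"

text \<open>\<open>\<lambda>\<^sup>+\<close> consists of the first \<open>m\<close> rows, and part \<open>j\<close> of \<open>\<lambda>\<^sup>-\<close> is the length of column \<open>j\<close>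
  of the skew diagram \<open>\<lambda>/\<lambda>\<^sup>+\<close>.\<close>

definition plus_part :: "nat \<Rightarrow> (nat \<Rightarrow> nat) \<Rightarrow> nat \<Rightarrow> nat"
  where "plus_part m lam i = (if i < m then lam i else 0)"

definition minus_part :: "nat \<Rightarrow> (nat \<Rightarrow> nat) \<Rightarrow> nat \<Rightarrow> nat"
  where "minus_part m lam j = card {i. (i, j) \<in> diagram lam - diagram (plus_part m lam)}"

definition sharp :: "nat \<Rightarrow> (nat \<Rightarrow> nat) \<Rightarrow> nat \<Rightarrow> nat"
  where "sharp m lam a = (if a < m then plus_part m lam a else minus_part m lam (a - m))"

text \<open>The standard tableau filled row by row with \<open>0, \<dots>, N - 1\<close>, and its row and column groups.\<close>

definition row_tableau :: "(nat \<Rightarrow> nat) \<Rightarrow> nat \<times> nat \<Rightarrow> nat"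
  where "row_tableau lam = (\<lambda>(i, j). (\<Sum>k<i. lam k) + j)"

definition row_group :: "nat \<Rightarrow> (nat \<Rightarrow> nat) \<Rightarrow> (nat \<Rightarrow> nat) set"
  where "row_group N lam = {p \<in> Sym N. \<forall>(i, j)\<in>diagram lam.
    \<exists>j'. (i, j') \<in> diagram lam \<and> p (row_tableau lam (i, j)) = row_tableau lam (i, j')}"

definition column_group :: "nat \<Rightarrow> (nat \<Rightarrow> nat) \<Rightarrow> (nat \<Rightarrow> nat) set"
  where "column_group N lam = {p \<in> Sym N. \<forall>(i, j)\<in>diagram lam.
    \<exists>i'. (i', j) \<in> diagram lam \<and> p (row_tableau lam (i, j)) = row_tableau lam (i', j)}"

definition young_symmetrizer :: "nat \<Rightarrow> (nat \<Rightarrow> nat) \<Rightarrow> ((nat \<Rightarrow> nat) \<Rightarrow>\<^sub>0 complex)"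
  where "young_symmetrizer N lam = (\<Sum>p\<in>row_group N lam. \<Sum>q\<in>column_group N lam.
    of_int (sign q) *\<^sub>C Poly_Mapping.single (p \<circ> q) 1)"

definition left_mult :: "(nat \<Rightarrow> nat) \<Rightarrow> ((nat \<Rightarrow> nat) \<Rightarrow>\<^sub>0 complex) \<Rightarrow> ((nat \<Rightarrow> nat) \<Rightarrow>\<^sub>0 complex)"
  where "left_mult p = lin_ext (\<lambda>q. Poly_Mapping.single (p \<circ> q) 1)"

text \<open>The Specht module as the left ideal of the group algebra generated by the Young symmetrizer;
  the one-row partition gives the trivial module.\<close>

definition specht :: "nat \<Rightarrow> (nat \<Rightarrow> nat) \<Rightarrow> ((nat \<Rightarrow> nat) \<Rightarrow>\<^sub>0 complex) set"
  where "specht N lam = cvec.span {left_mult p (young_symmetrizer N lam) | p. p \<in> Sym N}"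

definition sym_simple :: "nat \<Rightarrow> ((nat \<Rightarrow> nat) \<Rightarrow>\<^sub>0 complex) set \<Rightarrow> bool"
  where "sym_simple N S \<longleftrightarrow> S \<noteq> {0} \<and>
    (\<forall>K\<subseteq>S. cvec.subspace K \<and> (\<forall>p\<in>Sym N. left_mult p ` K \<subseteq> K) \<longrightarrow> K = {0} \<or> K = S)"

end

theory Submission
  imports Defs
begin

text \<open>In a homogeneous basis the sign rule becomes a family of scalars \<open>q a b\<close> with
  \<open>q a b * q b a = 1\<close>. Products of Young symmetrizers \<open>c\<^sub>\<lambda>\<close> yield orthogonal central elements
  \<open>e\<^sub>\<lambda>\<close> of the group algebra. Symmetrized products of matrix units show that every operator
  commuting with the symmetric group lies in the algebra generated by \<open>\<gg>\<ll>(V)\<close>; averaging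
  rank one operators over the group then makes the images of the \<open>c\<^sub>\<lambda>\<close> simple. Such an image
  contains a highest weight vector of weight \<open>\<lambda>\<^sup>\<sharp>\<close>, and lowering a highest weight vector one letter
  at a time shows that no other weights occur in tensor space. Hence the \<open>e\<^sub>\<lambda>\<close> with
  \<open>\<lambda>\<^bsub>m+1\<^esub> \<le> n\<close> add up to the identity of tensor space. Finally \<open>\<tau>(e a)\<close>, for their sum \<open>e\<close>, is a
  combination of matrix coefficients of tensor space, which identifies the commutant of
  \<open>\<gg>\<ll>(V)\<close> with the image of the group algebra.\<close>

section \<open>Linear maps\<close>

text \<open>The obstacle is completeness: the \<open>ye N lam\<close> with \<open>lam\<close> in
  \<open>Lam\<close> have to exhaust tensor space. This is settled by weights. Every nonzero
  subspace closed under the operators \<open>EE\<close> contains a highest weight vector, the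
  lowering arguments confine its weight to some \<open>sharp m lam\<close>, and Young symmetrizers
  realize each such weight. Simplicity and both commutants rest on one device, the average
  \<open>conj_sum\<close> of an operator over the group. The average always lies in the algebra
  \<open>UU\<close> generated by gl(V), and on the image of a Young symmetrizer the average of a
  rank one operator has rank at most one, because \<open>yc \<star> x \<star> yc\<close> is a
  multiple of \<open>yc\<close>. Scalars are read off with the trace form \<open>tau\<close>; that
  the square of \<open>yc\<close> is nonzero comes from the positivity of
  \<open>tau (x \<star> gtransp x)\<close> on elements with real coefficients. All crossing signs
  are governed by the relation \<open>q a b * q b a = 1\<close>. Parity is visible in
  \<open>q a a\<close>, which is why even letters may repeat along rows and odd letters along
  columns.\<close>

abbreviation clin :: "('a::complex_vector \<Rightarrow> 'b::complex_vector) \<Rightarrow> bool"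
  where "clin \<equiv> Vector_Spaces.linear scaleC scaleC"

lemma clinI:
  assumes "\<And>x y. f (x + y) = f x + f y" "\<And>c x. f (c *\<^sub>C x) = c *\<^sub>C f x"
  shows "clin f"
  using assms by (simp add: linear_scaleC_iff)

lemma clin_add: "clin f \<Longrightarrow> f (x + y) = f x + f y"
  and clin_scale: "clin f \<Longrightarrow> f (c *\<^sub>C x) = c *\<^sub>C f x"
  by (simp_all add: linear_scaleC_iff)

lemma clin_zero: "clin f \<Longrightarrow> f 0 = 0"
  using clin_scale[of f 0 0] by simp

lemma clin_uminus: "clin f \<Longrightarrow> f (- x) = - f x"
  using clin_scale[of f "-1" x] by simp

lemma clin_diff: "clin f \<Longrightarrow> f (x - y) = f x - f y"
  using clin_add[of f x "- y"] clin_uminus[of f y] by simp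

lemma clin_sum: "clin f \<Longrightarrow> f (\<Sum>i\<in>I. g i) = (\<Sum>i\<in>I. f (g i))"
  by (induction I rule: infinite_finite_induct) (simp_all add: clin_zero clin_add)

lemma clin_compose: "clin f \<Longrightarrow> clin g \<Longrightarrow> clin (\<lambda>x. g (f x))"
  by (simp add: linear_scaleC_iff)

lemma clin_ident: "clin (\<lambda>x. x)"
  by (simp add: linear_scaleC_iff)

lemma clin_plus: "clin f \<Longrightarrow> clin g \<Longrightarrow> clin (\<lambda>x. f x + g x)"
  by (simp add: linear_scaleC_iff algebra_simps cvec.scale_right_distrib)

lemma clin_scaled: "clin f \<Longrightarrow> clin (\<lambda>x. c *\<^sub>C f x)"
  by (simp add: linear_scaleC_iff cvec.scale_right_distrib scaleC_scaleC mult.commute)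

lemma clin_minus: "clin f \<Longrightarrow> clin g \<Longrightarrow> clin (\<lambda>x. f x - g x)"
  by (simp add: linear_scaleC_iff algebra_simps cvec.scale_right_diff_distrib)

lemma clin_sums: "(\<And>i. i \<in> I \<Longrightarrow> clin (f i)) \<Longrightarrow> clin (\<lambda>x. \<Sum>i\<in>I. f i x)"
  by (rule clinI) (simp_all add: clin_add clin_scale sum.distrib cvec.scale_sum_right)

lemma clin_const_zero: "clin (\<lambda>x. 0)"
  by (rule clinI) simp_all

lemma clin_scaleC_left:
  assumes "clin f"
  shows "clin (\<lambda>x. f x *\<^sub>C v)"
  by (rule clinI) (simp_all add: clin_add[OF assms] clin_scale[OF assms] scaleC_add_left
      scaleC_scaleC scaleC_complex_def)

lemmas clin_intros = clin_compose clin_ident clin_plus clin_scaled clin_minus clin_sums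
  clin_const_zero clin_scaleC_left

lemma clin_lookup: "clin (\<lambda>x. Poly_Mapping.lookup x p :: 'b::complex_vector)"
  by (rule clinI) (simp_all add: lookup_add lookup_scaleC)

lemma clin_eq_on_span:
  assumes "clin f" "clin g" "x \<in> cvec.span B" "\<And>b. b \<in> B \<Longrightarrow> f b = g b"
  shows "f x = g x"
  using assms(3)
proof (induction rule: cvec.span_induct_alt)
  case base
  show ?case by (simp add: assms clin_zero)
next
  case (step c x y)
  then show ?case by (simp add: assms clin_add clin_scale)
qed

lemma clin_span_mem:
  assumes "clin f" "x \<in> cvec.span B" "cvec.subspace K" "\<And>b. b \<in> B \<Longrightarrow> f b \<in> K"
  shows "f x \<in> K"
  using assms(2)
proof (induction rule: cvec.span_induct_alt)
  case base
  show ?case by (simp add: assms clin_zero cvec.subspace_0)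
next
  case (step c x y)
  then show ?case by (simp add: assms clin_add clin_scale cvec.subspace_add cvec.subspace_scale)
qed

lemma clin_subspace_image: "clin f \<Longrightarrow> cvec.subspace K \<Longrightarrow> cvec.subspace (f ` K)"
  by (metis Vector_Spaces.linear_def module_hom.subspace_image)

lemma clin_lin_ext_fun: "clin (\<lambda>\<phi>. lin_ext (h \<phi>) p)"
  if "\<And>x. clin (\<lambda>\<phi>. h \<phi> x)"
  unfolding lin_ext_def by (intro clin_sums clin_scaled that)


section \<open>The group algebra\<close>

type_synonym perm_algebra = "(nat \<Rightarrow> nat) \<Rightarrow>\<^sub>0 complex"

abbreviation sg :: "(nat \<Rightarrow> nat) \<Rightarrow> perm_algebra"
  where "sg p \<equiv> Poly_Mapping.single p 1"

text \<open>The product in the monoid algebra of all maps on \<open>nat\<close> under composition;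
  the group algebra sits inside it, so associativity and the unit law hold for arbitrary
  elements.\<close>

definition gmul :: "perm_algebra \<Rightarrow> perm_algebra \<Rightarrow> perm_algebra" (infixl \<open>\<star>\<close> 70)
  where "x \<star> y = lin_ext (\<lambda>p. left_mult p y) x"

lemma sum_single: "(\<Sum>p\<in>Poly_Mapping.keys x. Poly_Mapping.lookup x p *\<^sub>C Poly_Mapping.single p 1) = x"
  for x :: "'x \<Rightarrow>\<^sub>0 complex"
proof (rule poly_mapping_eqI)
  fix k
  have "Poly_Mapping.lookup (\<Sum>p\<in>Poly_Mapping.keys x. Poly_Mapping.lookup x p *\<^sub>C Poly_Mapping.single p 1) k
      = (\<Sum>p\<in>Poly_Mapping.keys x. Poly_Mapping.lookup x p * (1 when p = k))"
    by (simp add: lookup_sum lookup_scaleC scaleC_complex_def lookup_single)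
  also have "\<dots> = (\<Sum>p\<in>Poly_Mapping.keys x. if p = k then Poly_Mapping.lookup x k else 0)"
    by (rule sum.cong) (auto simp: when_def)
  also have "\<dots> = Poly_Mapping.lookup x k"
    by (simp add: in_keys_iff)
  finally show "Poly_Mapping.lookup (\<Sum>p\<in>Poly_Mapping.keys x. Poly_Mapping.lookup x p *\<^sub>C Poly_Mapping.single p 1) k
      = Poly_Mapping.lookup x k" .
qed

lemma group_algebra_subspace: "cvec.subspace (group_algebra N)"
proof (rule cvec.subspaceI)
  show "0 \<in> group_algebra N" by (simp add: group_algebra_def)
  show "x + y \<in> group_algebra N" if "x \<in> group_algebra N" "y \<in> group_algebra N" for x y
    using that Poly_Mapping.keys_add[of x y] by (auto simp: group_algebra_def)
  show "c *\<^sub>C x \<in> group_algebra N" if "x \<in> group_algebra N" for c x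
    using that by (auto simp: group_algebra_def in_keys_iff lookup_scaleC scaleC_complex_def)
qed

lemma sg_in: "p \<in> Sym N \<Longrightarrow> sg p \<in> group_algebra N"
  by (simp add: group_algebra_def)

lemma group_algebra_span: "group_algebra N = cvec.span (sg ` Sym N)"
proof
  show "group_algebra N \<subseteq> cvec.span (sg ` Sym N)"
  proof
    fix x assume "x \<in> group_algebra N"
    then have "Poly_Mapping.keys x \<subseteq> Sym N" by (simp add: group_algebra_def)
    then have "(\<Sum>p\<in>Poly_Mapping.keys x. Poly_Mapping.lookup x p *\<^sub>C sg p) \<in> cvec.span (sg ` Sym N)"
      by (intro cvec.span_sum cvec.span_scale cvec.span_base) auto
    then show "x \<in> cvec.span (sg ` Sym N)" by (simp add: sum_single)
  qed
  show "cvec.span (sg ` Sym N) \<subseteq> group_algebra N"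
    by (rule cvec.span_minimal) (auto simp: sg_in group_algebra_subspace)
qed

lemma clin_eq_sg:
  assumes "clin f" "clin g" "x \<in> group_algebra N" "\<And>p. p \<in> Sym N \<Longrightarrow> f (sg p) = g (sg p)"
  shows "f x = g x"
  using assms by (intro clin_eq_on_span[OF assms(1,2), of x "sg ` Sym N"])
    (auto simp: group_algebra_span)

lemma clin_eq_single:
  fixes f g :: "('x \<Rightarrow>\<^sub>0 complex) \<Rightarrow> 'b::complex_vector"
  assumes "clin f" "clin g" "\<And>p. f (Poly_Mapping.single p 1) = g (Poly_Mapping.single p 1)"
  shows "f x = g x"
proof -
  have "f (\<Sum>p\<in>Poly_Mapping.keys x. Poly_Mapping.lookup x p *\<^sub>C Poly_Mapping.single p 1)
      = g (\<Sum>p\<in>Poly_Mapping.keys x. Poly_Mapping.lookup x p *\<^sub>C Poly_Mapping.single p 1)"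
    by (simp add: clin_sum[OF assms(1)] clin_sum[OF assms(2)] clin_scale[OF assms(1)]
        clin_scale[OF assms(2)] assms(3))
  then show ?thesis by (simp add: sum_single)
qed

lemma clin_left_mult: "clin (left_mult p)"
  unfolding left_mult_def by (rule linear_lin_ext)

lemma left_mult_sg: "left_mult p (sg q) = sg (p \<circ> q)"
  by (simp add: left_mult_def lin_ext_single)

lemma clin_gmul_left: "clin (\<lambda>x. x \<star> y)"
  unfolding gmul_def by (rule linear_lin_ext)

lemma clin_gmul_right: "clin (\<lambda>y. x \<star> y)"
  unfolding gmul_def by (intro clin_lin_ext_fun clin_left_mult)

lemma sg_gmul: "sg p \<star> y = left_mult p y"
  by (simp add: gmul_def lin_ext_single)

lemma sg_gmul_sg [simp]: "sg p \<star> sg q = sg (p \<circ> q)"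
  by (simp add: sg_gmul left_mult_sg)

lemma gmul_zero [simp]: "x \<star> 0 = 0" "0 \<star> x = 0"
  by (simp_all add: clin_zero[OF clin_gmul_right] clin_zero[OF clin_gmul_left])

lemma gmul_scale [simp]: "x \<star> (c *\<^sub>C y) = c *\<^sub>C (x \<star> y)" "(c *\<^sub>C x) \<star> y = c *\<^sub>C (x \<star> y)"
  by (simp_all add: clin_scale[OF clin_gmul_right] clin_scale[OF clin_gmul_left])

lemma gmul_uminus [simp]: "x \<star> (- y) = - (x \<star> y)" "(- x) \<star> y = - (x \<star> y)"
  by (simp_all add: clin_uminus[OF clin_gmul_right] clin_uminus[OF clin_gmul_left])

lemma gmul_sum_right: "x \<star> (\<Sum>i\<in>I. f i) = (\<Sum>i\<in>I. x \<star> f i)"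
  by (rule clin_sum[OF clin_gmul_right])

lemma gmul_sum_left: "(\<Sum>i\<in>I. f i) \<star> x = (\<Sum>i\<in>I. f i \<star> x)"
  by (rule clin_sum[OF clin_gmul_left])

lemma gmul_assoc: "(x \<star> y) \<star> z = x \<star> (y \<star> z)"
proof -
  have 1: "(sg p \<star> sg q) \<star> z = sg p \<star> (sg q \<star> z)" for p q
    by (rule clin_eq_single[OF clin_gmul_right clin_compose[OF clin_gmul_right clin_gmul_right]])
      (simp add: comp_assoc)
  have 2: "(sg p \<star> y) \<star> z = sg p \<star> (y \<star> z)" for p
    by (rule clin_eq_single[OF clin_compose[OF clin_gmul_right clin_gmul_left]
          clin_compose[OF clin_gmul_left clin_gmul_right]]) (rule 1)
  show ?thesis
    by (rule clin_eq_single[OF clin_compose[OF clin_gmul_left clin_gmul_left] clin_gmul_left]) (rule 2)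
qed

lemma gmul_one [simp]: "sg id \<star> x = x" "x \<star> sg id = x"
proof -
  show "sg id \<star> x = x"
    by (rule clin_eq_single[where g = "\<lambda>x. x", OF clin_gmul_right clin_ident]) (simp only: sg_gmul_sg id_comp)
  show "x \<star> sg id = x"
    by (rule clin_eq_single[where g = "\<lambda>x. x", OF clin_gmul_left clin_ident]) (simp only: sg_gmul_sg comp_id)
qed

lemma Sym_comp: "p \<in> Sym N \<Longrightarrow> q \<in> Sym N \<Longrightarrow> p \<circ> q \<in> Sym N"
  by (simp add: permutes_compose)

lemma Sym_inv: "p \<in> Sym N \<Longrightarrow> inv p \<in> Sym N"
  by (simp add: permutes_inv)

lemma Sym_id: "id \<in> Sym N"
  by (simp add: permutes_id)

lemma finite_Sym: "finite (Sym N)"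
  by (simp add: finite_permutations)

lemma Sym_inv_comp [simp]:
  "p \<in> Sym N \<Longrightarrow> inv p \<circ> p = id" "p \<in> Sym N \<Longrightarrow> p \<circ> inv p = id"
  by (auto simp: permutes_inv_o)

lemma Sym_inv_app [simp]:
  "p \<in> Sym N \<Longrightarrow> inv p (p t) = t" "p \<in> Sym N \<Longrightarrow> p (inv p t) = t"
  by (auto simp: permutes_inverses)

lemma Sym_inv_inv [simp]: "p \<in> Sym N \<Longrightarrow> inv (inv p) = p"
  by (simp add: permutes_inv_inv)

lemma Sym_less: "p \<in> Sym N \<Longrightarrow> t < N \<Longrightarrow> p t < N"
  using permutes_in_image[of p "{..<N}" t] by simp

lemma Sym_inj: "p \<in> Sym N \<Longrightarrow> p s = p t \<longleftrightarrow> s = t"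
  by (metis Sym_inv_app(1))

lemma Sym_sign_comp: "p \<in> Sym N \<Longrightarrow> q \<in> Sym N \<Longrightarrow> sign (p \<circ> q) = sign p * sign q"
  by (intro sign_compose) (auto simp: permutation_permutes)

lemma Sym_sign_inv: "p \<in> Sym N \<Longrightarrow> sign (inv p) = sign p"
  by (intro sign_inverse) (auto simp: permutation_permutes)

lemma gmul_mem: "x \<in> group_algebra N \<Longrightarrow> y \<in> group_algebra N \<Longrightarrow> x \<star> y \<in> group_algebra N"
proof (rule clin_span_mem[OF clin_gmul_left, of x "sg ` Sym N" "group_algebra N" y])
  fix b assume "y \<in> group_algebra N" "b \<in> sg ` Sym N"
  then show "b \<star> y \<in> group_algebra N"
    by (intro clin_span_mem[OF clin_gmul_right, of y "sg ` Sym N" "group_algebra N" b])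
      (auto simp: group_algebra_span[symmetric] group_algebra_subspace sg_in permutes_compose)
qed (simp_all add: group_algebra_span[symmetric] group_algebra_subspace)

text \<open>The functional \<open>\<tau>\<close> is the trace of the regular representation divided by the order of
  the group.\<close>

definition tau :: "perm_algebra \<Rightarrow> complex"
  where "tau x = Poly_Mapping.lookup x id"

lemma clin_tau: "clin tau"
  unfolding tau_def by (rule clin_lookup)

lemma tau_sg: "tau (sg p) = (if p = id then 1 else 0)"
  by (auto simp: tau_def lookup_single)

lemma tau_scale [simp]: "tau (c *\<^sub>C x) = c * tau x"
  by (simp add: tau_def lookup_scaleC scaleC_complex_def)

text \<open>In a group \<open>p \<circ> q = id\<close> and \<open>q \<circ> p = id\<close> are
  equivalent; the rest is bilinearity.\<close>

lemma tau_commute: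
  assumes "x \<in> group_algebra N" "y \<in> group_algebra N"
  shows "tau (x \<star> y) = tau (y \<star> x)"
proof (rule clin_eq_sg[OF _ _ assms(1), where f = "\<lambda>x. tau (x \<star> y)" and g = "\<lambda>x. tau (y \<star> x)"])
  show "clin (\<lambda>x. tau (x \<star> y))" "clin (\<lambda>x. tau (y \<star> x))"
    by (intro clin_compose[OF _ clin_tau] clin_gmul_left clin_gmul_right)+
  fix p assume p: "p \<in> Sym N"
  show "tau (sg p \<star> y) = tau (y \<star> sg p)"
  proof (rule clin_eq_sg[OF _ _ assms(2)])
    show "clin (\<lambda>y. tau (sg p \<star> y))" "clin (\<lambda>y. tau (y \<star> sg p))"
      by (intro clin_compose[OF _ clin_tau] clin_gmul_left clin_gmul_right)+
    fix q assume q: "q \<in> Sym N"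
    have "p \<circ> q = id \<longleftrightarrow> q \<circ> p = id"
      using p q by (metis Sym_inv_comp(1) Sym_inv_comp(2) comp_id id_comp o_assoc)
    then show "tau (sg p \<star> sg q) = tau (sg q \<star> sg p)"
      by (simp add: tau_sg)
  qed
qed

text \<open>Coefficients become values of the trace form, so identities between products turn into
  identities between coefficients. \<open>yc N lam\<close> and \<open>eT\<close> are re-expanded in
  this way.\<close>

lemma tau_inv_gmul:
  assumes "p \<in> Sym N" "y \<in> group_algebra N"
  shows "tau (sg (inv p) \<star> y) = Poly_Mapping.lookup y p"
proof (rule clin_eq_sg[OF _ _ assms(2)])
  show "clin (\<lambda>y. tau (sg (inv p) \<star> y))"
    by (intro clin_compose[OF _ clin_tau] clin_gmul_right)
  show "clin (\<lambda>y. Poly_Mapping.lookup y p :: complex)"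
    by (rule clin_lookup)
  fix q assume q: "q \<in> Sym N"
  have "inv p \<circ> q = id \<longleftrightarrow> q = p"
    using assms(1) q by (metis Sym_inv_comp(1) Sym_inv_comp(2) comp_id id_comp o_assoc)
  then show "tau (sg (inv p) \<star> sg q) = Poly_Mapping.lookup (sg q) p"
    by (auto simp: tau_sg lookup_single)
qed

lemma group_algebra_expand:
  assumes "x \<in> group_algebra N"
  shows "x = (\<Sum>p\<in>Sym N. Poly_Mapping.lookup x p *\<^sub>C sg p)"
proof -
  have "x = (\<Sum>p\<in>Poly_Mapping.keys x. Poly_Mapping.lookup x p *\<^sub>C sg p)"
    by (simp add: sum_single)
  also have "\<dots> = (\<Sum>p\<in>Sym N. Poly_Mapping.lookup x p *\<^sub>C sg p)"
    using assms by (intro sum.mono_neutral_left)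
      (auto simp: group_algebra_def finite_permutations in_keys_iff)
  finally show ?thesis .
qed

text \<open>The anti-automorphism inverting permutations. It fixes \<open>symm\<close> and
  \<open>asymm\<close>, hence exchanges \<open>ya \<star> yb\<close> with
  \<open>yb \<star> ya\<close>.\<close>

definition gtransp :: "perm_algebra \<Rightarrow> perm_algebra"
  where "gtransp = lin_ext (\<lambda>p. sg (inv p))"

lemma clin_gtransp: "clin gtransp"
  unfolding gtransp_def by (rule linear_lin_ext)

lemma gtransp_sg [simp]: "gtransp (sg p) = sg (inv p)"
  by (simp add: gtransp_def lin_ext_single)

lemma gtransp_mem: "x \<in> group_algebra N \<Longrightarrow> gtransp x \<in> group_algebra N"
  by (rule clin_span_mem[OF clin_gtransp, of x "sg ` Sym N"])
    (auto simp: group_algebra_span[symmetric] group_algebra_subspace sg_in permutes_inv)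

lemma gtransp_gmul:
  assumes "x \<in> group_algebra N" "y \<in> group_algebra N"
  shows "gtransp (x \<star> y) = gtransp y \<star> gtransp x"
proof (rule clin_eq_sg[OF _ _ assms(1)])
  show "clin (\<lambda>x. gtransp (x \<star> y))" "clin (\<lambda>x. gtransp y \<star> gtransp x)"
    by (intro clin_compose[OF clin_gmul_left] clin_compose[OF clin_gtransp] clin_gtransp clin_gmul_right)+
  fix p assume p: "p \<in> Sym N"
  show "gtransp (sg p \<star> y) = gtransp y \<star> gtransp (sg p)"
  proof (rule clin_eq_sg[OF _ _ assms(2)])
    show "clin (\<lambda>y. gtransp (sg p \<star> y))" "clin (\<lambda>y. gtransp y \<star> gtransp (sg p))"
      by (intro clin_compose[OF clin_gmul_right] clin_compose[OF clin_gtransp] clin_gtransp clin_gmul_left)+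
    fix q assume "q \<in> Sym N"
    then show "gtransp (sg p \<star> sg q) = gtransp (sg q) \<star> gtransp (sg p)"
      using p by (simp add: o_inv_distrib permutes_bij)
  qed
qed

lemma tau_gmul_gtransp:
  assumes "x \<in> group_algebra N"
  shows "tau (x \<star> gtransp x) = (\<Sum>p\<in>Sym N. Poly_Mapping.lookup x p * Poly_Mapping.lookup x p)"
proof -
  have "tau (x \<star> gtransp x) = tau (gtransp x \<star> x)"
    using assms by (intro tau_commute gtransp_mem)
  also have "\<dots> = tau ((\<Sum>p\<in>Sym N. Poly_Mapping.lookup x p *\<^sub>C sg (inv p)) \<star> x)"
    by (subst group_algebra_expand[OF assms]) (simp add: clin_sum[OF clin_gtransp] clin_scale[OF clin_gtransp])
  also have "\<dots> = (\<Sum>p\<in>Sym N. Poly_Mapping.lookup x p * Poly_Mapping.lookup x p)"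
    by (simp add: gmul_sum_left clin_sum[OF clin_tau] tau_inv_gmul[OF _ assms])
  finally show ?thesis .
qed

text \<open>\<open>gtransp\<close> does not conjugate coefficients, so
  \<open>tau (x \<star> gtransp x)\<close> is a sum of squares and definite only on real elements.
  Products of \<open>symm\<close> and \<open>asymm\<close> are real.\<close>

definition real_coeffs :: "perm_algebra \<Rightarrow> bool"
  where "real_coeffs x \<longleftrightarrow> (\<forall>p. Poly_Mapping.lookup x p \<in> \<real>)"

lemma real_coeffs_sg [simp]: "real_coeffs (sg p)"
  by (simp add: real_coeffs_def lookup_single when_def)

lemma real_coeffs_sum: "(\<And>i. i \<in> I \<Longrightarrow> real_coeffs (f i)) \<Longrightarrow> real_coeffs (\<Sum>i\<in>I. f i)"
  by (auto simp: real_coeffs_def lookup_sum)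

lemma real_coeffs_scale: "c \<in> \<real> \<Longrightarrow> real_coeffs x \<Longrightarrow> real_coeffs (c *\<^sub>C x)"
  by (auto simp: real_coeffs_def lookup_scaleC scaleC_complex_def)

lemma real_coeffs_gmul: "real_coeffs x \<Longrightarrow> real_coeffs y \<Longrightarrow> real_coeffs (x \<star> y)"
  unfolding gmul_def lin_ext_def left_mult_def
  by (intro real_coeffs_sum real_coeffs_scale real_coeffs_sg) (auto simp: real_coeffs_def)

text \<open>The trace of \<open>x \<star> gtransp x\<close> is a sum of squares of real numbers, so
  it vanishes only if all coefficients do.\<close>

lemma gmul_gtransp_eq_0:
  assumes "x \<in> group_algebra N" "real_coeffs x" "x \<star> gtransp x = 0"
  shows "x = 0"
proof -
  have "(\<Sum>p\<in>Sym N. Poly_Mapping.lookup x p * Poly_Mapping.lookup x p) = 0"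
    using tau_gmul_gtransp[OF assms(1)] assms(3) by (simp add: tau_def)
  moreover have "Poly_Mapping.lookup x p * Poly_Mapping.lookup x p
      = of_real ((Re (Poly_Mapping.lookup x p))\<^sup>2)" for p
    using assms(2) by (simp add: real_coeffs_def complex_is_Real_iff complex_eq_iff power2_eq_square)
  ultimately have "complex_of_real (\<Sum>p\<in>Sym N. (Re (Poly_Mapping.lookup x p))\<^sup>2) = 0"
    by simp
  then have "(\<Sum>p\<in>Sym N. (Re (Poly_Mapping.lookup x p))\<^sup>2) = 0"
    by (simp only: of_real_eq_0_iff)
  then have "\<forall>p\<in>Sym N. Re (Poly_Mapping.lookup x p) = 0"
    by (subst (asm) sum_nonneg_eq_0_iff) (auto simp: finite_permutations)
  then have "\<forall>p\<in>Sym N. Poly_Mapping.lookup x p = 0"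
    using assms(2) by (simp add: real_coeffs_def complex_eq_iff complex_is_Real_iff)
  then show ?thesis
    using group_algebra_expand[OF assms(1)] by simp
qed

section \<open>Young symmetrizers\<close>

lemma part_mono: "lam \<in> partitions N \<Longrightarrow> i \<le> j \<Longrightarrow> lam j \<le> lam i"
  by (simp add: partitions_def antimono_def)

text \<open>A nonzero part at index \<open>i\<close> makes all parts up to \<open>i\<close> at least
  1, so that \<open>Suc i\<close> is at most \<open>N\<close>.\<close>

lemma part_zero:
  assumes "lam \<in> partitions N" "N \<le> i"
  shows "lam i = 0"
proof (rule ccontr)
  assume *: "lam i \<noteq> 0"
  have pos: "1 \<le> lam k" if "k \<le> i" for k
    using part_mono[OF assms(1) that] * by simp
  have "Suc i = (\<Sum>k\<le>i. 1)" by simp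
  also have "\<dots> \<le> (\<Sum>k\<le>i. lam k)" by (rule sum_mono) (use pos in auto)
  also have "\<dots> \<le> (\<Sum>k | lam k \<noteq> 0. lam k)"
    using pos assms(1) by (intro sum_mono2) (force simp: partitions_def)+
  also have "\<dots> = N" using assms(1) by (simp add: partitions_def)
  finally show False using assms(2) by simp
qed

lemma part_less: "lam \<in> partitions N \<Longrightarrow> j < lam i \<Longrightarrow> i < N"
  using part_zero[of lam N i] by (cases "i < N") auto

lemma part_sum:
  assumes "lam \<in> partitions N"
  shows "(\<Sum>i<N. lam i) = N"
proof -
  have "(\<Sum>i<N. lam i) = (\<Sum>i | lam i \<noteq> 0. lam i)"
    using part_zero[OF assms] by (intro sum.mono_neutral_right) (auto, metis not_less not_less_zero)
  then show ?thesis using assms by (simp add: partitions_def)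
qed

lemma part_sum_le:
  assumes "lam \<in> partitions N"
  shows "(\<Sum>i<k. lam i) \<le> N"
proof -
  have "(\<Sum>i<k. lam i) \<le> (\<Sum>i<max k N. lam i)" by (rule sum_mono2) auto
  also have "\<dots> = (\<Sum>i<N. lam i)"
    by (rule sum.mono_neutral_right) (use part_zero[OF assms] in auto)
  finally show ?thesis by (simp add: part_sum[OF assms])
qed

lemma diagram_Sigma:
  assumes "lam \<in> partitions N"
  shows "diagram lam = Sigma {..<N} (\<lambda>i. {..<lam i})"
  using part_zero[OF assms] by (auto simp: diagram_def) (metis not_less not_less_zero)

text \<open>Row \<open>i\<close> occupies the interval of length \<open>lam i\<close> after the
  cells of the earlier rows, so the filling is injective with values below \<open>N\<close>; the
  number of cells is \<open>N\<close>, which makes it surjective.\<close>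

lemma bij_row_tableau:
  assumes "lam \<in> partitions N"
  shows "bij_betw (row_tableau lam) (diagram lam) {..<N}"
proof -
  have less: "row_tableau lam (i, j) < (\<Sum>k<Suc i. lam k)" if "j < lam i" for i j
    using that by (simp add: row_tableau_def)
  have mono: "(\<Sum>k<i. lam k) \<le> (\<Sum>k<i'. lam k)" if "i \<le> i'" for i i'
    using that by (intro sum_mono2) auto
  have lt: "row_tableau lam (i, j) < row_tableau lam (i', j')" if "j < lam i" "i < i'" for i j i' j'
    using less[OF that(1)] mono[of "Suc i" i'] that(2) by (simp add: row_tableau_def)
  have inj: "inj_on (row_tableau lam) (diagram lam)"
  proof (rule inj_onI)
    fix x y assume xy: "x \<in> diagram lam" "y \<in> diagram lam" "row_tableau lam x = row_tableau lam y"
    obtain i j i' j' where [simp]: "x = (i, j)" "y = (i', j')" by (cases x, cases y)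
    have "i = i'"
      using xy lt[of j i i' j'] lt[of j' i' i j] by (force simp: diagram_def)
    then show "x = y" using xy by (simp add: row_tableau_def)
  qed
  have sub: "row_tableau lam ` diagram lam \<subseteq> {..<N}"
  proof -
    have "row_tableau lam (i, j) < N" if "j < lam i" for i j
      using less[OF that] part_sum_le[OF assms, of "Suc i"] by simp
    then show ?thesis by (auto simp: diagram_def)
  qed
  have "card (row_tableau lam ` diagram lam) = N"
    by (simp only: card_image[OF inj]) (simp add: diagram_Sigma[OF assms] part_sum[OF assms])
  then have "row_tableau lam ` diagram lam = {..<N}"
    using sub by (intro card_subset_eq) auto
  then show ?thesis using inj by (simp add: bij_betw_def)
qed

text \<open>Together with \<open>colof\<close> the inverse of \<open>row_tableau lam\<close> on
  \<open>{..<N}\<close>; the values outside this range are arbitrary.\<close>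

definition rowof :: "(nat \<Rightarrow> nat) \<Rightarrow> nat \<Rightarrow> nat"
  where "rowof lam t = fst (inv_into (diagram lam) (row_tableau lam) t)"

definition colof :: "(nat \<Rightarrow> nat) \<Rightarrow> nat \<Rightarrow> nat"
  where "colof lam t = snd (inv_into (diagram lam) (row_tableau lam) t)"

lemma tableau_cell:
  assumes "lam \<in> partitions N" "t < N"
  shows "row_tableau lam (rowof lam t, colof lam t) = t" "colof lam t < lam (rowof lam t)"
proof -
  have t: "t \<in> row_tableau lam ` diagram lam"
    using bij_row_tableau[OF assms(1)] assms(2) by (simp add: bij_betw_def)
  show "row_tableau lam (rowof lam t, colof lam t) = t"
    using f_inv_into_f[OF t] by (simp add: rowof_def colof_def)
  have "(rowof lam t, colof lam t) \<in> diagram lam"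
    using inv_into_into[OF t] by (simp add: rowof_def colof_def)
  then show "colof lam t < lam (rowof lam t)" by (simp add: diagram_def)
qed

lemma cell_tableau:
  assumes "lam \<in> partitions N" "j < lam i"
  shows "row_tableau lam (i, j) < N" "rowof lam (row_tableau lam (i, j)) = i"
    "colof lam (row_tableau lam (i, j)) = j"
proof -
  have d: "(i, j) \<in> diagram lam" using assms(2) by (simp add: diagram_def)
  show "row_tableau lam (i, j) < N"
    using bij_row_tableau[OF assms(1)] d by (auto simp: bij_betw_def)
  have "inv_into (diagram lam) (row_tableau lam) (row_tableau lam (i, j)) = (i, j)"
    using bij_row_tableau[OF assms(1)] d by (simp add: bij_betw_def)
  then show "rowof lam (row_tableau lam (i, j)) = i" "colof lam (row_tableau lam (i, j)) = j"
    by (simp_all add: rowof_def colof_def)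
qed

lemma cell_eqI:
  assumes "lam \<in> partitions N" "s < N" "t < N" "rowof lam s = rowof lam t" "colof lam s = colof lam t"
  shows "s = t"
  by (metis assms tableau_cell(1))

text \<open>Turns a condition on cells into the invariance of a label of positions, the form that
  \<open>stab\<close> makes uniform for rows and columns.\<close>

lemma row_group_iff:
  assumes "lam \<in> partitions N"
  shows "p \<in> row_group N lam \<longleftrightarrow> p \<in> Sym N \<and> (\<forall>t<N. rowof lam (p t) = rowof lam t)"
proof (intro iffI conjI allI impI)
  assume p: "p \<in> row_group N lam"
  then show S: "p \<in> Sym N" by (simp add: row_group_def)
  fix t assume t: "t < N"
  let ?c = "(rowof lam t, colof lam t)"
  have "?c \<in> diagram lam" using tableau_cell(2)[OF assms t] by (simp add: diagram_def)
  then obtain j' where "j' < lam (rowof lam t)" "p (row_tableau lam ?c) = row_tableau lam (rowof lam t, j')"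
    using p by (fastforce simp: row_group_def diagram_def)
  then show "rowof lam (p t) = rowof lam t"
    by (simp add: tableau_cell(1)[OF assms t] cell_tableau[OF assms])
next
  assume p: "p \<in> Sym N \<and> (\<forall>t<N. rowof lam (p t) = rowof lam t)"
  have "\<exists>j'. (i, j') \<in> diagram lam \<and> p (row_tableau lam (i, j)) = row_tableau lam (i, j')"
    if "(i, j) \<in> diagram lam" for i j
  proof -
    have ij: "j < lam i" using that by (simp add: diagram_def)
    let ?t = "row_tableau lam (i, j)"
    have t: "?t < N" "rowof lam ?t = i" using cell_tableau[OF assms ij] by auto
    have pt: "p ?t < N" "rowof lam (p ?t) = i" using p t Sym_less[of p N ?t] by auto
    then show ?thesis
      using tableau_cell[OF assms pt(1)] by (intro exI[of _ "colof lam (p ?t)"]) (simp add: diagram_def)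
  qed
  then show "p \<in> row_group N lam" using p by (auto simp: row_group_def)
qed

lemma column_group_iff:
  assumes "lam \<in> partitions N"
  shows "p \<in> column_group N lam \<longleftrightarrow> p \<in> Sym N \<and> (\<forall>t<N. colof lam (p t) = colof lam t)"
proof (intro iffI conjI allI impI)
  assume p: "p \<in> column_group N lam"
  then show S: "p \<in> Sym N" by (simp add: column_group_def)
  fix t assume t: "t < N"
  let ?c = "(rowof lam t, colof lam t)"
  have "?c \<in> diagram lam" using tableau_cell(2)[OF assms t] by (simp add: diagram_def)
  then obtain i' where "colof lam t < lam i'" "p (row_tableau lam ?c) = row_tableau lam (i', colof lam t)"
    using p by (fastforce simp: column_group_def diagram_def)
  then show "colof lam (p t) = colof lam t"
    by (simp add: tableau_cell(1)[OF assms t] cell_tableau[OF assms])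
next
  assume p: "p \<in> Sym N \<and> (\<forall>t<N. colof lam (p t) = colof lam t)"
  have "\<exists>i'. (i', j) \<in> diagram lam \<and> p (row_tableau lam (i, j)) = row_tableau lam (i', j)"
    if "(i, j) \<in> diagram lam" for i j
  proof -
    have ij: "j < lam i" using that by (simp add: diagram_def)
    let ?t = "row_tableau lam (i, j)"
    have t: "?t < N" "colof lam ?t = j" using cell_tableau[OF assms ij] by auto
    have pt: "p ?t < N" "colof lam (p ?t) = j" using p t Sym_less[of p N ?t] by auto
    then show ?thesis
      using tableau_cell[OF assms pt(1)] by (intro exI[of _ "rowof lam (p ?t)"]) (simp add: diagram_def)
  qed
  then show "p \<in> column_group N lam" using p by (auto simp: column_group_def)
qed

text \<open>Row and column groups are handled simultaneously as the subgroup of permutations that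
  preserve a labelling \<open>f\<close> of the positions.\<close>

definition stab :: "nat \<Rightarrow> (nat \<Rightarrow> nat) \<Rightarrow> (nat \<Rightarrow> nat) set"
  where "stab N f = {p \<in> Sym N. \<forall>t<N. f (p t) = f t}"

lemma row_group_stab: "lam \<in> partitions N \<Longrightarrow> row_group N lam = stab N (rowof lam)"
  and column_group_stab: "lam \<in> partitions N \<Longrightarrow> column_group N lam = stab N (colof lam)"
  using row_group_iff column_group_iff by (auto simp: stab_def)

lemma stab_Sym: "p \<in> stab N f \<Longrightarrow> p \<in> Sym N"
  by (simp add: stab_def)

lemma stab_id: "id \<in> stab N f"
  by (simp add: stab_def)

lemma stab_comp: "p \<in> stab N f \<Longrightarrow> q \<in> stab N f \<Longrightarrow> p \<circ> q \<in> stab N f"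
  using Sym_less[of q N] by (auto simp: stab_def permutes_compose)

lemma stab_inv: "p \<in> stab N f \<Longrightarrow> inv p \<in> stab N f"
proof -
  assume p: "p \<in> stab N f"
  then have S: "p \<in> Sym N" by (rule stab_Sym)
  have "f (inv p t) = f t" if "t < N" for t
  proof -
    have "f (p (inv p t)) = f (inv p t)"
      using p Sym_less[OF Sym_inv[OF S] that] unfolding stab_def by blast
    then show ?thesis by (simp only: Sym_inv_app(2)[OF S])
  qed
  then show ?thesis using Sym_inv[OF S] by (simp add: stab_def)
qed

lemma stab_transpose: "s < N \<Longrightarrow> t < N \<Longrightarrow> f s = f t \<Longrightarrow> Transposition.transpose s t \<in> stab N f"
  by (auto simp: stab_def permutes_swap_id Transposition.transpose_def)

lemma finite_stab: "finite (stab N f)"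
  by (rule finite_subset[OF _ finite_Sym[of N]]) (auto simp: stab_def)

lemma stab_left_bij: "p \<in> stab N f \<Longrightarrow> bij_betw ((\<circ>) p) (stab N f) (stab N f)"
  by (rule bij_betw_byWitness[where f' = "(\<circ>) (inv p)"])
    (auto simp: stab_comp stab_inv o_assoc stab_Sym Sym_inv_comp[OF stab_Sym])

lemma stab_right_bij: "p \<in> stab N f \<Longrightarrow> bij_betw (\<lambda>q. q \<circ> p) (stab N f) (stab N f)"
  by (rule bij_betw_byWitness[where f' = "\<lambda>q. q \<circ> inv p"])
    (auto simp: stab_comp stab_inv comp_assoc stab_Sym Sym_inv_comp[OF stab_Sym])

section \<open>Symmetrizing and antisymmetrizing over a labelling\<close>

definition symm :: "nat \<Rightarrow> (nat \<Rightarrow> nat) \<Rightarrow> perm_algebra"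
  where "symm N f = (\<Sum>p\<in>stab N f. sg p)"

definition asymm :: "nat \<Rightarrow> (nat \<Rightarrow> nat) \<Rightarrow> perm_algebra"
  where "asymm N f = (\<Sum>p\<in>stab N f. of_int (sign p) *\<^sub>C sg p)"

lemma symm_mem: "symm N f \<in> group_algebra N"
  unfolding symm_def by (intro cvec.subspace_sum group_algebra_subspace sg_in stab_Sym)

lemma asymm_mem: "asymm N f \<in> group_algebra N"
  unfolding asymm_def
  by (intro cvec.subspace_sum cvec.subspace_scale group_algebra_subspace sg_in stab_Sym)

lemma stab_sign_comp: "p \<in> stab N f \<Longrightarrow> q \<in> stab N f \<Longrightarrow> sign (p \<circ> q) = sign p * sign q"
  by (rule Sym_sign_comp[OF stab_Sym stab_Sym])

lemma symm_left: "p \<in> stab N f \<Longrightarrow> sg p \<star> symm N f = symm N f"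
  unfolding symm_def gmul_sum_right sg_gmul_sg
  by (rule sum.reindex_bij_betw[OF stab_left_bij])

lemma symm_right: "p \<in> stab N f \<Longrightarrow> symm N f \<star> sg p = symm N f"
  unfolding symm_def gmul_sum_left sg_gmul_sg
  by (rule sum.reindex_bij_betw[OF stab_right_bij])

lemma asymm_left:
  assumes "p \<in> stab N f"
  shows "sg p \<star> asymm N f = of_int (sign p) *\<^sub>C asymm N f"
proof -
  have "sg p \<star> asymm N f = (\<Sum>q\<in>stab N f. of_int (sign p) *\<^sub>C of_int (sign (p \<circ> q)) *\<^sub>C sg (p \<circ> q))"
    unfolding asymm_def gmul_sum_right
    by (rule sum.cong) (auto simp: stab_sign_comp[OF assms] scaleC_scaleC simp flip: of_int_mult)
  also have "\<dots> = of_int (sign p) *\<^sub>C asymm N f"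
    unfolding asymm_def cvec.scale_sum_right
    by (rule sum.reindex_bij_betw[OF stab_left_bij[OF assms]])
  finally show ?thesis .
qed

lemma asymm_right:
  assumes "p \<in> stab N f"
  shows "asymm N f \<star> sg p = of_int (sign p) *\<^sub>C asymm N f"
proof -
  have "asymm N f \<star> sg p = (\<Sum>q\<in>stab N f. of_int (sign p) *\<^sub>C of_int (sign (q \<circ> p)) *\<^sub>C sg (q \<circ> p))"
    unfolding asymm_def gmul_sum_left
    by (rule sum.cong) (auto simp: stab_sign_comp[OF _ assms] scaleC_scaleC mult.left_commute
        simp flip: of_int_mult)
  also have "\<dots> = of_int (sign p) *\<^sub>C asymm N f"
    unfolding asymm_def cvec.scale_sum_right
    by (rule sum.reindex_bij_betw[OF stab_right_bij[OF assms]])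
  finally show ?thesis .
qed

lemma symm_square: "symm N f \<star> symm N f = of_nat (card (stab N f)) *\<^sub>C symm N f"
proof -
  have "symm N f \<star> symm N f = (\<Sum>p\<in>stab N f. symm N f)"
    by (subst (1) symm_def) (simp add: gmul_sum_left symm_left)
  then show ?thesis by (simp add: cvec.sum_constant_scale)
qed

lemma asymm_square: "asymm N f \<star> asymm N f = of_nat (card (stab N f)) *\<^sub>C asymm N f"
proof -
  have "asymm N f \<star> asymm N f = (\<Sum>p\<in>stab N f. asymm N f)"
    by (subst (1) asymm_def)
      (simp add: gmul_sum_left asymm_left scaleC_scaleC scaleC_one flip: of_int_mult)
  then show ?thesis by (simp add: cvec.sum_constant_scale)
qed

lemma gtransp_symm: "gtransp (symm N f) = symm N f"
proof -
  have "bij_betw inv (stab N f) (stab N f)"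
    by (rule bij_betw_byWitness[where f' = inv]) (auto simp: stab_inv Sym_inv_inv[OF stab_Sym])
  then show ?thesis
    unfolding symm_def clin_sum[OF clin_gtransp] gtransp_sg by (rule sum.reindex_bij_betw)
qed

lemma gtransp_asymm: "gtransp (asymm N f) = asymm N f"
proof -
  have b: "bij_betw inv (stab N f) (stab N f)"
    by (rule bij_betw_byWitness[where f' = inv]) (auto simp: stab_inv Sym_inv_inv[OF stab_Sym])
  have "gtransp (asymm N f) = (\<Sum>p\<in>stab N f. of_int (sign (inv p)) *\<^sub>C sg (inv p))"
    unfolding asymm_def clin_sum[OF clin_gtransp]
    by (rule sum.cong) (auto simp: clin_scale[OF clin_gtransp] Sym_sign_inv[OF stab_Sym])
  also have "\<dots> = asymm N f"
    unfolding asymm_def by (rule sum.reindex_bij_betw[OF b])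
  finally show ?thesis .
qed

lemma real_coeffs_symm: "real_coeffs (symm N f)"
  unfolding symm_def by (intro real_coeffs_sum real_coeffs_sg)

lemma real_coeffs_asymm: "real_coeffs (asymm N f)"
  unfolding asymm_def by (intro real_coeffs_sum real_coeffs_scale real_coeffs_sg) auto

lemma eq_uminus_imp_0:
  fixes x :: "'a::complex_vector"
  assumes "x = - x"
  shows "x = 0"
proof -
  have "2 *\<^sub>C x = x + x" using scaleC_add_left[of 1 1 x] by (simp add: scaleC_one)
  also have "\<dots> = 0" using assms by (metis add.right_inverse)
  finally show ?thesis by simp
qed

text \<open>Conjugation by \<open>g\<close> carries the transposition of \<open>inv g s\<close> and
  \<open>inv g t\<close> to that of \<open>s\<close> and \<open>t\<close>. The left factor absorbs
  it with sign 1 and the right factor with sign -1, so the product equals its own negative.\<close>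

lemma symm_asymm_collision:
  assumes "g \<in> Sym N" "s < N" "t < N" "s \<noteq> t" "f s = f t" "h (inv g s) = h (inv g t)"
  shows "symm N f \<star> (sg g \<star> asymm N h) = 0"
proof -
  let ?t1 = "Transposition.transpose s t" and ?t2 = "Transposition.transpose (inv g s) (inv g t)"
  have t2: "?t2 \<in> stab N h"
    using assms Sym_less[OF Sym_inv[OF assms(1)]] by (intro stab_transpose) auto
  have eq: "?t1 \<circ> g = g \<circ> ?t2"
    using assms(1) by (auto simp: fun_eq_iff Transposition.transpose_def permutes_inverses)
  have "inv g s \<noteq> inv g t" using assms by (metis Sym_inv_app(2))
  then have sign: "sign ?t2 = - 1" by (simp add: sign_swap_id)
  have "symm N f \<star> (sg g \<star> asymm N h) = (symm N f \<star> sg ?t1) \<star> (sg g \<star> asymm N h)"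
    by (simp add: symm_right[OF stab_transpose[of s N t f]] assms)
  also have "\<dots> = symm N f \<star> (sg (?t1 \<circ> g) \<star> asymm N h)"
    by (simp add: gmul_assoc flip: sg_gmul_sg)
  also have "\<dots> = symm N f \<star> (sg g \<star> (sg ?t2 \<star> asymm N h))"
    unfolding eq by (simp add: gmul_assoc flip: sg_gmul_sg)
  also have "\<dots> = - (symm N f \<star> (sg g \<star> asymm N h))"
    by (simp add: asymm_left[OF t2] sign scaleC_one)
  finally show ?thesis by (rule eq_uminus_imp_0)
qed

section \<open>Collisions between rows and columns, and dominance\<close>

lemma card_col_less:
  assumes "lam \<in> partitions N"
  shows "card {t\<in>{..<N}. colof lam t < j} = (\<Sum>i<N. min (lam i) j)"
proof -
  let ?S = "Sigma {..<N} (\<lambda>i. {..<min (lam i) j})"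
  have sub: "?S \<subseteq> diagram lam" by (auto simp: diagram_def)
  have "{t\<in>{..<N}. colof lam t < j} = row_tableau lam ` ?S"
  proof (intro set_eqI iffI)
    fix t assume t: "t \<in> {t\<in>{..<N}. colof lam t < j}"
    then have "(rowof lam t, colof lam t) \<in> ?S"
      using tableau_cell(2)[OF assms, of t] part_less[OF assms, of "colof lam t" "rowof lam t"] by simp
    then show "t \<in> row_tableau lam ` ?S"
      using tableau_cell(1)[OF assms, of t] t by (intro image_eqI[of t _ "(rowof lam t, colof lam t)"]) auto
  next
    fix t assume "t \<in> row_tableau lam ` ?S"
    then show "t \<in> {t\<in>{..<N}. colof lam t < j}"
      using cell_tableau[OF assms] by auto
  qed
  then have "card {t\<in>{..<N}. colof lam t < j} = card ?S"
    using card_image[OF inj_on_subset[OF bij_betw_imp_inj_on[OF bij_row_tableau[OF assms]] sub]]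
    by (simp only:)
  then show ?thesis by simp
qed

lemma card_row:
  assumes "lam \<in> partitions N"
  shows "card {t\<in>{..<N}. rowof lam t = i} = lam i"
proof -
  let ?S = "{i} \<times> {..<lam i}"
  have sub: "?S \<subseteq> diagram lam" by (auto simp: diagram_def)
  have "{t\<in>{..<N}. rowof lam t = i} = row_tableau lam ` ?S"
  proof (intro set_eqI iffI)
    fix t assume t: "t \<in> {t\<in>{..<N}. rowof lam t = i}"
    then have "(rowof lam t, colof lam t) \<in> ?S"
      using tableau_cell[OF assms, of t] by auto
    then show "t \<in> row_tableau lam ` ?S"
      using tableau_cell(1)[OF assms, of t] t by (intro image_eqI[of t _ "(rowof lam t, colof lam t)"]) auto
  next
    fix t assume "t \<in> row_tableau lam ` ?S"
    then show "t \<in> {t\<in>{..<N}. rowof lam t = i}"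
      using cell_tableau[OF assms] by auto
  qed
  then have "card {t\<in>{..<N}. rowof lam t = i} = card ?S"
    using card_image[OF inj_on_subset[OF bij_betw_imp_inj_on[OF bij_row_tableau[OF assms]] sub]]
    by (simp only:)
  then show ?thesis by simp
qed

lemma rowof_less: "lam \<in> partitions N \<Longrightarrow> t < N \<Longrightarrow> rowof lam t < N"
  by (rule part_less[OF _ tableau_cell(2)])

text \<open>Two entries of row \<open>i\<close> in the same column of the tableau of
  \<open>mu\<close> moved by \<open>g\<close> would collide. So each of the first \<open>j\<close>
  columns supplies at most one of them and \<open>j\<close> bounds the size of \<open>A i j\<close>;
  the row length is the other bound. Over all rows the sets \<open>A i j\<close> exhaust the entries
  of the first \<open>j\<close> columns.\<close>

lemma collision_free_count:
  assumes lam: "lam \<in> partitions N" and mu: "mu \<in> partitions N" and g: "g \<in> Sym N"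
    and inj: "inj_on (\<lambda>s. (rowof lam s, colof mu (inv g s))) {..<N}"
  defines "A \<equiv> \<lambda>i j. {s\<in>{..<N}. rowof lam s = i \<and> colof mu (inv g s) < j}"
  shows "card (A i j) \<le> min (lam i) j" and "(\<Sum>i<N. card (A i j)) = (\<Sum>i<N. min (mu i) j)"
proof -
  have "card (A i j) \<le> card {s\<in>{..<N}. rowof lam s = i}"
    unfolding A_def by (rule card_mono) auto
  moreover have "card (A i j) \<le> card {..<j}"
  proof (rule card_inj_on_le)
    show "inj_on (\<lambda>s. colof mu (inv g s)) (A i j)"
      using inj by (auto simp: inj_on_def A_def)
  qed (auto simp: A_def)
  ultimately show "card (A i j) \<le> min (lam i) j" unfolding card_row[OF lam] by simp
  have "(\<Sum>i<N. card (A i j)) = card (\<Union>i<N. A i j)"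
    by (rule card_UN_disjoint[symmetric]) (auto simp: A_def)
  also have "(\<Union>i<N. A i j) = {s\<in>{..<N}. colof mu (inv g s) < j}"
    using rowof_less[OF lam] by (auto simp: A_def)
  also have "card \<dots> = card {t\<in>{..<N}. colof mu t < j}"
    by (rule bij_betw_same_card[where f = "inv g"], rule bij_betw_byWitness[where f' = g])
      (use g in \<open>auto simp: Sym_less Sym_less[OF Sym_inv[OF g], simplified] permutes_inverses\<close>)
  finally show "(\<Sum>i<N. card (A i j)) = (\<Sum>i<N. min (mu i) j)"
    unfolding card_col_less[OF mu] .
qed

text \<open>The difference of consecutive sums is the length of column \<open>j\<close>, whose cells
  lie in the topmost rows. Hence these sums determine the partition.\<close>

lemma part_row_iff_card:
  assumes "lam \<in> partitions N"
  shows "j < lam i \<longleftrightarrow> i < (\<Sum>k<N. min (lam k) (Suc j)) - (\<Sum>k<N. min (lam k) j)"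
proof -
  have "(\<Sum>k<N. min (lam k) (Suc j)) = (\<Sum>k<N. min (lam k) j + (if j < lam k then 1 else 0))"
    by (rule sum.cong) auto
  also have "\<dots> = (\<Sum>k<N. min (lam k) j) + card {k\<in>{..<N}. j < lam k}"
    by (simp add: sum.distrib sum.If_cases Int_def)
  finally have eq: "(\<Sum>k<N. min (lam k) (Suc j)) - (\<Sum>k<N. min (lam k) j) = card {k\<in>{..<N}. j < lam k}"
    by simp
  let ?S = "{k\<in>{..<N}. j < lam k}"
  have down: "k \<in> ?S" if "k \<le> k'" "k' \<in> ?S" for k k'
    using part_mono[OF assms that(1)] that by auto
  have "i < card ?S" if "j < lam i"
  proof -
    have "i < N" by (rule part_less[OF assms that])
    then have "{..i} \<subseteq> ?S" using down[of _ i] that by auto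
    then have "card {..i} \<le> card ?S" by (intro card_mono) auto
    then show ?thesis by simp
  qed
  moreover have "card ?S \<le> i" if "\<not> j < lam i"
  proof -
    have "?S \<subseteq> {..<i}" 
    proof
      fix k assume "k \<in> ?S"
      then show "k \<in> {..<i}" using part_mono[OF assms, of i k] that by (cases "i \<le> k") auto
    qed
    then have "card ?S \<le> card {..<i}" by (intro card_mono) auto
    then show ?thesis by simp
  qed
  ultimately show ?thesis unfolding eq by (meson not_less)
qed

lemma part_eqI:
  assumes "lam \<in> partitions N" "mu \<in> partitions N"
    and "\<And>j. (\<Sum>i<N. min (lam i) j) = (\<Sum>i<N. min (mu i) j)"
  shows "lam = mu"
proof
  fix i
  have "j < lam i \<longleftrightarrow> j < mu i" for j
    unfolding part_row_iff_card[OF assms(1)] part_row_iff_card[OF assms(2)] assms(3) ..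
  from this[of "mu i"] this[of "lam i"] show "lam i = mu i" by simp
qed

text \<open>For \<open>mu = lam\<close> the bounds of \<open>collision_free_count\<close> have the
  same total as the counts, so each of them is attained. Thus the column that \<open>inv g\<close>
  assigns to a position always meets the row of this position.\<close>

lemma collision_free_factor:
  assumes lam: "lam \<in> partitions N" and g: "g \<in> Sym N"
    and inj: "inj_on (\<lambda>s. (rowof lam s, colof lam (inv g s))) {..<N}"
  obtains r q where "r \<in> stab N (rowof lam)" "q \<in> stab N (colof lam)" "g = r \<circ> q"
proof -
  define A where "A \<equiv> \<lambda>i j. {s\<in>{..<N}. rowof lam s = i \<and> colof lam (inv g s) < j}"
  have le: "card (A i j) \<le> min (lam i) j" and eq: "(\<Sum>i<N. card (A i j)) = (\<Sum>i<N. min (lam i) j)" for i j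
    using collision_free_count[OF lam lam g inj] unfolding A_def by blast+
  have card: "card (A i j) = min (lam i) j" if "i < N" for i j
  proof (rule ccontr)
    assume "card (A i j) \<noteq> min (lam i) j"
    then have "card (A i j) < min (lam i) j" using le[of i j] by linarith
    then have "(\<Sum>i<N. card (A i j)) < (\<Sum>i<N. min (lam i) j)"
      using that le by (intro sum_strict_mono_ex1) auto
    then show False using eq by simp
  qed
  have cell: "colof lam (inv g s) < lam (rowof lam s)" if s: "s < N" for s
  proof -
    let ?i = "rowof lam s"
    have "A ?i (lam ?i) = {s\<in>{..<N}. rowof lam s = ?i}"
    proof (rule card_subset_eq)
      show "card (A ?i (lam ?i)) = card {s\<in>{..<N}. rowof lam s = ?i}"
        unfolding card_row[OF lam] using card[OF rowof_less[OF lam s]] by simp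
    qed (auto simp: A_def)
    then show ?thesis using s by (auto simp: A_def)
  qed
  \<comment> \<open>\<open>h\<close> shifts each position within its row to the column of its
    preimage under \<open>g\<close>. So \<open>h\<close> preserves rows, \<open>h \<circ> g\<close>
    preserves columns, and \<open>r = inv h\<close> gives the factorization.\<close>
  define h where "h s = (if s < N then row_tableau lam (rowof lam s, colof lam (inv g s)) else s)" for s
  have h: "h s < N" "rowof lam (h s) = rowof lam s" "colof lam (h s) = colof lam (inv g s)" if "s < N" for s
    using that cell_tableau[OF lam cell[OF that]] by (simp_all add: h_def)
  have "inj_on h {..<N}"
  proof (rule inj_onI)
    fix s t assume st: "s \<in> {..<N}" "t \<in> {..<N}" "h s = h t"
    then have "rowof lam s = rowof lam t" "colof lam (inv g s) = colof lam (inv g t)"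
      using h(2,3)[of s] h(2,3)[of t] by auto
    then show "s = t" using inj_onD[OF inj, of s t] st by auto
  qed
  moreover have "h ` {..<N} \<subseteq> {..<N}" using h by auto
  ultimately have "bij_betw h {..<N} {..<N}"
    by (simp add: bij_betw_def endo_inj_surj)
  then have hS: "h \<in> Sym N"
    by (simp, intro bij_imp_permutes) (simp_all add: h_def)
  have hR: "h \<in> stab N (rowof lam)"
    using hS h by (simp add: stab_def)
  have "h \<circ> g \<in> stab N (colof lam)"
    using hS g h Sym_less[OF g] by (auto simp: stab_def permutes_compose permutes_inverses)
  moreover have "g = inv h \<circ> (h \<circ> g)"
    using hS by (simp add: o_assoc permutes_inv_o)
  ultimately show thesis
    using that stab_inv[OF hR] by blast
qed

section \<open>Young symmetrizers as quasi-idempotents\<close>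

abbreviation ya :: "nat \<Rightarrow> (nat \<Rightarrow> nat) \<Rightarrow> perm_algebra"
  where "ya N lam \<equiv> symm N (rowof lam)"

abbreviation yb :: "nat \<Rightarrow> (nat \<Rightarrow> nat) \<Rightarrow> perm_algebra"
  where "yb N lam \<equiv> asymm N (colof lam)"

abbreviation yc :: "nat \<Rightarrow> (nat \<Rightarrow> nat) \<Rightarrow> perm_algebra"
  where "yc \<equiv> young_symmetrizer"

lemma young_symmetrizer_eq:
  assumes "lam \<in> partitions N"
  shows "yc N lam = ya N lam \<star> yb N lam"
  unfolding young_symmetrizer_def row_group_stab[OF assms] column_group_stab[OF assms]
    symm_def asymm_def gmul_sum_left by (simp add: gmul_sum_right)

lemma yc_mem: "lam \<in> partitions N \<Longrightarrow> yc N lam \<in> group_algebra N"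
  by (simp add: young_symmetrizer_eq gmul_mem symm_mem asymm_mem)

text \<open>For one permutation \<open>g\<close> there are two cases: a collision kills the product;
  otherwise \<open>g\<close> is a row permutation after a column permutation, and the outer factors
  absorb both up to a sign.\<close>

lemma ya_x_yb:
  assumes lam: "lam \<in> partitions N" and x: "x \<in> group_algebra N"
  shows "\<exists>k. ya N lam \<star> (x \<star> yb N lam) = k *\<^sub>C yc N lam"
proof -
  let ?K = "cvec.span {yc N lam}"
  have "ya N lam \<star> (x \<star> yb N lam) \<in> ?K"
  proof (rule clin_span_mem[of "\<lambda>x. ya N lam \<star> (x \<star> yb N lam)" x "sg ` Sym N"])
    show "clin (\<lambda>x. ya N lam \<star> (x \<star> yb N lam))"
      by (rule clin_compose[OF clin_gmul_left clin_gmul_right])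
    show "x \<in> cvec.span (sg ` Sym N)" using x by (simp add: group_algebra_span)
    fix y assume "y \<in> sg ` Sym N"
    then obtain g where g: "g \<in> Sym N" "y = sg g" by auto
    show "ya N lam \<star> (y \<star> yb N lam) \<in> ?K"
    proof (cases "inj_on (\<lambda>s. (rowof lam s, colof lam (inv g s))) {..<N}")
      case True
      then obtain r q where rq: "r \<in> stab N (rowof lam)" "q \<in> stab N (colof lam)" "g = r \<circ> q"
        using collision_free_factor[OF lam g(1)] by blast
      have "ya N lam \<star> (y \<star> yb N lam) = (ya N lam \<star> sg r) \<star> (sg q \<star> yb N lam)"
        unfolding g(2) rq(3) sg_gmul_sg[symmetric] by (simp only: gmul_assoc)
      also have "\<dots> = of_int (sign q) *\<^sub>C yc N lam"
        by (simp add: symm_right[OF rq(1)] asymm_left[OF rq(2)] young_symmetrizer_eq[OF lam])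
      finally show ?thesis by (simp add: cvec.span_base cvec.span_scale)
    next
      case False
      then obtain s t where "s < N" "t < N" "s \<noteq> t" "rowof lam s = rowof lam t"
        "colof lam (inv g s) = colof lam (inv g t)"
        by (auto simp: inj_on_def)
      then have "ya N lam \<star> (y \<star> yb N lam) = 0"
        unfolding g(2) by (intro symm_asymm_collision g(1))
      then show ?thesis by (simp add: cvec.span_zero)
    qed
  qed (rule cvec.subspace_span)
  then show ?thesis by (auto simp: cvec.span_singleton)
qed

text \<open>A nonzero product needs some \<open>g\<close> without collisions, and summing its bounds
  over the rows gives the inequality: the conjugate of \<open>mu\<close> is dominated by the
  conjugate of \<open>lam\<close>.\<close>

lemma ya_x_yb_dominance:
  assumes lam: "lam \<in> partitions N" and mu: "mu \<in> partitions N" and x: "x \<in> group_algebra N"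
    and nz: "ya N lam \<star> (x \<star> yb N mu) \<noteq> 0"
  shows "(\<Sum>i<N. min (mu i) j) \<le> (\<Sum>i<N. min (lam i) j)"
proof (rule ccontr)
  assume *: "\<not> ?thesis"
  have "ya N lam \<star> (sg g \<star> yb N mu) = 0" if g: "g \<in> Sym N" for g
  proof (cases "inj_on (\<lambda>s. (rowof lam s, colof mu (inv g s))) {..<N}")
    case True
    have "(\<Sum>i<N. min (mu i) j) \<le> (\<Sum>i<N. min (lam i) j)"
      unfolding collision_free_count(2)[OF lam mu g True, symmetric]
      by (rule sum_mono) (rule collision_free_count(1)[OF lam mu g True])
    then show ?thesis using * by blast
  next
    case False
    then obtain s t where "s < N" "t < N" "s \<noteq> t" "rowof lam s = rowof lam t"
      "colof mu (inv g s) = colof mu (inv g t)"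
      by (auto simp: inj_on_def)
    then show ?thesis by (intro symm_asymm_collision g)
  qed
  then have "ya N lam \<star> (x \<star> yb N mu) = 0"
    by (intro clin_eq_sg[OF clin_compose[OF clin_gmul_left clin_gmul_right] clin_const_zero x])
  then show False using nz by simp
qed

text \<open>The outer factors \<open>ya N lam\<close> and \<open>yb N mu\<close> give one dominance
  relation. The inner factor \<open>yb N lam \<star> x \<star> ya N mu\<close> must be nonzero too,
  and its transpose gives the opposite relation; together they force
  \<open>lam = mu\<close>.\<close>

lemma yc_x_yc_diff:
  assumes lam: "lam \<in> partitions N" and mu: "mu \<in> partitions N" and x: "x \<in> group_algebra N"
    and ne: "lam \<noteq> mu"
  shows "yc N lam \<star> (x \<star> yc N mu) = 0"
proof (rule ccontr)
  assume nz: "yc N lam \<star> (x \<star> yc N mu) \<noteq> 0"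
  have e1: "yc N lam \<star> (x \<star> yc N mu) = ya N lam \<star> ((yb N lam \<star> x \<star> ya N mu) \<star> yb N mu)"
    by (simp add: young_symmetrizer_eq lam mu gmul_assoc)
  then have "ya N lam \<star> ((yb N lam \<star> x \<star> ya N mu) \<star> yb N mu) \<noteq> 0" using nz by simp
  from ya_x_yb_dominance[OF lam mu _ this]
  have le1: "(\<Sum>i<N. min (mu i) j) \<le> (\<Sum>i<N. min (lam i) j)" for j
    by (simp add: gmul_mem symm_mem asymm_mem x)
  have "yb N lam \<star> x \<star> ya N mu \<noteq> 0" using nz e1 by auto
  then have "gtransp (yb N lam \<star> x \<star> ya N mu) \<noteq> 0"
  proof -
    have "gtransp (gtransp y) = y" if "y \<in> group_algebra N" for y
      by (rule clin_eq_sg[OF clin_compose[OF clin_gtransp clin_gtransp] clin_ident that])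
        (simp add: permutes_inv_inv)
    then show ?thesis
      using \<open>yb N lam \<star> x \<star> ya N mu \<noteq> 0\<close> clin_zero[OF clin_gtransp]
      by (metis asymm_mem gmul_mem symm_mem x)
  qed
  then have "ya N mu \<star> (gtransp x \<star> yb N lam) \<noteq> 0"
    by (simp add: gtransp_gmul[of _ N] gmul_mem symm_mem asymm_mem x gtransp_symm gtransp_asymm gmul_assoc)
  from ya_x_yb_dominance[OF mu lam gtransp_mem[OF x] this]
  have "lam = mu" using le1 by (intro part_eqI[OF lam mu]) (meson antisym)
  then show False using ne by simp
qed

text \<open>Row and column group meet only in the identity, because a position is determined by its
  row and column. So \<open>id\<close> arises only as \<open>id \<circ> id\<close>, with sign
  1.\<close>

lemma tau_yc:
  assumes "lam \<in> partitions N"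
  shows "tau (yc N lam) = 1"
proof -
  have eq: "p \<circ> q = id \<longleftrightarrow> p = id \<and> q = id"
    if p: "p \<in> stab N (rowof lam)" and q: "q \<in> stab N (colof lam)" for p q
  proof
    assume pq: "p \<circ> q = id"
    have "q t = t" for t
    proof (cases "t < N")
      case True
      have qt: "q t < N" using Sym_less[OF stab_Sym[OF q] True] .
      have "rowof lam (p (q t)) = rowof lam (q t)" using p qt by (simp add: stab_def)
      then have "rowof lam t = rowof lam (q t)" using pq by (simp add: fun_eq_iff)
      moreover have "colof lam (q t) = colof lam t" using q True by (simp add: stab_def)
      ultimately show ?thesis using cell_eqI[OF assms qt True] by simp
    next
      case False
      then show ?thesis using stab_Sym[OF q] by (simp add: permutes_not_in)
    qed
    then have "q = id" by auto
    then show "p = id \<and> q = id" using pq by simp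
  qed simp
  have "yc N lam = (\<Sum>p\<in>stab N (rowof lam). \<Sum>q\<in>stab N (colof lam). of_int (sign q) *\<^sub>C sg (p \<circ> q))"
    unfolding young_symmetrizer_eq[OF assms] symm_def asymm_def gmul_sum_left
    by (simp add: gmul_sum_right)
  then have "tau (yc N lam) = (\<Sum>p\<in>stab N (rowof lam). \<Sum>q\<in>stab N (colof lam).
      of_int (sign q) * (if p \<circ> q = id then 1 else 0))"
    by (simp add: clin_sum[OF clin_tau] tau_sg)
  also have "\<dots> = (\<Sum>p\<in>stab N (rowof lam). \<Sum>q\<in>stab N (colof lam).
      if q = id then (if p = id then 1 else 0) else 0)"
    by (intro sum.cong) (auto simp: eq)
  also have "\<dots> = 1"
    by (simp add: finite_stab stab_id)
  finally show ?thesis .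
qed

lemma yc_nonzero: "lam \<in> partitions N \<Longrightarrow> yc N lam \<noteq> 0"
  using tau_yc[of lam N] by (auto simp: tau_def)

text \<open>The scalar of \<open>yc_square\<close>, read off at the identity since
  \<open>tau (yc N lam) = 1\<close>. Classically it is the product of the hook lengths of
  \<open>lam\<close>.\<close>

definition yk :: "nat \<Rightarrow> (nat \<Rightarrow> nat) \<Rightarrow> complex"
  where "yk N lam = tau (yc N lam \<star> yc N lam)"

lemma yc_square:
  assumes "lam \<in> partitions N"
  shows "yc N lam \<star> yc N lam = yk N lam *\<^sub>C yc N lam"
proof -
  have "yc N lam \<star> yc N lam = ya N lam \<star> ((yb N lam \<star> ya N lam) \<star> yb N lam)"
    by (simp add: young_symmetrizer_eq[OF assms] gmul_assoc)
  then obtain k where k: "yc N lam \<star> yc N lam = k *\<^sub>C yc N lam"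
    using ya_x_yb[OF assms gmul_mem[OF asymm_mem symm_mem]] by metis
  then have "yk N lam = k" by (simp add: yk_def tau_yc[OF assms])
  then show ?thesis using k by simp
qed

text \<open>If the square of \<open>ya \<star> yb\<close> vanished, then
  \<open>y = yb \<star> ya \<star> yb\<close> would satisfy \<open>y \<star> gtransp y = 0\<close>,
  so \<open>y = 0\<close> by positivity. The same argument for \<open>z = yb \<star> ya\<close>,
  with \<open>z \<star> gtransp z\<close> a multiple of \<open>y\<close>, gives \<open>z = 0\<close>
  and then \<open>yc N lam = 0\<close>.\<close>

lemma yk_nonzero:
  assumes "lam \<in> partitions N"
  shows "yk N lam \<noteq> 0"
proof
  assume 0: "yk N lam = 0"
  let ?a = "ya N lam" and ?b = "yb N lam"
  have ab0: "?a \<star> (?b \<star> (?a \<star> ?b)) = 0"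
    using yc_square[OF assms] 0 by (simp add: young_symmetrizer_eq[OF assms] gmul_assoc)
  let ?y = "?b \<star> ?a \<star> ?b"
  have y: "?y \<in> group_algebra N" "real_coeffs ?y" "gtransp ?y = ?y"
    by (simp_all add: gmul_mem symm_mem asymm_mem real_coeffs_gmul real_coeffs_symm real_coeffs_asymm
        gtransp_gmul[of _ N] gtransp_symm gtransp_asymm gmul_assoc)
  have "?y \<star> ?y = ?b \<star> ?a \<star> (?b \<star> ?b) \<star> ?a \<star> ?b" by (simp only: gmul_assoc)
  also have "\<dots> = of_nat (card (stab N (colof lam))) *\<^sub>C (?b \<star> (?a \<star> (?b \<star> (?a \<star> ?b))))"
    by (simp add: asymm_square gmul_assoc)
  finally have "?y \<star> gtransp ?y = 0" using y(3) ab0 by simp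
  then have y0: "?y = 0" using gmul_gtransp_eq_0 y by blast
  let ?z = "?b \<star> ?a"
  have z: "?z \<in> group_algebra N" "real_coeffs ?z" "gtransp ?z = ?a \<star> ?b"
    by (simp_all add: gmul_mem symm_mem asymm_mem real_coeffs_gmul real_coeffs_symm real_coeffs_asymm
        gtransp_gmul[of _ N] gtransp_symm gtransp_asymm)
  have "?z \<star> gtransp ?z = ?b \<star> (?a \<star> ?a) \<star> ?b" by (simp only: z(3) gmul_assoc)
  also have "\<dots> = of_nat (card (stab N (rowof lam))) *\<^sub>C ?y"
    by (simp add: symm_square gmul_assoc)
  finally have "?z \<star> gtransp ?z = 0" using y0 by simp
  then have "?z = 0" using gmul_gtransp_eq_0 z by blast
  then have "?a \<star> ?b = 0" using z(3) clin_zero[OF clin_gtransp] by simp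
  then show False using yc_nonzero[OF assms] by (simp add: young_symmetrizer_eq[OF assms])
qed

text \<open>By \<open>ya_x_yb\<close> the product is a multiple of \<open>yc N lam\<close>. Applying
  \<open>tau\<close> and moving the last factor to the front identifies the multiple, since
  \<open>tau (yc N lam) = 1\<close>.\<close>

lemma yc_x_yc:
  assumes lam: "lam \<in> partitions N" and x: "x \<in> group_algebra N"
  shows "yc N lam \<star> (x \<star> yc N lam) = (yk N lam * tau (yc N lam \<star> x)) *\<^sub>C yc N lam"
proof -
  have "yc N lam \<star> (x \<star> yc N lam) = ya N lam \<star> ((yb N lam \<star> x \<star> ya N lam) \<star> yb N lam)"
    by (simp add: young_symmetrizer_eq[OF lam] gmul_assoc)
  then obtain k where k: "yc N lam \<star> (x \<star> yc N lam) = k *\<^sub>C yc N lam"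
    using ya_x_yb[OF lam gmul_mem[OF gmul_mem[OF asymm_mem x] symm_mem]] by metis
  have "k = tau (yc N lam \<star> (x \<star> yc N lam))" by (simp add: k tau_yc[OF lam])
  also have "\<dots> = tau ((yc N lam \<star> x) \<star> yc N lam)" by (simp add: gmul_assoc)
  also have "\<dots> = tau (yc N lam \<star> (yc N lam \<star> x))"
    by (rule tau_commute[of _ N]) (intro gmul_mem yc_mem lam x)+
  also have "\<dots> = tau ((yc N lam \<star> yc N lam) \<star> x)" by (simp add: gmul_assoc)
  also have "\<dots> = yk N lam * tau (yc N lam \<star> x)" by (simp add: yc_square[OF lam])
  finally show ?thesis using k by simp
qed

text \<open>Summing the conjugates of \<open>yc N lam\<close> produces a central element. The
  normalization makes it fix \<open>yc N lam\<close>: one factor \<open>yk\<close> comes from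
  \<open>yc_x_yc\<close> and the other from \<open>yc_square\<close>.\<close>

definition ye :: "nat \<Rightarrow> (nat \<Rightarrow> nat) \<Rightarrow> perm_algebra"
  where "ye N lam = inverse ((yk N lam)\<^sup>2) *\<^sub>C (\<Sum>g\<in>Sym N. sg g \<star> (yc N lam \<star> sg (inv g)))"

lemma ye_mem: "lam \<in> partitions N \<Longrightarrow> ye N lam \<in> group_algebra N"
  unfolding ye_def
  by (intro cvec.subspace_scale cvec.subspace_sum group_algebra_subspace gmul_mem yc_mem sg_in Sym_inv)

lemma ye_central:
  assumes lam: "lam \<in> partitions N" and x: "x \<in> group_algebra N"
  shows "ye N lam \<star> x = x \<star> ye N lam"
proof (rule clin_eq_sg[OF clin_gmul_right clin_gmul_left x])
  fix p assume p: "p \<in> Sym N"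
  let ?s = "\<lambda>g. sg g \<star> (yc N lam \<star> sg (inv g))"
  have "sg p \<star> (\<Sum>g\<in>Sym N. ?s g) = (\<Sum>g\<in>Sym N. ?s (p \<circ> g) \<star> sg p)"
    unfolding gmul_sum_right
  proof (rule sum.cong)
    fix g assume g: "g \<in> Sym N"
    have "inv (p \<circ> g) \<circ> p = inv g"
      using p g by (simp add: o_inv_distrib permutes_bij comp_assoc permutes_inv_o)
    then have "?s (p \<circ> g) \<star> sg p = sg p \<star> sg g \<star> (yc N lam \<star> sg (inv g))"
      by (simp add: gmul_assoc)
    then show "sg p \<star> ?s g = ?s (p \<circ> g) \<star> sg p"
      by (simp only: gmul_assoc)
  qed simp
  also have "\<dots> = (\<Sum>g\<in>Sym N. ?s g) \<star> sg p"
    unfolding gmul_sum_left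
    by (rule sum.reindex_bij_betw[where h = "(\<circ>) p"], rule bij_betw_byWitness[where f' = "(\<circ>) (inv p)"])
      (use p in \<open>auto simp: o_assoc permutes_inv_o permutes_compose permutes_inv\<close>)
  finally show "ye N lam \<star> sg p = sg p \<star> ye N lam"
    by (simp add: ye_def)
qed

lemma ye_yc:
  assumes lam: "lam \<in> partitions N"
  shows "ye N lam \<star> yc N lam = yc N lam"
proof -
  let ?c = "yc N lam" and ?k = "yk N lam"
  have "(\<Sum>g\<in>Sym N. sg g \<star> (?c \<star> sg (inv g))) \<star> ?c
      = (\<Sum>g\<in>Sym N. (?k * Poly_Mapping.lookup ?c g) *\<^sub>C (sg g \<star> ?c))"
    unfolding gmul_sum_left
  proof (rule sum.cong)
    fix g assume g: "g \<in> Sym N"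
    have "tau (?c \<star> sg (inv g)) = tau (sg (inv g) \<star> ?c)"
      using g by (intro tau_commute[of _ N] yc_mem lam sg_in Sym_inv)
    also have "\<dots> = Poly_Mapping.lookup ?c g" by (rule tau_inv_gmul[OF g yc_mem[OF lam]])
    finally show "sg g \<star> (?c \<star> sg (inv g)) \<star> ?c = (?k * Poly_Mapping.lookup ?c g) *\<^sub>C (sg g \<star> ?c)"
      using yc_x_yc[OF lam sg_in[OF Sym_inv[OF g]]] by (simp add: gmul_assoc)
  qed simp
  also have "\<dots> = ?k *\<^sub>C ((\<Sum>g\<in>Sym N. Poly_Mapping.lookup ?c g *\<^sub>C sg g) \<star> ?c)"
    by (simp add: gmul_sum_left cvec.scale_sum_right scaleC_scaleC)
  also have "(\<Sum>g\<in>Sym N. Poly_Mapping.lookup ?c g *\<^sub>C sg g) = ?c"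
    by (rule group_algebra_expand[OF yc_mem[OF lam], symmetric])
  finally show ?thesis
    using yk_nonzero[OF lam]
    by (simp add: ye_def yc_square[OF lam] scaleC_scaleC power2_eq_square scaleC_one divide_simps
        flip: mult.assoc inverse_mult_distrib)
qed

lemma ye_yc_diff:
  assumes lam: "lam \<in> partitions N" and mu: "mu \<in> partitions N" and "lam \<noteq> mu"
  shows "ye N lam \<star> yc N mu = 0"
  using yc_x_yc_diff[OF lam mu sg_in[OF Sym_inv] assms(3)]
  by (simp add: ye_def gmul_sum_left gmul_assoc permutes_inv)

section \<open>Specht modules as left ideals\<close>

lemma specht_subspace: "cvec.subspace (specht N lam)"
  by (simp add: specht_def cvec.subspace_span)

lemma specht_eq:
  "specht N lam = (\<lambda>x. x \<star> yc N lam) ` group_algebra N"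
proof
  show "specht N lam \<subseteq> (\<lambda>x. x \<star> yc N lam) ` group_algebra N"
    unfolding specht_def
  proof (rule cvec.span_minimal)
    show "{left_mult p (yc N lam) |p. p \<in> Sym N} \<subseteq> (\<lambda>x. x \<star> yc N lam) ` group_algebra N"
      by (auto simp flip: sg_gmul intro!: imageI sg_in)
    show "cvec.subspace ((\<lambda>x. x \<star> yc N lam) ` group_algebra N)"
      by (rule clin_subspace_image[OF clin_gmul_left group_algebra_subspace])
  qed
  show "(\<lambda>x. x \<star> yc N lam) ` group_algebra N \<subseteq> specht N lam"
  proof (rule image_subsetI)
    fix x assume "x \<in> group_algebra N"
    then show "x \<star> yc N lam \<in> specht N lam"
      unfolding group_algebra_span
      by (rule clin_span_mem[OF clin_gmul_left _ specht_subspace])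
        (auto simp: specht_def sg_gmul intro!: cvec.span_base)
  qed
qed

lemma specht_mem: "lam \<in> partitions N \<Longrightarrow> s \<in> specht N lam \<Longrightarrow> s \<in> group_algebra N"
  by (auto simp: specht_eq gmul_mem yc_mem)

lemma specht_yc: "lam \<in> partitions N \<Longrightarrow> s \<in> specht N lam \<Longrightarrow> s \<star> yc N lam = yk N lam *\<^sub>C s"
  by (auto simp: specht_eq gmul_assoc yc_square)

text \<open>If \<open>y\<close> has a nonzero coefficient at \<open>p\<close>, then
  \<open>tau (yc \<star> (sg (inv p) \<star> y))\<close> is nonzero because right multiplication by
  \<open>yc\<close> scales \<open>y\<close> by \<open>yk\<close>. So
  \<open>yc \<star> (sg (inv p) \<star> y)\<close> is a nonzero multiple of the generator
  \<open>yc\<close>.\<close>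

lemma specht_simple:
  assumes lam: "lam \<in> partitions N"
  shows "sym_simple N (specht N lam)"
  unfolding sym_simple_def
proof (intro conjI allI impI)
  have c: "yc N lam \<in> specht N lam"
    unfolding specht_eq using sg_in[OF Sym_id] by (metis gmul_one(1) imageI)
  then show "specht N lam \<noteq> {0}" using yc_nonzero[OF lam] by auto
  fix K assume sub: "K \<subseteq> specht N lam"
    and K: "cvec.subspace K \<and> (\<forall>p\<in>Sym N. left_mult p ` K \<subseteq> K)"
  have mul: "x \<star> y \<in> K" if "x \<in> group_algebra N" "y \<in> K" for x y
    using that(1) unfolding group_algebra_span
    by (rule clin_span_mem[OF clin_gmul_left]) (use K that(2) in \<open>auto simp: sg_gmul image_subset_iff\<close>)
  show "K = {0} \<or> K = specht N lam"
  proof (rule disjCI)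
    assume "K \<noteq> specht N lam"
    have "y = 0" if y: "y \<in> K" for y
    proof (rule ccontr)
      assume "y \<noteq> 0"
      have yA: "y \<in> group_algebra N" using y sub specht_mem[OF lam] by blast
      then obtain p where p: "p \<in> Sym N" "Poly_Mapping.lookup y p \<noteq> 0"
      proof -
        have "y = 0" if 0: "\<forall>p\<in>Sym N. Poly_Mapping.lookup y p = 0"
        proof -
          have "y = (\<Sum>p\<in>Sym N. Poly_Mapping.lookup y p *\<^sub>C sg p)"
            by (rule group_algebra_expand[OF yA])
          also have "\<dots> = 0" by (rule sum.neutral) (use 0 in simp)
          finally show ?thesis .
        qed
        then show ?thesis using that \<open>y \<noteq> 0\<close> by blast
      qed
      have pA: "sg (inv p) \<in> group_algebra N" by (intro sg_in Sym_inv p)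
      have yc: "y \<star> yc N lam = yk N lam *\<^sub>C y" using specht_yc[OF lam] y sub by blast
      have "tau (yc N lam \<star> (sg (inv p) \<star> y)) = tau ((sg (inv p) \<star> y) \<star> yc N lam)"
        by (intro tau_commute[of _ N] gmul_mem yc_mem lam pA yA)
      also have "\<dots> = yk N lam * Poly_Mapping.lookup y p"
        by (simp add: gmul_assoc yc tau_inv_gmul[OF p(1) yA])
      finally have t: "tau (yc N lam \<star> (sg (inv p) \<star> y)) \<noteq> 0"
        using p(2) yk_nonzero[OF lam] by simp
      have "yk N lam *\<^sub>C (yc N lam \<star> (sg (inv p) \<star> y)) = yc N lam \<star> ((sg (inv p) \<star> y) \<star> yc N lam)"
        by (simp add: gmul_assoc yc)
      also have "\<dots> = (yk N lam * tau (yc N lam \<star> (sg (inv p) \<star> y))) *\<^sub>C yc N lam"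
        by (rule yc_x_yc[OF lam gmul_mem[OF pA yA]])
      finally have "yk N lam *\<^sub>C (yc N lam \<star> (sg (inv p) \<star> y))
          = yk N lam *\<^sub>C (tau (yc N lam \<star> (sg (inv p) \<star> y)) *\<^sub>C yc N lam)"
        by (simp add: scaleC_scaleC)
      then have "yc N lam \<star> (sg (inv p) \<star> y) = tau (yc N lam \<star> (sg (inv p) \<star> y)) *\<^sub>C yc N lam"
        by (rule cvec.scale_left_imp_eq[OF yk_nonzero[OF lam]])
      then have "yc N lam = inverse (tau (yc N lam \<star> (sg (inv p) \<star> y))) *\<^sub>C (yc N lam \<star> (sg (inv p) \<star> y))"
        using t by (metis left_inverse scaleC_one scaleC_scaleC)
      also have "\<dots> \<in> K"
        using K by (intro cvec.subspace_scale mul gmul_mem yc_mem lam pA y) auto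
      finally have "specht N lam \<subseteq> K"
        using mul by (auto simp: specht_eq)
      then show False using sub \<open>K \<noteq> specht N lam\<close> by blast
    qed
    then show "K = {0}" using K cvec.subspace_0[of K] by auto
  qed
qed

section \<open>Words and the operators on tensor space\<close>

definition words :: "nat \<Rightarrow> nat \<Rightarrow> nat list set"
  where "words N D = {w. length w = N \<and> set w \<subseteq> {..<D}}"

lemma finite_words: "finite (words N D)"
  unfolding words_def using finite_lists_length_eq[of "{..<D}" N] by (simp add: conj_commute)

lemma words_nth: "w \<in> words N D \<Longrightarrow> i < N \<Longrightarrow> w ! i < D"
  by (simp add: words_def) (meson lessThan_iff nth_mem subsetD)

lemma words_length: "w \<in> words N D \<Longrightarrow> length w = N"
  by (simp add: words_def)

lemma words_update: "w \<in> words N D \<Longrightarrow> a < D \<Longrightarrow> w[i := a] \<in> words N D"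
  unfolding words_def using set_update_subset_insert[of w i a] by auto

text \<open>Gathers the two factors of an unordered pair of positions. Products over inversions can
  then be compared pair by pair, where \<open>q a b * q b a = 1\<close> applies.\<close>

lemma prod_pairs_symmetrize:
  fixes f :: "nat \<Rightarrow> nat \<Rightarrow> 'a::comm_monoid_mult"
  assumes "\<And>i. i < N \<Longrightarrow> f i i = 1"
  shows "(\<Prod>i<N. \<Prod>j<N. f i j) = (\<Prod>i<N. \<Prod>j<N. if i < j then f i j * f j i else 1)"
proof -
  have "(\<Prod>i<N. \<Prod>j<N. f i j) = (\<Prod>i<N. \<Prod>j<N. (if i < j then f i j else 1) * (if j < i then f i j else 1))"
    using assms by (intro prod.cong refl) (auto simp: not_less_iff_gr_or_eq)
  also have "\<dots> = (\<Prod>i<N. \<Prod>j<N. if i < j then f i j else 1) * (\<Prod>i<N. \<Prod>j<N. if j < i then f i j else 1)"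
    by (simp add: prod.distrib)
  also have "(\<Prod>i<N. \<Prod>j<N. if j < i then f i j else 1) = (\<Prod>i<N. \<Prod>j<N. if i < j then f j i else 1)"
    by (rule prod.swap)
  also have "(\<Prod>i<N. \<Prod>j<N. if i < j then f i j else 1) * \<dots>
      = (\<Prod>i<N. \<Prod>j<N. if i < j then f i j * f j i else 1)"
    unfolding prod.distrib[symmetric] by (intro prod.cong refl) simp
  finally show ?thesis .
qed

text \<open>Splits off the factors involving position \<open>i\<close>, the only ones that see a
  change of the letter there.\<close>

lemma prod_pairs_remove:
  fixes f :: "nat \<Rightarrow> nat \<Rightarrow> 'a::comm_monoid_mult"
  assumes "i < N" "f i i = 1"
  shows "(\<Prod>k<N. \<Prod>l<N. f k l) = (\<Prod>k\<in>{..<N}-{i}. \<Prod>l\<in>{..<N}-{i}. f k l) * (\<Prod>k\<in>{..<N}-{i}. f i k * f k i)"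
proof -
  have r: "(\<Prod>k<N. g k) = g i * (\<Prod>k\<in>{..<N}-{i}. g k)" for g :: "nat \<Rightarrow> 'a"
    by (rule prod.remove) (use assms in auto)
  show ?thesis
    unfolding r using assms(2) by (simp add: prod.distrib mult_ac)
qed

text \<open>The inverse turns this into a left action: the letter at position \<open>i\<close> moves
  to position \<open>p i\<close>.\<close>

definition act :: "(nat \<Rightarrow> nat) \<Rightarrow> nat list \<Rightarrow> nat list"
  where "act p w = permute_list (inv p) w"

lemma act_nth: "p \<in> Sym N \<Longrightarrow> length w = N \<Longrightarrow> i < N \<Longrightarrow> act p w ! i = w ! inv p i"
  by (simp add: act_def permute_list_nth permutes_inv)

lemma act_nth_app: "p \<in> Sym N \<Longrightarrow> length w = N \<Longrightarrow> i < N \<Longrightarrow> act p w ! p i = w ! i"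
  using Sym_less[of p N i] by (simp add: act_nth[of p N] permutes_inverses)

lemma act_length [simp]: "length (act p w) = length w"
  by (simp add: act_def)

lemma act_words: "p \<in> Sym N \<Longrightarrow> w \<in> words N D \<Longrightarrow> act p w \<in> words N D"
  by (simp add: words_def act_def permutes_inv)

lemma act_comp:
  assumes "p \<in> Sym N" "r \<in> Sym N" "length w = N"
  shows "act (p \<circ> r) w = act p (act r w)"
  using assms permute_list_compose[of "inv p" w "inv r"]
  by (simp add: act_def o_inv_distrib permutes_bij permutes_inv)

lemma act_id [simp]: "act id w = w"
  by (simp add: act_def)

text \<open>The intended values are \<open>q a b = \<omega> (d a) (d b)\<close> for the degrees \<open>d a\<close> of the basis vectors, of
  which the first \<open>m\<close> are even; \<open>T w\<close> is the basis tensor of the word \<open>w\<close> and \<open>crd w\<close> the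
  corresponding coordinate.\<close>

locale word_space =
  fixes N D m :: nat and q :: "nat \<Rightarrow> nat \<Rightarrow> complex"
    and T :: "nat list \<Rightarrow> 'm::complex_vector" and crd :: "nat list \<Rightarrow> 'm \<Rightarrow> complex"
  assumes q_inv: "a < D \<Longrightarrow> b < D \<Longrightarrow> q a b * q b a = 1"
    and q_even: "a < m \<Longrightarrow> q a a = 1"
    and q_odd: "m \<le> a \<Longrightarrow> a < D \<Longrightarrow> q a a = - 1"
    and m_le: "m \<le> D"
    and clin_crd: "clin (crd w)"
    and crd_T: "w \<in> words N D \<Longrightarrow> w' \<in> words N D \<Longrightarrow> crd w (T w') = (if w = w' then 1 else 0)"
begin

abbreviation W :: "nat list set"
  where "W \<equiv> words N D"

definition M :: "'m set"
  where "M = cvec.span (T ` W)"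

text \<open>Linear extension from the basis tensors, made total by the coordinates, so that the
  operators below are linear on the whole type and not just on \<open>M\<close>.\<close>

definition ext :: "(nat list \<Rightarrow> 'm) \<Rightarrow> 'm \<Rightarrow> 'm"
  where "ext h x = (\<Sum>w\<in>W. crd w x *\<^sub>C h w)"

lemma M_subspace: "cvec.subspace M"
  by (simp add: M_def cvec.subspace_span)

lemma T_mem: "w \<in> W \<Longrightarrow> T w \<in> M"
  by (simp add: M_def cvec.span_base)

lemma clin_ext: "clin (ext h)"
  unfolding ext_def by (intro clin_sums clin_scaleC_left clin_crd)

lemma sum_delta_T: "w \<in> W \<Longrightarrow> (\<Sum>w'\<in>W. crd w' (T w) *\<^sub>C h w') = h w"
  for h :: "nat list \<Rightarrow> 'b::complex_vector"
proof -
  assume w: "w \<in> W"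
  have "(\<Sum>w'\<in>W. crd w' (T w) *\<^sub>C h w') = (\<Sum>w'\<in>W. if w' = w then h w else 0)"
    by (rule sum.cong) (auto simp: crd_T w scaleC_one)
  then show ?thesis using w finite_words by simp
qed

lemma ext_T [simp]: "w \<in> W \<Longrightarrow> ext h (T w) = h w"
  unfolding ext_def by (rule sum_delta_T)

lemma M_eqI:
  assumes "clin f" "clin g" "x \<in> M" "\<And>w. w \<in> W \<Longrightarrow> f (T w) = g (T w)"
  shows "f x = g x"
  using assms by (intro clin_eq_on_span[of f g x "T ` W"]) (auto simp: M_def)

lemma M_expand: "x \<in> M \<Longrightarrow> x = (\<Sum>w\<in>W. crd w x *\<^sub>C T w)"
  by (rule M_eqI[of "\<lambda>x. x" "\<lambda>x. \<Sum>w\<in>W. crd w x *\<^sub>C T w"])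
    (auto intro!: clin_ident clin_sums clin_scaleC_left clin_crd simp: sum_delta_T)

lemma M_eq_0I: "x \<in> M \<Longrightarrow> (\<And>w. w \<in> W \<Longrightarrow> crd w x = 0) \<Longrightarrow> x = 0"
  using M_expand[of x] by simp

lemma ext_mem:
  assumes "cvec.subspace K" "\<And>w. w \<in> W \<Longrightarrow> h w \<in> K"
  shows "ext h x \<in> K"
  unfolding ext_def using assms by (intro cvec.subspace_sum cvec.subspace_scale) auto

lemma M_mem:
  assumes "clin f" "cvec.subspace K" "\<And>w. w \<in> W \<Longrightarrow> f (T w) \<in> K" "x \<in> M"
  shows "f x \<in> K"
  using assms by (intro clin_span_mem[of f x "T ` W" K]) (auto simp: M_def)

lemma clin_after_ext: "clin f \<Longrightarrow> f (ext h x) = (\<Sum>w\<in>W. crd w x *\<^sub>C f (h w))"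
  by (simp add: ext_def clin_sum clin_scale)

lemma q_nz: "a < D \<Longrightarrow> b < D \<Longrightarrow> q a b \<noteq> 0"
  using q_inv[of a b] by auto

lemma q_inv': "a < D \<Longrightarrow> b < D \<Longrightarrow> q a b = inverse (q b a)"
  using q_inv[of a b] by (metis inverse_unique mult.commute)

text \<open>The generalized Koszul sign: each pair of letters reversed by \<open>p\<close>
  contributes \<open>q\<close> of the two letters in their original order.\<close>

definition eps :: "(nat \<Rightarrow> nat) \<Rightarrow> nat list \<Rightarrow> complex"
  where "eps p w = (\<Prod>i<N. \<Prod>j<N. if i < j \<and> p j < p i then q (w ! i) (w ! j) else 1)"

lemma eps_id [simp]: "eps id w = 1"
  by (auto simp: eps_def intro!: prod.neutral)

text \<open>A pair reversed by \<open>r\<close> and reversed back by \<open>p\<close> contributes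
  two mutually inverse factors on the right and none on the left; a pair reversed exactly once
  contributes the same factor to both sides.\<close>

lemma eps_comp:
  assumes p: "p \<in> Sym N" and r: "r \<in> Sym N" and w: "w \<in> W"
  shows "eps (p \<circ> r) w = eps p (act r w) * eps r w"
proof -
  let ?A = "\<lambda>k l. if r k < r l \<and> p (r l) < p (r k) then q (w ! k) (w ! l) else 1"
  let ?B = "\<lambda>k l. if k < l \<and> r l < r k then q (w ! k) (w ! l) else 1"
  let ?C = "\<lambda>k l. if k < l \<and> p (r l) < p (r k) then q (w ! k) (w ! l) else 1"
  let ?F = "\<lambda>i j. if i < j \<and> p j < p i then q (act r w ! i) (act r w ! j) else 1"
  have rp: "r permutes {..<N}" using r by simp
  have "eps p (act r w) = (\<Prod>k<N. \<Prod>l<N. ?F (r k) (r l))"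
    unfolding eps_def by (subst prod.permute[OF rp], subst prod.permute[OF rp]) (simp add: o_def)
  also have "\<dots> = (\<Prod>k<N. \<Prod>l<N. ?A k l)"
    by (intro prod.cong refl) (simp add: act_nth_app[OF r words_length[OF w]])
  finally have "eps p (act r w) * eps r w = (\<Prod>k<N. \<Prod>l<N. ?A k l * ?B k l)"
    by (simp add: eps_def prod.distrib)
  also have "\<dots> = (\<Prod>k<N. \<Prod>l<N. if k < l then ?A k l * ?B k l * (?A l k * ?B l k) else 1)"
    by (rule prod_pairs_symmetrize) simp
  also have "\<dots> = (\<Prod>k<N. \<Prod>l<N. if k < l then ?C k l * ?C l k else 1)"
  proof (intro prod.cong refl)
    fix k l assume kl: "k \<in> {..<N}" "l \<in> {..<N}"
    have "q (w ! k) (w ! l) * q (w ! l) (w ! k) = 1"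
      using kl by (intro q_inv words_nth[OF w]) auto
    moreover have "r k \<noteq> r l" "p (r k) \<noteq> p (r l)" if "k < l"
      using that Sym_inj[OF p] Sym_inj[OF r] by auto
    ultimately show "(if k < l then ?A k l * ?B k l * (?A l k * ?B l k) else 1)
        = (if k < l then ?C k l * ?C l k else 1)"
      by (auto simp: not_less_iff_gr_or_eq)
  qed
  also have "\<dots> = (\<Prod>k<N. \<Prod>l<N. ?C k l)"
    by (rule prod_pairs_symmetrize[symmetric]) simp
  finally show ?thesis by (simp add: eps_def)
qed

definition nu :: "(nat \<Rightarrow> nat) \<Rightarrow> 'm \<Rightarrow> 'm"
  where "nu p = ext (\<lambda>w. eps p w *\<^sub>C T (act p w))"

lemma clin_nu: "clin (nu p)"
  unfolding nu_def by (rule clin_ext)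

lemma nu_T: "w \<in> W \<Longrightarrow> nu p (T w) = eps p w *\<^sub>C T (act p w)"
  by (simp add: nu_def)

lemma nu_mem: "p \<in> Sym N \<Longrightarrow> nu p x \<in> M"
  unfolding nu_def
  by (intro ext_mem M_subspace cvec.subspace_scale T_mem act_words)

lemma nu_comp:
  assumes "p \<in> Sym N" "r \<in> Sym N"
  shows "nu (p \<circ> r) x = nu p (nu r x)"
proof -
  have "nu p (eps r w *\<^sub>C T (act r w)) = eps (p \<circ> r) w *\<^sub>C T (act (p \<circ> r) w)" if w: "w \<in> W" for w
    using assms w eps_comp[OF assms w] act_comp[OF assms words_length[OF w]]
    by (simp add: clin_scale[OF clin_nu] nu_T act_words scaleC_scaleC mult.commute)
  then have "nu p (nu r x) = ext (\<lambda>w. eps (p \<circ> r) w *\<^sub>C T (act (p \<circ> r) w)) x"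
    by (subst nu_def[of r], subst clin_after_ext[OF clin_nu]) (simp only: ext_def cong: sum.cong)
  then show ?thesis by (simp add: nu_def)
qed

lemma nu_id: "x \<in> M \<Longrightarrow> nu id x = x"
  by (rule M_eqI[OF clin_nu clin_ident]) (auto simp: nu_T scaleC_one)

lemma nu_inv: "p \<in> Sym N \<Longrightarrow> x \<in> M \<Longrightarrow> nu p (nu (inv p) x) = x"
  "p \<in> Sym N \<Longrightarrow> x \<in> M \<Longrightarrow> nu (inv p) (nu p x) = x"
  by (simp_all add: nu_comp[symmetric] permutes_inv permutes_inv_o nu_id)

lemma eps_adjacent:
  assumes "Suc i < N"
  shows "eps (Transposition.transpose i (Suc i)) w = q (w ! i) (w ! Suc i)"
proof -
  let ?t = "Transposition.transpose i (Suc i)"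
  have inv: "k < l \<and> ?t l < ?t k \<longleftrightarrow> k = i \<and> l = Suc i" for k l
    by (auto simp: Transposition.transpose_def)
  have "eps ?t w = (\<Prod>k<N. \<Prod>l<N. if k = i then (if l = Suc i then q (w ! i) (w ! Suc i) else 1) else 1)"
    unfolding eps_def inv by (intro prod.cong refl) auto
  also have "\<dots> = (\<Prod>k<N. if k = i then (\<Prod>l<N. if l = Suc i then q (w ! i) (w ! Suc i) else 1) else 1)"
    by (intro prod.cong refl) auto
  also have "\<dots> = q (w ! i) (w ! Suc i)"
    using assms by simp
  finally show ?thesis .
qed

text \<open>The sign \<open>\<omega> (d(E\<^sub>a\<^sub>c), \<dots>)\<close> for moving the operator \<open>E\<^sub>a\<^sub>c\<close>, of degree \<open>d a - d c\<close>, past the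
  first \<open>i\<close> letters; note that \<open>q w c\<close> is inverse to \<open>q c w\<close>.\<close>

definition kap :: "nat \<Rightarrow> nat \<Rightarrow> nat \<Rightarrow> nat list \<Rightarrow> complex"
  where "kap a c i w = (\<Prod>k<i. q a (w ! k) * q (w ! k) c)"

text \<open>The matrix unit \<open>E\<^sub>a\<^sub>c\<close> acting on the tensor factor at position \<open>i\<close>.\<close>

definition opE :: "nat \<Rightarrow> nat \<Rightarrow> nat \<Rightarrow> 'm \<Rightarrow> 'm"
  where "opE a c i = ext (\<lambda>w. if w ! i = c then kap a c i w *\<^sub>C T (w[i := a]) else 0)"

definition EE :: "nat \<Rightarrow> nat \<Rightarrow> 'm \<Rightarrow> 'm"
  where "EE a c x = (\<Sum>i<N. opE a c i x)"

lemma clin_opE: "clin (opE a c i)"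
  unfolding opE_def by (rule clin_ext)

lemma clin_EE: "clin (EE a c)"
  unfolding EE_def by (intro clin_sums clin_opE)

lemma opE_T: "w \<in> W \<Longrightarrow> opE a c i (T w) = (if w ! i = c then kap a c i w *\<^sub>C T (w[i := a]) else 0)"
  by (simp add: opE_def)

lemma opE_mem: "a < D \<Longrightarrow> opE a c i x \<in> M"
  unfolding opE_def
  by (intro ext_mem M_subspace)
    (auto intro!: cvec.subspace_scale M_subspace T_mem words_update simp: cvec.subspace_0 M_subspace)

lemma EE_mem: "a < D \<Longrightarrow> EE a c x \<in> M"
  unfolding EE_def by (intro cvec.subspace_sum M_subspace opE_mem)

lemma kap_nz:
  assumes "w \<in> W" "a < D" "c < D" "i < N"
  shows "kap a c i w \<noteq> 0"
  unfolding kap_def using assms by (auto simp: q_nz words_nth)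

lemma act_update:
  assumes p: "p \<in> Sym N" and "length w = N" "i < N"
  shows "act p (w[i := a]) = (act p w)[p i := a]"
proof (rule nth_equalityI)
  fix j assume j: "j < length (act p (w[i := a]))"
  have "inv p j < N" using j assms Sym_less[OF Sym_inv[OF p], of j] by simp
  then show "act p (w[i := a]) ! j = (act p w)[p i := a] ! j"
    using j assms p
    by (cases "j = p i")
      (auto simp: act_nth[OF p] permutes_inverses nth_list_update Sym_less[OF p] permutes_inv_eq)
qed simp

text \<open>The letters other than the replaced one can be compared one at a time. Such a letter
  contributes to \<open>kap\<close> if it stands before the position of the operator, and to
  \<open>eps\<close> if \<open>p\<close> makes it cross that position. Changing \<open>c\<close> to
  \<open>a\<close> alters the latter, and in each of the four relative orders the factors balance by
  \<open>q a b * q b a = 1\<close>.\<close>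

lemma nu_opE:
  assumes p: "p \<in> Sym N" and i: "i < N" and a: "a < D" and c: "c < D"
  shows "nu p (opE a c i x) = opE a c (p i) (nu p x)"
proof -
  have "nu p (opE a c i (T w)) = opE a c (p i) (nu p (T w))" if w: "w \<in> W" for w
  proof (cases "w ! i = c")
    case False
    then show ?thesis
      using w i p
      by (simp add: opE_T nu_T clin_zero[OF clin_nu] clin_scale[OF clin_opE] act_words act_nth_app[OF p]
          words_length)
  next
    case True
    let ?R = "{..<N} - {i}"
    let ?w' = "w[i := a]"
    let ?f = "\<lambda>w k l. if k < l \<and> p l < p k then q (w ! k) (w ! l) else (1::complex)"
    \<comment> \<open>Only pairs containing \<open>i\<close> distinguish \<open>w\<close> from
      \<open>?w'\<close>; the other pairs contribute the same product to both sides.\<close>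
    have eps: "eps p v = (\<Prod>k\<in>?R. \<Prod>l\<in>?R. ?f v k l) * (\<Prod>k\<in>?R. ?f v i k * ?f v k i)" for v
      unfolding eps_def using i by (intro prod_pairs_remove) auto
    have R: "(\<Prod>k\<in>?R. \<Prod>l\<in>?R. ?f ?w' k l) = (\<Prod>k\<in>?R. \<Prod>l\<in>?R. ?f w k l)"
      by (intro prod.cong refl) auto
    have k1: "kap a c i w = (\<Prod>k\<in>?R. if k < i then q a (w ! k) * q (w ! k) c else 1)"
      unfolding kap_def using i
      by (intro prod.mono_neutral_cong_left) auto
    have "kap a c (p i) (act p w)
        = (\<Prod>k\<in>{..<N} - {p i}. if k < p i then q a (act p w ! k) * q (act p w ! k) c else 1)"
      unfolding kap_def using Sym_less[OF p i] by (intro prod.mono_neutral_cong_left) auto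
    also have "\<dots> = (\<Prod>k\<in>?R. if p k < p i then q a (act p w ! p k) * q (act p w ! p k) c else 1)"
    proof (rule prod.reindex_bij_betw[symmetric], rule bij_betw_byWitness[where f' = "inv p"])
      show "p ` ?R \<subseteq> {..<N} - {p i}"
        using Sym_less[OF p] Sym_inj[OF p] by auto
      show "inv p ` ({..<N} - {p i}) \<subseteq> ?R"
        using Sym_less[OF Sym_inv[OF p]] p by (auto simp: permutes_inv_eq)
    qed (use p in \<open>auto simp: permutes_inverses\<close>)
    also have "\<dots> = (\<Prod>k\<in>?R. if p k < p i then q a (w ! k) * q (w ! k) c else 1)"
      by (intro prod.cong refl) (simp add: act_nth_app[OF p words_length[OF w]])
    finally have k2: "kap a c (p i) (act p w)
        = (\<Prod>k\<in>?R. if p k < p i then q a (w ! k) * q (w ! k) c else 1)" .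
    have "kap a c i w * (\<Prod>k\<in>?R. ?f ?w' i k * ?f ?w' k i)
        = (\<Prod>k\<in>?R. ?f w i k * ?f w k i) * kap a c (p i) (act p w)"
      unfolding k1 k2 prod.distrib[symmetric]
    proof (intro prod.cong refl)
      fix k assume k: "k \<in> ?R"
      have wk: "w ! k < D" using k by (intro words_nth[OF w]) auto
      have eqs: "q a (w ! k) * q (w ! k) a = 1" "q c (w ! k) * q (w ! k) c = 1"
        using q_inv a c wk by auto
      have "p k \<noteq> p i" using k Sym_inj[OF p] by auto
      moreover have "?w' ! i = a" "?w' ! k = w ! k" using i words_length[OF w] k by auto
      ultimately show "(if k < i then q a (w ! k) * q (w ! k) c else 1) * (?f ?w' i k * ?f ?w' k i)
          = (?f w i k * ?f w k i) * (if p k < p i then q a (w ! k) * q (w ! k) c else 1)"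
        using k eqs True by (auto simp: not_less_iff_gr_or_eq algebra_simps)
    qed
    then have "kap a c i w * eps p ?w' = eps p w * kap a c (p i) (act p w)"
      unfolding eps R by (simp add: mult.left_commute mult.assoc)
    then show ?thesis
      using w i p a True words_update[OF w a]
      by (simp add: opE_T nu_T clin_scale[OF clin_nu] clin_scale[OF clin_opE] act_words
          act_nth_app[OF p] words_length scaleC_scaleC act_update)
  qed
  then have *: "nu p (if w ! i = c then kap a c i w *\<^sub>C T (w[i := a]) else 0)
      = opE a c (p i) (eps p w *\<^sub>C T (act p w))" if "w \<in> W" for w
    unfolding nu_T[OF that, symmetric] opE_T[OF that, symmetric] using that .
  have "nu p (opE a c i x)
      = (\<Sum>w\<in>W. crd w x *\<^sub>C nu p (if w ! i = c then kap a c i w *\<^sub>C T (w[i := a]) else 0))"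
    unfolding opE_def by (rule clin_after_ext[OF clin_nu])
  also have "\<dots> = (\<Sum>w\<in>W. crd w x *\<^sub>C opE a c (p i) (eps p w *\<^sub>C T (act p w)))"
    by (rule sum.cong) (simp_all only: *)
  also have "\<dots> = opE a c (p i) (nu p x)"
    unfolding nu_def by (rule clin_after_ext[OF clin_opE, symmetric])
  finally show ?thesis .
qed

lemma nu_EE:
  assumes "p \<in> Sym N" "a < D" "c < D"
  shows "nu p (EE a c x) = EE a c (nu p x)"
proof -
  have "nu p (EE a c x) = (\<Sum>i<N. opE a c (p i) (nu p x))"
    unfolding EE_def clin_sum[OF clin_nu] by (rule sum.cong) (auto simp: nu_opE[OF assms(1) _ assms(2,3)])
  also have "\<dots> = EE a c (nu p x)"
    unfolding EE_def using assms(1) by (subst sum.permute[of p]) (auto simp: o_def)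
  finally show ?thesis .
qed

lemma opE_same:
  assumes "i < N" "a < D" "c < D" "e < D" "c' < D"
  shows "opE a c i (opE c' e i x) = (if c = c' then opE a e i x else 0)"
proof -
  have "opE a c i (if w ! i = e then kap c' e i w *\<^sub>C T (w[i := c']) else 0)
      = (if c = c' then (if w ! i = e then kap a e i w *\<^sub>C T (w[i := a]) else 0) else 0)"
    if w: "w \<in> W" for w
  proof -
    have "kap c e i w * kap a c i (w[i := c]) = kap a e i w"
      unfolding kap_def prod.distrib[symmetric]
    proof (intro prod.cong refl)
      fix k assume k: "k \<in> {..<i}"
      then have "q c (w ! k) * q (w ! k) c = 1" using assms by (intro q_inv words_nth[OF w]) auto
      then show "q c (w ! k) * q (w ! k) e * (q a (w[i := c] ! k) * q (w[i := c] ! k) c)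
          = q a (w ! k) * q (w ! k) e"
        using k by (simp add: algebra_simps)
    qed
    then show ?thesis
      using assms w
      by (auto simp: clin_zero[OF clin_opE] clin_scale[OF clin_opE] opE_T words_update words_length
          scaleC_scaleC)
  qed
  then have "opE a c i (opE c' e i x)
      = (\<Sum>w\<in>W. crd w x *\<^sub>C (if c = c' then (if w ! i = e then kap a e i w *\<^sub>C T (w[i := a]) else 0) else 0))"
    by (subst opE_def[of c']) (simp add: clin_after_ext[OF clin_opE])
  then show ?thesis by (simp add: opE_def ext_def)
qed

text \<open>The value of the commutative factor at the degrees of \<open>E\<^sub>a\<^sub>c\<close> and \<open>E\<^sub>b\<^sub>d\<close>.\<close>

definition chi :: "nat \<Rightarrow> nat \<Rightarrow> nat \<Rightarrow> nat \<Rightarrow> complex"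
  where "chi a c b d = q a b * q c d * q d a * q b c"

lemma chi_inv:
  assumes "a < D" "c < D" "b < D" "d < D"
  shows "chi a c b d * chi b d a c = 1"
proof -
  have "chi a c b d * chi b d a c = (q a b * q b a) * (q c d * q d c) * (q d a * q a d) * (q b c * q c b)"
    by (simp add: chi_def algebra_simps)
  then show ?thesis by (simp add: q_inv assms)
qed

text \<open>The operator at \<open>i\<close> sees only letters to the left of \<open>i\<close>, but
  replacing \<open>c\<close> by \<open>a\<close> at \<open>i\<close> changes one factor of the sign
  at \<open>j\<close>, from \<open>q b c * q c d\<close> to \<open>q b a * q a d\<close>. The ratio
  of the two is \<open>chi a c b d\<close>.\<close>

lemma opE_commute_less:
  assumes "i < j" "j < N" and D: "a < D" "c < D" "b < D" "d < D"
  shows "opE a c i (opE b d j x) = chi a c b d *\<^sub>C opE b d j (opE a c i x)"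
proof -
  have "opE a c i (if w ! j = d then kap b d j w *\<^sub>C T (w[j := b]) else 0)
      = chi a c b d *\<^sub>C opE b d j (if w ! i = c then kap a c i w *\<^sub>C T (w[i := a]) else 0)"
    if w: "w \<in> W" for w
  proof (cases "w ! i = c \<and> w ! j = d")
    case True
    have k1: "kap a c i (w[j := b]) = kap a c i w"
      unfolding kap_def using assms(1) by (intro prod.cong refl) auto
    have r: "(\<Prod>k<j. g k) = g i * (\<Prod>k\<in>{..<j}-{i}. g k)" for g :: "nat \<Rightarrow> complex"
      by (rule prod.remove) (use assms in auto)
    have "(\<Prod>k\<in>{..<j}-{i}. q b (w[i := a] ! k) * q (w[i := a] ! k) d)
        = (\<Prod>k\<in>{..<j}-{i}. q b (w ! k) * q (w ! k) d)"
      by (intro prod.cong refl) auto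
    then have k2: "q b c * q c d * kap b d j (w[i := a]) = q b a * q a d * kap b d j w"
      unfolding kap_def r using True assms words_length[OF w] by simp
    have "chi a c b d * kap b d j (w[i := a]) = q a b * q d a * (q b c * q c d * kap b d j (w[i := a]))"
      by (simp add: chi_def algebra_simps)
    also have "\<dots> = (q a b * q b a) * (q d a * q a d) * kap b d j w"
      unfolding k2 by (simp add: algebra_simps)
    finally have "chi a c b d * kap b d j (w[i := a]) = kap b d j w"
      by (simp add: q_inv D)
    then show ?thesis
      using True assms w words_length[OF w]
      by (simp add: clin_scale[OF clin_opE] opE_T words_update scaleC_scaleC k1
          list_update_swap[of i j] mult.assoc[symmetric] mult.commute)
  next
    case False
    then show ?thesis
      using assms w words_length[OF w]
      by (auto simp: clin_zero[OF clin_opE] clin_scale[OF clin_opE] opE_T words_update)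
  qed
  moreover have "opE a c i (opE b d j x)
      = (\<Sum>w\<in>W. crd w x *\<^sub>C opE a c i (if w ! j = d then kap b d j w *\<^sub>C T (w[j := b]) else 0))"
    unfolding opE_def[of b d j] by (rule clin_after_ext[OF clin_opE])
  moreover have "opE b d j (opE a c i x)
      = (\<Sum>w\<in>W. crd w x *\<^sub>C opE b d j (if w ! i = c then kap a c i w *\<^sub>C T (w[i := a]) else 0))"
    unfolding opE_def[of a c i] by (rule clin_after_ext[OF clin_opE])
  ultimately show ?thesis
    by (simp add: cvec.scale_sum_right) (intro sum.cong refl, simp only: scaleC_scaleC mult.commute)
qed

lemma opE_commute:
  assumes "i \<noteq> j" "i < N" "j < N" and D: "a < D" "c < D" "b < D" "d < D"
  shows "opE a c i (opE b d j x) = chi a c b d *\<^sub>C opE b d j (opE a c i x)"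
proof (cases "i < j")
  case True
  then show ?thesis using assms by (intro opE_commute_less)
next
  case False
  then have "opE b d j (opE a c i x) = chi b d a c *\<^sub>C opE a c i (opE b d j x)"
    using assms by (intro opE_commute_less) auto
  then show ?thesis using chi_inv[OF D] by (simp add: scaleC_scaleC scaleC_one)
qed

text \<open>Operators at different positions commute up to \<open>chi\<close>, so the correction
  terms come from the diagonal \<open>i = j\<close>, where matrix units multiply. This is the
  bracket relation of the colour Lie algebra for matrix units.\<close>

lemma EE_EE:
  assumes D: "a < D" "c < D" "b < D" "d < D"
  shows "EE a c (EE b d x) = chi a c b d *\<^sub>C EE b d (EE a c x)
    + (if c = b then EE a d x else 0) - chi a c b d *\<^sub>C (if d = a then EE b c x else 0)"
proof -
  have "opE a c i (opE b d j x) = chi a c b d *\<^sub>C opE b d j (opE a c i x)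
      + (if j = i then (if c = b then opE a d i x else 0)
           - chi a c b d *\<^sub>C (if d = a then opE b c i x else 0) else 0)" if "i < N" "j < N" for i j
    using that by (auto simp: opE_same D opE_commute[OF _ that D])
  then have "EE a c (EE b d x) = (\<Sum>i<N. \<Sum>j<N. chi a c b d *\<^sub>C opE b d j (opE a c i x)
      + (if j = i then (if c = b then opE a d i x else 0)
           - chi a c b d *\<^sub>C (if d = a then opE b c i x else 0) else 0))"
    by (simp add: EE_def clin_sum[OF clin_opE])
  also have "\<dots> = (\<Sum>i<N. \<Sum>j<N. chi a c b d *\<^sub>C opE b d j (opE a c i x))
      + (\<Sum>i<N. (if c = b then opE a d i x else 0) - chi a c b d *\<^sub>C (if d = a then opE b c i x else 0))"
    by (simp add: sum.distrib)
  also have "(\<Sum>i<N. \<Sum>j<N. chi a c b d *\<^sub>C opE b d j (opE a c i x)) = chi a c b d *\<^sub>C EE b d (EE a c x)"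
    by (subst sum.swap) (simp add: EE_def clin_sum[OF clin_opE] cvec.scale_sum_right)
  finally show ?thesis
    by (simp add: EE_def sum_subtractf cvec.scale_sum_right)
qed

end

section \<open>The commutant of the symmetric group\<close>

definition positions :: "nat \<Rightarrow> nat \<Rightarrow> nat list set"
  where "positions N k = {ps. length ps = k \<and> distinct ps \<and> set ps \<subseteq> {..<N}}"

lemma finite_positions: "finite (positions N k)"
  by (rule finite_subset[of _ "{ps. set ps \<subseteq> {..<N} \<and> length ps = k}"])
    (auto simp: positions_def finite_lists_length_eq)

lemma positions_0: "positions N 0 = {[]}"
  by (auto simp: positions_def)

lemma positions_Suc:
  "bij_betw (\<lambda>(ps, i). i # ps) (SIGMA ps:positions N k. {..<N} - set ps) (positions N (Suc k))"
  by (rule bij_betw_byWitness[where f' = "\<lambda>ps. (tl ps, hd ps)"])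
    (auto simp: positions_def length_Suc_conv)

lemma Sym_positions: "bij_betw (\<lambda>p. map p [0..<N]) (Sym N) (positions N N)"
proof (rule bij_betw_byWitness[where f' = "\<lambda>ps i. if i < N then ps ! i else i"])
  show "\<forall>p\<in>Sym N. (\<lambda>i. if i < N then map p [0..<N] ! i else i) = p"
    by (auto simp: fun_eq_iff permutes_not_in)
  show "\<forall>ps\<in>positions N N. map (\<lambda>i. if i < N then ps ! i else i) [0..<N] = ps"
    by (auto simp: positions_def intro!: nth_equalityI)
  show "(\<lambda>p. map p [0..<N]) ` Sym N \<subseteq> positions N N"
    by (auto simp: positions_def distinct_map permutes_inj_on Sym_less)
  show "(\<lambda>ps i. if i < N then ps ! i else i) ` positions N N \<subseteq> Sym N"
  proof (rule image_subsetI)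
    fix ps assume ps: "ps \<in> positions N N"
    then have len: "length ps = N" "distinct ps" "set ps \<subseteq> {..<N}" by (auto simp: positions_def)
    have "set ps = {..<N}"
      by (rule card_subset_eq[OF _ len(3)]) (simp_all add: distinct_card[OF len(2)] len(1))
    then have "bij_betw ((!) ps) {..<N} {..<N}"
      by (intro bij_betw_nth len(2)) (simp_all add: len(1))
    then have "bij_betw (\<lambda>i. if i < N then ps ! i else i) {..<N} {..<N}"
      by (rule iffD2[OF bij_betw_cong, rotated]) simp
    then have "(\<lambda>i. if i < N then ps ! i else i) permutes {..<N}"
      by (rule bij_imp_permutes) simp
    then show "(\<lambda>i. if i < N then ps ! i else i) \<in> Sym N"
      by simp
  qed
qed

context word_space
begin

primrec emono :: "(nat \<times> nat) list \<Rightarrow> nat list \<Rightarrow> 'm \<Rightarrow> 'm"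
  where "emono [] ps x = x"
  | "emono (X # Xs) ps x = opE (fst X) (snd X) (hd ps) (emono Xs (tl ps) x)"

lemma clin_emono: "clin (emono Xs ps)"
proof (induction Xs arbitrary: ps)
  case Nil
  have "emono [] ps = (\<lambda>x. x)" by auto
  then show ?case by (simp add: clin_ident)
next
  case (Cons X Xs)
  have "emono (X # Xs) ps = (\<lambda>x. opE (fst X) (snd X) (hd ps) (emono Xs (tl ps) x))" by auto
  then show ?case using clin_compose[OF Cons clin_opE] by simp
qed

text \<open>Distributes the factors of a monomial over distinct positions in all possible ways. For
  \<open>N\<close> factors this is the group average of a single distribution; shorter monomials
  serve the induction on the length.\<close>

definition SS :: "(nat \<times> nat) list \<Rightarrow> 'm \<Rightarrow> 'm"
  where "SS Xs x = (\<Sum>ps\<in>positions N (length Xs). emono Xs ps x)"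

text \<open>The operators coming from the enveloping algebra, kept as functions so that commutants
  can be treated before the tensor algebra enters; \<open>UU_piT\<close> provides the link.\<close>

inductive_set UU :: "('m \<Rightarrow> 'm) set"
  where UU_id: "(\<lambda>x. x) \<in> UU"
  | UU_EE: "a < D \<Longrightarrow> c < D \<Longrightarrow> f \<in> UU \<Longrightarrow> (\<lambda>x. EE a c (f x)) \<in> UU"
  | UU_add: "f \<in> UU \<Longrightarrow> g \<in> UU \<Longrightarrow> (\<lambda>x. f x + g x) \<in> UU"
  | UU_scale: "f \<in> UU \<Longrightarrow> (\<lambda>x. k *\<^sub>C f x) \<in> UU"

lemma UU_zero: "(\<lambda>x. 0) \<in> UU"
  using UU_scale[OF UU_id, of 0] by simp

lemma UU_diff: "f \<in> UU \<Longrightarrow> g \<in> UU \<Longrightarrow> (\<lambda>x. f x - g x) \<in> UU"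
  using UU_add[OF _ UU_scale[of g "-1"], of f] by simp

lemma UU_sum: "finite I \<Longrightarrow> (\<And>i. i \<in> I \<Longrightarrow> f i \<in> UU) \<Longrightarrow> (\<lambda>x. \<Sum>i\<in>I. f i x) \<in> UU"
  by (induction I rule: finite_induct) (auto intro: UU_zero UU_add)

lemma clin_UU: "f \<in> UU \<Longrightarrow> clin f"
  by (induction rule: UU.induct) (auto intro: clin_intros clin_compose[OF _ clin_EE])

text \<open>The product of the values \<open>chi\<close> picked up when
  \<open>E\<^sub>a\<^sub>c\<close> moves past the first \<open>l\<close> factors of a
  monomial.\<close>

primrec coef :: "nat \<Rightarrow> nat \<Rightarrow> (nat \<times> nat) list \<Rightarrow> nat \<Rightarrow> complex"
  where "coef a c [] l = 1"
  | "coef a c (X # Xs) l = (case l of 0 \<Rightarrow> 1 | Suc l' \<Rightarrow> chi a c (fst X) (snd X) * coef a c Xs l')"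

abbreviation letters :: "(nat \<times> nat) list \<Rightarrow> bool"
  where "letters Xs \<equiv> set Xs \<subseteq> {..<D} \<times> {..<D}"

text \<open>A matrix unit acting at a position already occupied by the \<open>l\<close>-th factor of a monomial can be
  moved next to that factor and multiplied with it.\<close>

lemma opE_emono_absorb:
  assumes "a < D" "c < D" "letters Xs" "ps \<in> positions N (length Xs)" "l < length Xs"
  shows "opE a c (ps ! l) (emono Xs ps x) =
    coef a c Xs l *\<^sub>C (if c = fst (Xs ! l) then emono (Xs[l := (a, snd (Xs ! l))]) ps x else 0)"
  using assms(3-5)
proof (induction Xs arbitrary: ps l)
  case Nil
  then show ?case by simp
next
  case (Cons X Xs)
  obtain b d where X: "X = (b, d)" by (cases X)
  obtain i ps' where ps: "ps = i # ps'"
    using Cons.prems(2) by (auto simp: positions_def length_Suc_conv)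
  have i: "i < N" "i \<notin> set ps'" and ps': "ps' \<in> positions N (length Xs)"
    using Cons.prems(2) by (auto simp: positions_def ps)
  have bd: "b < D" "d < D" and Xs: "letters Xs" using Cons.prems(1) by (auto simp: X)
  show ?case
  proof (cases l)
    case 0
    then show ?thesis
      using assms(1,2) i bd by (simp add: X ps opE_same scaleC_one)
  next
    case (Suc l')
    have l': "l' < length Xs" using Cons.prems(3) Suc by simp
    have j: "ps' ! l' \<in> set ps'" using l' ps' by (auto simp: positions_def)
    then have jN: "ps' ! l' < N" "ps' ! l' \<noteq> i" using ps' i by (auto simp: positions_def)
    have "opE a c (ps ! l) (emono (X # Xs) ps x)
        = chi a c b d *\<^sub>C opE b d i (opE a c (ps' ! l') (emono Xs ps' x))"
      using opE_commute[OF jN(2,1) i(1) assms(1,2) bd] by (simp add: X ps Suc)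
    also have "\<dots> = coef a c (X # Xs) l *\<^sub>C
        opE b d i (if c = fst (Xs ! l') then emono (Xs[l' := (a, snd (Xs ! l'))]) ps' x else 0)"
      by (simp add: Cons.IH[OF Xs ps' l'] clin_scale[OF clin_opE] X Suc scaleC_scaleC)
    finally show ?thesis
      by (simp add: X ps Suc clin_zero[OF clin_opE])
  qed
qed

text \<open>The new matrix unit acts either at a free position, which gives the sum for the longer
  monomial, or at an occupied one, where it merges with the factor there. Solved for the longer
  monomial, this is the recursion behind \<open>SS_UU\<close>.\<close>

lemma EE_SS:
  assumes a: "a < D" and c: "c < D" and Xs: "letters Xs"
  shows "EE a c (SS Xs x) = SS ((a, c) # Xs) x + (\<Sum>l<length Xs. coef a c Xs l *\<^sub>C
    (if c = fst (Xs ! l) then SS (Xs[l := (a, snd (Xs ! l))]) x else 0))"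
proof -
  let ?k = "length Xs"
  have "EE a c (SS Xs x) = (\<Sum>ps\<in>positions N ?k. \<Sum>i<N. opE a c i (emono Xs ps x))"
    unfolding SS_def clin_sum[OF clin_EE] by (simp add: EE_def)
  also have "\<dots> = (\<Sum>ps\<in>positions N ?k. (\<Sum>i\<in>{..<N} - set ps. opE a c i (emono Xs ps x))
      + (\<Sum>i\<in>set ps. opE a c i (emono Xs ps x)))"
    by (intro sum.cong refl) (simp add: sum.subset_diff positions_def)
  also have "\<dots> = (\<Sum>ps\<in>positions N ?k. \<Sum>i\<in>{..<N} - set ps. opE a c i (emono Xs ps x))
      + (\<Sum>ps\<in>positions N ?k. \<Sum>i\<in>set ps. opE a c i (emono Xs ps x))"
    by (simp add: sum.distrib)
  also have "(\<Sum>ps\<in>positions N ?k. \<Sum>i\<in>{..<N} - set ps. opE a c i (emono Xs ps x)) = SS ((a, c) # Xs) x"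
  proof -
    have "(\<Sum>ps\<in>positions N ?k. \<Sum>i\<in>{..<N} - set ps. opE a c i (emono Xs ps x))
        = (\<Sum>(ps, i)\<in>(SIGMA ps:positions N ?k. {..<N} - set ps). emono ((a, c) # Xs) (i # ps) x)"
      by (subst sum.Sigma) (auto simp: finite_positions)
    also have "\<dots> = (\<Sum>z\<in>(SIGMA ps:positions N ?k. {..<N} - set ps).
        emono ((a, c) # Xs) ((\<lambda>(ps, i). i # ps) z) x)"
      by (rule sum.cong) auto
    also have "\<dots> = SS ((a, c) # Xs) x"
      unfolding SS_def by (subst sum.reindex_bij_betw[OF positions_Suc]) simp
    finally show ?thesis .
  qed
  also have "(\<Sum>ps\<in>positions N ?k. \<Sum>i\<in>set ps. opE a c i (emono Xs ps x))
      = (\<Sum>ps\<in>positions N ?k. \<Sum>l<?k. coef a c Xs l *\<^sub>C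
          (if c = fst (Xs ! l) then emono (Xs[l := (a, snd (Xs ! l))]) ps x else 0))"
  proof (rule sum.cong[OF refl])
    fix ps assume ps: "ps \<in> positions N ?k"
    have "bij_betw ((!) ps) {..<?k} (set ps)"
      using ps by (intro bij_betw_nth) (auto simp: positions_def)
    then have "(\<Sum>i\<in>set ps. opE a c i (emono Xs ps x)) = (\<Sum>l<?k. opE a c (ps ! l) (emono Xs ps x))"
      by (rule sum.reindex_bij_betw[symmetric])
    then show "(\<Sum>i\<in>set ps. opE a c i (emono Xs ps x)) = (\<Sum>l<?k. coef a c Xs l *\<^sub>C
          (if c = fst (Xs ! l) then emono (Xs[l := (a, snd (Xs ! l))]) ps x else 0))"
      using opE_emono_absorb[OF a c Xs ps] by simp
  qed
  also have "\<dots> = (\<Sum>l<?k. \<Sum>ps\<in>positions N ?k. coef a c Xs l *\<^sub>C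
          (if c = fst (Xs ! l) then emono (Xs[l := (a, snd (Xs ! l))]) ps x else 0))"
    by (rule sum.swap)
  also have "\<dots> = (\<Sum>l<?k. coef a c Xs l *\<^sub>C
    (if c = fst (Xs ! l) then SS (Xs[l := (a, snd (Xs ! l))]) x else 0))"
    by (intro sum.cong refl) (simp add: SS_def cvec.scale_sum_right)
  finally show ?thesis .
qed

lemma SS_UU: "letters Xs \<Longrightarrow> SS Xs \<in> UU"
proof (induction "length Xs" arbitrary: Xs)
  case 0
  have "SS Xs = (\<lambda>x. x)" using 0 by (auto simp: SS_def positions_0 fun_eq_iff)
  then show ?case by (simp add: UU_id)
next
  case (Suc k)
  obtain a c Ys where Xs: "Xs = (a, c) # Ys" using Suc.hyps(2) by (cases Xs) auto
  have ac: "a < D" "c < D" and Ys: "letters Ys" "k = length Ys" using Suc by (auto simp: Xs)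
  have IH: "SS Zs \<in> UU" if "length Zs = k" "letters Zs" for Zs
    using Suc.hyps(1)[of Zs] that by simp
  have upd: "letters (Ys[l := (a, snd (Ys ! l))])" if "l < length Ys" for l
  proof -
    have "Ys ! l \<in> {..<D} \<times> {..<D}" using Ys(1) that by auto
    then show ?thesis
      using Ys(1) ac set_update_subset_insert[of Ys l "(a, snd (Ys ! l))"] by fastforce
  qed
  have "(\<lambda>x. \<Sum>l<length Ys. coef a c Ys l *\<^sub>C
      (if c = fst (Ys ! l) then SS (Ys[l := (a, snd (Ys ! l))]) x else 0)) \<in> UU"
  proof (intro UU_sum UU_scale finite_lessThan)
    fix l assume "l \<in> {..<length Ys}"
    then show "(\<lambda>x. if c = fst (Ys ! l) then SS (Ys[l := (a, snd (Ys ! l))]) x else 0) \<in> UU"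
      using IH[of "Ys[l := (a, snd (Ys ! l))]"] upd[of l] Ys(2)
      by (cases "c = fst (Ys ! l)") (auto simp: UU_zero)
  qed
  moreover have "(\<lambda>x. EE a c (SS Ys x)) \<in> UU"
    using IH[of Ys] Ys ac by (intro UU_EE) auto
  ultimately have "(\<lambda>x. EE a c (SS Ys x) - (\<Sum>l<length Ys. coef a c Ys l *\<^sub>C
      (if c = fst (Ys ! l) then SS (Ys[l := (a, snd (Ys ! l))]) x else 0))) \<in> UU"
    by (intro UU_diff)
  then show ?case
    by (simp add: EE_SS[OF ac Ys(1)] Xs)
qed

text \<open>The average over the group without the factor \<open>1 / N!\<close>; the result commutes
  with the permutations.\<close>

definition conj_sum :: "('m \<Rightarrow> 'm) \<Rightarrow> 'm \<Rightarrow> 'm"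
  where "conj_sum g x = (\<Sum>p\<in>Sym N. nu p (g (nu (inv p) x)))"

lemma nu_emono:
  assumes "p \<in> Sym N" "letters Xs" "length ps = length Xs" "set ps \<subseteq> {..<N}"
  shows "nu p (emono Xs ps x) = emono Xs (map p ps) (nu p x)"
  using assms(2-4)
proof (induction Xs arbitrary: ps)
  case Nil
  then show ?case by simp
next
  case (Cons X Xs)
  obtain i ps' where ps: "ps = i # ps'" using Cons.prems(2) by (auto simp: length_Suc_conv)
  show ?case
    using Cons.prems Cons.IH[of ps'] assms(1) by (auto simp: ps nu_opE)
qed

text \<open>Conjugation by \<open>p\<close> carries an operator at position \<open>i\<close> to
  position \<open>p i\<close>, and for \<open>N\<close> factors the images of \<open>[0..<N]\<close>
  run through all injective placements.\<close>

lemma conj_sum_emono: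
  assumes "letters Xs" "length Xs = N" "x \<in> M"
  shows "conj_sum (emono Xs [0..<N]) x = SS Xs x"
proof -
  have "conj_sum (emono Xs [0..<N]) x = (\<Sum>p\<in>Sym N. emono Xs (map p [0..<N]) x)"
    unfolding conj_sum_def
  proof (rule sum.cong[OF refl])
    fix p assume p: "p \<in> Sym N"
    have "nu p (emono Xs [0..<N] (nu (inv p) x)) = emono Xs (map p [0..<N]) (nu p (nu (inv p) x))"
      by (rule nu_emono[OF p assms(1)]) (simp_all add: assms(2) lessThan_atLeast0)
    then show "nu p (emono Xs [0..<N] (nu (inv p) x)) = emono Xs (map p [0..<N]) x"
      by (simp only: nu_inv(1)[OF p assms(3)])
  qed
  also have "\<dots> = SS Xs x"
    unfolding SS_def assms(2) by (rule sum.reindex_bij_betw[OF Sym_positions])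
  finally show ?thesis .
qed

text \<open>The case \<open>k = 0\<close> is the goal: matrix units at all positions compose to an
  operator that sends \<open>T w\<close> to a nonzero multiple of \<open>T u\<close> and kills the
  other basis tensors. The induction starts at \<open>k = N\<close> and lowers \<open>k\<close>;
  only the positions from \<open>k\<close> on have been processed, and the scalar
  \<open>\<kappa> v\<close> stays a product of nonzero signs.\<close>

lemma emono_unit:
  assumes u: "u \<in> W" and w: "w \<in> W" and k: "k \<le> N"
  shows "\<exists>\<kappa>. (\<forall>v\<in>W. \<kappa> v \<noteq> 0) \<and> (\<forall>v\<in>W. emono (drop k (zip u w)) [k..<N] (T v) =
    (if drop k v = drop k w then \<kappa> v *\<^sub>C T (take k v @ drop k u) else 0))"
  using k
proof (induction k rule: inc_induct)
  case base
  show ?case using u w by (intro exI[of _ "\<lambda>_. 1"]) (auto simp: words_length scaleC_one)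
next
  case (step k)
  then obtain \<kappa> where k0: "\<And>v. v \<in> W \<Longrightarrow> \<kappa> v \<noteq> 0" and k1: "\<And>v. v \<in> W \<Longrightarrow>
    emono (drop (Suc k) (zip u w)) [Suc k..<N] (T v) =
      (if drop (Suc k) v = drop (Suc k) w then \<kappa> v *\<^sub>C T (take (Suc k) v @ drop (Suc k) u) else 0)"
    by blast
  have len: "length u = N" "length w = N" using u w by (auto simp: words_length)
  have uk: "u ! k < D" "w ! k < D" using step u w by (auto intro: words_nth)
  have dz: "drop k (zip u w) = (u ! k, w ! k) # drop (Suc k) (zip u w)"
    using step len by (simp add: Cons_nth_drop_Suc[symmetric])
  have upt: "[k..<N] = k # [Suc k..<N]" using step by (simp add: upt_conv_Cons)
  have main: "emono (drop k (zip u w)) [k..<N] (T v) =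
      (if drop k v = drop k w then (kap (u ! k) (w ! k) k v * \<kappa> v) *\<^sub>C T (take k v @ drop k u) else 0)"
    if v: "v \<in> W" for v
  proof (cases "drop (Suc k) v = drop (Suc k) w")
    case False
    then have "drop k v \<noteq> drop k w" by (metis drop_Suc tl_drop)
    then show ?thesis
      using False by (simp add: dz upt k1[OF v] clin_zero[OF clin_opE])
  next
    case True
    have lv: "length v = N" using v by (rule words_length)
    let ?v' = "take (Suc k) v @ drop (Suc k) u"
    have v': "?v' \<in> W"
      using u v unfolding words_def by (auto dest: in_set_takeD in_set_dropD)
    have nth: "?v' ! k = v ! k" using step lv by (simp add: nth_append)
    have upd: "?v'[k := u ! k] = take k v @ drop k u"
      using step lv len
      by (simp add: take_Suc_conv_app_nth list_update_append Cons_nth_drop_Suc[symmetric])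
    have kk: "kap a c k ?v' = kap a c k v" for a c
      unfolding kap_def using step lv by (intro prod.cong refl) (auto simp: nth_append)
    have "drop k v = drop k w \<longleftrightarrow> v ! k = w ! k"
      using True step lv len by (simp add: Cons_nth_drop_Suc[symmetric])
    then show ?thesis
      using True by (auto simp: dz upt k1[OF v] clin_scale[OF clin_opE] opE_T[OF v'] nth upd kk
          scaleC_scaleC mult.commute)
  qed
  show ?case
    using main k0 kap_nz[OF _ uk, of _ k] step
    by (intro exI[of _ "\<lambda>v. kap (u ! k) (w ! k) k v * \<kappa> v"]) auto
qed


definition munit :: "nat list \<Rightarrow> nat list \<Rightarrow> 'm \<Rightarrow> 'm"
  where "munit u w x = crd w x *\<^sub>C T u"

lemma clin_munit: "clin (munit u w)"
  unfolding munit_def by (intro clin_scaleC_left clin_crd)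

lemma conj_sum_cong: "(\<And>x. x \<in> M \<Longrightarrow> f x = g x) \<Longrightarrow> conj_sum f x = conj_sum g x"
  by (simp add: conj_sum_def nu_mem permutes_inv)

lemma conj_sum_munit:
  assumes u: "u \<in> W" and w: "w \<in> W"
  shows "\<exists>F\<in>UU. \<forall>x\<in>M. F x = conj_sum (munit u w) x"
proof -
  obtain \<kappa> where k: "\<kappa> w \<noteq> 0" "\<And>v. v \<in> W \<Longrightarrow> emono (zip u w) [0..<N] (T v) = (if v = w then \<kappa> v *\<^sub>C T u else 0)"
    using emono_unit[OF u w, of 0] w by auto
  have mon: "emono (zip u w) [0..<N] x = \<kappa> w *\<^sub>C munit u w x" if "x \<in> M" for x
  proof (rule M_eqI[OF clin_emono clin_scaled[OF clin_munit] that])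
    fix v assume v: "v \<in> W"
    show "emono (zip u w) [0..<N] (T v) = \<kappa> w *\<^sub>C munit u w (T v)"
      unfolding k(2)[OF v] munit_def crd_T[OF w v] by (simp add: scaleC_one)
  qed
  have letters: "letters (zip u w)"
  proof
    fix X assume "X \<in> set (zip u w)"
    then obtain a c where "X = (a, c)" "a \<in> set u" "c \<in> set w"
      using set_zip_leftD set_zip_rightD by (metis surj_pair)
    then show "X \<in> {..<D} \<times> {..<D}" using u w by (auto simp: words_def)
  qed
  have len: "length (zip u w) = N" using u w by (simp add: words_length)
  have "conj_sum (munit u w) x = inverse (\<kappa> w) *\<^sub>C SS (zip u w) x" if x: "x \<in> M" for x
  proof -
    have "SS (zip u w) x = conj_sum (\<lambda>x. \<kappa> w *\<^sub>C munit u w x) x"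
      unfolding conj_sum_emono[OF letters len x, symmetric] by (rule conj_sum_cong) (rule mon)
    also have "\<dots> = \<kappa> w *\<^sub>C conj_sum (munit u w) x"
      by (simp add: conj_sum_def clin_scale[OF clin_nu] cvec.scale_sum_right)
    finally show ?thesis using k(1) by (simp add: scaleC_scaleC scaleC_one)
  qed
  then show ?thesis using UU_scale[OF SS_UU[OF letters]] by (intro bexI) auto
qed

text \<open>Every operator on \<open>M\<close> is a combination of the rank one operators
  \<open>munit u w\<close>, and averaging is linear.\<close>

lemma conj_sum_UU:
  assumes g: "clin g" "\<And>w. w \<in> W \<Longrightarrow> g (T w) \<in> M"
  shows "\<exists>F\<in>UU. \<forall>x\<in>M. F x = conj_sum g x"
proof -
  have "\<forall>u\<in>W. \<forall>w\<in>W. \<exists>F. F \<in> UU \<and> (\<forall>x\<in>M. F x = conj_sum (munit u w) x)"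
    using conj_sum_munit by blast
  then obtain F where F: "\<And>u w. u \<in> W \<Longrightarrow> w \<in> W \<Longrightarrow> F u w \<in> UU"
    "\<And>u w x. u \<in> W \<Longrightarrow> w \<in> W \<Longrightarrow> x \<in> M \<Longrightarrow> F u w x = conj_sum (munit u w) x"
    by metis
  have gx: "g x = (\<Sum>w\<in>W. \<Sum>u\<in>W. crd u (g (T w)) *\<^sub>C munit u w x)" if x: "x \<in> M" for x
  proof -
    have "g x = (\<Sum>w\<in>W. crd w x *\<^sub>C g (T w))"
      by (subst M_expand[OF x]) (simp add: clin_sum[OF g(1)] clin_scale[OF g(1)])
    also have "\<dots> = (\<Sum>w\<in>W. crd w x *\<^sub>C (\<Sum>u\<in>W. crd u (g (T w)) *\<^sub>C T u))"
      by (intro sum.cong refl, subst M_expand[OF g(2), symmetric]) auto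
    finally show ?thesis
      by (simp add: munit_def cvec.scale_sum_right scaleC_scaleC mult.commute)
  qed
  have eq: "conj_sum g x = (\<Sum>w\<in>W. \<Sum>u\<in>W. crd u (g (T w)) *\<^sub>C F u w x)" if x: "x \<in> M" for x
  proof -
    have "conj_sum g x = (\<Sum>p\<in>Sym N. \<Sum>w\<in>W. \<Sum>u\<in>W. crd u (g (T w)) *\<^sub>C nu p (munit u w (nu (inv p) x)))"
      unfolding conj_sum_def
      by (intro sum.cong refl)
        (simp add: gx nu_mem permutes_inv clin_sum[OF clin_nu] clin_scale[OF clin_nu])
    also have "\<dots> = (\<Sum>w\<in>W. \<Sum>u\<in>W. \<Sum>p\<in>Sym N. crd u (g (T w)) *\<^sub>C nu p (munit u w (nu (inv p) x)))"
      by (simp only: sum.swap[of _ _ "Sym N"])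
    finally show ?thesis
      using F(2) x by (simp add: conj_sum_def cvec.scale_sum_right)
  qed
  have "(\<lambda>x. \<Sum>w\<in>W. \<Sum>u\<in>W. crd u (g (T w)) *\<^sub>C F u w x) \<in> UU"
    by (intro UU_sum UU_scale F finite_words)
  then show ?thesis using eq by (intro bexI) auto
qed

text \<open>An operator commuting with the permutations is its own average up to the factor
  \<open>N!\<close>.\<close>

lemma commutant_UU:
  assumes f: "clin f" "\<And>w. w \<in> W \<Longrightarrow> f (T w) \<in> M"
    and comm: "\<And>p x. p \<in> Sym N \<Longrightarrow> x \<in> M \<Longrightarrow> f (nu p x) = nu p (f x)"
  shows "\<exists>F\<in>UU. \<forall>x\<in>M. F x = f x"
proof -
  obtain F where F: "F \<in> UU" "\<And>x. x \<in> M \<Longrightarrow> F x = conj_sum f x"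
    using conj_sum_UU[OF f] by blast
  have "conj_sum f x = of_nat (card (Sym N)) *\<^sub>C f x" if x: "x \<in> M" for x
  proof -
    have fx: "f x \<in> M" by (rule M_mem[OF f(1) M_subspace f(2) x])
    have "conj_sum f x = (\<Sum>p\<in>Sym N. f x)"
      unfolding conj_sum_def
      by (intro sum.cong refl) (simp add: comm[symmetric] nu_mem nu_inv x permutes_inv)
    then show ?thesis by (simp add: cvec.sum_constant_scale)
  qed
  moreover have "of_nat (card (Sym N)) \<noteq> (0 :: complex)"
    by (simp add: card_permutations[OF refl])
  ultimately have "inverse (of_nat (card (Sym N))) *\<^sub>C F x = f x" if "x \<in> M" for x
    using F(2)[OF that] that by (simp add: scaleC_scaleC scaleC_one)
  then show ?thesis
    using UU_scale[OF F(1)]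
    by (intro bexI[of _ "\<lambda>x. inverse (of_nat (card (Sym N))) *\<^sub>C F x"] ballI)
qed

section \<open>Subspaces closed under the operators of the Lie algebra\<close>

definition stable :: "'m set \<Rightarrow> bool"
  where "stable K \<longleftrightarrow> cvec.subspace K \<and> K \<subseteq> M \<and> (\<forall>a<D. \<forall>c<D. \<forall>x\<in>K. EE a c x \<in> K)"

lemma stable_UU:
  assumes "stable K" "F \<in> UU" "x \<in> K"
  shows "F x \<in> K"
  using assms(2)
proof induction
  case UU_id
  show ?case by (rule assms(3))
next
  case UU_EE
  then show ?case using assms(1) by (simp add: stable_def)
next
  case UU_add
  then show ?case using assms(1) by (simp add: stable_def cvec.subspace_add)
next
  case UU_scale
  then show ?case using assms(1) by (simp add: stable_def cvec.subspace_scale)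
qed

text \<open>Serves for projections onto weights and degrees: they commute with the permutations and
  therefore agree on \<open>M\<close> with elements of \<open>UU\<close>.\<close>

lemma stable_commutant:
  assumes "stable K" "clin f" "\<And>w. w \<in> W \<Longrightarrow> f (T w) \<in> M"
    and "\<And>p x. p \<in> Sym N \<Longrightarrow> x \<in> M \<Longrightarrow> f (nu p x) = nu p (f x)" and "x \<in> K"
  shows "f x \<in> K"
proof -
  obtain F where F: "F \<in> UU" "\<forall>x\<in>M. F x = f x" using commutant_UU[OF assms(2-4)] by blast
  have "x \<in> M" using assms(1,5) by (auto simp: stable_def)
  then show ?thesis using stable_UU[OF assms(1) F(1) assms(5)] F(2) by simp
qed

lemma stable_conj_sum:
  assumes "stable K" "clin g" "\<And>w. w \<in> W \<Longrightarrow> g (T w) \<in> M" "x \<in> K"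
  shows "conj_sum g x \<in> K"
proof -
  obtain F where F: "F \<in> UU" "\<forall>x\<in>M. F x = conj_sum g x" using conj_sum_UU[OF assms(2-3)] by blast
  have "x \<in> M" using assms(1,4) by (auto simp: stable_def)
  then show ?thesis using stable_UU[OF assms(1) F(1) assms(4)] F(2) by simp
qed

lemma UU_nu:
  assumes "F \<in> UU" "p \<in> Sym N"
  shows "nu p (F x) = F (nu p x)"
  using assms(1)
  by induction (auto simp: nu_EE[OF assms(2)] clin_add[OF clin_nu] clin_scale[OF clin_nu])

end

section \<open>Simplicity of the multiplicity spaces\<close>

context word_space
begin

definition nuA :: "perm_algebra \<Rightarrow> 'm \<Rightarrow> 'm"
  where "nuA a x = lin_ext (\<lambda>p. nu p x) a"

lemma clin_nuA: "clin (nuA a)"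
  unfolding nuA_def by (rule clin_lin_ext_fun[where h = "\<lambda>x p. nu p x"]) (rule clin_nu)

lemma clin_nuA_left: "clin (\<lambda>a. nuA a x)"
  unfolding nuA_def by (rule linear_lin_ext)

lemma nuA_sg [simp]: "nuA (sg p) x = nu p x"
  by (simp add: nuA_def lin_ext_single)

lemma nuA_expand: "a \<in> group_algebra N \<Longrightarrow> nuA a x = (\<Sum>p\<in>Sym N. Poly_Mapping.lookup a p *\<^sub>C nu p x)"
  unfolding nuA_def by (rule lin_ext_superset) (auto simp: finite_permutations group_algebra_def)

lemma nuA_mem: "a \<in> group_algebra N \<Longrightarrow> nuA a x \<in> M"
  unfolding nuA_expand by (intro cvec.subspace_sum cvec.subspace_scale M_subspace nu_mem)

lemma nuA_gmul:
  assumes "a \<in> group_algebra N" "b \<in> group_algebra N"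
  shows "nuA (a \<star> b) x = nuA a (nuA b x)"
proof (rule clin_eq_sg[OF _ _ assms(1)])
  show "clin (\<lambda>a. nuA (a \<star> b) x)" by (rule clin_compose[OF clin_gmul_left clin_nuA_left])
  show "clin (\<lambda>a. nuA a (nuA b x))" by (rule clin_nuA_left)
  fix p assume p: "p \<in> Sym N"
  show "nuA (sg p \<star> b) x = nuA (sg p) (nuA b x)"
  proof (rule clin_eq_sg[OF _ _ assms(2)])
    show "clin (\<lambda>b. nuA (sg p \<star> b) x)" by (rule clin_compose[OF clin_gmul_right clin_nuA_left])
    show "clin (\<lambda>b. nuA (sg p) (nuA b x))" by (rule clin_compose[OF clin_nuA_left clin_nuA])
    fix r assume "r \<in> Sym N"
    then show "nuA (sg p \<star> sg r) x = nuA (sg p) (nuA (sg r) x)"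
      using nu_comp[OF p] by simp
  qed
qed

lemma nuA_commute:
  assumes "a \<in> group_algebra N" "clin f" "\<And>p. p \<in> Sym N \<Longrightarrow> nu p (f x) = f (nu p x)"
  shows "nuA a (f x) = f (nuA a x)"
  by (rule clin_eq_sg[OF clin_nuA_left clin_compose[OF clin_nuA_left assms(2)] assms(1)])
    (simp add: assms(3))

lemma nuA_EE: "a \<in> group_algebra N \<Longrightarrow> b < D \<Longrightarrow> c < D \<Longrightarrow> nuA a (EE b c x) = EE b c (nuA a x)"
  by (rule nuA_commute[OF _ clin_EE]) (simp_all add: nu_EE)

lemma nuA_UU: "a \<in> group_algebra N \<Longrightarrow> F \<in> UU \<Longrightarrow> nuA a (F x) = F (nuA a x)"
  by (rule nuA_commute[OF _ clin_UU]) (simp_all add: UU_nu)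

lemma UU_mem: "F \<in> UU \<Longrightarrow> x \<in> M \<Longrightarrow> F x \<in> M"
  by (rule stable_UU[of M]) (auto simp: stable_def M_subspace EE_mem)

text \<open>As \<open>yc N lam\<close> is a nonzero multiple of a primitive idempotent, this image
  is the multiplicity space of the Specht module in tensor space. For \<open>lam\<close> in
  \<open>Lam\<close> it will be the simple module with highest weight
  \<open>sharp m lam\<close>.\<close>

definition LL :: "(nat \<Rightarrow> nat) \<Rightarrow> 'm set"
  where "LL lam = nuA (yc N lam) ` M"

lemma LL_subspace: "cvec.subspace (LL lam)"
  unfolding LL_def by (rule clin_subspace_image[OF clin_nuA M_subspace])

lemma LL_sub: "lam \<in> partitions N \<Longrightarrow> LL lam \<subseteq> M"
  by (auto simp: LL_def nuA_mem yc_mem)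

lemma LL_stable: "lam \<in> partitions N \<Longrightarrow> stable (LL lam)"
  unfolding stable_def using LL_subspace[of lam] LL_sub[of lam]
  by (auto simp: LL_def nuA_EE[symmetric] yc_mem EE_mem)

lemma LL_yc:
  assumes "lam \<in> partitions N" "x \<in> LL lam"
  shows "nuA (yc N lam) x = yk N lam *\<^sub>C x"
  using assms
  by (auto simp: LL_def nuA_gmul[symmetric] yc_mem yc_square clin_scale[OF clin_nuA_left])

text \<open>The average commutes with \<open>yc\<close>, which acts on \<open>x\<close> and
  \<open>y\<close> as the scalar \<open>yk\<close>. Between two factors \<open>yc\<close> each
  \<open>sg p\<close> becomes the scalar \<open>yk * tau (yc \<star> sg p)\<close>. Up to inversion
  of \<open>p\<close> these traces are the coefficients of \<open>yc\<close>, so the coordinates add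
  up to one coordinate of \<open>nuA yc x\<close>.\<close>

lemma conj_sum_rank_one:
  assumes lam: "lam \<in> partitions N" and x: "x \<in> LL lam" and y: "y \<in> LL lam"
  shows "conj_sum (\<lambda>v. crd w v *\<^sub>C y) x = (yk N lam * crd w x) *\<^sub>C y"
proof -
  let ?c = "yc N lam" and ?k = "yk N lam" and ?g = "\<lambda>v. crd w v *\<^sub>C y"
  have k: "?k \<noteq> 0" by (rule yk_nonzero[OF lam])
  have c: "?c \<in> group_algebra N" by (rule yc_mem[OF lam])
  have xM: "x \<in> M" and yM: "y \<in> M" using x y LL_sub[OF lam] by auto
  have g: "clin ?g" "\<And>v. ?g v \<in> M"
    by (auto intro: clin_scaleC_left clin_crd cvec.subspace_scale M_subspace yM)
  obtain F where F: "F \<in> UU" "\<And>v. v \<in> M \<Longrightarrow> F v = conj_sum ?g v"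
    using conj_sum_UU[OF g] by blast
  have tau: "tau (?c \<star> sg (inv p)) = Poly_Mapping.lookup ?c p" if p: "p \<in> Sym N" for p
    using tau_commute[OF c sg_in[OF Sym_inv[OF p]]] tau_inv_gmul[OF p c] by simp
  have "?k *\<^sub>C conj_sum ?g x = F (nuA ?c x)"
    using F(2)[OF xM] by (simp add: LL_yc[OF lam x] clin_scale[OF clin_UU[OF F(1)]])
  also have "\<dots> = nuA ?c (conj_sum ?g x)"
    unfolding F(2)[OF xM, symmetric] by (rule nuA_UU[OF c F(1), symmetric])
  also have "\<dots> = (\<Sum>p\<in>Sym N. crd w (nu (inv p) x) *\<^sub>C nuA ?c (nu p y))"
    by (simp add: conj_sum_def clin_sum[OF clin_nuA] clin_scale[OF clin_nuA] clin_scale[OF clin_nu])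
  also have "\<dots> = (\<Sum>p\<in>Sym N. (crd w (nu (inv p) x) * (?k * tau (?c \<star> sg p))) *\<^sub>C y)"
  proof (rule sum.cong[OF refl])
    fix p assume p: "p \<in> Sym N"
    have "?k *\<^sub>C nuA ?c (nu p y) = nuA ?c (nuA (sg p) (nuA ?c y))"
      by (simp add: LL_yc[OF lam y] clin_scale[OF clin_nu] clin_scale[OF clin_nuA])
    also have "\<dots> = nuA (?c \<star> (sg p \<star> ?c)) y"
      using nuA_gmul[OF c gmul_mem[OF sg_in[OF p] c]] nuA_gmul[OF sg_in[OF p] c] by simp
    also have "\<dots> = ?k *\<^sub>C ((?k * tau (?c \<star> sg p)) *\<^sub>C y)"
      unfolding yc_x_yc[OF lam sg_in[OF p]]
      by (simp add: clin_scale[OF clin_nuA_left] LL_yc[OF lam y] scaleC_scaleC mult_ac)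
    finally have "nuA ?c (nu p y) = (?k * tau (?c \<star> sg p)) *\<^sub>C y"
      by (rule cvec.scale_left_imp_eq[OF k])
    then show "crd w (nu (inv p) x) *\<^sub>C nuA ?c (nu p y)
        = (crd w (nu (inv p) x) * (?k * tau (?c \<star> sg p))) *\<^sub>C y"
      by (simp add: scaleC_scaleC)
  qed
  also have "\<dots> = (?k * (\<Sum>p\<in>Sym N. tau (?c \<star> sg p) * crd w (nu (inv p) x))) *\<^sub>C y"
    by (simp add: cvec.scale_sum_left sum_distrib_left mult_ac)
  also have "(\<Sum>p\<in>Sym N. tau (?c \<star> sg p) * crd w (nu (inv p) x))
      = (\<Sum>p\<in>Sym N. tau (?c \<star> sg (inv p)) * crd w (nu p x))"
    by (subst sum_permutations_inverse) (auto intro!: sum.cong simp: permutes_inv_inv)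
  also have "\<dots> = crd w (nuA ?c x)"
    by (simp add: nuA_expand[OF c] clin_sum[OF clin_crd] clin_scale[OF clin_crd] tau scaleC_complex_def)
  also have "\<dots> = ?k * crd w x"
    by (simp add: LL_yc[OF lam x] clin_scale[OF clin_crd] scaleC_complex_def)
  finally have "?k *\<^sub>C conj_sum ?g x = ?k *\<^sub>C ((?k * crd w x) *\<^sub>C y)"
    by (simp add: scaleC_scaleC)
  then show ?thesis by (rule cvec.scale_left_imp_eq[OF k])
qed

text \<open>Some coordinate \<open>crd w x\<close> of a nonzero \<open>x\<close> in \<open>K\<close>
  is nonzero. For any \<open>y\<close> in \<open>LL lam\<close> the averaged operator
  \<open>v \<mapsto> crd w v *\<^sub>C y\<close> preserves \<open>K\<close> and sends
  \<open>x\<close> to a nonzero multiple of \<open>y\<close>.\<close>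

theorem LL_simple:
  assumes lam: "lam \<in> partitions N" and K: "stable K" "K \<subseteq> LL lam" "K \<noteq> {0}"
  shows "K = LL lam"
proof
  show "LL lam \<subseteq> K"
  proof
    fix y assume y: "y \<in> LL lam"
    have "0 \<in> K" using K(1) by (simp add: stable_def cvec.subspace_0)
    then obtain x where x: "x \<in> K" "x \<noteq> 0" using K(3) by auto
    have xL: "x \<in> LL lam" using x K(2) by auto
    then obtain w where w: "w \<in> W" "crd w x \<noteq> 0"
      using M_eq_0I[of x] x(2) LL_sub[OF lam] by blast
    have yM: "y \<in> M" using y LL_sub[OF lam] by auto
    have "conj_sum (\<lambda>v. crd w v *\<^sub>C y) x \<in> K"
      by (rule stable_conj_sum[OF K(1) _ _ x(1)])
        (auto intro: clin_scaleC_left clin_crd cvec.subspace_scale M_subspace yM)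
    then have "(yk N lam * crd w x) *\<^sub>C y \<in> K"
      by (simp add: conj_sum_rank_one[OF lam xL y])
    moreover have "cvec.subspace K" using K(1) by (simp add: stable_def)
    ultimately have "inverse (yk N lam * crd w x) *\<^sub>C ((yk N lam * crd w x) *\<^sub>C y) \<in> K"
      by (rule cvec.subspace_scale[rotated])
    moreover have nz: "yk N lam * crd w x \<noteq> 0" using w(2) yk_nonzero[OF lam] by simp
    ultimately show "y \<in> K" by (simp only: scaleC_scaleC left_inverse[OF nz] scaleC_one)
  qed
qed (rule K(2))


section \<open>Highest weight vectors\<close>

definition proj :: "(nat list \<Rightarrow> bool) \<Rightarrow> 'm \<Rightarrow> 'm"
  where "proj P = ext (\<lambda>w. if P w then T w else 0)"

lemma clin_proj: "clin (proj P)"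
  unfolding proj_def by (rule clin_ext)

lemma proj_T: "w \<in> W \<Longrightarrow> proj P (T w) = (if P w then T w else 0)"
  by (simp add: proj_def)

lemma proj_T_mem: "w \<in> W \<Longrightarrow> proj P (T w) \<in> M"
  by (simp add: proj_T T_mem cvec.subspace_0 M_subspace)

lemma proj_mem: "proj P x \<in> M"
  unfolding proj_def
  by (rule ext_mem[OF M_subspace]) (simp add: T_mem cvec.subspace_0 M_subspace)

lemma crd_proj: "w \<in> W \<Longrightarrow> crd w (proj P x) = (if P w then crd w x else 0)"
proof -
  assume w: "w \<in> W"
  have "crd w (proj P x) = (\<Sum>w'\<in>W. if w' = w then (if P w then crd w x else 0) else 0)"
    unfolding proj_def ext_def clin_sum[OF clin_crd]
    by (intro sum.cong refl)
      (auto simp: clin_scale[OF clin_crd] crd_T w clin_zero[OF clin_crd] scaleC_complex_def)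
  then show ?thesis using w finite_words by simp
qed

lemma proj_nu:
  assumes "\<And>w. w \<in> W \<Longrightarrow> P (act p w) = P w" "p \<in> Sym N" "x \<in> M"
  shows "proj P (nu p x) = nu p (proj P x)"
  by (rule M_eqI[OF clin_compose[OF clin_nu clin_proj] clin_compose[OF clin_proj clin_nu] assms(3)])
    (use assms in \<open>simp add: nu_T proj_T clin_scale[OF clin_proj] act_words clin_zero[OF clin_nu]\<close>)

lemma proj_nuA:
  assumes "\<And>p w. p \<in> Sym N \<Longrightarrow> w \<in> W \<Longrightarrow> P (act p w) = P w" "a \<in> group_algebra N" "x \<in> M"
  shows "nuA a (proj P x) = proj P (nuA a x)"
  by (rule nuA_commute[OF assms(2) clin_proj]) (simp add: proj_nu assms)

lemma proj_stable:
  assumes "stable K" "\<And>p w. p \<in> Sym N \<Longrightarrow> w \<in> W \<Longrightarrow> P (act p w) = P w" "x \<in> K"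
  shows "proj P x \<in> K"
  by (rule stable_commutant[OF assms(1) clin_proj proj_T_mem proj_nu assms(3)]) (use assms in auto)

section \<open>Weights of tensors\<close>

lemma mset_act: "p \<in> Sym N \<Longrightarrow> w \<in> W \<Longrightarrow> mset (act p w) = mset w"
  by (simp add: act_def words_length permutes_inv)

text \<open>A weight is recorded as the multiset of letters: its multiplicities are the eigenvalues
  of the operators \<open>EE a a\<close>. Zero is a weight vector of every weight.\<close>

definition wvec :: "nat multiset \<Rightarrow> 'm \<Rightarrow> bool"
  where "wvec A x \<longleftrightarrow> x \<in> M \<and> (\<forall>w\<in>W. crd w x \<noteq> 0 \<longrightarrow> mset w = A)"

lemma wvec_proj: "wvec A (proj (\<lambda>w. mset w = A) x)"
  by (simp add: wvec_def proj_mem crd_proj)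

lemma EE_T: "w \<in> W \<Longrightarrow> EE a c (T w) = (\<Sum>i<N. if w ! i = c then kap a c i w *\<^sub>C T (w[i := a]) else 0)"
  by (simp add: EE_def opE_T)

lemma crd_EE:
  assumes "x \<in> M" "a < D" "w \<in> W" "crd w (EE a c x) \<noteq> 0"
  shows "\<exists>w'\<in>W. crd w' x \<noteq> 0 \<and> (\<exists>i<N. w' ! i = c \<and> w = w'[i := a])"
proof (rule ccontr)
  assume neg: "\<not> ?thesis"
  have "EE a c x = (\<Sum>w'\<in>W. crd w' x *\<^sub>C EE a c (T w'))"
    by (subst M_expand[OF assms(1)]) (simp add: clin_sum[OF clin_EE] clin_scale[OF clin_EE])
  then have "crd w (EE a c x) = (\<Sum>w'\<in>W. crd w' x * (\<Sum>i<N. if w' ! i = c then kap a c i w' * crd w (T (w'[i := a])) else 0))"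
    by (simp add: clin_sum[OF clin_crd] clin_scale[OF clin_crd] EE_T if_distrib clin_zero[OF clin_crd]
        scaleC_complex_def cong: if_cong)
  also have "\<dots> = 0"
  proof (rule sum.neutral, rule ballI)
    fix w' assume w': "w' \<in> W"
    show "crd w' x * (\<Sum>i<N. if w' ! i = c then kap a c i w' * crd w (T (w'[i := a])) else 0) = 0"
    proof (cases "crd w' x = 0")
      case False
      have "(\<Sum>i<N. if w' ! i = c then kap a c i w' * crd w (T (w'[i := a])) else 0) = 0"
        using neg w' False assms(2,3) by (intro sum.neutral) (auto simp: crd_T words_update)
      then show ?thesis by simp
    qed simp
  qed
  finally show False using assms(4) by simp
qed

text \<open>If \<open>c\<close> is missing from \<open>A\<close>, the difference removes nothing;
  but then the image is zero, which has every weight.\<close>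

lemma wvec_EE:
  assumes "wvec A x" "a < D"
  shows "wvec (add_mset a (A - {#c#})) (EE a c x)"
  unfolding wvec_def
proof (intro conjI ballI impI)
  show "EE a c x \<in> M" by (rule EE_mem[OF assms(2)])
  fix w assume "w \<in> W" "crd w (EE a c x) \<noteq> 0"
  then obtain w' i where "w' \<in> W" "crd w' x \<noteq> 0" "i < N" "w' ! i = c" "w = w'[i := a]"
    using crd_EE[of x a w c] assms by (auto simp: wvec_def)
  then show "mset w = add_mset a (A - {#c#})"
    using assms(1) by (simp add: wvec_def mset_update words_length)
qed

lemma EE_wvec_0:
  assumes "wvec A x" "a < D" "c \<notin># A"
  shows "EE a c x = 0"
proof (rule M_eq_0I[OF EE_mem[OF assms(2)]], rule ccontr)
  fix w assume "w \<in> W" "crd w (EE a c x) \<noteq> 0"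
  then obtain w' i where "w' \<in> W" "crd w' x \<noteq> 0" "i < N" "w' ! i = c"
    using crd_EE[of x a w c] assms by (auto simp: wvec_def)
  then have "c \<in># mset w'" "mset w' = A"
    using assms(1) words_length[of w' N D] by (auto simp: wvec_def intro: nth_mem)
  then show False using assms(3) by simp
qed

lemma EE_diag_T:
  assumes "w \<in> W" "a < D"
  shows "EE a a (T w) = of_nat (count (mset w) a) *\<^sub>C T w"
proof -
  have "kap a a i w = 1" if "i < N" for i
    unfolding kap_def using that assms by (intro prod.neutral) (auto simp: q_inv words_nth)
  then have "EE a a (T w) = (\<Sum>i<N. if w ! i = a then T w else 0)"
    unfolding EE_T[OF assms(1)] by (intro sum.cong refl) (auto simp: scaleC_one)
  also have "\<dots> = (\<Sum>i\<in>{i. i < N \<and> w ! i = a}. T w)"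
    by (simp add: sum.inter_filter[symmetric])
  also have "\<dots> = of_nat (card {i. i < N \<and> w ! i = a}) *\<^sub>C T w"
    by (rule cvec.sum_constant_scale)
  also have "card {i. i < N \<and> w ! i = a} = count (mset w) a"
    using words_length[OF assms(1)] by (simp add: count_mset count_list_eq_length_filter length_filter_conv_card eq_commute)
  finally show ?thesis .
qed

lemma EE_diag:
  assumes "wvec A x" "a < D"
  shows "EE a a x = of_nat (count A a) *\<^sub>C x"
proof -
  have "EE a a x = (\<Sum>w\<in>W. crd w x *\<^sub>C EE a a (T w))"
    by (subst M_expand[of x]) (use assms(1) in \<open>auto simp: wvec_def clin_sum[OF clin_EE] clin_scale[OF clin_EE]\<close>)
  also have "\<dots> = (\<Sum>w\<in>W. of_nat (count A a) *\<^sub>C (crd w x *\<^sub>C T w))"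
  proof (rule sum.cong[OF refl])
    fix w assume w: "w \<in> W"
    show "crd w x *\<^sub>C EE a a (T w) = of_nat (count A a) *\<^sub>C (crd w x *\<^sub>C T w)"
      using assms w by (cases "crd w x = 0") (auto simp: wvec_def EE_diag_T scaleC_scaleC mult.commute)
  qed
  also have "\<dots> = of_nat (count A a) *\<^sub>C x"
    unfolding cvec.scale_sum_right[symmetric] using M_expand[of x] assms(1) by (simp add: wvec_def)
  finally show ?thesis .
qed

text \<open>Every \<open>EE a c\<close> with \<open>a < c\<close> increases \<open>ht\<close>, so a nonzero vector of largest height is annihilated
  by all of them.\<close>

definition ht :: "nat list \<Rightarrow> nat"
  where "ht w = (\<Sum>a\<leftarrow>w. D - a)"

lemma ht_update: "w \<in> W \<Longrightarrow> i < N \<Longrightarrow> ht (w[i := a]) + (D - w ! i) = ht w + (D - a)"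
proof -
  assume w: "w \<in> W" "i < N"
  then have "i < length (map ((-) D) w)" by (simp add: words_length)
  from sum_list_update[OF this, of "D - a"] elem_le_sum_list[OF this]
  show ?thesis using w by (simp add: ht_def map_update words_length)
qed

lemma ht_bound: "w \<in> W \<Longrightarrow> ht w \<le> N * D"
proof -
  assume "w \<in> W"
  then have "ht w \<le> (\<Sum>a\<leftarrow>w. D)" unfolding ht_def by (intro sum_list_mono) auto
  then show ?thesis using \<open>w \<in> W\<close> by (simp add: sum_list_triv words_length)
qed

definition hwv :: "nat multiset \<Rightarrow> 'm \<Rightarrow> bool"
  where "hwv A x \<longleftrightarrow> wvec A x \<and> x \<noteq> 0 \<and> (\<forall>a c. a < c \<longrightarrow> c < D \<longrightarrow> EE a c x = 0)"

lemma wvec_nonzero: "wvec A x \<Longrightarrow> x \<noteq> 0 \<Longrightarrow> \<exists>w\<in>W. mset w = A \<and> crd w x \<noteq> 0"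
  using M_eq_0I[of x] by (auto simp: wvec_def)

lemma hwv_exists:
  assumes K: "stable K" and nz: "K \<noteq> {0}"
  shows "\<exists>A x. x \<in> K \<and> hwv A x"
proof -
  have KM: "K \<subseteq> M" and K0: "0 \<in> K" using K by (auto simp: stable_def cvec.subspace_0)
  define Q where "Q w \<longleftrightarrow> w \<in> W \<and> (\<exists>x\<in>K. wvec (mset w) x \<and> crd w x \<noteq> 0)" for w
  obtain x where x: "x \<in> K" "x \<noteq> 0" using nz K0 by auto
  then obtain w where w: "w \<in> W" "crd w x \<noteq> 0" using M_eq_0I[of x] KM by blast
  \<comment> \<open>Weight components of elements of \<open>K\<close> stay in \<open>K\<close>,
    because the projection commutes with the permutations.\<close>
  have "proj (\<lambda>v. mset v = mset w) x \<in> K"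
    by (rule proj_stable[OF K _ x(1)]) (simp add: mset_act)
  then have "Q w"
    unfolding Q_def by (intro conjI bexI[of _ "proj (\<lambda>v. mset v = mset w) x"] w wvec_proj)
      (simp_all add: crd_proj w)
  moreover have "\<forall>v. Q v \<longrightarrow> ht v < Suc (N * D)" by (simp add: Q_def ht_bound less_Suc_eq_le)
  ultimately have "\<exists>v. Q v \<and> (\<forall>u. Q u \<longrightarrow> ht u \<le> ht v)"
    by (rule ex_has_greatest_nat)
  then obtain v where v: "Q v" "\<And>u. Q u \<Longrightarrow> ht u \<le> ht v" by blast
  from v(1) obtain y where y: "y \<in> K" "wvec (mset v) y" "crd v y \<noteq> 0"
    unfolding Q_def by blast
  have "EE a c y = 0" if ac: "a < c" "c < D" for a c
  proof (rule ccontr)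
    assume nz: "EE a c y \<noteq> 0"
    let ?A = "add_mset a (mset v - {#c#})"
    have wv: "wvec ?A (EE a c y)" using y(2) ac by (intro wvec_EE) auto
    obtain u where u: "u \<in> W" "mset u = ?A" "crd u (EE a c y) \<noteq> 0"
      using wvec_nonzero[OF wv nz] by blast
    have "EE a c y \<in> K" using K y(1) ac by (simp add: stable_def)
    then have "Q u"
      unfolding Q_def u(2) by (intro conjI bexI[of _ "EE a c y"] u wv)
    then have le: "ht u \<le> ht v" by (rule v(2))
    obtain v' i where v': "v' \<in> W" "crd v' y \<noteq> 0" "i < N" "v' ! i = c" "u = v'[i := a]"
      using crd_EE[of y a u c] u ac y KM by auto
    have "mset v' = mset v" using v' y(2) by (simp add: wvec_def)
    then have "ht v' = ht v" unfolding ht_def by (metis mset_map sum_mset_sum_list)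
    moreover have "ht u + (D - c) = ht v' + (D - a)" using ht_update[OF v'(1,3), of a] v'(4,5) by simp
    ultimately show False using le ac by simp
  qed
  moreover have "y \<noteq> 0" using y(3) clin_zero[OF clin_crd] by metis
  ultimately show ?thesis using y by (auto simp: hwv_def)
qed

text \<open>Repeatedly lowering a highest weight vector from letter \<open>a\<close> to a letter \<open>c\<close> of the same
  parity.\<close>

lemma hwv_antimono:
  assumes h: "hwv A x" and ac: "a < c" "c < D" and par: "c < m \<or> m \<le> a"
  shows "count A c \<le> count A a"
proof (rule ccontr)
  assume neg: "\<not> ?thesis"
  define u where "u k = (EE c a ^^ k) x" for k
  define As where "As k = ((\<lambda>B. add_mset c (B - {#a#})) ^^ k) A" for k
  have aD: "a < D" using ac by simp
  have ne: "a \<noteq> c" using ac by simp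
  have uS: "u (Suc k) = EE c a (u k)" for k by (simp add: u_def)
  have w: "wvec (As k) (u k)" for k
  proof (induction k)
    case 0
    show ?case using h by (simp add: u_def As_def hwv_def)
  next
    case (Suc k)
    show ?case using wvec_EE[OF Suc ac(2), of a] by (simp add: u_def As_def)
  qed
  have cnt: "count (As k) a = count A a - k" "count (As k) c = count A c + k" for k
    by (induction k) (use ne in \<open>auto simp: As_def\<close>)
  \<comment> \<open>After \<open>count A a\<close> lowerings no letter \<open>a\<close> is left, so
    the string must end; below it is shown never to end if
    \<open>count A a < count A c\<close>.\<close>
  have z: "u (Suc k) = 0" if "count A a \<le> k" for k
  proof -
    have "a \<notin># As k" using that cnt(1)[of k] by (simp flip: count_eq_zero_iff)
    then show ?thesis using EE_wvec_0[OF w ac(2)] by (simp add: uS)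
  qed
  have d: "EE a a (u k) - EE c c (u k) = (of_nat (count A a) - of_nat (count A c) - 2 * of_nat k) *\<^sub>C u k" for k
  proof (cases "k \<le> count A a")
    case True
    then show ?thesis
      by (simp add: EE_diag[OF w] aD ac cnt of_nat_diff cvec.scale_left_diff_distrib[symmetric])
  next
    case False
    then have "u k = 0" using z[of "k - 1"] by (cases k) auto
    then show ?thesis by (simp add: clin_zero[OF clin_EE])
  qed
  \<comment> \<open>For letters of equal parity the product of \<open>q a a\<close> and
    \<open>q c c\<close> is 1, so \<open>EE a c\<close> and \<open>EE c a\<close> satisfy the
    ordinary sl2 relation.\<close>
  have "chi a c c a = 1"
  proof -
    have "chi a c c a = (q a c * q c a) * (q a a * q c c)" by (simp add: chi_def)
    also have "\<dots> = 1"
      using par ac q_inv[OF aD ac(2)] q_even[of a] q_even[of c] q_odd[of a] q_odd[of c] by auto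
    finally show ?thesis .
  qed
  then have EF: "EE a c (EE c a y) = EE c a (EE a c y) + (EE a a y - EE c c y)" for y
    by (subst EE_EE) (use aD ac in \<open>simp_all add: scaleC_one\<close>)
  \<comment> \<open>The usual sl2 formula for raising the vector lowered \<open>Suc k\<close> times.
    Its second factor is a negative integer when \<open>count A a < count A c\<close>.\<close>
  have E: "EE a c (u (Suc k)) =
      (of_nat (Suc k) * (of_nat (count A a) - of_nat (count A c) - of_nat k)) *\<^sub>C u k" for k
  proof (induction k)
    case 0
    have "EE a c (u 0) = 0" using h ac by (simp add: u_def hwv_def)
    then show ?case using EF[of "u 0"] d[of 0] by (simp add: uS[of 0] clin_zero[OF clin_EE])
  next
    case (Suc k)
    have "EE a c (u (Suc (Suc k))) = EE c a (EE a c (u (Suc k))) + (EE a a (u (Suc k)) - EE c c (u (Suc k)))"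
      by (simp only: uS[of "Suc k"] EF)
    also have "\<dots> = (of_nat (Suc k) * (of_nat (count A a) - of_nat (count A c) - of_nat k)) *\<^sub>C u (Suc k)
        + (of_nat (count A a) - of_nat (count A c) - 2 * of_nat (Suc k)) *\<^sub>C u (Suc k)"
      by (simp only: Suc d clin_scale[OF clin_EE] uS[symmetric])
    also have "\<dots> = (of_nat (Suc k) * (of_nat (count A a) - of_nat (count A c) - of_nat k)
        + (of_nat (count A a) - of_nat (count A c) - 2 * of_nat (Suc k))) *\<^sub>C u (Suc k)"
      by (simp only: scaleC_add_left)
    also have "of_nat (Suc k) * (of_nat (count A a) - of_nat (count A c) - of_nat k)
        + (of_nat (count A a) - of_nat (count A c) - 2 * of_nat (Suc k))
        = (of_nat (Suc (Suc k)) * (of_nat (count A a) - of_nat (count A c) - of_nat (Suc k)) :: complex)"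
      by (simp add: algebra_simps)
    finally show ?case .
  qed
  have "u k \<noteq> 0" for k
  proof (induction k)
    case 0
    then show ?case using h by (simp add: u_def hwv_def)
  next
    case (Suc k)
    have "complex_of_nat (count A a + 0) \<noteq> of_nat (count A c + k)"
      using neg unfolding of_nat_eq_iff by simp
    then have "of_nat (count A a) - of_nat (count A c) - of_nat k \<noteq> (0::complex)"
      by (auto simp: algebra_simps)
    then have "EE a c (u (Suc k)) \<noteq> 0"
      unfolding E using Suc by (simp del: of_nat_Suc)
    then show ?case using clin_zero[OF clin_EE] by metis
  qed
  then show False using z[of "count A a"] by simp
qed

text \<open>Lowering the last even letter successively to each of the odd letters exhausts the even letter
  unless one of the odd letters does not occur.\<close>

lemma hwv_odd_zero:
  assumes h: "hwv A x" and m: "0 < m" and s: "s = count A (m - 1)" and sD: "m + s < D"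
  shows "count A (m + s) = 0"
proof (rule ccontr)
  assume neg: "count A (m + s) \<noteq> 0"
  define a where "a = m - 1"
  have a: "a < m" "a < D" using m m_le by (auto simp: a_def)
  define u where "u k = rec_nat x (\<lambda>k y. EE (m + k) a y) k" for k
  define As where "As k = rec_nat A (\<lambda>k B. add_mset (m + k) (B - {#a#})) k" for k
  have uS: "u (Suc k) = EE (m + k) a (u k)" for k by (simp add: u_def)
  have w: "wvec (As k) (u k)" if "m + k \<le> D" for k
    using that
  proof (induction k)
    case 0
    show ?case using h by (simp add: u_def As_def hwv_def)
  next
    case (Suc k)
    then show ?case using wvec_EE[of "As k" "u k" "m + k" a] by (simp add: u_def As_def)
  qed
  have cnt_a: "count (As k) a = s - k" for k
    using a by (induction k) (auto simp: As_def s a_def)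
  have cnt_k: "count (As l) (m + k) = count A (m + k)" if "l \<le> k" for k l
    using that a by (induction l) (auto simp: As_def)
  \<comment> \<open>As long as the lowering has not reached the odd letter \<open>m + k\<close>,
    turning this letter into \<open>a\<close> or into an earlier odd letter still gives
    zero.\<close>
  have kill: "(\<forall>i<k. EE (m + i) (m + k) (u l) = 0) \<and> EE a (m + k) (u l) = 0"
    if "l \<le> k" "m + k < D" for k l
    using that
  proof (induction l)
    case 0
    then show ?case using h a by (auto simp: u_def hwv_def)
  next
    case (Suc l)
    have IH: "\<And>i. i < k \<Longrightarrow> EE (m + i) (m + k) (u l) = 0" "EE a (m + k) (u l) = 0"
      using Suc by auto
    have "EE (m + i) (m + k) (u (Suc l)) = 0" if "i < k" for i
      unfolding uS by (subst EE_EE) (use a Suc that IH in \<open>auto simp: clin_zero[OF clin_EE]\<close>)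
    moreover have "EE a (m + k) (u (Suc l)) = 0"
      unfolding uS by (subst EE_EE) (use a Suc IH in \<open>auto simp: clin_zero[OF clin_EE]\<close>)
    ultimately show ?case by blast
  qed
  \<comment> \<open>Letters of opposite parity give \<open>chi = -1\<close>, hence an
    anticommutator, and the scalar is the sum of the two counts instead of their difference. It
    vanishes only if both counts do.\<close>
  have step: "EE a (m + k) (u (Suc k)) = (of_nat (s - k) + of_nat (count A (m + k))) *\<^sub>C u k"
    if k: "m + k < D" for k
  proof -
    have "chi a (m + k) (m + k) a = (q a (m + k) * q (m + k) a) * (q a a * q (m + k) (m + k))"
      by (simp add: chi_def)
    also have "\<dots> = - 1" using a k by (simp add: q_inv q_even q_odd)
    finally have "EE a (m + k) (u (Suc k)) = EE a a (u k) + EE (m + k) (m + k) (u k)"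
      unfolding uS by (subst EE_EE) (use a k kill[of k k] in \<open>auto simp: clin_zero[OF clin_EE] scaleC_one\<close>)
    then show ?thesis
      using EE_diag[OF w[of k] a(2)] EE_diag[OF w[of k] k] k
      by (simp add: cnt_a cnt_k scaleC_add_left)
  qed
  have nz: "u k \<noteq> 0" if "k \<le> s" for k
    using that
  proof (induction k)
    case 0
    then show ?case using h by (simp add: u_def hwv_def)
  next
    case (Suc k)
    have "of_nat (s - k + count A (m + k)) \<noteq> (0::complex)"
      using Suc unfolding of_nat_eq_0_iff by simp
    then have "of_nat (s - k) + of_nat (count A (m + k)) \<noteq> (0::complex)"
      by (simp only: of_nat_add not_False_eq_True)
    then have "EE a (m + k) (u (Suc k)) \<noteq> 0" using Suc sD by (simp add: step)
    then show ?case using clin_zero[OF clin_EE] by metis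
  qed
  \<comment> \<open>After \<open>s\<close> steps the letter \<open>a\<close> is used up, so the next
    vector is zero, while the step formula gives \<open>count A (m + s)\<close> times the nonzero
    \<open>u s\<close>.\<close>
  have "a \<notin># As s" using cnt_a[of s] by (simp flip: count_eq_zero_iff)
  then have "u (Suc s) = 0" using EE_wvec_0[OF w[of s], of "m + s" a] sD by (simp add: uS)
  then have "of_nat (count A (m + s)) *\<^sub>C u s = 0"
    using step[OF sD] by (simp add: clin_zero[OF clin_EE])
  then show False using neg nz[of s] by simp
qed

lemma hwv_mset:
  assumes "hwv A x"
  shows "size A = N" "set_mset A \<subseteq> {..<D}"
proof -
  obtain w where "w \<in> W" "mset w = A" using assms wvec_nonzero by (auto simp: hwv_def)
  then show "size A = N" "set_mset A \<subseteq> {..<D}" by (auto simp: words_def)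
qed

definition Lam :: "(nat \<Rightarrow> nat) set"
  where "Lam = {lam \<in> partitions N. lam m \<le> D - m}"

text \<open>Inverts \<open>sharp\<close>: the even counts are the first \<open>m\<close> rows, and
  the rows below are the conjugate of the odd counts \<open>\<nu>\<close>.
  \<open>hwv_antimono\<close> makes both pieces decreasing, and \<open>hwv_odd_zero\<close> makes
  them fit: from row \<open>m\<close> on the lengths are at most
  \<open>count A (m - 1)\<close>.\<close>

lemma hwv_shape:
  assumes h: "hwv A x"
  shows "\<exists>lam\<in>Lam. \<forall>a<D. count A a = sharp m lam a"
proof -
  define n where "n = D - m"
  define \<nu> where "\<nu> j = (if j < n then count A (m + j) else 0)" for j
  define lam where "lam i = (if i < m then count A i else card {j. j < n \<and> i - m < \<nu> j})" for i
  have D: "D = m + n" using m_le by (simp add: n_def)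
  have nu_mono: "\<nu> j' \<le> \<nu> j" if "j \<le> j'" for j j'
    using hwv_antimono[OF h, of "m + j" "m + j'"] that D by (cases "j = j'") (auto simp: \<nu>_def)
  have cols: "j < card {j. j < n \<and> i < \<nu> j} \<longleftrightarrow> i < \<nu> j" for i j
  proof -
    let ?S = "{j. j < n \<and> i < \<nu> j}"
    have fin: "finite ?S" by simp
    show ?thesis
    proof
      assume *: "i < \<nu> j"
      have "{..j} \<subseteq> ?S"
      proof
        fix j' assume "j' \<in> {..j}"
        then have "i < \<nu> j'" using nu_mono[of j' j] * by simp
        then show "j' \<in> ?S" by (auto simp: \<nu>_def split: if_splits)
      qed
      then have "card {..j} \<le> card ?S" by (rule card_mono[OF fin])
      then show "j < card ?S" by simp
    next
      assume *: "j < card ?S"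
      show "i < \<nu> j"
      proof (rule ccontr)
        assume neg: "\<not> i < \<nu> j"
        have "?S \<subseteq> {..<j}"
        proof
          fix j' assume "j' \<in> ?S"
          then show "j' \<in> {..<j}" using nu_mono[of j j'] neg by (cases "j \<le> j'") auto
        qed
        then have "card ?S \<le> card {..<j}" by (intro card_mono) auto
        then show False using * by simp
      qed
    qed
  qed
  have le_cnt: "\<nu> j \<le> N" for j
    using count_le_size[of A "m + j"] hwv_mset(1)[OF h] by (simp add: \<nu>_def)
  have mono: "lam i' \<le> lam i" if "i \<le> i'" for i i'
  proof (cases "i' < m")
    case True
    then show ?thesis
      using that hwv_antimono[OF h, of i i'] m_le by (cases "i = i'") (auto simp: lam_def)
  next
    case i': False
    show ?thesis
    proof (cases "i < m")
      case False
      then show ?thesis using that i' by (auto simp: lam_def intro!: card_mono)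
    next
      case True
      define s where "s = count A (m - 1)"
      have "\<nu> s = 0"
        using hwv_odd_zero[OF h _ s_def] True D by (auto simp: \<nu>_def)
      then have "\<not> s < card {j. j < n \<and> i' - m < \<nu> j}"
        unfolding cols by simp
      moreover have "s \<le> count A i"
        using hwv_antimono[OF h, of i "m - 1"] True m_le by (cases "i = m - 1") (auto simp: s_def)
      ultimately show ?thesis using True i' by (simp add: lam_def)
    qed
  qed
  have supp: "i < m + N" if "lam i \<noteq> 0" for i
  proof (rule ccontr)
    assume *: "\<not> i < m + N"
    have "\<not> i - m < \<nu> j" for j using le_cnt[of j] * by simp
    then show False using that * by (simp add: lam_def)
  qed
  have "(\<Sum>i | lam i \<noteq> 0. lam i) = (\<Sum>i<m + N. lam i)"
    by (rule sum.mono_neutral_left) (use supp in auto)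
  also have "\<dots> = (\<Sum>i<m. lam i) + (\<Sum>i<N. lam (m + i))"
  proof -
    have "(\<Sum>i<m + K. lam i) = (\<Sum>i<m. lam i) + (\<Sum>i<K. lam (m + i))" for K
      by (induction K) simp_all
    then show ?thesis .
  qed
  also have "(\<Sum>i<N. lam (m + i)) = (\<Sum>i<N. \<Sum>j<n. if i < \<nu> j then 1 else 0)"
  proof (rule sum.cong[OF refl])
    fix i
    have "{j. j < n \<and> i < \<nu> j} = {..<n} \<inter> {j. i < \<nu> j}" by auto
    then show "lam (m + i) = (\<Sum>j<n. if i < \<nu> j then 1 else 0)"
      by (simp add: lam_def sum.If_cases)
  qed
  also have "\<dots> = (\<Sum>j<n. \<Sum>i<N. if i < \<nu> j then 1 else 0)"
    by (rule sum.swap)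
  also have "\<dots> = (\<Sum>j<n. count A (m + j))"
  proof (rule sum.cong[OF refl])
    fix j assume j: "j \<in> {..<n}"
    have "{..<N} \<inter> {i. i < \<nu> j} = {..<\<nu> j}" using le_cnt[of j] by auto
    then show "(\<Sum>i<N. if i < \<nu> j then 1 else 0) = count A (m + j)"
      using j by (simp add: sum.If_cases \<nu>_def)
  qed
  also have "(\<Sum>i<m. lam i) = (\<Sum>i<m. count A i)" by (simp add: lam_def)
  also have "(\<Sum>i<m. count A i) + (\<Sum>j<n. count A (m + j)) = (\<Sum>a<m + n. count A a)"
  proof -
    have "(\<Sum>a<m + K. count A a) = (\<Sum>i<m. count A i) + (\<Sum>j<K. count A (m + j))" for K
      by (induction K) simp_all
    then show ?thesis by simp
  qed
  also have "\<dots> = (\<Sum>a\<in>set_mset A. count A a)"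
    using hwv_mset(2)[OF h]
    by (intro sum.mono_neutral_right) (auto simp: D not_in_iff)
  also have "\<dots> = N" using hwv_mset(1)[OF h] by (simp add: size_multiset_overloaded_eq)
  finally have part: "lam \<in> partitions N"
    using mono supp by (auto simp: partitions_def antimono_def intro!: finite_subset[of _ "{..<m + N}"])
  have "card {j. j < n \<and> i < \<nu> j} \<le> n" for i
    using card_mono[of "{..<n}" "{j. j < n \<and> i < \<nu> j}"] by auto
  then have "lam \<in> Lam" using part by (simp add: Lam_def lam_def n_def)
  moreover have "count A a = sharp m lam a" if a: "a < D" for a
  proof (cases "a < m")
    case True
    then show ?thesis by (simp add: sharp_def plus_part_def lam_def)
  next
    case False
    define j where "j = a - m"
    have j: "j < n" "a = m + j" using False a D by (auto simp: j_def)
    have "{i. (i, j) \<in> diagram lam - diagram (plus_part m lam)} = {i. m \<le> i \<and> j < card {j. j < n \<and> i - m < \<nu> j}}"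
      by (auto simp: diagram_def plus_part_def lam_def split: if_splits)
    also have "\<dots> = {m..<m + \<nu> j}" unfolding cols by auto
    finally show ?thesis using j by (simp add: sharp_def minus_part_def \<nu>_def)
  qed
  ultimately show ?thesis by blast
qed

end

section \<open>Signs of permutations fixing a word, and explicit highest weight vectors\<close>

context word_space
begin

lemma eps_nz: "w \<in> W \<Longrightarrow> eps p w \<noteq> 0"
  unfolding eps_def by (auto simp: q_nz words_nth)

lemma act_eq_iff:
  assumes p: "p \<in> Sym N" and "length w = N"
  shows "act p w = w \<longleftrightarrow> (\<forall>s<N. w ! p s = w ! s)"
proof
  assume "act p w = w"
  then show "\<forall>s<N. w ! p s = w ! s" using act_nth_app[OF assms] by metis
next
  assume *: "\<forall>s<N. w ! p s = w ! s"
  show "act p w = w"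
  proof (rule nth_equalityI)
    fix i assume "i < length (act p w)"
    then have i: "i < N" using assms(2) by simp
    then have "inv p i < N" using Sym_less[OF Sym_inv[OF p]] by simp
    then have "w ! p (inv p i) = w ! inv p i" using * by blast
    then show "act p w ! i = w ! i" using act_nth[OF assms i] Sym_inv_app(2)[OF p] by simp
  qed simp
qed

text \<open>Equal letters can be moved to the first two positions by conjugation, where the coefficient of
  their transposition is visible.\<close>

lemma eps_transpose:
  assumes w: "w \<in> W" and st: "s < N" "t < N" "s \<noteq> t" and eq: "w ! s = w ! t"
  shows "eps (Transposition.transpose s t) w = q (w ! s) (w ! s)"
proof -
  let ?tr = "Transposition.transpose s t"
  define t' where "t' = Transposition.transpose s 0 t"
  define g where "g = Transposition.transpose t' 1 \<circ> Transposition.transpose s 0"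
  have N: "Suc 0 < N" using st by linarith
  have t': "t' < N" "t' \<noteq> 0" using st N by (auto simp: t'_def Transposition.transpose_def)
  have g: "g \<in> Sym N"
    unfolding g_def using st t' N by (intro Sym_comp) (auto intro: permutes_swap_id)
  have gs: "g s = 0" using t' by (simp add: g_def Transposition.transpose_def)
  have gt: "g t = Suc 0" by (simp add: g_def t'_def[symmetric])
  have tr: "?tr \<in> Sym N" using st by (simp add: permutes_swap_id)
  have tr01: "Transposition.transpose 0 (Suc 0) \<in> Sym N" using N by (simp add: permutes_swap_id)
  have conj: "g \<circ> ?tr = Transposition.transpose 0 (Suc 0) \<circ> g"
  proof
    fix x
    have "g x = 0 \<longleftrightarrow> x = s" "g x = Suc 0 \<longleftrightarrow> x = t"
      using Sym_inj[OF g] gs gt by metis+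
    then show "(g \<circ> ?tr) x = (Transposition.transpose 0 (Suc 0) \<circ> g) x"
      using gs gt by (auto simp: Transposition.transpose_def)
  qed
  have fix_w: "act ?tr w = w"
    using eq by (subst act_eq_iff[OF tr words_length[OF w]]) (auto simp: Transposition.transpose_def)
  have "eps g w * eps ?tr w = eps (g \<circ> ?tr) w"
    by (simp add: eps_comp[OF g tr w] fix_w)
  also have "\<dots> = eps (Transposition.transpose 0 (Suc 0)) (act g w) * eps g w"
    unfolding conj by (rule eps_comp[OF tr01 g w])
  also have "eps (Transposition.transpose 0 (Suc 0)) (act g w) = q (act g w ! g s) (act g w ! g t)"
    using eps_adjacent[OF N, of "act g w"] by (simp add: gs gt)
  also have "\<dots> = q (w ! s) (w ! s)"
    using act_nth_app[OF g words_length[OF w]] st eq by simp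
  finally show ?thesis using eps_nz[OF w, of g] by (simp add: mult.commute)
qed

lemma nu_transpose:
  assumes "w \<in> W" "s < N" "t < N" "s \<noteq> t" "w ! s = w ! t"
  shows "nu (Transposition.transpose s t) (T w) = q (w ! s) (w ! s) *\<^sub>C T w"
proof -
  have tr: "Transposition.transpose s t \<in> Sym N" using assms by (simp add: permutes_swap_id)
  have "act (Transposition.transpose s t) w = w"
    using assms by (subst act_eq_iff[OF tr words_length[OF assms(1)]]) (auto simp: Transposition.transpose_def)
  then show ?thesis using eps_transpose[OF assms] by (simp add: nu_T assms(1))
qed

text \<open>Induction on the number of moved positions: composing with the transposition of
  \<open>s\<close> and \<open>p s\<close> makes \<open>s\<close> fixed and moves no new position.
  The transposed letters agree, so \<open>eps_transpose\<close> gives its sign, which is the same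
  for all moved positions.\<close>

lemma eps_fix:
  assumes w: "w \<in> W" and p: "p \<in> Sym N" and fix_w: "\<And>s. s < N \<Longrightarrow> w ! p s = w ! s"
    and letter: "\<And>s. s < N \<Longrightarrow> p s \<noteq> s \<Longrightarrow> q (w ! s) (w ! s) = (if neg then - 1 else 1)"
  shows "eps p w = of_int (if neg then sign p else 1)"
  using p fix_w letter
proof (induction "card {s. s < N \<and> p s \<noteq> s}" arbitrary: p rule: less_induct)
  case less
  show ?case
  proof (cases "\<exists>s<N. p s \<noteq> s")
    case False
    then have "p s = s" for s using less.prems(1) by (cases "s < N") (auto simp: permutes_not_in)
    then have "p = id" by auto
    then show ?thesis by simp
  next
    case True
    then obtain s where s: "s < N" "p s \<noteq> s" by blast
    have ps: "p s < N" by (rule Sym_less[OF less.prems(1) s(1)])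
    let ?tr = "Transposition.transpose s (p s)"
    let ?p' = "?tr \<circ> p"
    have tr: "?tr \<in> Sym N" using s ps by (simp add: permutes_swap_id)
    have p': "?p' \<in> Sym N" by (rule Sym_comp[OF tr less.prems(1)])
    have pp: "p = ?tr \<circ> ?p'" by (simp add: o_assoc[symmetric] fun_eq_iff)
    have sub: "{u. u < N \<and> ?p' u \<noteq> u} \<subset> {u. u < N \<and> p u \<noteq> u}"
    proof
      show "{u. u < N \<and> ?p' u \<noteq> u} \<subseteq> {u. u < N \<and> p u \<noteq> u}"
      proof
        fix u assume u: "u \<in> {u. u < N \<and> ?p' u \<noteq> u}"
        have "p u \<noteq> u"
        proof
          assume "p u = u"
          moreover from this have "u \<noteq> s" "u \<noteq> p s" using s Sym_inj[OF less.prems(1)] by metis+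
          ultimately show False using u by (simp add: Transposition.transpose_def)
        qed
        then show "u \<in> {u. u < N \<and> p u \<noteq> u}" using u by simp
      qed
      show "{u. u < N \<and> ?p' u \<noteq> u} \<noteq> {u. u < N \<and> p u \<noteq> u}"
        using s by (auto simp: set_eq_iff intro!: exI[of _ s])
    qed
    have fix': "w ! ?p' u = w ! u" if "u < N" for u
      using less.prems(2)[OF that] less.prems(2)[OF s(1)] by (auto simp: Transposition.transpose_def)
    have IH: "eps ?p' w = of_int (if neg then sign ?p' else 1)"
    proof (rule less.hyps[OF _ p' fix'])
      show "card {u. u < N \<and> ?p' u \<noteq> u} < card {u. u < N \<and> p u \<noteq> u}"
        by (rule psubset_card_mono[OF _ sub]) simp
      show "q (w ! u) (w ! u) = (if neg then - 1 else 1)" if "u < N" "?p' u \<noteq> u" for u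
        using sub that less.prems(3)[of u] by blast
    qed
    have "act ?p' w = w" using fix' act_eq_iff[OF p' words_length[OF w]] by simp
    then have e1: "eps p w = eps ?tr w * eps ?p' w"
      using eps_comp[OF tr p' w] pp by metis
    have e2: "eps ?tr w = (if neg then - 1 else 1)"
      using eps_transpose[OF w s(1) ps] less.prems(2)[OF s(1)] less.prems(3)[OF s] s(2) by simp
    have "sign p = sign ?tr * sign ?p'" using Sym_sign_comp[OF tr p'] pp by metis
    then have e3: "sign ?p' = - sign p" using s(2) by (simp add: sign_swap_id split: if_splits)
    show ?thesis unfolding e1 e2 IH e3 by simp
  qed
qed

text \<open>Exchanging two equal odd letters multiplies the basis tensor by -1, while the
  symmetrizer absorbs the transposition unchanged.\<close>

lemma nuA_symm_eq_0:
  assumes w: "w \<in> W" and st: "s < N" "t < N" "s \<noteq> t" "w ! s = w ! t"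
    and f: "f s = f t" and odd: "m \<le> w ! s"
  shows "nuA (symm N f) (T w) = 0"
proof -
  let ?tr = "Transposition.transpose s t"
  have tr: "?tr \<in> stab N f" using st f by (intro stab_transpose)
  have "q (w ! s) (w ! s) = - 1" using odd words_nth[OF w st(1)] by (rule q_odd)
  then have "nu ?tr (T w) = - T w" using nu_transpose[OF w st] by (simp add: scaleC_one)
  then have "nuA (symm N f) (nuA (sg ?tr) (T w)) = - nuA (symm N f) (T w)"
    by (simp add: clin_uminus[OF clin_nuA])
  then have "nuA (symm N f) (T w) = - nuA (symm N f) (T w)"
    by (simp add: nuA_gmul[symmetric] symm_mem sg_in[OF stab_Sym[OF tr]] symm_right[OF tr] del: nuA_sg)
  then show ?thesis by (rule eq_uminus_imp_0)
qed

text \<open>Here the exchange of equal even letters acts trivially and the antisymmetrizer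
  contributes the sign -1.\<close>

lemma nuA_asymm_eq_0:
  assumes w: "w \<in> W" and st: "s < N" "t < N" "s \<noteq> t" "w ! s = w ! t"
    and f: "f s = f t" and even: "w ! s < m"
  shows "nuA (asymm N f) (T w) = 0"
proof -
  let ?tr = "Transposition.transpose s t"
  have tr: "?tr \<in> stab N f" using st f by (intro stab_transpose)
  have "q (w ! s) (w ! s) = 1" using even by (rule q_even)
  then have "nu ?tr (T w) = T w" using nu_transpose[OF w st] by (simp add: scaleC_one)
  then have "nuA (asymm N f) (T w) = nuA (asymm N f) (nuA (sg ?tr) (T w))" by simp
  also have "\<dots> = nuA (asymm N f \<star> sg ?tr) (T w)"
    by (rule nuA_gmul[symmetric]) (intro asymm_mem sg_in stab_Sym[OF tr])+
  also have "\<dots> = - nuA (asymm N f) (T w)"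
    using st(3) by (simp add: asymm_right[OF tr] sign_swap_id scaleC_one clin_uminus[OF clin_nuA_left])
  finally show ?thesis by (rule eq_uminus_imp_0)
qed

lemma nuA_symm_expand: "w \<in> W \<Longrightarrow> nuA (symm N f) (T w) = (\<Sum>p\<in>stab N f. eps p w *\<^sub>C T (act p w))"
  by (simp add: symm_def clin_sum[OF clin_nuA_left] nu_T)

lemma nuA_asymm_expand:
  "w \<in> W \<Longrightarrow> nuA (asymm N f) (T w) = (\<Sum>p\<in>stab N f. (of_int (sign p) * eps p w) *\<^sub>C T (act p w))"
  by (simp add: asymm_def clin_sum[OF clin_nuA_left] clin_scale[OF clin_nuA_left] nu_T scaleC_scaleC)

lemma wvec_T: "w \<in> W \<Longrightarrow> wvec (mset w) (T w)"
  by (simp add: wvec_def T_mem crd_T)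

lemma wvec_nuA:
  assumes "a \<in> group_algebra N" "wvec A x"
  shows "wvec A (nuA a x)"
proof -
  have x: "proj (\<lambda>w. mset w = A) x = x"
  proof -
    have "x \<in> M" using assms(2) by (simp add: wvec_def)
    have "proj (\<lambda>w. mset w = A) x = (\<Sum>w\<in>W. crd w x *\<^sub>C T w)"
      unfolding proj_def ext_def using assms(2)
      by (intro sum.cong refl) (auto simp: wvec_def)
    then show ?thesis using M_expand[OF \<open>x \<in> M\<close>] by simp
  qed
  have "nuA a (proj (\<lambda>w. mset w = A) x) = proj (\<lambda>w. mset w = A) (nuA a x)"
    using assms by (intro proj_nuA) (auto simp: mset_act wvec_def)
  then show ?thesis using wvec_proj[of A "nuA a x"] unfolding x by simp
qed

text \<open>Row \<open>i < m\<close> of the tableau is filled with the even letter \<open>i\<close>, and below these rows column \<open>j\<close>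
  is filled with the odd letter \<open>m + j\<close>.\<close>

definition hword :: "(nat \<Rightarrow> nat) \<Rightarrow> nat list"
  where "hword lam = map (\<lambda>t. if rowof lam t < m then rowof lam t else m + colof lam t) [0..<N]"

lemma hword_nth: "t < N \<Longrightarrow> hword lam ! t = (if rowof lam t < m then rowof lam t else m + colof lam t)"
  by (simp add: hword_def)

text \<open>The hook condition \<open>lam m \<le> D - m\<close> bounds the columns from row
  \<open>m\<close> on, so that there are enough odd letters to fill them.\<close>

lemma hword_words:
  assumes "lam \<in> Lam"
  shows "hword lam \<in> W"
proof -
  have lam: "lam \<in> partitions N" "lam m \<le> D - m" using assms by (auto simp: Lam_def)
  have odd: "m + colof lam t < D" if "t < N" "\<not> rowof lam t < m" for t
  proof -
    have "colof lam t < lam (rowof lam t)" by (rule tableau_cell(2)[OF lam(1) that(1)])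
    also have "\<dots> \<le> lam m" using that(2) by (intro part_mono[OF lam(1)]) simp
    also have "\<dots> \<le> D - m" by (rule lam(2))
    finally show ?thesis by simp
  qed
  have less: "hword lam ! t < D" if t: "t < N" for t
  proof (cases "rowof lam t < m")
    case True
    then show ?thesis using m_le t by (simp add: hword_nth)
  next
    case False
    then show ?thesis using odd[OF t False] t by (simp add: hword_nth)
  qed
  have len: "length (hword lam) = N" by (simp add: hword_def)
  have "set (hword lam) \<subseteq> {..<D}"
  proof
    fix a assume "a \<in> set (hword lam)"
    then obtain t where "t < N" "a = hword lam ! t" unfolding in_set_conv_nth len by blast
    then show "a \<in> {..<D}" using less by simp
  qed
  then show ?thesis using len by (simp add: words_def)
qed

lemma count_hword:
  assumes lam: "lam \<in> partitions N"
  shows "count (mset (hword lam)) a = sharp m lam a"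
proof -
  have "count (mset (hword lam)) a = card {t. t < N \<and> hword lam ! t = a}"
    unfolding count_mset count_list_eq_length_filter length_filter_conv_card
    by (rule arg_cong[of _ _ card]) (auto simp: hword_def)
  also have "\<dots> = sharp m lam a"
  proof (cases "a < m")
    case True
    have "{t. t < N \<and> hword lam ! t = a} = {t\<in>{..<N}. rowof lam t = a}"
      using True by (auto simp: hword_nth)
    then show ?thesis using True card_row[OF lam] by (simp add: sharp_def plus_part_def)
  next
    case False
    let ?j = "a - m"
    have "{t. t < N \<and> hword lam ! t = a} = (\<lambda>i. row_tableau lam (i, ?j)) ` {i. m \<le> i \<and> ?j < lam i}"
    proof (intro set_eqI iffI)
      fix t assume t: "t \<in> {t. t < N \<and> hword lam ! t = a}"
      then have "t < N" by simp
      have "\<not> rowof lam t < m" "colof lam t = ?j"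
        using t False by (auto simp: hword_nth split: if_splits)
      then show "t \<in> (\<lambda>i. row_tableau lam (i, ?j)) ` {i. m \<le> i \<and> ?j < lam i}"
        using tableau_cell[OF lam \<open>t < N\<close>] by (intro image_eqI[of _ _ "rowof lam t"]) simp_all
    next
      fix t assume "t \<in> (\<lambda>i. row_tableau lam (i, ?j)) ` {i. m \<le> i \<and> ?j < lam i}"
      then obtain i where i: "m \<le> i" "?j < lam i" "t = row_tableau lam (i, ?j)" by auto
      then show "t \<in> {t. t < N \<and> hword lam ! t = a}"
        using cell_tableau[OF lam i(2)] False by (simp add: hword_nth)
    qed
    moreover have "inj_on (\<lambda>i. row_tableau lam (i, ?j)) {i. m \<le> i \<and> ?j < lam i}"
      by (rule inj_on_inverseI[of _ "rowof lam"]) (simp add: cell_tableau(2)[OF lam])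
    moreover have "{i. (i, ?j) \<in> diagram lam - diagram (plus_part m lam)} = {i. m \<le> i \<and> ?j < lam i}"
      by (auto simp: diagram_def plus_part_def split: if_splits)
    ultimately show ?thesis using False by (simp add: card_image sharp_def minus_part_def)
  qed
  finally show ?thesis .
qed

text \<open>With \<open>ya\<close> applied before \<open>yb\<close>, every raised word is killed by
  one of the two factors; in \<open>hw\<close> a further \<open>ya\<close> moves the result into the
  image of \<open>yc = ya \<star> yb\<close>.\<close>

definition pre_hw :: "(nat \<Rightarrow> nat) \<Rightarrow> 'm"
  where "pre_hw lam = nuA (yb N lam) (nuA (ya N lam) (T (hword lam)))"

text \<open>A raised letter meets a copy of itself. If \<open>x\<close> is odd, its row contains
  \<open>x\<close> further to the left and the row symmetrizer kills the word. If \<open>x\<close>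
  is even, then after any row permutation the column of the raised letter meets row
  \<open>x\<close>, which carries the letter \<open>x\<close>, and the column antisymmetrizer
  applies.\<close>

lemma raised_hword_eq_0:
  assumes lam: "lam \<in> Lam" and t: "t < N" and x: "x < hword lam ! t"
  shows "nuA (yb N lam) (nuA (ya N lam) (T ((hword lam)[t := x]))) = 0"
proof -
  have lp: "lam \<in> partitions N" using lam by (simp add: Lam_def)
  let ?w = "hword lam"
  let ?w' = "?w[t := x]"
  have w: "?w \<in> W" by (rule hword_words[OF lam])
  have xD: "x < D" using x words_nth[OF w t] by simp
  have w': "?w' \<in> W" by (rule words_update[OF w xD])
  have len: "length ?w = N" "length ?w' = N" using words_length[OF w] by auto
  let ?i = "rowof lam t" and ?j = "colof lam t"
  have cell: "?j < lam ?i" by (rule tableau_cell(2)[OF lp t])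
  show ?thesis
  proof (cases "x < m")
    case True
    have xi: "x < ?i" using x t True by (auto simp: hword_nth split: if_splits)
    have "nuA (yb N lam) (T (act p ?w')) = 0" if p: "p \<in> stab N (rowof lam)" for p
    proof -
      have pS: "p \<in> Sym N" by (rule stab_Sym[OF p])
      have pt: "p t < N" "rowof lam (p t) = ?i" using Sym_less[OF pS t] p t by (auto simp: stab_def)
      let ?u = "row_tableau lam (x, colof lam (p t))"
      have "colof lam (p t) < lam ?i" using tableau_cell(2)[OF lp pt(1)] pt(2) by simp
      also have "\<dots> \<le> lam x" using xi by (intro part_mono[OF lp]) simp
      finally have c: "colof lam (p t) < lam x" .
      note u = cell_tableau[OF lp c]
      have iu: "inv p ?u < N" "rowof lam (inv p ?u) = x"
        using Sym_less[OF Sym_inv[OF pS] u(1)] stab_inv[OF p] u by (auto simp: stab_def)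
      have "inv p ?u \<noteq> t" using iu(2) xi by auto
      then have "act p ?w' ! ?u = x"
        using act_nth[OF pS len(2) u(1)] iu True by (simp add: hword_nth)
      moreover have "act p ?w' ! p t = x" using act_nth_app[OF pS len(2) t] t len by simp
      ultimately show ?thesis
        using u pt xi True by (intro nuA_asymm_eq_0[of _ ?u "p t"] act_words[OF pS w']) auto
    qed
    then show ?thesis
      by (simp add: nuA_symm_expand[OF w'] clin_sum[OF clin_nuA] clin_scale[OF clin_nuA])
  next
    case False
    have im: "\<not> ?i < m" using x False t by (auto simp: hword_nth split: if_splits)
    then have xj: "x - m < ?j" using x False t by (simp add: hword_nth)
    let ?u = "row_tableau lam (?i, x - m)"
    have c: "x - m < lam ?i" using xj cell by simp
    note u = cell_tableau[OF lp c]
    have ut: "?u \<noteq> t" using u(3) xj by auto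
    have "?w' ! ?u = x" using ut u im False by (simp add: hword_nth)
    moreover have "?w' ! t = x" using t len by simp
    ultimately have "nuA (ya N lam) (T ?w') = 0"
      using u ut t False by (intro nuA_symm_eq_0[OF w', of ?u t]) auto
    then show ?thesis by (simp add: clin_zero[OF clin_nuA])
  qed
qed

lemma EE_pre_hw:
  assumes lam: "lam \<in> Lam" and ac: "a < c" "c < D"
  shows "EE a c (pre_hw lam) = 0"
proof -
  let ?w = "hword lam"
  have w: "?w \<in> W" by (rule hword_words[OF lam])
  have "EE a c (pre_hw lam) = nuA (yb N lam) (nuA (ya N lam) (EE a c (T ?w)))"
    using ac by (simp add: pre_hw_def nuA_EE asymm_mem symm_mem)
  also have "\<dots> = (\<Sum>i<N. nuA (yb N lam) (nuA (ya N lam) (if ?w ! i = c then kap a c i ?w *\<^sub>C T (?w[i := a]) else 0)))"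
    by (simp add: EE_T[OF w] clin_sum[OF clin_nuA])
  also have "\<dots> = 0"
    using ac raised_hword_eq_0[OF lam]
    by (intro sum.neutral) (auto simp: clin_scale[OF clin_nuA] clin_zero[OF clin_nuA])
  finally show ?thesis .
qed

text \<open>The coefficient at the basis tensor of \<open>hword lam\<close> counts the pairs of a
  row and a column permutation that together restore the word: each contributes 1, and the identity
  pair is among them.\<close>

lemma pre_hw_nonzero:
  assumes lam: "lam \<in> Lam"
  shows "pre_hw lam \<noteq> 0"
proof
  assume "pre_hw lam = 0"
  have lp: "lam \<in> partitions N" using lam by (simp add: Lam_def)
  let ?w = "hword lam" and ?R = "stab N (rowof lam)" and ?C = "stab N (colof lam)"
  have w: "?w \<in> W" by (rule hword_words[OF lam])
  have len: "length ?w = N" by (rule words_length[OF w])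
  \<comment> \<open>If the word is restored, \<open>r\<close> fixes all positions from row
    \<open>m\<close> on, where the letters record the column, and \<open>p\<close> fixes all
    positions above, where they record the row. So \<open>r\<close> moves only even letters, with
    sign 1, and \<open>p\<close> only odd ones, where \<open>eps\<close> cancels
    \<open>sign p\<close>.\<close>
  have coeff_one: "eps r ?w = 1 \<and> of_int (sign p) * eps p (act r ?w) = 1"
    if r: "r \<in> ?R" and p: "p \<in> ?C" and eq: "act p (act r ?w) = ?w" for r p
  proof -
    have rS: "r \<in> Sym N" and pS: "p \<in> Sym N" using r p by (auto dest: stab_Sym)
    have "act (p \<circ> r) ?w = ?w" using eq act_comp[OF pS rS len] by simp
    then have fix_w: "?w ! p (r s) = ?w ! s" if "s < N" for s
      using act_eq_iff[OF Sym_comp[OF pS rS] len] that by simp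
    have rows: "rowof lam (r s) = rowof lam s" "r s < N" if "s < N" for s
      using r that Sym_less[OF rS that] by (auto simp: stab_def)
    have cols: "colof lam (p s) = colof lam s" "p s < N" if "s < N" for s
      using p that Sym_less[OF pS that] by (auto simp: stab_def)
    have r_fix: "r s = s" if s: "s < N" and "\<not> rowof lam s < m" for s
    proof -
      have "colof lam (p (r s)) = colof lam s"
        using fix_w[OF s] s that(2) rows[OF s] cols[OF rows(2)[OF s]] by (auto simp: hword_nth split: if_splits)
      then show ?thesis
        using cell_eqI[OF lp rows(2)[OF s] s] rows(1)[OF s] cols(1)[OF rows(2)[OF s]] by simp
    qed
    have p_fix: "p s = s" if s: "s < N" and "rowof lam s < m" for s
    proof -
      let ?s = "inv r s"
      have s': "?s < N" "r ?s = s" using Sym_less[OF Sym_inv[OF rS] s] Sym_inv_app(2)[OF rS] by auto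
      then have "rowof lam ?s = rowof lam s" using rows(1)[OF s'(1)] by simp
      then have "rowof lam (p s) = rowof lam s"
        using fix_w[OF s'(1)] s s' that(2) cols[OF s] by (auto simp: hword_nth split: if_splits)
      then show ?thesis using cell_eqI[OF lp cols(2)[OF s] s] cols(1)[OF s] by simp
    qed
    have rw: "?w ! r s = ?w ! s" if "s < N" for s
      using r_fix[OF that] rows[OF that] that by (cases "rowof lam s < m") (auto simp: hword_nth)
    have pw: "?w ! p s = ?w ! s" if "s < N" for s
    proof (cases "rowof lam s < m")
      case False
      have "r s = s" by (rule r_fix[OF that False])
      then show ?thesis using fix_w[OF that] by simp
    qed (simp add: p_fix that)
    have "eps r ?w = of_int (if False then sign r else 1)"
    proof (rule eps_fix[OF w rS rw])
      show "q (?w ! s) (?w ! s) = (if False then - 1 else 1)" if "s < N" "r s \<noteq> s" for s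
        using r_fix[OF that(1)] that by (auto simp: hword_nth q_even)
    qed
    moreover have "eps p ?w = of_int (if True then sign p else 1)"
    proof (rule eps_fix[OF w pS pw])
      show "q (?w ! s) (?w ! s) = (if True then - 1 else 1)" if "s < N" "p s \<noteq> s" for s
        using p_fix[OF that(1)] that words_nth[OF w that(1)] by (auto simp: hword_nth q_odd)
    qed
    moreover have "act r ?w = ?w" using rw act_eq_iff[OF rS len] by simp
    ultimately show ?thesis by (simp flip: of_int_mult)
  qed
  have "pre_hw lam = (\<Sum>r\<in>?R. \<Sum>p\<in>?C. (eps r ?w * (of_int (sign p) * eps p (act r ?w))) *\<^sub>C T (act p (act r ?w)))"
    unfolding pre_hw_def nuA_symm_expand[OF w] clin_sum[OF clin_nuA] clin_scale[OF clin_nuA]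
    by (intro sum.cong refl)
      (simp add: nuA_asymm_expand act_words[OF stab_Sym w] cvec.scale_sum_right scaleC_scaleC)
  then have "crd ?w (pre_hw lam) = (\<Sum>r\<in>?R. \<Sum>p\<in>?C.
      eps r ?w * (of_int (sign p) * eps p (act r ?w)) * crd ?w (T (act p (act r ?w))))"
    by (simp add: clin_sum[OF clin_crd] clin_scale[OF clin_crd] scaleC_complex_def)
  also have "\<dots> = (\<Sum>r\<in>?R. \<Sum>p\<in>?C. of_nat (if act p (act r ?w) = ?w then 1 else 0))"
  proof (intro sum.cong refl)
    fix r p assume rp: "r \<in> ?R" "p \<in> ?C"
    have "act p (act r ?w) \<in> W" by (intro act_words w stab_Sym[OF rp(1)] stab_Sym[OF rp(2)])
    then show "eps r ?w * (of_int (sign p) * eps p (act r ?w)) * crd ?w (T (act p (act r ?w)))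
        = of_nat (if act p (act r ?w) = ?w then 1 else 0)"
      using coeff_one[OF rp] by (auto simp: crd_T[OF w])
  qed
  also have "\<dots> = of_nat (\<Sum>r\<in>?R. \<Sum>p\<in>?C. if act p (act r ?w) = ?w then 1 else 0)"
    by simp
  finally have "of_nat (\<Sum>r\<in>?R. \<Sum>p\<in>?C. if act p (act r ?w) = ?w then 1 else 0) = (0::complex)"
    unfolding \<open>pre_hw lam = 0\<close> clin_zero[OF clin_crd] ..
  then have "(\<Sum>r\<in>?R. \<Sum>p\<in>?C. if act p (act r ?w) = ?w then 1 else (0::nat)) = 0"
    unfolding of_nat_eq_0_iff .
  then have "(\<Sum>p\<in>?C. if act p (act id ?w) = ?w then 1 else (0::nat)) = 0"
    unfolding sum_eq_0_iff[OF finite_stab] using stab_id by blast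
  then have "(if act id (act id ?w) = ?w then 1 else (0::nat)) = 0"
    unfolding sum_eq_0_iff[OF finite_stab] using stab_id by blast
  then show False by simp
qed

definition hw :: "(nat \<Rightarrow> nat) \<Rightarrow> 'm"
  where "hw lam = nuA (ya N lam) (pre_hw lam)"

lemma hw_LL:
  assumes "lam \<in> Lam"
  shows "hw lam \<in> LL lam"
proof -
  have lp: "lam \<in> partitions N" using assms by (simp add: Lam_def)
  have "hw lam = nuA (yc N lam) (nuA (ya N lam) (T (hword lam)))"
    by (simp add: hw_def pre_hw_def nuA_gmul[symmetric] symm_mem asymm_mem gmul_mem young_symmetrizer_eq[OF lp] gmul_assoc)
  then show ?thesis by (simp add: LL_def nuA_mem symm_mem)
qed

text \<open>Nonvanishing is seen by applying \<open>yb\<close> once more: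
  \<open>yb \<star> ya \<star> (yb \<star> ya)\<close> is the transpose of the square of
  \<open>yc\<close>, hence \<open>yk\<close> times \<open>yb \<star> ya\<close>, and the result is a
  nonzero multiple of \<open>pre_hw lam\<close>.\<close>

lemma hw_hwv:
  assumes lam: "lam \<in> Lam"
  shows "hwv (mset (hword lam)) (hw lam)"
  unfolding hwv_def
proof (intro conjI allI impI)
  have lp: "lam \<in> partitions N" using lam by (simp add: Lam_def)
  show "wvec (mset (hword lam)) (hw lam)"
    unfolding hw_def pre_hw_def by (intro wvec_nuA symm_mem asymm_mem wvec_T hword_words lam)
  show "EE a c (hw lam) = 0" if "a < c" "c < D" for a c
    using EE_pre_hw[OF lam that] that
    by (simp add: hw_def nuA_EE[OF symm_mem, symmetric] clin_zero[OF clin_nuA])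
  show "hw lam \<noteq> 0"
  proof
    let ?a = "ya N lam" and ?b = "yb N lam"
    assume "hw lam = 0"
    then have "nuA ?b (nuA ?a (pre_hw lam)) = 0" by (simp add: hw_def clin_zero[OF clin_nuA])
    then have "nuA (?b \<star> ?a \<star> (?b \<star> ?a)) (T (hword lam)) = 0"
      by (simp add: pre_hw_def nuA_gmul symm_mem asymm_mem gmul_mem)
    also have "?b \<star> ?a \<star> (?b \<star> ?a) = gtransp (yc N lam \<star> yc N lam)"
      by (simp add: young_symmetrizer_eq[OF lp] gtransp_gmul[of _ N] gmul_mem symm_mem asymm_mem
          gtransp_symm gtransp_asymm)
    also have "\<dots> = yk N lam *\<^sub>C (?b \<star> ?a)"
      by (simp add: yc_square[OF lp] clin_scale[OF clin_gtransp])
        (simp add: young_symmetrizer_eq[OF lp] gtransp_gmul[of _ N] symm_mem asymm_mem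
          gtransp_symm gtransp_asymm)
    finally have "yk N lam *\<^sub>C pre_hw lam = 0"
      by (simp add: pre_hw_def nuA_gmul symm_mem asymm_mem clin_scale[OF clin_nuA_left])
    then show False using yk_nonzero[OF lp] pre_hw_nonzero[OF lam] by simp
  qed
qed

end

section \<open>Completeness and the double commutant\<close>

text \<open>By induction the claim holds on the kernel of \<open>f j\<close> in \<open>S\<close>.
  The defect \<open>\<psi>\<close> then vanishes on this kernel, so it is a multiple of
  \<open>f j\<close>, with the factor determined at any \<open>a0\<close> outside the kernel. This
  will express \<open>tau (eT \<star> a)\<close> by matrix coefficients.\<close>

lemma functional_in_span:
  fixes \<phi> :: "'a::complex_vector \<Rightarrow> complex" and f :: "'i \<Rightarrow> 'a \<Rightarrow> complex"
  assumes "finite I" "clin \<phi>" "\<And>i. clin (f i)" "cvec.subspace S"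
    and "\<And>a. a \<in> S \<Longrightarrow> (\<forall>i\<in>I. f i a = 0) \<Longrightarrow> \<phi> a = 0"
  shows "\<exists>c. \<forall>a\<in>S. \<phi> a = (\<Sum>i\<in>I. c i * f i a)"
  using assms(1,4,5)
proof (induction I arbitrary: S)
  case empty
  then show ?case by auto
next
  case (insert j I)
  let ?S = "{a \<in> S. f j a = 0}"
  have sub: "cvec.subspace ?S"
    using insert.prems(1)
    by (auto simp: cvec.subspace_def clin_zero[OF assms(3)] clin_add[OF assms(3)] clin_scale[OF assms(3)]
        scaleC_complex_def)
  obtain c where c: "\<And>a. a \<in> ?S \<Longrightarrow> \<phi> a = (\<Sum>i\<in>I. c i * f i a)"
    using insert.IH[OF sub] insert.prems(2) by auto
  define \<psi> where "\<psi> a = \<phi> a - (\<Sum>i\<in>I. c i * f i a)" for a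
  have \<psi>: "clin \<psi>"
    unfolding \<psi>_def using clin_scaled[OF assms(3)]
    by (intro clin_minus clin_sums assms(2)) (simp add: scaleC_complex_def)
  show ?case
  proof (cases "\<exists>a0\<in>S. f j a0 \<noteq> 0")
    case False
    then have "?S = S" by auto
    then have "\<phi> a = (\<Sum>i\<in>insert j I. (c(j := 0)) i * f i a)" if "a \<in> S" for a
      using c[of a] that insert.hyps by (simp add: sum.insert) (rule sum.cong, auto)
    then show ?thesis by blast
  next
    case True
    then obtain a0 where a0: "a0 \<in> S" "f j a0 \<noteq> 0" by blast
    define k where "k = \<psi> a0 / f j a0"
    have "\<psi> a = k * f j a" if a: "a \<in> S" for a
    proof -
      let ?b = "a - (f j a / f j a0) *\<^sub>C a0"
      have "?b \<in> ?S"
        using a a0 insert.prems(1)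
        by (auto simp: clin_diff[OF assms(3)] clin_scale[OF assms(3)] scaleC_complex_def
            intro!: cvec.subspace_diff cvec.subspace_scale)
      then have "\<psi> ?b = 0" using c by (simp add: \<psi>_def)
      then show ?thesis
        using a0 by (simp add: clin_diff[OF \<psi>] clin_scale[OF \<psi>] scaleC_complex_def k_def field_simps)
    qed
    then have "\<phi> a = (\<Sum>i\<in>insert j I. (c(j := k)) i * f i a)" if "a \<in> S" for a
    proof -
      have "(\<Sum>i\<in>I. (c(j := k)) i * f i a) = (\<Sum>i\<in>I. c i * f i a)"
        using insert.hyps(2) by (intro sum.cong refl) auto
      moreover have "\<phi> a = \<psi> a + (\<Sum>i\<in>I. c i * f i a)" by (simp add: \<psi>_def)
      ultimately show ?thesis
        using that insert.hyps \<open>\<And>a. a \<in> S \<Longrightarrow> \<psi> a = k * f j a\<close> by simp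
    qed
    then show ?thesis by blast
  qed
qed

lemma finite_partitions: "finite (partitions N)"
proof (rule finite_subset)
  have "lam i \<le> N" if "lam \<in> partitions N" for lam i
  proof -
    have "lam i \<le> (\<Sum>k<Suc i. lam k)" by simp
    also have "\<dots> \<le> N" by (rule part_sum_le[OF that])
    finally show ?thesis .
  qed
  then show "partitions N \<subseteq> {f. \<forall>i. (i \<in> {..<N} \<longrightarrow> f i \<in> {..N}) \<and> (i \<notin> {..<N} \<longrightarrow> f i = 0)}"
    using part_zero by auto
  show "finite {f. \<forall>i. (i \<in> {..<N} \<longrightarrow> f i \<in> {..N}) \<and> (i \<notin> {..<N} \<longrightarrow> f i = (0::nat))}"
    by (rule finite_set_of_finite_funs) auto
qed

text \<open>By centrality \<open>ye N lam\<close> moves next to the inner \<open>yc N lam\<close> of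
  each conjugate, where \<open>ye_yc\<close> absorbs it.\<close>

lemma ye_ye:
  assumes lam: "lam \<in> partitions N"
  shows "ye N lam \<star> ye N lam = ye N lam"
proof -
  have "ye N lam \<star> (sg g \<star> (yc N lam \<star> sg (inv g))) = sg g \<star> (yc N lam \<star> sg (inv g))"
    if g: "g \<in> Sym N" for g
  proof -
    have "ye N lam \<star> (sg g \<star> (yc N lam \<star> sg (inv g))) = (ye N lam \<star> sg g) \<star> (yc N lam \<star> sg (inv g))"
      by (simp only: gmul_assoc)
    also have "\<dots> = sg g \<star> ((ye N lam \<star> yc N lam) \<star> sg (inv g))"
      by (simp only: ye_central[OF lam sg_in[OF g]] gmul_assoc)
    finally show ?thesis by (simp add: ye_yc[OF lam])
  qed
  then show ?thesis
    by (subst (2) ye_def) (simp add: gmul_sum_right, simp add: ye_def)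
qed

lemma ye_ye_diff:
  assumes lam: "lam \<in> partitions N" and mu: "mu \<in> partitions N" and ne: "lam \<noteq> mu"
  shows "ye N lam \<star> ye N mu = 0"
proof -
  have "ye N lam \<star> (sg g \<star> (yc N mu \<star> sg (inv g))) = 0" if g: "g \<in> Sym N" for g
  proof -
    have "ye N lam \<star> (sg g \<star> (yc N mu \<star> sg (inv g))) = (ye N lam \<star> sg g) \<star> (yc N mu \<star> sg (inv g))"
      by (simp only: gmul_assoc)
    also have "\<dots> = sg g \<star> ((ye N lam \<star> yc N mu) \<star> sg (inv g))"
      by (simp only: ye_central[OF lam sg_in[OF g]] gmul_assoc)
    finally show ?thesis by (simp add: ye_yc_diff[OF lam mu ne])
  qed
  then show ?thesis
    by (subst (2) ye_def) (simp add: gmul_sum_right)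
qed

section \<open>Modules generated by a highest weight vector, completeness, and the double
  commutant\<close>

context word_space
begin

lemma finite_Lam: "finite Lam"
  by (rule finite_subset[OF _ finite_partitions[of N]]) (auto simp: Lam_def)

lemma Lam_part: "lam \<in> Lam \<Longrightarrow> lam \<in> partitions N"
  by (simp add: Lam_def)

lemma nuA_central_nu:
  assumes "lam \<in> partitions N" "p \<in> Sym N" "x \<in> M"
  shows "nuA (ye N lam) (nu p x) = nu p (nuA (ye N lam) x)"
proof -
  have "nuA (ye N lam) (nuA (sg p) x) = nuA (sg p) (nuA (ye N lam) x)"
    using ye_central[OF assms(1) sg_in[OF assms(2)]]
    by (simp add: nuA_gmul[symmetric] ye_mem assms(1) sg_in[OF assms(2)] del: nuA_sg)
  then show ?thesis by simp
qed

lemma ye_LL: "lam \<in> partitions N \<Longrightarrow> x \<in> LL lam \<Longrightarrow> nuA (ye N lam) x = x"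
  by (auto simp: LL_def nuA_gmul[symmetric] ye_mem yc_mem ye_yc)

text \<open>Its span stands for the module generated by a highest weight vector \<open>u\<close>:
  products of lowering operators in any order, without raising or diagonal ones.\<close>

inductive_set lowered :: "'m \<Rightarrow> 'm set" for u
  where lowered_base: "u \<in> lowered u"
  | lowered_step: "y \<in> lowered u \<Longrightarrow> c < a \<Longrightarrow> a < D \<Longrightarrow> EE a c y \<in> lowered u"

text \<open>\<open>EE_EE\<close> moves any operator past the outermost lowering operator; all
  resulting terms act first on a vector with one lowering fewer, to which the induction
  applies.\<close>

lemma lowered_EE:
  assumes u: "hwv A u" and y: "y \<in> lowered u"
  shows "\<forall>a<D. \<forall>c<D. EE a c y \<in> cvec.span (lowered u)"
  using y
proof induction
  case lowered_base
  show ?case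
  proof (intro allI impI)
    fix a c assume D: "a < D" "c < D"
    consider "a < c" | "a = c" | "c < a" by linarith
    then show "EE a c u \<in> cvec.span (lowered u)"
    proof cases
      case 1
      then show ?thesis using u D by (simp add: hwv_def cvec.span_zero)
    next
      case 2
      then show ?thesis
        using EE_diag[of A u a] u D
        by (simp add: hwv_def cvec.span_scale cvec.span_base lowered.lowered_base)
    next
      case 3
      then show ?thesis
        using D by (intro cvec.span_base lowered.lowered_step lowered.lowered_base)
    qed
  qed
next
  case (lowered_step y d b)
  have low: "EE b d z \<in> cvec.span (lowered u)" if "z \<in> cvec.span (lowered u)" for z
    using that lowered_step.hyps
    by (intro clin_span_mem[OF clin_EE that cvec.subspace_span] cvec.span_base lowered.lowered_step)
  show ?case
  proof (intro allI impI)
    fix a c assume D: "a < D" "c < D"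
    have bd: "b < D" "d < D" using lowered_step.hyps by auto
    have IH: "EE a' c' y \<in> cvec.span (lowered u)" if "a' < D" "c' < D" for a' c'
      using lowered_step.IH that by blast
    show "EE a c (EE b d y) \<in> cvec.span (lowered u)"
      unfolding EE_EE[OF D bd] using D bd
      by (intro cvec.span_diff cvec.span_add cvec.span_scale low IH)
        (auto intro: IH cvec.span_zero)
  qed
qed

lemma UU_lowered:
  assumes u: "hwv A u" and F: "F \<in> UU"
  shows "F u \<in> cvec.span (lowered u)"
  using F
proof induction
  case UU_id
  show ?case by (simp add: cvec.span_base lowered_base)
next
  case (UU_EE a c f)
  then show ?case
    using lowered_EE[OF u] by (intro clin_span_mem[OF clin_EE UU_EE.IH cvec.subspace_span]) auto
qed (simp_all add: cvec.span_add cvec.span_scale)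

text \<open>Lowering strictly decreases the height of the words that occur. The last clause covers
  \<open>y = u\<close> as well and is what carries the induction.\<close>

lemma lowered_ht:
  assumes u: "hwv A u" and y: "y \<in> lowered u" and A: "A = mset v" "v \<in> W"
  shows "y \<in> M \<and> (y = u \<or> (\<forall>w\<in>W. crd w y \<noteq> 0 \<longrightarrow> ht w < ht v)) \<and> (\<forall>w\<in>W. crd w y \<noteq> 0 \<longrightarrow> ht w \<le> ht v)"
  using y
proof induction
  case lowered_base
  have "ht w = ht v" if "w \<in> W" "crd w u \<noteq> 0" for w
  proof -
    have "mset w = mset v" using u that A by (auto simp: hwv_def wvec_def)
    then show ?thesis unfolding ht_def by (metis mset_map sum_mset_sum_list)
  qed
  then show ?case using u by (auto simp: hwv_def wvec_def)
next
  case (lowered_step y c a)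
  have "ht w < ht v" if w: "w \<in> W" "crd w (EE a c y) \<noteq> 0" for w
  proof -
    obtain w' i where w': "w' \<in> W" "crd w' y \<noteq> 0" "i < N" "w' ! i = c" "w = w'[i := a]"
      using crd_EE[OF _ lowered_step.hyps(3) w] lowered_step.IH by blast
    have "ht w + (D - c) = ht w' + (D - a)" using ht_update[OF w'(1,3), of a] w'(4,5) by simp
    then have "ht w < ht w'" using lowered_step.hyps by simp
    also have "\<dots> \<le> ht v" using lowered_step.IH w'(1,2) by blast
    finally show ?thesis .
  qed
  then show ?case using EE_mem[OF lowered_step.hyps(3)] by (auto intro: less_imp_le)
qed

text \<open>Words of weight \<open>A\<close> have the full height, which among lowered vectors
  occurs only in \<open>u\<close>; so the projection retains just the multiple of
  \<open>u\<close>.\<close>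

lemma UU_weight_space:
  assumes u: "hwv A u" and F: "F \<in> UU"
  shows "\<exists>k. proj (\<lambda>w. mset w = A) (F u) = k *\<^sub>C u"
proof -
  obtain v where v: "v \<in> W" "A = mset v" using u wvec_nonzero by (auto simp: hwv_def)
  have "proj (\<lambda>w. mset w = A) (F u) \<in> cvec.span {u}"
  proof (rule clin_span_mem[OF clin_proj UU_lowered[OF u F] cvec.subspace_span])
    fix y assume y: "y \<in> lowered u"
    note low = lowered_ht[OF u y v(2,1)]
    show "proj (\<lambda>w. mset w = A) y \<in> cvec.span {u}"
    proof (cases "y = u")
      case True
      have "proj (\<lambda>w. mset w = A) u = (\<Sum>w\<in>W. crd w u *\<^sub>C T w)"
        unfolding proj_def ext_def using u by (intro sum.cong refl) (auto simp: hwv_def wvec_def)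
      then have "proj (\<lambda>w. mset w = A) u = u" using M_expand[of u] u by (simp add: hwv_def wvec_def)
      then show ?thesis using True by (simp add: cvec.span_base)
    next
      case False
      have "proj (\<lambda>w. mset w = A) y = 0"
      proof (rule M_eq_0I[OF proj_mem], rule ccontr)
        fix w assume w: "w \<in> W" "crd w (proj (\<lambda>w. mset w = A) y) \<noteq> 0"
        then have "mset w = mset v" "crd w y \<noteq> 0" using v by (auto simp: crd_proj split: if_splits)
        moreover from this have "ht w = ht v" unfolding ht_def by (metis mset_map sum_mset_sum_list)
        ultimately show False using low False w by auto
      qed
      then show ?thesis by (simp add: cvec.span_zero)
    qed
  qed
  then show ?thesis by (auto simp: cvec.span_singleton)
qed

text \<open>A vector annihilated by all \<open>e\<^sub>\<lambda>\<close> would generate a highest weight vector of some weight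
  \<open>\<lambda>\<^sup>\<sharp>\<close>. Its sum with the highest weight vector of the same weight in the image of the Young
  symmetrizer generates a module with a one-dimensional highest weight space, but \<open>e\<^sub>\<lambda>\<close>, which acts
  through the enveloping algebra, separates the two.\<close>

theorem ye_complete:
  assumes x: "x \<in> M" and z: "\<And>lam. lam \<in> Lam \<Longrightarrow> nuA (ye N lam) x = 0"
  shows "x = 0"
proof (rule ccontr)
  assume nz: "x \<noteq> 0"
  let ?K = "{y \<in> M. \<forall>lam\<in>Lam. nuA (ye N lam) y = 0}"
  have "cvec.subspace ?K"
    by (rule cvec.subspaceI)
      (simp_all add: clin_zero[OF clin_nuA] clin_add[OF clin_nuA] clin_scale[OF clin_nuA]
        cvec.subspace_0 cvec.subspace_add cvec.subspace_scale M_subspace)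
  then have K: "stable ?K"
    unfolding stable_def
    by (auto simp: EE_mem nuA_EE ye_mem Lam_part clin_zero[OF clin_EE])
  moreover have "?K \<noteq> {0}" using x z nz by blast
  ultimately obtain A v' where v': "v' \<in> ?K" "hwv A v'" using hwv_exists by blast
  then obtain lam where lam: "lam \<in> Lam" "\<And>a. a < D \<Longrightarrow> count A a = sharp m lam a"
    using hwv_shape by blast
  have lp: "lam \<in> partitions N" by (rule Lam_part[OF lam(1)])
  let ?B = "mset (hword lam)"
  have v: "hwv ?B (hw lam)" "hw lam \<in> LL lam" by (intro hw_hwv hw_LL lam)+
  have "A = ?B"
  proof (rule multiset_eqI)
    fix a
    show "count A a = count ?B a"
    proof (cases "a < D")
      case True
      then show ?thesis by (simp only: lam(2) count_hword[OF lp])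
    next
      case False
      then have "a \<notin># A" "a \<notin># ?B" using hwv_mset(2)[OF v'(2)] hwv_mset(2)[OF v(1)] by auto
      then show ?thesis by (simp only: not_in_iff)
    qed
  qed
  let ?v = "hw lam"
  have vM: "?v \<in> M" "v' \<in> M" using v(2) LL_sub[OF lp] v' by auto
  have e: "nuA (ye N lam) ?v = ?v" "nuA (ye N lam) v' = 0"
    using ye_LL[OF lp v(2)] v'(1) lam(1) by auto
  have eu: "nuA (ye N lam) (?v + v') = ?v" by (simp add: clin_add[OF clin_nuA] e)
  have u: "hwv A (?v + v')"
    unfolding hwv_def
  proof (intro conjI allI impI)
    show "wvec A (?v + v')"
      using v(1) v'(2) \<open>A = ?B\<close> unfolding hwv_def wvec_def
      by (auto simp: M_subspace cvec.subspace_add clin_add[OF clin_crd])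
    show "?v + v' \<noteq> 0" using eu v(1) clin_zero[OF clin_nuA, of "ye N lam"] by (auto simp: hwv_def)
    show "EE a c (?v + v') = 0" if "a < c" "c < D" for a c
      using v(1) v'(2) that by (simp add: hwv_def clin_add[OF clin_EE])
  qed
  \<comment> \<open>Being central, \<open>ye N lam\<close> commutes with the permutations and so
    acts on \<open>M\<close> as an element of \<open>UU\<close>; this brings \<open>?v\<close> into
    the module generated by \<open>?v + v'\<close>.\<close>
  obtain F where F: "F \<in> UU" "\<forall>x\<in>M. F x = nuA (ye N lam) x"
    using commutant_UU[OF clin_nuA nuA_mem[OF ye_mem[OF lp]] nuA_central_nu[OF lp]] by blast
  have "F (?v + v') = ?v" using F(2) vM eu by (simp add: cvec.subspace_add M_subspace)
  then obtain k where k: "proj (\<lambda>w. mset w = A) ?v = k *\<^sub>C (?v + v')"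
    using UU_weight_space[OF u F(1)] by metis
  have "proj (\<lambda>w. mset w = A) ?v = (\<Sum>w\<in>W. crd w ?v *\<^sub>C T w)"
    unfolding proj_def ext_def using v(1) \<open>A = ?B\<close>
    by (intro sum.cong refl) (auto simp: hwv_def wvec_def)
  then have vk: "?v = k *\<^sub>C (?v + v')" using k M_expand[OF vM(1)] by simp
  \<comment> \<open>Applying \<open>ye N lam\<close> once more gives
    \<open>?v = k *\<^sub>C ?v\<close>, so \<open>k = 1\<close> and \<open>v'\<close> would
    vanish.\<close>
  have "?v = nuA (ye N lam) (k *\<^sub>C (?v + v'))" unfolding vk[symmetric] e(1) ..
  also have "\<dots> = k *\<^sub>C ?v" by (simp only: clin_scale[OF clin_nuA] eu)
  finally have "(1 - k) *\<^sub>C ?v = 0" by (simp add: cvec.scale_left_diff_distrib scaleC_one)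
  then have "k = 1" using v(1) by (simp add: hwv_def)
  then have "v' = 0" using vk by (simp add: scaleC_one)
  then show False using v'(2) by (simp add: hwv_def)
qed

definition eT :: perm_algebra
  where "eT = (\<Sum>lam\<in>Lam. ye N lam)"

lemma eT_mem: "eT \<in> group_algebra N"
  unfolding eT_def by (intro cvec.subspace_sum group_algebra_subspace ye_mem Lam_part)

text \<open>Each \<open>ye N lam\<close> is idempotent and annihilates the others, so it kills
  \<open>x - nuA eT x\<close>, and \<open>ye_complete\<close> applies.\<close>

lemma nuA_eT:
  assumes "x \<in> M"
  shows "nuA eT x = x"
proof -
  have "nuA (ye N lam) (x - nuA eT x) = 0" if lam: "lam \<in> Lam" for lam
  proof -
    have "ye N lam \<star> eT = (\<Sum>mu\<in>Lam. if mu = lam then ye N lam else 0)"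
      unfolding eT_def gmul_sum_right using lam
      by (intro sum.cong refl) (auto simp: ye_ye ye_ye_diff Lam_part)
    also have "\<dots> = ye N lam" using lam finite_Lam by simp
    finally show ?thesis
      by (simp add: clin_diff[OF clin_nuA] nuA_gmul[symmetric] ye_mem Lam_part lam eT_mem)
  qed
  moreover have "x - nuA eT x \<in> M"
    by (intro cvec.subspace_diff M_subspace nuA_mem eT_mem assms)
  ultimately have "x - nuA eT x = 0" by (rule ye_complete[rotated])
  then show ?thesis by simp
qed

text \<open>Cyclicity of the trace reduces the claim to \<open>tau (yc \<star> b) = 0\<close> for
  conjugates \<open>b\<close> of \<open>a\<close>, which also act as zero. But
  \<open>yc \<star> b \<star> yc\<close> is a multiple of \<open>yc\<close> with this trace as a
  factor, and \<open>yc\<close> does not act as zero because of \<open>hw lam\<close>.\<close>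

lemma tau_eT_kernel:
  assumes a: "a \<in> group_algebra N" and z: "\<And>x. x \<in> M \<Longrightarrow> nuA a x = 0"
  shows "tau (eT \<star> a) = 0"
proof -
  have "tau (ye N lam \<star> a) = 0" if lam: "lam \<in> Lam" for lam
  proof -
    have lp: "lam \<in> partitions N" by (rule Lam_part[OF lam])
    let ?c = "yc N lam"
    have c: "?c \<in> group_algebra N" by (rule yc_mem[OF lp])
    have "tau (sg g \<star> (?c \<star> sg (inv g)) \<star> a) = 0" if g: "g \<in> Sym N" for g
    proof -
      let ?b = "sg (inv g) \<star> (a \<star> sg g)"
      have gA: "sg g \<in> group_algebra N" "sg (inv g) \<in> group_algebra N" using g by (auto intro: sg_in permutes_inv)
      have b: "?b \<in> group_algebra N" by (intro gmul_mem a gA)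
      obtain x where x: "x \<in> M" "nuA ?c x \<noteq> 0"
        using hw_LL[OF lam] hw_hwv[OF lam] by (auto simp: LL_def hwv_def)
      have "nuA ?b (nuA ?c x) = 0"
        by (simp add: nuA_gmul gmul_mem a gA z nuA_mem c nu_mem g clin_zero[OF clin_nuA] del: nuA_sg)
      then have "nuA (?c \<star> (?b \<star> ?c)) x = 0"
        by (simp add: nuA_gmul[OF c gmul_mem[OF b c]] nuA_gmul[OF b c] clin_zero[OF clin_nuA])
      then have "(yk N lam * tau (?c \<star> ?b)) *\<^sub>C nuA ?c x = 0"
        by (simp add: yc_x_yc[OF lp b] clin_scale[OF clin_nuA_left])
      then have "tau (?c \<star> ?b) = 0" using x(2) yk_nonzero[OF lp] by simp
      moreover have "tau (sg g \<star> (?c \<star> sg (inv g) \<star> a)) = tau ((?c \<star> sg (inv g) \<star> a) \<star> sg g)"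
        by (intro tau_commute[of _ N] gmul_mem gA c a)
      ultimately show ?thesis by (simp only: gmul_assoc)
    qed
    then show ?thesis
      by (simp add: ye_def gmul_sum_left clin_sum[OF clin_tau])
  qed
  then show ?thesis by (simp add: eT_def gmul_sum_left clin_sum[OF clin_tau])
qed

lemma UU_commute:
  assumes f: "clin f" and comm: "\<And>a c x. a < D \<Longrightarrow> c < D \<Longrightarrow> x \<in> M \<Longrightarrow> f (EE a c x) = EE a c (f x)"
    and F: "F \<in> UU" and x: "x \<in> M"
  shows "f (F x) = F (f x)"
  using F by induction (auto simp: comm UU_mem x clin_add[OF f] clin_scale[OF f])

text \<open>By \<open>tau_eT_kernel\<close> and \<open>functional_in_span\<close> the coefficients
  of \<open>eT\<close> are combinations of matrix coefficients. This rewrites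
  \<open>x = nuA eT x\<close> as a sum of averaged rank one operators applied to basis tensors. The
  averages lie in \<open>UU\<close>, so \<open>f\<close> commutes with them and acts on the basis
  tensors only; read backwards, the formula gives \<open>b\<close>.\<close>

theorem double_commutant:
  assumes f: "clin f" and fM: "\<And>x. x \<in> M \<Longrightarrow> f x \<in> M"
    and comm: "\<And>a c x. a < D \<Longrightarrow> c < D \<Longrightarrow> x \<in> M \<Longrightarrow> f (EE a c x) = EE a c (f x)"
  shows "\<exists>b\<in>group_algebra N. \<forall>x\<in>M. f x = nuA b x"
proof -
  define \<phi> where "\<phi> = (\<lambda>(u, w) a. crd u (nuA a (T w)))"
  have "\<exists>c. \<forall>a\<in>group_algebra N. tau (eT \<star> a) = (\<Sum>z\<in>W \<times> W. c z * \<phi> z a)"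
  proof (rule functional_in_span)
    show "clin (\<lambda>a. tau (eT \<star> a))" by (rule clin_compose[OF clin_gmul_right clin_tau])
    show "clin (\<phi> z)" for z
      by (cases z) (simp add: \<phi>_def clin_compose[OF clin_nuA_left clin_crd])
    fix a assume a: "a \<in> group_algebra N" and z: "\<forall>z\<in>W \<times> W. \<phi> z a = 0"
    have "nuA a (T w) = 0" if "w \<in> W" for w
      by (rule M_eq_0I[OF nuA_mem[OF a]]) (use z that in \<open>auto simp: \<phi>_def\<close>)
    then have "nuA a x = 0" if "x \<in> M" for x
      by (intro M_eqI[OF clin_nuA clin_const_zero that])
    then show "tau (eT \<star> a) = 0" by (rule tau_eT_kernel[OF a])
  qed (auto simp: finite_words group_algebra_subspace)
  then obtain c where c: "\<And>a. a \<in> group_algebra N \<Longrightarrow> tau (eT \<star> a) = (\<Sum>z\<in>W \<times> W. c z * \<phi> z a)"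
    by blast
  have coeff: "Poly_Mapping.lookup eT p = (\<Sum>z\<in>W \<times> W. c z * crd (fst z) (nu (inv p) (T (snd z))))"
    if p: "p \<in> Sym N" for p
  proof -
    have "Poly_Mapping.lookup eT p = tau (sg (inv p) \<star> eT)" by (rule tau_inv_gmul[OF p eT_mem, symmetric])
    also have "\<dots> = tau (eT \<star> sg (inv p))"
      using p by (intro tau_commute[of _ N] eT_mem sg_in Sym_inv)
    also have "\<dots> = (\<Sum>z\<in>W \<times> W. c z * crd (fst z) (nu (inv p) (T (snd z))))"
      by (subst c) (use p in \<open>auto intro!: sum.cong sg_in permutes_inv simp: \<phi>_def split: prod.splits\<close>)
    finally show ?thesis .
  qed
  \<comment> \<open>The formula for the coefficients of \<open>eT\<close>, with
    \<open>f (T w)\<close> in place of \<open>T w\<close>.\<close>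
  define b where "b = (\<Sum>p\<in>Sym N. (\<Sum>z\<in>W \<times> W. c z * crd (fst z) (nu (inv p) (f (T (snd z))))) *\<^sub>C sg p)"
  have bA: "b \<in> group_algebra N"
    unfolding b_def by (intro cvec.subspace_sum cvec.subspace_scale group_algebra_subspace sg_in)
  have "f x = nuA b x" if x: "x \<in> M" for x
  proof -
    have cs: "f (conj_sum (\<lambda>v. crd u v *\<^sub>C x) (T w)) = conj_sum (\<lambda>v. crd u v *\<^sub>C x) (f (T w))"
      if w: "w \<in> W" for u w
    proof -
      have "clin (\<lambda>v. crd u v *\<^sub>C x)" by (intro clin_scaleC_left clin_crd)
      moreover have "crd u v *\<^sub>C x \<in> M" for v by (intro cvec.subspace_scale M_subspace x)
      ultimately obtain F where F: "F \<in> UU" "\<And>y. y \<in> M \<Longrightarrow> F y = conj_sum (\<lambda>v. crd u v *\<^sub>C x) y"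
        using conj_sum_UU[of "\<lambda>v. crd u v *\<^sub>C x"] by blast
      show ?thesis
        using UU_commute[OF f comm F(1) T_mem[OF w]] F(2) T_mem[OF w] fM by simp
    qed
    have sum: "(\<Sum>z\<in>W \<times> W. c z *\<^sub>C conj_sum (\<lambda>v. crd (fst z) v *\<^sub>C x) (h (snd z)))
        = (\<Sum>p\<in>Sym N. (\<Sum>z\<in>W \<times> W. c z * crd (fst z) (nu (inv p) (h (snd z)))) *\<^sub>C nu p x)" for h
      unfolding conj_sum_def cvec.scale_sum_left cvec.scale_sum_right
      by (subst sum.swap) (simp add: clin_scale[OF clin_nu] scaleC_scaleC)
    have "f x = f (nuA eT x)" by (simp add: nuA_eT x)
    also have "nuA eT x = (\<Sum>p\<in>Sym N. (\<Sum>z\<in>W \<times> W. c z * crd (fst z) (nu (inv p) (T (snd z)))) *\<^sub>C nu p x)"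
      unfolding nuA_expand[OF eT_mem] by (rule sum.cong[OF refl]) (simp only: coeff)
    also have "\<dots> = (\<Sum>z\<in>W \<times> W. c z *\<^sub>C conj_sum (\<lambda>v. crd (fst z) v *\<^sub>C x) (T (snd z)))"
      by (rule sum[symmetric])
    also have "f \<dots> = (\<Sum>z\<in>W \<times> W. c z *\<^sub>C conj_sum (\<lambda>v. crd (fst z) v *\<^sub>C x) (f (T (snd z))))"
      unfolding clin_sum[OF f] clin_scale[OF f] by (intro sum.cong refl) (auto simp: cs)
    also have "\<dots> = nuA b x"
      unfolding sum[of "\<lambda>w. f (T w)"] b_def clin_sum[OF clin_nuA_left] clin_scale[OF clin_nuA_left] nuA_sg ..
    finally show ?thesis .
  qed
  then show ?thesis using bA by blast
qed

end

section \<open>Multilinear maps and gradings\<close>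

lemma multilinearI:
  assumes "\<And>ws k a b. k < length ws \<Longrightarrow> \<phi> (ws[k := a + b]) = \<phi> (ws[k := a]) + \<phi> (ws[k := b])"
    and "\<And>ws k c a. k < length ws \<Longrightarrow> \<phi> (ws[k := c *\<^sub>C a]) = c *\<^sub>C \<phi> (ws[k := a])"
  shows "multilinear \<phi>"
  unfolding multilinear_def
proof (intro conjI allI)
  fix us ws :: "'a list" and a b :: 'a and c
  show "\<phi> (us @ (a + b) # ws) = \<phi> (us @ a # ws) + \<phi> (us @ b # ws)"
    using assms(1)[of "length us" "us @ a # ws" a b] by simp
  show "\<phi> (us @ (c *\<^sub>C a) # ws) = c *\<^sub>C \<phi> (us @ a # ws)"
    using assms(2)[of "length us" "us @ a # ws" c a] by simp
qed

lemma multilinear_add: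
  assumes "multilinear \<phi>" "k < length ws"
  shows "\<phi> (ws[k := a + b]) = \<phi> (ws[k := a]) + \<phi> (ws[k := b])"
  using assms(1) unfolding multilinear_def upd_conv_take_nth_drop[OF assms(2)] by blast

lemma multilinear_scale:
  assumes "multilinear \<phi>" "k < length ws"
  shows "\<phi> (ws[k := c *\<^sub>C a]) = c *\<^sub>C \<phi> (ws[k := a])"
  using assms(1) unfolding multilinear_def upd_conv_take_nth_drop[OF assms(2)] by blast

lemma multilinear_zero:
  assumes "multilinear \<phi>" "k < length ws" "ws ! k = 0"
  shows "\<phi> ws = 0"
  using multilinear_scale[OF assms(1,2), of 0 0] assms(3)
  by (metis cvec.scale_zero_left list_update_id)

lemma multilinear_clin: "multilinear \<phi> \<Longrightarrow> k < length ws \<Longrightarrow> clin (\<lambda>a. \<phi> (ws[k := a]))"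
  by (rule clinI) (simp_all add: multilinear_add multilinear_scale)

lemma multilinear_sums:
  "(\<And>i. i \<in> I \<Longrightarrow> multilinear (\<phi> i)) \<Longrightarrow> multilinear (\<lambda>ws. \<Sum>i\<in>I. \<phi> i ws)"
  by (rule multilinearI)
    (simp_all add: multilinear_add multilinear_scale sum.distrib cvec.scale_sum_right)

lemma multilinear_scaled: "multilinear \<phi> \<Longrightarrow> multilinear (\<lambda>ws. c *\<^sub>C \<phi> ws)"
  by (rule multilinearI)
    (simp_all add: multilinear_add multilinear_scale scaleC_add_right scaleC_scaleC mult.commute)

lemma tensor_span: "t \<in> cvec.span (range tensor)"
proof -
  obtain p where "t = abs_tensor p" by (metis Quotient3_abs_rep[OF Quotient3_tensor])
  moreover have "abs_tensor p = (\<Sum>x\<in>Poly_Mapping.keys p. Poly_Mapping.lookup p x *\<^sub>C tensor x)"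
  proof -
    have lin: "clin abs_tensor"
      by (rule clinI) (simp_all add: plus_tensor.abs_eq scaleC_tensor.abs_eq)
    have "abs_tensor p = abs_tensor (\<Sum>x\<in>Poly_Mapping.keys p. Poly_Mapping.lookup p x *\<^sub>C Poly_Mapping.single x 1)"
      by (simp only: sum_single)
    then show ?thesis
      by (simp only: clin_sum[OF lin] clin_scale[OF lin] tensor.abs_eq)
  qed
  ultimately have "t = (\<Sum>x\<in>Poly_Mapping.keys p. Poly_Mapping.lookup p x *\<^sub>C tensor x)" by simp
  also have "\<dots> \<in> cvec.span (range tensor)"
    by (intro cvec.span_sum cvec.span_scale cvec.span_base rangeI)
  finally show ?thesis .
qed

section \<open>Homogeneous components of a grading\<close>

definition is_decomp :: "('g \<Rightarrow> 'a::complex_vector set) \<Rightarrow> 'a \<Rightarrow> ('g \<Rightarrow> 'a) \<Rightarrow> bool"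
  where "is_decomp G x f \<longleftrightarrow> (\<forall>\<beta>. f \<beta> \<in> G \<beta>) \<and> finite {\<beta>. f \<beta> \<noteq> 0} \<and> x = (\<Sum>\<beta> | f \<beta> \<noteq> 0. f \<beta>)"

lemma is_decomp_superset:
  assumes "is_decomp G x f" "finite J" "{\<beta>. f \<beta> \<noteq> 0} \<subseteq> J"
  shows "x = (\<Sum>\<beta>\<in>J. f \<beta>)"
  using assms unfolding is_decomp_def by (auto intro: sum.mono_neutral_left)

context
  fixes G :: "'g \<Rightarrow> 'a::complex_vector set"
  assumes ds: "direct_sum UNIV G UNIV"
begin

lemma grading_subspace: "cvec.subspace (G \<beta>)"
  using ds by (simp add: direct_sum_def)

lemma decomp_homogeneous: "x \<in> G \<beta> \<Longrightarrow> is_decomp G x (\<lambda>\<alpha>. if \<alpha> = \<beta> then x else 0)"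
proof -
  assume x: "x \<in> G \<beta>"
  have sub: "{\<alpha>. (if \<alpha> = \<beta> then x else 0) \<noteq> 0} \<subseteq> {\<beta>}" by auto
  have "(\<Sum>\<alpha> | (if \<alpha> = \<beta> then x else 0) \<noteq> 0. if \<alpha> = \<beta> then x else 0)
      = (\<Sum>\<alpha>\<in>{\<beta>}. if \<alpha> = \<beta> then x else 0)"
    by (rule sum.mono_neutral_left) auto
  then show ?thesis
    using x finite_subset[OF sub] by (auto simp: is_decomp_def cvec.subspace_0 grading_subspace)
qed

lemma decomp_add:
  assumes "is_decomp G x f" "is_decomp G y g"
  shows "is_decomp G (x + y) (\<lambda>\<beta>. f \<beta> + g \<beta>)"
proof -
  let ?J = "{\<beta>. f \<beta> \<noteq> 0} \<union> {\<beta>. g \<beta> \<noteq> 0}"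
  have fin: "finite ?J" using assms by (auto simp: is_decomp_def)
  have sub: "{\<beta>. f \<beta> + g \<beta> \<noteq> 0} \<subseteq> ?J" by auto
  have "x + y = (\<Sum>\<beta>\<in>?J. f \<beta> + g \<beta>)"
    using is_decomp_superset[OF assms(1) fin] is_decomp_superset[OF assms(2) fin] by (simp add: sum.distrib)
  also have "\<dots> = (\<Sum>\<beta> | f \<beta> + g \<beta> \<noteq> 0. f \<beta> + g \<beta>)"
    by (rule sum.mono_neutral_right[OF fin sub]) auto
  finally show ?thesis
    using assms finite_subset[OF sub fin]
    by (auto simp: is_decomp_def intro: cvec.subspace_add grading_subspace)
qed

lemma decomp_scale:
  assumes "is_decomp G x f"
  shows "is_decomp G (c *\<^sub>C x) (\<lambda>\<beta>. c *\<^sub>C f \<beta>)"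
proof -
  let ?J = "{\<beta>. f \<beta> \<noteq> 0}"
  have fin: "finite ?J" using assms by (auto simp: is_decomp_def)
  have sub: "{\<beta>. c *\<^sub>C f \<beta> \<noteq> 0} \<subseteq> ?J" by auto
  have "c *\<^sub>C x = (\<Sum>\<beta>\<in>?J. c *\<^sub>C f \<beta>)"
    using assms by (simp add: is_decomp_def cvec.scale_sum_right)
  also have "\<dots> = (\<Sum>\<beta> | c *\<^sub>C f \<beta> \<noteq> 0. c *\<^sub>C f \<beta>)"
    by (rule sum.mono_neutral_right[OF fin sub]) auto
  finally show ?thesis
    using assms finite_subset[OF sub fin]
    by (auto simp: is_decomp_def intro: cvec.subspace_scale grading_subspace)
qed

lemma decomp_exists: "\<exists>f. is_decomp G x f"
proof -
  have "x \<in> cvec.span (\<Union>\<beta>. G \<beta>)" using ds by (simp add: direct_sum_def)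
  then show ?thesis
  proof (induction rule: cvec.span_induct_alt)
    case base
    show ?case using decomp_homogeneous[of 0] cvec.subspace_0[OF grading_subspace] by blast
  next
    case (step c x y)
    then show ?case using decomp_homogeneous decomp_scale decomp_add by blast
  qed
qed

lemma decomp_unique:
  assumes "is_decomp G x f" "is_decomp G x g"
  shows "f = g"
proof
  fix \<beta>
  let ?J = "{\<beta>. f \<beta> \<noteq> 0} \<union> {\<beta>. g \<beta> \<noteq> 0}"
  have fin: "finite ?J" using assms by (auto simp: is_decomp_def)
  have "(\<Sum>\<beta>\<in>?J. f \<beta> - g \<beta>) = 0"
    using is_decomp_superset[OF assms(1) fin] is_decomp_superset[OF assms(2) fin]
    by (simp add: sum_subtractf)
  moreover have "\<forall>\<beta>\<in>?J. f \<beta> - g \<beta> \<in> G \<beta>"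
    using assms by (auto simp: is_decomp_def intro: cvec.subspace_diff grading_subspace)
  moreover note fin
  moreover have indep: "\<forall>J f. finite J \<and> J \<subseteq> UNIV \<and> (\<forall>j\<in>J. f j \<in> G j) \<and> (\<Sum>j\<in>J. f j) = 0 \<longrightarrow> (\<forall>j\<in>J. f j = 0)"
    using ds unfolding direct_sum_def by blast
  ultimately have "\<forall>\<beta>\<in>?J. f \<beta> - g \<beta> = 0"
    using fin by (intro indep[THEN spec, THEN spec, THEN mp]) simp
  then have "\<beta> \<in> ?J \<Longrightarrow> f \<beta> = g \<beta>" by (simp only: right_minus_eq)
  then show "f \<beta> = g \<beta>" by (cases "f \<beta> = 0"; cases "g \<beta> = 0") simp_all
qed

lemma hpart_eqI: "is_decomp G x f \<Longrightarrow> hpart G \<alpha> x = f \<alpha>"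
proof -
  assume f: "is_decomp G x f"
  have "(THE f. is_decomp G x f) = f" by (rule the_equality[of "is_decomp G x", OF f]) (rule decomp_unique[OF _ f])
  then show ?thesis unfolding is_decomp_def hpart_def by simp
qed

lemma hpart_homogeneous: "x \<in> G \<beta> \<Longrightarrow> hpart G \<alpha> x = (if \<alpha> = \<beta> then x else 0)"
  by (rule hpart_eqI[OF decomp_homogeneous])

lemma clin_hpart: "clin (hpart G \<alpha>)"
proof (rule clinI)
  fix x y c
  obtain f g where f: "is_decomp G x f" and g: "is_decomp G y g" using decomp_exists by blast
  show "hpart G \<alpha> (x + y) = hpart G \<alpha> x + hpart G \<alpha> y"
    by (simp add: hpart_eqI[OF f] hpart_eqI[OF g] hpart_eqI[OF decomp_add[OF f g]])
  show "hpart G \<alpha> (c *\<^sub>C x) = c *\<^sub>C hpart G \<alpha> x"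
    by (simp add: hpart_eqI[OF f] hpart_eqI[OF decomp_scale[OF f]])
qed

end

lemma map2_update:
  "length xs = length ys \<Longrightarrow> map2 h xs (ys[k := y]) = (map2 h xs ys)[k := h (xs ! k) y]"
proof (rule nth_equalityI)
  fix i assume "length xs = length ys" "i < length (map2 h xs (ys[k := y]))"
  then show "map2 h xs (ys[k := y]) ! i = (map2 h xs ys)[k := h (xs ! k) y] ! i"
    by (cases "k = i") auto
qed simp

lemma multilinear_extend_homogeneous:
  assumes ds: "direct_sum UNIV V UNIV" and F: "\<And>\<beta>s. multilinear (F \<beta>s)"
  shows "multilinear (extend_homogeneous V F)"
proof (rule multilinearI)
  fix ws :: "'b list" and k a b c
  assume k: "k < length ws"
  show "extend_homogeneous V F (ws[k := a + b]) = extend_homogeneous V F (ws[k := a]) + extend_homogeneous V F (ws[k := b])"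
    unfolding extend_homogeneous_def length_list_update sum.distrib[symmetric]
    by (rule sum.cong[OF refl]) (simp add: k map2_update clin_add[OF clin_hpart[OF ds]] multilinear_add[OF F])
  show "extend_homogeneous V F (ws[k := c *\<^sub>C a]) = c *\<^sub>C extend_homogeneous V F (ws[k := a])"
    unfolding extend_homogeneous_def length_list_update cvec.scale_sum_right
    by (rule sum.cong[OF refl]) (simp add: k map2_update clin_scale[OF clin_hpart[OF ds]] multilinear_scale[OF F])
qed

text \<open>The position is fixed and short words are sent to 0, since the laws of
  \<open>tensor_lift\<close> ask for multilinearity on words of every length.\<close>

lemma multilinear_tensor_apply:
  assumes "clin f"
  shows "multilinear (\<lambda>ws. if j < length ws then tensor (ws[j := f (ws ! j)]) else 0)"
proof (rule multilinearI)
  fix ws :: "'a list" and k a b c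
  assume k: "k < length ws"
  note sw = list_update_swap[of k j]
  show "(if j < length (ws[k := a + b]) then tensor ((ws[k := a + b])[j := f (ws[k := a + b] ! j)]) else 0)
      = (if j < length (ws[k := a]) then tensor ((ws[k := a])[j := f (ws[k := a] ! j)]) else 0)
        + (if j < length (ws[k := b]) then tensor ((ws[k := b])[j := f (ws[k := b] ! j)]) else 0)"
    using k by (cases "j = k")
      (auto simp: clin_add[OF assms] multilinear_add[OF multilinear_tensor] sw)
  show "(if j < length (ws[k := c *\<^sub>C a]) then tensor ((ws[k := c *\<^sub>C a])[j := f (ws[k := c *\<^sub>C a] ! j)]) else 0)
      = c *\<^sub>C (if j < length (ws[k := a]) then tensor ((ws[k := a])[j := f (ws[k := a] ! j)]) else 0)"
    using k by (cases "j = k")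
      (auto simp: clin_scale[OF assms] multilinear_scale[OF multilinear_tensor] sw)
qed

lemma multilinear_sum_apply:
  assumes "clin f"
  shows "multilinear (\<lambda>ws. \<Sum>j<length ws. c j *\<^sub>C tensor (ws[j := f (ws ! j)]))"
proof -
  \<comment> \<open>The number of summands depends on the word. For a fixed number \<open>n\<close>
    the sum is multilinear, and updating a letter does not change the length.\<close>
  define S where "S n ws = (\<Sum>j<n. c j *\<^sub>C (if j < length ws then tensor (ws[j := f (ws ! j)]) else 0))"
    for n ws
  have S: "multilinear (S n)" for n
    unfolding S_def by (intro multilinear_sums multilinear_scaled multilinear_tensor_apply assms)
  have eq: "(\<Sum>j<length ws. c j *\<^sub>C tensor (ws[j := f (ws ! j)])) = S (length ws) ws" for ws
    unfolding S_def by (intro sum.cong) auto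
  show ?thesis
    unfolding eq by (intro multilinearI) (simp_all add: multilinear_add[OF S] multilinear_scale[OF S])
qed

lemma multilinear_tensor_swap:
  "multilinear (\<lambda>ws. if Suc i < length ws then k *\<^sub>C tensor (ws[i := ws ! Suc i, Suc i := ws ! i]) else 0)"
proof (rule multilinearI)
  fix ws :: "'a list" and j a b c
  assume j: "j < length ws"
  have sw: "(ws[j := x])[i := ws[j := x] ! Suc i, Suc i := ws[j := x] ! i] =
    (ws[i := ws ! Suc i, Suc i := ws ! i])[(if j = i then Suc i else if j = Suc i then i else j) := x]"
    if "Suc i < length ws" for x
    by (rule nth_equalityI) (use that j in \<open>auto simp: nth_list_update\<close>)
  let ?P = "\<lambda>x. if Suc i < length (ws[j := x])
    then k *\<^sub>C tensor ((ws[j := x])[i := ws[j := x] ! Suc i, Suc i := ws[j := x] ! i]) else 0"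
  show "?P (a + b) = ?P a + ?P b"
    using j by (cases "Suc i < length ws")
      (simp_all only: length_list_update sw, auto simp: multilinear_add[OF multilinear_tensor] scaleC_add_right)
  show "?P (c *\<^sub>C a) = c *\<^sub>C ?P a"
    using j by (cases "Suc i < length ws")
      (simp_all only: length_list_update sw, auto simp: multilinear_scale[OF multilinear_tensor] scaleC_scaleC mult.commute)
qed

section \<open>Tensor space in a homogeneous basis\<close>

text \<open>The common ground of two uses: the ordered basis given in the first part of the theorem,
  and a homogeneous basis chosen freely for the second part.\<close>

locale graded_basis =
  fixes \<omega> :: "'g::ab_group_add \<Rightarrow> 'g \<Rightarrow> complex" and V :: "'g \<Rightarrow> 'v::complex_vector set"
    and N D m :: nat and b :: "nat \<Rightarrow> 'v" and d :: "nat \<Rightarrow> 'g"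
  assumes cf: "commutative_factor \<omega>" and ds: "direct_sum UNIV V UNIV"
    and b_inj: "inj_on b {..<D}" and b_indep: "\<not> cvec.dependent (b ` {..<D})"
    and b_span: "cvec.span (b ` {..<D}) = UNIV"
    and b_deg: "a < D \<Longrightarrow> b a \<in> V (d a)"
    and m_D: "m \<le> D" and even: "a < m \<Longrightarrow> \<omega> (d a) (d a) = 1"
    and odd: "m \<le> a \<Longrightarrow> a < D \<Longrightarrow> \<omega> (d a) (d a) = - 1"
begin

lemma om_nz: "\<omega> \<alpha> \<beta> \<noteq> 0"
  and om_inv: "\<omega> \<alpha> \<beta> = inverse (\<omega> \<beta> \<alpha>)"
  and om_add_left: "\<omega> (\<alpha> + \<beta>) \<gamma> = \<omega> \<alpha> \<gamma> * \<omega> \<beta> \<gamma>"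
  and om_add_right: "\<omega> \<alpha> (\<beta> + \<gamma>) = \<omega> \<alpha> \<beta> * \<omega> \<alpha> \<gamma>"
  using cf unfolding commutative_factor_def by blast+

lemma om_zero_left [simp]: "\<omega> 0 \<gamma> = 1"
  using om_add_left[of 0 0 \<gamma>] om_nz by simp

lemma om_zero_right [simp]: "\<omega> \<gamma> 0 = 1"
  using om_add_right[of \<gamma> 0 0] om_nz by simp

lemma om_swap: "\<omega> \<alpha> \<beta> * \<omega> \<beta> \<alpha> = 1"
  by (subst om_inv) (simp add: om_nz)

lemma om_minus_left: "\<omega> (- \<alpha>) \<gamma> = \<omega> \<gamma> \<alpha>"
proof -
  have "\<omega> (- \<alpha>) \<gamma> * \<omega> \<alpha> \<gamma> = 1" using om_add_left[of "- \<alpha>" \<alpha> \<gamma>] by simp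
  then have "\<omega> (- \<alpha>) \<gamma> * (\<omega> \<alpha> \<gamma> * \<omega> \<gamma> \<alpha>) = \<omega> \<gamma> \<alpha>" by (simp add: mult.assoc[symmetric])
  then show ?thesis by (simp add: om_swap)
qed

lemma om_diff_left: "\<omega> (\<alpha> - \<beta>) \<gamma> = \<omega> \<alpha> \<gamma> * \<omega> \<gamma> \<beta>"
  using om_add_left[of \<alpha> "- \<beta>" \<gamma>] by (simp add: om_minus_left)

lemma om_diff_right: "\<omega> \<gamma> (\<alpha> - \<beta>) = \<omega> \<gamma> \<alpha> * \<omega> \<beta> \<gamma>"
proof -
  have "\<omega> \<gamma> (\<alpha> - \<beta>) * \<omega> (\<alpha> - \<beta>) \<gamma> = 1" by (rule om_swap)
  then have "\<omega> \<gamma> (\<alpha> - \<beta>) * (\<omega> \<alpha> \<gamma> * \<omega> \<gamma> \<beta>) * (\<omega> \<gamma> \<alpha> * \<omega> \<beta> \<gamma>) = \<omega> \<gamma> \<alpha> * \<omega> \<beta> \<gamma>"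
    by (simp add: om_diff_left)
  moreover have "(\<omega> \<alpha> \<gamma> * \<omega> \<gamma> \<beta>) * (\<omega> \<gamma> \<alpha> * \<omega> \<beta> \<gamma>) = 1"
    using om_swap[of \<alpha> \<gamma>] om_swap[of \<gamma> \<beta>] by (simp add: mult_ac) (metis mult.left_commute mult.right_neutral)
  ultimately show ?thesis by (metis mult.assoc mult.right_neutral)
qed

lemma om_sum_list: "\<omega> \<alpha> (sum_list (take j \<beta>s)) = (\<Prod>k<min j (length \<beta>s). \<omega> \<alpha> (\<beta>s ! k))"
proof (induction j)
  case (Suc j)
  then show ?case
    by (cases "j < length \<beta>s") (simp_all add: take_Suc_conv_app_nth om_add_right min_def)
qed simp

section \<open>Coordinates of vectors and tensors\<close>

definition co :: "nat \<Rightarrow> 'v \<Rightarrow> complex"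
  where "co a v = cvec.representation (b ` {..<D}) v (b a)"

lemma clin_co: "clin (co a)"
  by (rule clinI)
    (simp_all add: co_def cvec.representation_add[OF b_indep] cvec.representation_scale[OF b_indep] b_span
      scaleC_complex_def)

lemma co_b: "a < D \<Longrightarrow> c < D \<Longrightarrow> co a (b c) = (if a = c then 1 else 0)"
  using inj_onD[OF b_inj, of a c]
  by (auto simp: co_def cvec.representation_basis[OF b_indep])

lemma v_expand: "v = (\<Sum>a<D. co a v *\<^sub>C b a)"
proof -
  have "(\<Sum>x\<in>b ` {..<D}. cvec.representation (b ` {..<D}) v x *\<^sub>C x) = v"
    by (rule cvec.sum_representation_eq[OF b_indep]) (auto simp: b_span)
  then show ?thesis by (simp add: sum.reindex[OF b_inj] co_def)
qed

lemma v_eqI: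
  assumes "clin f" "clin g" "\<And>a. a < D \<Longrightarrow> f (b a) = g (b a)"
  shows "f v = g v"
  by (rule clin_eq_on_span[OF assms(1,2), of v "b ` {..<D}"]) (auto simp: b_span assms(3))

lemma b_nz: "a < D \<Longrightarrow> b a \<noteq> 0"
  using co_b[of a a] clin_zero[OF clin_co, of a] by auto

lemma hpart_b: "a < D \<Longrightarrow> hpart V \<alpha> (b a) = (if \<alpha> = d a then b a else 0)"
  by (rule hpart_homogeneous[OF ds b_deg])

lemma co_homogeneous:
  assumes "v \<in> V \<beta>" "c < D" "d c \<noteq> \<beta>"
  shows "co c v = 0"
proof -
  have "co c (hpart V \<beta> v) = (\<Sum>a<D. co a v * co c (hpart V \<beta> (b a)))"
    by (subst v_expand[of v])
      (simp add: clin_sum[OF clin_hpart[OF ds]] clin_scale[OF clin_hpart[OF ds]] clin_sum[OF clin_co]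
        clin_scale[OF clin_co] scaleC_complex_def)
  also have "\<dots> = 0"
    using assms(2,3) by (intro sum.neutral) (auto simp: hpart_b co_b clin_zero[OF clin_co])
  finally show ?thesis using hpart_homogeneous[OF ds assms(1), of \<beta>] by simp
qed

lemma degs_V: "degs V = d ` {..<D}"
proof (intro set_eqI iffI)
  fix \<alpha> assume "\<alpha> \<in> degs V"
  then obtain v where v: "v \<in> V \<alpha>" "v \<noteq> 0"
    using cvec.subspace_0[OF grading_subspace[OF ds, of \<alpha>]] by (auto simp: degs_def)
  show "\<alpha> \<in> d ` {..<D}"
  proof (rule ccontr)
    assume "\<alpha> \<notin> d ` {..<D}"
    then have "(\<Sum>a<D. co a v *\<^sub>C b a) = 0"
      using co_homogeneous[OF v(1)] by (intro sum.neutral) auto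
    then show False using v_expand[of v] v(2) by simp
  qed
next
  fix \<alpha> assume "\<alpha> \<in> d ` {..<D}"
  then show "\<alpha> \<in> degs V" using b_deg b_nz by (auto simp: degs_def)
qed

text \<open>Words of the wrong length get 0, which makes this a linear functional on the whole
  tensor algebra, as the locale \<open>word_space\<close> demands.\<close>

definition crdt :: "nat list \<Rightarrow> 'v tensor \<Rightarrow> complex"
  where "crdt w = tensor_lift (\<lambda>vs. if length vs = length w then (\<Prod>i<length w. co (w ! i) (vs ! i)) else 0)"

lemma multilinear_crdt:
  "multilinear (\<lambda>vs. if length vs = length w then (\<Prod>i<length w. co (w ! i) (vs ! i)) else 0)"
proof -
  have r: "(\<Prod>i<length w. co (w ! i) (ws[k := x] ! i))
      = co (w ! k) x * (\<Prod>i\<in>{..<length w} - {k}. co (w ! i) (ws ! i))"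
    if "k < length ws" "length ws = length w" for ws k x
  proof -
    have "(\<Prod>i<length w. co (w ! i) (ws[k := x] ! i))
        = co (w ! k) (ws[k := x] ! k) * (\<Prod>i\<in>{..<length w} - {k}. co (w ! i) (ws[k := x] ! i))"
      using that by (intro prod.remove) auto
    also have "(\<Prod>i\<in>{..<length w} - {k}. co (w ! i) (ws[k := x] ! i))
        = (\<Prod>i\<in>{..<length w} - {k}. co (w ! i) (ws ! i))"
      by (intro prod.cong refl) auto
    finally show ?thesis using that by simp
  qed
  show ?thesis
  proof (rule multilinearI, goal_cases)
    case (1 ws k x y)
    then show ?case
      by (cases "length ws = length w") (simp_all add: r[OF 1] clin_add[OF clin_co] distrib_right)
  next
    case (2 ws k c x)
    then show ?case
      by (cases "length ws = length w") (simp_all add: r[OF 2] clin_scale[OF clin_co] scaleC_complex_def)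
  qed
qed

lemma crdt_tensor: "crdt w (tensor vs) =
    (if length vs = length w then (\<Prod>i<length w. co (w ! i) (vs ! i)) else 0)"
  unfolding crdt_def by (rule tensor_lift_tensor[OF multilinear_crdt])

lemma crdt_basis:
  assumes "w \<in> words N D" "w' \<in> words N D"
  shows "crdt w (tensor (map b w')) = (if w = w' then 1 else 0)"
proof -
  have len: "length w = N" "length w' = N" using assms by (auto simp: words_length)
  have "crdt w (tensor (map b w')) = (\<Prod>i<N. if w ! i = w' ! i then 1 else 0)"
    unfolding crdt_tensor using assms len by (auto intro!: prod.cong simp: co_b words_nth)
  also have "\<dots> = (if w = w' then 1 else 0)"
  proof (cases "w = w'")
    case False
    then obtain i where "i < N" "w ! i \<noteq> w' ! i" using len by (metis nth_equalityI)
    then have "(\<Prod>i<N. if w ! i = w' ! i then 1 else (0::complex)) = 0" by (intro prod_zero) auto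
    then show ?thesis using False by simp
  qed simp
  finally show ?thesis .
qed

sublocale word_space N D m "\<lambda>a c. \<omega> (d a) (d c)" "\<lambda>w. tensor (map b w)" crdt
proof (rule word_space.intro)
  show "clin (crdt w)" for w unfolding crdt_def by (rule linear_tensor_lift[OF multilinear_crdt])
qed (simp_all add: om_swap even odd m_D crdt_basis)

text \<open>Letters are expanded from left to right; \<open>u\<close> holds those already replaced
  by basis vectors.\<close>

lemma tensor_expand_span:
  assumes "set u \<subseteq> {..<D}"
  shows "tensor (map b u @ vs) \<in> cvec.span ((\<lambda>w. tensor (map b w)) ` words (length u + length vs) D)"
  using assms
proof (induction vs arbitrary: u)
  case Nil
  then show ?case by (auto intro!: cvec.span_base simp: words_def)
next
  case (Cons v vs)
  have lin: "clin (\<lambda>x. tensor ((map b u @ v # vs)[length u := x]))"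
    by (rule multilinear_clin[OF multilinear_tensor]) simp
  then have lin': "clin (\<lambda>x. tensor (map b u @ x # vs))"
    by (simp add: list_update_append)
  have "tensor (map b u @ v # vs) = (\<Sum>a<D. co a v *\<^sub>C tensor (map b u @ b a # vs))"
    by (subst v_expand[of v]) (simp only: clin_sum[OF lin'] clin_scale[OF lin'])
  also have "\<dots> \<in> cvec.span ((\<lambda>w. tensor (map b w)) ` words (length u + length (v # vs)) D)"
  proof (intro cvec.span_sum cvec.span_scale)
    fix a assume "a \<in> {..<D}"
    then show "tensor (map b u @ b a # vs) \<in> cvec.span ((\<lambda>w. tensor (map b w)) ` words (length u + length (v # vs)) D)"
      using Cons.IH[of "u @ [a]"] Cons.prems by simp
  qed
  finally show ?case .
qed

lemma M_tensor_power: "M = tensor_power N"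
proof
  show "M \<subseteq> tensor_power N"
    unfolding M_def tensor_power_def by (rule cvec.span_mono) (auto simp: words_def)
  show "tensor_power N \<subseteq> M"
    unfolding tensor_power_def
  proof (rule cvec.span_minimal[OF _ M_subspace])
    show "{tensor vs |vs. length vs = N} \<subseteq> M"
      using tensor_expand_span[of "[]"] by (auto simp: M_def)
  qed
qed

text \<open>For any other tuple of degrees some letter has component zero in the prescribed degree,
  so multilinearity removes the summand.\<close>

lemma extend_homogeneous_basis:
  assumes F: "\<And>\<beta>s. multilinear (F \<beta>s)" and w: "set w \<subseteq> {..<D}"
  shows "extend_homogeneous V F (map b w) = F (map d w) (map b w)"
proof -
  let ?B = "{\<beta>s. set \<beta>s \<subseteq> degs V \<and> length \<beta>s = length (map b w)}"
  have fin: "finite ?B" unfolding degs_V by (rule finite_lists_length_eq) simp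
  have dB: "map d w \<in> ?B" using w by (auto simp: degs_V)
  have wD: "w ! i < D" if "i < length w" for i using w nth_mem[OF that] by blast
  have dw: "map2 (hpart V) (map d w) (map b w) = map b w"
    by (rule nth_equalityI) (auto simp: hpart_b wD)
  have zero: "F \<beta>s (map2 (hpart V) \<beta>s (map b w)) = 0" if \<beta>: "\<beta>s \<in> ?B" "\<beta>s \<noteq> map d w" for \<beta>s
  proof -
    have len: "length \<beta>s = length w" using \<beta> by simp
    then obtain i where i: "i < length w" "\<beta>s ! i \<noteq> d (w ! i)"
      using \<beta>(2) by (metis length_map nth_equalityI nth_map)
    show ?thesis
      by (rule multilinear_zero[OF F, of i]) (use i len in \<open>simp_all add: hpart_b wD\<close>)
  qed
  have "extend_homogeneous V F (map b w) = (\<Sum>\<beta>s\<in>{map d w}. F \<beta>s (map2 (hpart V) \<beta>s (map b w)))"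
    unfolding extend_homogeneous_def using fin dB zero by (intro sum.mono_neutral_right) auto
  then show ?thesis by (simp add: dw)
qed

lemma swap_act_eq_nu:
  assumes i: "Suc i < N" and t: "t \<in> M"
  shows "swap_act \<omega> V i t = nu (Transposition.transpose i (Suc i)) t"
proof -
  let ?F = "\<lambda>\<beta>s ws. if Suc i < length ws
       then \<omega> (\<beta>s ! i) (\<beta>s ! Suc i) *\<^sub>C tensor (ws[i := ws ! Suc i, Suc i := ws ! i]) else (0 :: 'v tensor)"
  let ?tr = "Transposition.transpose i (Suc i)"
  have F: "multilinear (?F \<beta>s)" for \<beta>s by (rule multilinear_tensor_swap)
  have ml: "multilinear (extend_homogeneous V ?F)" by (rule multilinear_extend_homogeneous[OF ds F])
  have tr: "?tr \<in> Sym N" using i by (simp add: permutes_swap_id)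
  show ?thesis
    unfolding swap_act_def
  proof (rule M_eqI[OF linear_tensor_lift[OF ml] clin_nu t])
    fix w assume w: "w \<in> W"
    have len: "length w = N" and sw: "set w \<subseteq> {..<D}" using w by (auto simp: words_def)
    have "(map b w)[i := map b w ! Suc i, Suc i := map b w ! i] = map b (act ?tr w)"
    proof (rule nth_equalityI)
      fix j assume j: "j < length ((map b w)[i := map b w ! Suc i, Suc i := map b w ! i])"
      have "inv ?tr = ?tr" by simp
      then show "(map b w)[i := map b w ! Suc i, Suc i := map b w ! i] ! j = map b (act ?tr w) ! j"
        using j i len act_nth[OF tr len, of j]
        by (auto simp: nth_list_update Transposition.transpose_def)
    qed simp
    then show "tensor_lift (extend_homogeneous V ?F) (tensor (map b w)) = nu ?tr (tensor (map b w))"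
      using i len eps_adjacent[OF i, of w]
      by (simp add: tensor_lift_tensor[OF ml] extend_homogeneous_basis[OF F sw] nu_T[OF w])
  qed
qed

section \<open>Matrix units and the action of the colour Lie algebra\<close>

lift_definition munit_endo :: "nat \<Rightarrow> nat \<Rightarrow> 'v endo" is "\<lambda>a c v. co c v *\<^sub>C b a"
  by (rule clin_scaleC_left[OF clin_co])

lemma munit_endo_gl: "a < D \<Longrightarrow> c < D \<Longrightarrow> munit_endo a c \<in> gl V (d a - d c)"
proof -
  assume ac: "a < D" "c < D"
  have "co c v *\<^sub>C b a \<in> V (d a - d c + \<beta>)" if "v \<in> V \<beta>" for v \<beta>
  proof (cases "d c = \<beta>")
    case True
    then show ?thesis using b_deg[OF ac(1)] by (auto intro: cvec.subspace_scale grading_subspace[OF ds])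
  next
    case False
    then show ?thesis
      using co_homogeneous[OF that ac(2)] by (simp add: cvec.subspace_0 grading_subspace[OF ds])
  qed
  then show ?thesis by (simp add: gl_def munit_endo.rep_eq)
qed

lemma clin_app_endo: "clin (app_endo X)"
  using app_endo by blast

lemma clin_app_endo_left: "clin (\<lambda>X. app_endo X v)"
  by (rule clinI) (simp_all add: plus_endo.rep_eq scaleC_endo.rep_eq)

lemma endo_eqI: "(\<And>a. a < D \<Longrightarrow> app_endo X (b a) = app_endo Y (b a)) \<Longrightarrow> X = Y"
  by (rule app_endo_inject[THEN iffD1], rule ext) (rule v_eqI[OF clin_app_endo clin_app_endo])

lemma endo_expand: "X = (\<Sum>a<D. \<Sum>c<D. co a (app_endo X (b c)) *\<^sub>C munit_endo a c)"
proof (rule endo_eqI)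
  fix e assume e: "e < D"
  have "app_endo (\<Sum>a<D. \<Sum>c<D. co a (app_endo X (b c)) *\<^sub>C munit_endo a c) (b e)
      = (\<Sum>a<D. \<Sum>c<D. if c = e then co a (app_endo X (b c)) *\<^sub>C b a else 0)"
    unfolding clin_sum[OF clin_app_endo_left] clin_scale[OF clin_app_endo_left]
    using e by (intro sum.cong refl) (simp add: munit_endo.rep_eq co_b scaleC_one)
  also have "\<dots> = (\<Sum>a<D. co a (app_endo X (b e)) *\<^sub>C b a)" using e by simp
  also have "\<dots> = app_endo X (b e)" by (rule v_expand[symmetric])
  finally show "app_endo X (b e) = app_endo (\<Sum>a<D. \<Sum>c<D. co a (app_endo X (b c)) *\<^sub>C munit_endo a c) (b e)"
    by simp
qed

lemma gl_subspace: "cvec.subspace (gl V \<alpha>)"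
  by (rule cvec.subspaceI)
    (auto simp: gl_def zero_endo.rep_eq plus_endo.rep_eq scaleC_endo.rep_eq
      intro: cvec.subspace_0 cvec.subspace_add cvec.subspace_scale grading_subspace[OF ds])

text \<open>Matrix units are homogeneous and span. For independence, a relation is applied to
  \<open>b a\<close>: the summands land in the distinct degrees \<open>j + d a\<close>, so each of
  them vanishes.\<close>

lemma gl_direct_sum: "direct_sum UNIV (gl V) UNIV"
  unfolding direct_sum_def
proof (intro conjI allI impI ballI)
  show "cvec.subspace (gl V i)" for i by (rule gl_subspace)
  have "X \<in> cvec.span (\<Union>i. gl V i)" for X
  proof (subst endo_expand[of X], intro cvec.span_sum cvec.span_scale cvec.span_base)
    fix a c assume "a \<in> {..<D}" "c \<in> {..<D}"
    then have "munit_endo a c \<in> gl V (d a - d c)" by (intro munit_endo_gl) auto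
    then show "munit_endo a c \<in> (\<Union>i. gl V i)" by blast
  qed
  then show "UNIV = cvec.span (\<Union>i. gl V i)" by auto
  fix J f \<xi> assume J: "finite J \<and> J \<subseteq> UNIV \<and> (\<forall>j\<in>J. f j \<in> gl V j) \<and> (\<Sum>j\<in>J. f j) = 0" and \<xi>: "\<xi> \<in> J"
  show "f \<xi> = 0"
  proof (rule endo_eqI)
    fix a assume a: "a < D"
    have mem: "app_endo (f j) (b a) \<in> V (j + d a)" if "j \<in> J" for j
      using J that b_deg[OF a] by (auto simp: gl_def)
    have "0 = hpart V (\<xi> + d a) (app_endo (\<Sum>j\<in>J. f j) (b a))"
      using J by (simp add: zero_endo.rep_eq clin_zero[OF clin_hpart[OF ds]])
    also have "\<dots> = (\<Sum>j\<in>J. hpart V (\<xi> + d a) (app_endo (f j) (b a)))"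
      by (simp add: clin_sum[OF clin_app_endo_left] clin_sum[OF clin_hpart[OF ds]])
    also have "\<dots> = (\<Sum>j\<in>J. if j = \<xi> then app_endo (f \<xi>) (b a) else 0)"
      by (intro sum.cong refl) (auto simp: hpart_homogeneous[OF ds mem])
    also have "\<dots> = app_endo (f \<xi>) (b a)" using J \<xi> by simp
    finally show "app_endo (f \<xi>) (b a) = app_endo 0 (b a)" by (simp add: zero_endo.rep_eq)
  qed
qed

lemma munit_endo_nz: "a < D \<Longrightarrow> c < D \<Longrightarrow> munit_endo a c \<noteq> 0"
proof
  assume ac: "a < D" "c < D" and "munit_endo a c = 0"
  then have "app_endo (munit_endo a c) (b c) = 0" by (simp add: zero_endo.rep_eq)
  then show False using ac b_nz[of a] by (simp add: munit_endo.rep_eq co_b scaleC_one)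
qed

text \<open>The sum defining the action runs over these degrees and would be 0 by convention if
  there were infinitely many. Only differences \<open>d a - d c\<close> occur, the degrees of the
  matrix units.\<close>

lemma finite_degs_gl: "finite (degs (gl V))"
proof (rule finite_subset)
  show "degs (gl V) \<subseteq> (\<lambda>(a, c). d a - d c) ` ({..<D} \<times> {..<D})"
  proof
    fix \<xi> assume "\<xi> \<in> degs (gl V)"
    then obtain X where X: "X \<in> gl V \<xi>" "X \<noteq> 0"
      using cvec.subspace_0[OF gl_subspace[of \<xi>]] by (auto simp: degs_def)
    show "\<xi> \<in> (\<lambda>(a, c). d a - d c) ` ({..<D} \<times> {..<D})"
    proof (rule ccontr)
      assume *: "\<xi> \<notin> (\<lambda>(a, c). d a - d c) ` ({..<D} \<times> {..<D})"
      have "co a (app_endo X (b c)) = 0" if "a < D" "c < D" for a c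
      proof (rule co_homogeneous[OF _ that(1)])
        show "app_endo X (b c) \<in> V (\<xi> + d c)" using X(1) b_deg[OF that(2)] by (simp add: gl_def)
        show "d a \<noteq> \<xi> + d c" using * that by force
      qed
      then have "(\<Sum>a<D. \<Sum>c<D. co a (app_endo X (b c)) *\<^sub>C munit_endo a c) = 0"
        by (intro sum.neutral) auto
      then show False using endo_expand[of X] X(2) by simp
    qed
  qed
qed simp

definition glF :: "'v endo \<Rightarrow> 'v list \<Rightarrow> 'v tensor"
  where "glF X vs = (\<Sum>\<xi>\<in>degs (gl V). extend_homogeneous V
    (\<lambda>\<beta>s ws. \<Sum>j<length ws. \<omega> \<xi> (sum_list (take j \<beta>s)) *\<^sub>C
       tensor (ws[j := app_endo (hpart (gl V) \<xi> X) (ws ! j)])) vs)"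

lemma multilinear_glF: "multilinear (glF X)"
  unfolding glF_def
  by (intro multilinear_sums multilinear_extend_homogeneous[OF ds] multilinear_sum_apply clin_app_endo)

lemma gl_act_lift: "gl_act \<omega> V X = tensor_lift (glF X)"
  unfolding gl_act_def by (rule arg_cong[where f = tensor_lift]) (simp add: glF_def fun_eq_iff)

lemma clin_gl_act: "clin (gl_act \<omega> V X)"
  unfolding gl_act_lift by (rule linear_tensor_lift[OF multilinear_glF])

lemma clin_gl_act_left: "clin (\<lambda>X. gl_act \<omega> V X t)"
proof -
  have *: "clin (\<lambda>X. tensor (ws[j := app_endo (hpart (gl V) \<xi> X) v]))" if "j < length ws" for ws j \<xi> v
    using that
    by (intro clin_compose[OF clin_hpart[OF gl_direct_sum]] clin_compose[OF clin_app_endo_left]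
        multilinear_clin[OF multilinear_tensor])
  then have "clin (\<lambda>X. glF X vs)" for vs
    unfolding glF_def extend_homogeneous_def by (intro clin_sums clin_scaled *) simp
  then show ?thesis
    unfolding gl_act_lift tensor_lift_def by (intro clin_lin_ext_fun)
qed

text \<open>Only the degree \<open>d a - d c\<close> of the matrix unit contributes. Its sign
  against the first letters splits, by the multiplicativity of \<open>\<omega>\<close>, into the two
  factors of \<open>kap\<close>.\<close>

lemma gl_act_munit:
  assumes ac: "a < D" "c < D" and t: "t \<in> M"
  shows "gl_act \<omega> V (munit_endo a c) t = EE a c t"
proof (rule M_eqI[OF clin_gl_act clin_EE t])
  fix w assume w: "w \<in> W"
  have len: "length w = N" and sw: "set w \<subseteq> {..<D}" using w by (auto simp: words_def)
  let ?\<xi>0 = "d a - d c"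
  let ?F = "\<lambda>\<xi> \<beta>s ws. \<Sum>j<length ws. \<omega> \<xi> (sum_list (take j \<beta>s)) *\<^sub>C
       tensor (ws[j := app_endo (hpart (gl V) \<xi> (munit_endo a c)) (ws ! j)])"
  have F: "multilinear (?F \<xi> \<beta>s)" for \<xi> \<beta>s by (rule multilinear_sum_apply[OF clin_app_endo])
  have hp: "hpart (gl V) \<xi> (munit_endo a c) = (if \<xi> = ?\<xi>0 then munit_endo a c else 0)" for \<xi>
    by (rule hpart_homogeneous[OF gl_direct_sum munit_endo_gl[OF ac]])
  have \<xi>0: "?\<xi>0 \<in> degs (gl V)"
    using munit_endo_gl[OF ac] munit_endo_nz[OF ac] by (auto simp: degs_def)
  have other: "?F \<xi> \<beta>s ws = 0" if "\<xi> \<noteq> ?\<xi>0" for \<xi> \<beta>s ws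
    using that
    by (auto intro!: sum.neutral multilinear_zero[OF multilinear_tensor] simp: hp zero_endo.rep_eq)
  have "gl_act \<omega> V (munit_endo a c) (tensor (map b w)) = glF (munit_endo a c) (map b w)"
    unfolding gl_act_lift by (rule tensor_lift_tensor[OF multilinear_glF])
  also have "\<dots> = (\<Sum>\<xi>\<in>degs (gl V). ?F \<xi> (map d w) (map b w))"
    unfolding glF_def by (intro sum.cong refl extend_homogeneous_basis F sw)
  also have "\<dots> = (\<Sum>\<xi>\<in>{?\<xi>0}. ?F \<xi> (map d w) (map b w))"
    by (rule sum.mono_neutral_right[OF finite_degs_gl]) (use \<xi>0 in simp, intro ballI other, simp)
  also have "\<dots> = (\<Sum>j<N. \<omega> ?\<xi>0 (sum_list (take j (map d w))) *\<^sub>C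
      tensor ((map b w)[j := app_endo (munit_endo a c) (b (w ! j))]))"
    by (simp add: len hp)
  also have "\<dots> = EE a c (tensor (map b w))"
    unfolding EE_T[OF w]
  proof (rule sum.cong[OF refl])
    fix j assume "j \<in> {..<N}"
    then have j: "j < N" by simp
    have wj: "w ! j < D" by (rule words_nth[OF w j])
    have "\<omega> ?\<xi>0 (sum_list (take j (map d w))) = kap a c j w"
      unfolding om_sum_list kap_def using j len
      by (intro prod.cong) (auto simp: om_diff_left min_def)
    moreover have "tensor ((map b w)[j := app_endo (munit_endo a c) (b (w ! j))])
        = (if w ! j = c then tensor (map b (w[j := a])) else 0)"
      using ac wj j len
      by (auto simp: munit_endo.rep_eq co_b scaleC_one map_update
          intro!: multilinear_zero[OF multilinear_tensor, of j])
    ultimately show "\<omega> ?\<xi>0 (sum_list (take j (map d w))) *\<^sub>C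
        tensor ((map b w)[j := app_endo (munit_endo a c) (b (w ! j))])
        = (if w ! j = c then kap a c j w *\<^sub>C tensor (map b (w[j := a])) else 0)"
      by simp
  qed
  finally show "gl_act \<omega> V (munit_endo a c) (tensor (map b w)) = EE a c (tensor (map b w))" .
qed

lemma gl_act_expand:
  assumes "t \<in> M"
  shows "gl_act \<omega> V X t = (\<Sum>a<D. \<Sum>c<D. co a (app_endo X (b c)) *\<^sub>C EE a c t)"
proof -
  have "gl_act \<omega> V X t = gl_act \<omega> V (\<Sum>a<D. \<Sum>c<D. co a (app_endo X (b c)) *\<^sub>C munit_endo a c) t"
    using endo_expand[of X] by simp
  also have "\<dots> = (\<Sum>a<D. \<Sum>c<D. co a (app_endo X (b c)) *\<^sub>C EE a c t)"
    unfolding clin_sum[OF clin_gl_act_left] clin_scale[OF clin_gl_act_left]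
    by (intro sum.cong refl) (simp add: gl_act_munit assms)
  finally show ?thesis .
qed

lemma gl_act_mem: "t \<in> M \<Longrightarrow> gl_act \<omega> V X t \<in> M"
  unfolding gl_act_expand by (intro cvec.subspace_sum cvec.subspace_scale M_subspace EE_mem) simp

lemma stable_gl_act: "stable K \<Longrightarrow> t \<in> K \<Longrightarrow> gl_act \<omega> V X t \<in> K"
  by (subst gl_act_expand)
    (auto simp: stable_def intro!: cvec.subspace_sum cvec.subspace_scale)

lemma stable_gl_iff: "stable K \<longleftrightarrow> cvec.subspace K \<and> K \<subseteq> M \<and> (\<forall>X. \<forall>t\<in>K. gl_act \<omega> V X t \<in> K)"
proof
  assume "stable K"
  then show "cvec.subspace K \<and> K \<subseteq> M \<and> (\<forall>X. \<forall>t\<in>K. gl_act \<omega> V X t \<in> K)"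
    using stable_gl_act by (auto simp: stable_def)
next
  assume K: "cvec.subspace K \<and> K \<subseteq> M \<and> (\<forall>X. \<forall>t\<in>K. gl_act \<omega> V X t \<in> K)"
  have "EE a c t \<in> K" if "a < D" "c < D" "t \<in> K" for a c t
  proof -
    have "gl_act \<omega> V (munit_endo a c) t \<in> K" using K that(3) by blast
    moreover have "t \<in> M" using K that(3) by blast
    ultimately show ?thesis by (simp only: gl_act_munit[OF that(1,2)])
  qed
  then show "stable K" using K by (simp add: stable_def)
qed

lemma nu_gl_act: "p \<in> Sym N \<Longrightarrow> t \<in> M \<Longrightarrow> nu p (gl_act \<omega> V X t) = gl_act \<omega> V X (nu p t)"
  by (simp add: gl_act_expand nu_mem clin_sum[OF clin_nu] clin_scale[OF clin_nu] nu_EE)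

lemma gl_coeff_0:
  assumes "X \<in> gl V \<alpha>" "a < D" "c < D" "d a - d c \<noteq> \<alpha>"
  shows "co a (app_endo X (b c)) = 0"
proof (rule co_homogeneous[OF _ assms(2)])
  show "app_endo X (b c) \<in> V (\<alpha> + d c)" using assms(1) b_deg[OF assms(3)] by (simp add: gl_def)
  show "d a \<noteq> \<alpha> + d c" using assms(4) by auto
qed

lemma munit_endo_comp: "a < D \<Longrightarrow> c < D \<Longrightarrow> e < D \<Longrightarrow> f < D \<Longrightarrow>
  munit_endo a c \<circ>\<^sub>e munit_endo e f = (if c = e then munit_endo a f else 0)"
  by (rule endo_eqI)
    (auto simp: comp_endo.rep_eq munit_endo.rep_eq zero_endo.rep_eq clin_scale[OF clin_co] co_b scaleC_complex_def)

text \<open>The defect \<open>B\<close> of the relation is bilinear, so it suffices to treat matrix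
  units. Those of degrees \<open>\<alpha>\<close> and \<open>\<beta>\<close> satisfy it by
  \<open>EE_EE\<close>; all others enter with coefficient 0 by \<open>gl_coeff_0\<close>.\<close>

lemma gl_act_bracket:
  assumes X: "X \<in> gl V \<alpha>" and Y: "Y \<in> gl V \<beta>" and t: "t \<in> M"
  shows "gl_act \<omega> V (bracket \<omega> \<alpha> \<beta> X Y) t
    = gl_act \<omega> V X (gl_act \<omega> V Y t) - \<omega> \<alpha> \<beta> *\<^sub>C gl_act \<omega> V Y (gl_act \<omega> V X t)"
proof -
  define B where "B X Y = gl_act \<omega> V (bracket \<omega> \<alpha> \<beta> X Y) t
    - (gl_act \<omega> V X (gl_act \<omega> V Y t) - \<omega> \<alpha> \<beta> *\<^sub>C gl_act \<omega> V Y (gl_act \<omega> V X t))" for X Y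
  have comp_left: "clin (\<lambda>X. X \<circ>\<^sub>e Y)" and comp_right: "clin (\<lambda>X. Y \<circ>\<^sub>e X)" for Y :: "'v endo"
    by (rule clinI; rule endo_eqI; simp add: comp_endo.rep_eq plus_endo.rep_eq scaleC_endo.rep_eq
        clin_add[OF clin_app_endo] clin_scale[OF clin_app_endo])+
  have B1: "clin (\<lambda>X. B X Y)" for Y
    unfolding B_def bracket_def
    by (intro clin_minus clin_scaled clin_compose[OF _ clin_gl_act] clin_gl_act_left
        clin_compose[OF _ clin_gl_act_left] comp_left comp_right)
  have B2: "clin (\<lambda>Y. B X Y)" for X
    unfolding B_def bracket_def
    by (intro clin_minus clin_scaled clin_compose[OF _ clin_gl_act] clin_gl_act_left
        clin_compose[OF _ clin_gl_act_left] comp_left comp_right)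
  have unit: "B (munit_endo a c) (munit_endo e f) = 0"
    if D: "a < D" "c < D" "e < D" "f < D" and ab: "d a - d c = \<alpha>" "d e - d f = \<beta>" for a c e f
  proof -
    have chi: "chi a c e f = \<omega> \<alpha> \<beta>"
      unfolding chi_def ab[symmetric] by (simp add: om_diff_left om_diff_right mult_ac)
    have "gl_act \<omega> V (bracket \<omega> \<alpha> \<beta> (munit_endo a c) (munit_endo e f)) t
        = (if c = e then EE a f t else 0) - \<omega> \<alpha> \<beta> *\<^sub>C (if f = a then EE e c t else 0)"
      using D t
      by (simp add: bracket_def munit_endo_comp clin_diff[OF clin_gl_act_left] clin_scale[OF clin_gl_act_left]
          gl_act_munit clin_zero[OF clin_gl_act_left])
    then show ?thesis
      using D t EE_EE[OF D, of t] by (simp add: B_def gl_act_munit EE_mem chi)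
  qed
  have B0: "B X Y = (\<Sum>a<D. \<Sum>c<D. \<Sum>e<D. \<Sum>f<D.
      co a (app_endo X (b c)) *\<^sub>C co e (app_endo Y (b f)) *\<^sub>C B (munit_endo a c) (munit_endo e f))"
  proof -
    have "B X Y = B (\<Sum>a<D. \<Sum>c<D. co a (app_endo X (b c)) *\<^sub>C munit_endo a c) Y"
      using endo_expand[of X] by simp
    also have "\<dots> = (\<Sum>a<D. \<Sum>c<D. co a (app_endo X (b c)) *\<^sub>C B (munit_endo a c) Y)"
      by (simp only: clin_sum[OF B1] clin_scale[OF B1])
    also have "\<dots> = (\<Sum>a<D. \<Sum>c<D. co a (app_endo X (b c)) *\<^sub>C B (munit_endo a c)
        (\<Sum>e<D. \<Sum>f<D. co e (app_endo Y (b f)) *\<^sub>C munit_endo e f))"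
      using endo_expand[of Y] by simp
    finally show ?thesis
      by (simp only: clin_sum[OF B2] clin_scale[OF B2] cvec.scale_sum_right)
  qed
  have "B X Y = 0"
    unfolding B0
  proof (intro sum.neutral ballI)
    fix a c e f assume "a \<in> {..<D}" "c \<in> {..<D}" "e \<in> {..<D}" "f \<in> {..<D}"
    then have D: "a < D" "c < D" "e < D" "f < D" by auto
    show "co a (app_endo X (b c)) *\<^sub>C co e (app_endo Y (b f)) *\<^sub>C B (munit_endo a c) (munit_endo e f) = 0"
      using unit[OF D] gl_coeff_0[OF X D(1,2)] gl_coeff_0[OF Y D(3,4)]
      by (cases "d a - d c = \<alpha>"; cases "d e - d f = \<beta>") auto
  qed
  then show ?thesis by (simp add: B_def)
qed

end

section \<open>The two representations\<close>

lemma linear_on_sum: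
  assumes "cvec.subspace K" "linear_on K f" "finite I" "\<And>i. i \<in> I \<Longrightarrow> g i \<in> K"
  shows "f (\<Sum>i\<in>I. c i *\<^sub>C g i) = (\<Sum>i\<in>I. c i *\<^sub>C f (g i))"
  using assms(3,4)
proof (induction I rule: finite_induct)
  case empty
  have "f (0 *\<^sub>C 0) = 0 *\<^sub>C f 0"
    using assms(2) cvec.subspace_0[OF assms(1)] unfolding linear_on_def by blast
  then show ?case by simp
next
  case (insert i I)
  have "(\<Sum>i\<in>I. c i *\<^sub>C g i) \<in> K" "c i *\<^sub>C g i \<in> K"
    using insert by (auto intro!: cvec.subspace_sum cvec.subspace_scale assms(1))
  then show ?case using assms(2) insert by (simp add: linear_on_def)
qed

lemma clin_linear_on: "clin f \<Longrightarrow> linear_on K f"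
  by (simp add: linear_on_def clin_add clin_scale)

context graded_basis
begin

lemma linear_on_M_expand:
  assumes "linear_on M f" "x \<in> M"
  shows "f x = ext (\<lambda>w. f (tensor (map b w))) x"
proof -
  have "f (\<Sum>w\<in>W. crdt w x *\<^sub>C tensor (map b w)) = (\<Sum>w\<in>W. crdt w x *\<^sub>C f (tensor (map b w)))"
    by (rule linear_on_sum[OF M_subspace assms(1) finite_words T_mem])
  then show ?thesis using M_expand[OF assms(2)] by (simp add: ext_def)
qed

text \<open>\<open>nu\<close> meets the conditions of the definite description. For uniqueness, a
  second solution agrees with it on adjacent transpositions, then on products of these and hence on
  all transpositions, which generate the group.\<close>

lemma nu_sym_eq: "nu_sym \<omega> V N = (\<lambda>p\<in>Sym N. restrict (nu p) M)"
  unfolding nu_sym_def M_tensor_power[symmetric]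
proof (rule the_equality, goal_cases)
  case 1
  show ?case
  proof (intro conjI ballI allI impI)
    show "(\<lambda>p\<in>Sym N. restrict (nu p) M) \<in> Sym N \<rightarrow>\<^sub>E End_on M"
      by (auto simp: End_on_def linear_on_def nu_mem clin_add[OF clin_nu] clin_scale[OF clin_nu]
          cvec.subspace_add[OF M_subspace] cvec.subspace_scale[OF M_subspace])
    show "(\<lambda>p\<in>Sym N. restrict (nu p) M) id = restrict id M"
      by (auto simp: permutes_id nu_id fun_eq_iff restrict_def)
    show "(\<lambda>p\<in>Sym N. restrict (nu p) M) (p \<circ> r) =
        compose M ((\<lambda>p\<in>Sym N. restrict (nu p) M) p) ((\<lambda>p\<in>Sym N. restrict (nu p) M) r)"
      if "p \<in> Sym N" "r \<in> Sym N" for p r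
      using that Sym_comp[OF that] nu_comp[OF that] nu_mem[OF that(2)]
      by (auto simp: compose_def fun_eq_iff restrict_def)
    show "(\<lambda>p\<in>Sym N. restrict (nu p) M) (Transposition.transpose i (Suc i)) = restrict (swap_act \<omega> V i) M"
      if "Suc i < N" for i
      using that by (auto simp: permutes_swap_id swap_act_eq_nu fun_eq_iff restrict_def)
  qed
next
  case (2 \<nu>)
  let ?\<nu> = "\<lambda>p\<in>Sym N. restrict (nu p) M"
  have ext: "\<nu> \<in> Sym N \<rightarrow>\<^sub>E End_on M" and id: "\<nu> id = restrict id M"
    and comp: "\<And>p r. p \<in> Sym N \<Longrightarrow> r \<in> Sym N \<Longrightarrow> \<nu> (p \<circ> r) = compose M (\<nu> p) (\<nu> r)"
    and adj: "\<And>i. Suc i < N \<Longrightarrow> \<nu> (Transposition.transpose i (Suc i)) = restrict (swap_act \<omega> V i) M"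
    using 2 by blast+
  have comp': "?\<nu> (p \<circ> r) = compose M (?\<nu> p) (?\<nu> r)" if "p \<in> Sym N" "r \<in> Sym N" for p r
    using that Sym_comp[OF that] nu_comp[OF that] nu_mem[OF that(2)]
    by (auto simp: compose_def fun_eq_iff restrict_def)
  have id': "\<nu> id = ?\<nu> id"
    unfolding id by (auto simp: permutes_id nu_id fun_eq_iff restrict_def)
  have adj': "\<nu> (Transposition.transpose i (Suc i)) = ?\<nu> (Transposition.transpose i (Suc i))" if "Suc i < N" for i
    unfolding adj[OF that] using that by (auto simp: permutes_swap_id swap_act_eq_nu fun_eq_iff restrict_def)
  have seq: "apply_adj_transps xs \<in> Sym N \<and> \<nu> (apply_adj_transps xs) = ?\<nu> (apply_adj_transps xs)"
    if "\<forall>i\<in>set xs. Suc i < N" for xs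
    using that
  proof (induction xs)
    case Nil
    then show ?case using id' by (simp only: apply_adj_transps_Nil Sym_id simp_thms)
  next
    case (Cons i xs)
    have i: "Suc i < N" and IH: "apply_adj_transps xs \<in> Sym N"
      "\<nu> (apply_adj_transps xs) = ?\<nu> (apply_adj_transps xs)" using Cons by auto
    have tr: "Transposition.transpose i (Suc i) \<in> Sym N" using i by (simp add: permutes_swap_id)
    show ?case
      using comp[OF tr IH(1)] comp'[OF tr IH(1)] Sym_comp[OF tr IH(1)] adj'[OF i] IH(2)
      by (simp only: apply_adj_transps_Cons Suc_eq_plus1[symmetric] simp_thms)
  qed
  have tr: "\<nu> (Transposition.transpose s t) = ?\<nu> (Transposition.transpose s t)" if st: "s < N" "t < N" for s t
  proof -
    have less: "\<nu> (Transposition.transpose s t) = ?\<nu> (Transposition.transpose s t)" if "s < t" "t < N" for s t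
    proof -
      have "\<forall>i\<in>set (adj_transp_seq s t). Suc i < N" using that by (simp add: set_adj_transp_seq)
      from seq[OF this] show ?thesis by (simp only: adj_transp_seq_correct[OF that(1)])
    qed
    consider "s < t" | "t < s" | "s = t" by linarith
    then show ?thesis
    proof cases
      case 1
      then show ?thesis using less st by blast
    next
      case 2
      then show ?thesis using less[OF 2 st(1)] by (simp only: transpose_commute)
    next
      case 3
      then show ?thesis using id' by (simp only: transpose_same)
    qed
  qed
  have "\<nu> p = ?\<nu> p" if "p permutes {..<N}" for p
    using that finite_lessThan
  proof (induction p rule: permutes_induct)
    case id
    show ?case by (rule id')
  next
    case (swap s t p)
    have S: "Transposition.transpose s t \<in> Sym N" "p \<in> Sym N" using swap by (auto simp: permutes_swap_id)
    have "\<nu> (Transposition.transpose s t) = ?\<nu> (Transposition.transpose s t)" using tr swap by simp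
    then show ?case unfolding comp[OF S] comp'[OF S] by (simp only: swap.IH)
  qed
  then show "\<nu> = ?\<nu>"
    using ext by (intro extensionalityI[of _ "Sym N"]) (auto simp: PiE_def)
qed

lemma nu_sym_app: "p \<in> Sym N \<Longrightarrow> x \<in> M \<Longrightarrow> nu_sym \<omega> V N p x = nu p x"
  by (simp add: nu_sym_eq)

lemma nu_rep_eq:
  assumes "a \<in> group_algebra N"
  shows "nu_rep \<omega> V N a = restrict (nuA a) M"
proof -
  have "lin_ext (\<lambda>p. nu_sym \<omega> V N p x) a = nuA a x" if "x \<in> M" for x
    unfolding lin_ext_def nuA_def using assms that
    by (intro sum.cong refl) (auto simp: nu_sym_app group_algebra_def)
  then show ?thesis by (auto simp: nu_rep_def M_tensor_power[symmetric] restrict_def fun_eq_iff)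
qed

section \<open>The action of the enveloping algebra on tensor space\<close>

definition piT :: "'v tensor \<Rightarrow> 'v endo tensor \<Rightarrow> 'v tensor"
  where "piT x = tensor_lift (\<lambda>Xs. foldr (gl_act \<omega> V) Xs x)"

lemma clin_foldr_gl_act: "clin (foldr (gl_act \<omega> V) Xs)"
proof (induction Xs)
  case Nil
  show ?case by (rule clinI) simp_all
next
  case (Cons X Xs)
  have "foldr (gl_act \<omega> V) (X # Xs) = (\<lambda>x. gl_act \<omega> V X (foldr (gl_act \<omega> V) Xs x))" by auto
  then show ?case using clin_compose[OF Cons clin_gl_act] by simp
qed

lemma multilinear_foldr_gl_act: "multilinear (\<lambda>Xs. foldr (gl_act \<omega> V) Xs x)"
  unfolding multilinear_def
  by (simp add: clin_add[OF clin_gl_act_left] clin_scale[OF clin_gl_act_left]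
      clin_add[OF clin_foldr_gl_act] clin_scale[OF clin_foldr_gl_act])

lemma piT_tensor: "piT x (tensor Xs) = foldr (gl_act \<omega> V) Xs x"
  unfolding piT_def by (rule tensor_lift_tensor[OF multilinear_foldr_gl_act])

lemma clin_piT: "clin (piT x)"
  unfolding piT_def by (rule linear_tensor_lift[OF multilinear_foldr_gl_act])

lemma foldr_gl_act_mem: "x \<in> M \<Longrightarrow> foldr (gl_act \<omega> V) Xs x \<in> M"
  by (induction Xs) (auto simp: gl_act_mem)

lemma piT_mem: "x \<in> M \<Longrightarrow> piT x t \<in> M"
  by (rule clin_span_mem[OF clin_piT tensor_span M_subspace]) (auto simp: piT_tensor foldr_gl_act_mem)

lemma piT_linear: "clin (\<lambda>x. piT x t)"
proof (rule clinI)
  fix x y c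
  show "piT (x + y) t = piT x t + piT y t"
    by (rule clin_eq_on_span[OF clin_piT clin_plus[OF clin_piT clin_piT] tensor_span])
      (auto simp: piT_tensor clin_add[OF clin_foldr_gl_act])
  show "piT (c *\<^sub>C x) t = c *\<^sub>C piT x t"
    by (rule clin_eq_on_span[OF clin_piT clin_scaled[OF clin_piT] tensor_span])
      (auto simp: piT_tensor clin_scale[OF clin_foldr_gl_act])
qed

lemma nu_foldr_gl_act:
  "p \<in> Sym N \<Longrightarrow> x \<in> M \<Longrightarrow> nu p (foldr (gl_act \<omega> V) Xs x) = foldr (gl_act \<omega> V) Xs (nu p x)"
  by (induction Xs) (auto simp: nu_gl_act foldr_gl_act_mem)

lemma nu_piT:
  assumes "p \<in> Sym N" "x \<in> M"
  shows "nu p (piT x t) = piT (nu p x) t"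
  by (rule clin_eq_on_span[OF clin_compose[OF clin_piT clin_nu] clin_piT tensor_span])
    (use assms in \<open>auto simp: piT_tensor nu_foldr_gl_act\<close>)

lemma piT_U_ideal:
  assumes "x \<in> M" "t \<in> U_ideal \<omega> V"
  shows "piT x t = 0"
proof (rule clin_eq_on_span[OF clin_piT clin_const_zero assms(2)[unfolded U_ideal_def]])
  fix s assume "s \<in> {tensor (us @ [X, Y] @ ws) - \<omega> \<alpha> \<beta> *\<^sub>C tensor (us @ [Y, X] @ ws)
       - tensor (us @ [bracket \<omega> \<alpha> \<beta> X Y] @ ws) | us ws X Y \<alpha> \<beta>. X \<in> gl V \<alpha> \<and> Y \<in> gl V \<beta>}"
  then obtain us ws X Y \<alpha> \<beta> where s: "s = tensor (us @ [X, Y] @ ws) - \<omega> \<alpha> \<beta> *\<^sub>C tensor (us @ [Y, X] @ ws)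
       - tensor (us @ [bracket \<omega> \<alpha> \<beta> X Y] @ ws)" and XY: "X \<in> gl V \<alpha>" "Y \<in> gl V \<beta>"
    by blast
  let ?y = "foldr (gl_act \<omega> V) ws x"
  have "piT x s = foldr (gl_act \<omega> V) us (gl_act \<omega> V X (gl_act \<omega> V Y ?y)
      - \<omega> \<alpha> \<beta> *\<^sub>C gl_act \<omega> V Y (gl_act \<omega> V X ?y) - gl_act \<omega> V (bracket \<omega> \<alpha> \<beta> X Y) ?y)"
    by (simp add: s piT_tensor clin_diff[OF clin_piT] clin_scale[OF clin_piT]
        clin_diff[OF clin_foldr_gl_act] clin_scale[OF clin_foldr_gl_act])
  then show "piT x s = 0"
    using gl_act_bracket[OF XY foldr_gl_act_mem[OF assms(1)]]
    by (simp add: clin_zero[OF clin_foldr_gl_act])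
qed

text \<open>\<open>piT x\<close> kills \<open>U_ideal\<close> and is therefore constant on cosets,
  so \<open>the_elem\<close> in \<open>pi_rep\<close> picks the common value.\<close>

lemma pi_rep_image: "pi_rep \<omega> V N ` U_gl \<omega> V = range (\<lambda>t. \<lambda>x\<in>M. piT x t)"
proof -
  have cls: "pi_rep \<omega> V N ({(s, t). s - t \<in> U_ideal \<omega> V} `` {t}) = (\<lambda>x\<in>M. piT x t)" for t
  proof -
    have "the_elem (piT x ` ({(s, t). s - t \<in> U_ideal \<omega> V} `` {t})) = piT x t" if x: "x \<in> M" for x
    proof -
      let ?C = "{(s, t). s - t \<in> U_ideal \<omega> V} `` {t}"
      have eq: "piT x s = piT x t" if "s \<in> ?C" for s
      proof -
        have "piT x (t - s) = 0" using that by (intro piT_U_ideal[OF x]) simp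
        then show ?thesis by (simp add: clin_diff[OF clin_piT])
      qed
      have t: "t \<in> ?C" by (simp add: U_ideal_def cvec.span_zero)
      have "piT x ` ?C = (\<lambda>_. piT x t) ` ?C" by (rule image_cong[OF refl eq])
      also have "\<dots> = {piT x t}" by (rule image_constant[OF t])
      finally show ?thesis by simp
    qed
    then show ?thesis
      unfolding pi_rep_def M_tensor_power[symmetric] piT_def[symmetric] by (rule restrict_ext)
  qed
  have "UNIV // R = range (\<lambda>t. R `` {t})" for R :: "('v endo tensor \<times> 'v endo tensor) set"
    unfolding quotient_def by blast
  then show ?thesis
    unfolding U_gl_def by (simp only: image_image cls)
qed

lemma UU_piT: "F \<in> UU \<Longrightarrow> \<exists>t. \<forall>x\<in>M. piT x t = F x"
proof (induction rule: UU.induct)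
  case UU_id
  have "\<forall>x\<in>M. piT x (tensor []) = x" by (simp add: piT_tensor)
  then show ?case by blast
next
  case (UU_EE a c f)
  then obtain t where t: "\<forall>x\<in>M. piT x t = f x" by blast
  let ?X = "munit_endo a c"
  \<comment> \<open>Left multiplication by \<open>?X\<close> in the tensor algebra is the lift of
    prefixing a letter.\<close>
  have ml: "multilinear (\<lambda>Xs. tensor (?X # Xs))"
    unfolding multilinear_def append_Cons[symmetric]
    using multilinear_tensor[unfolded multilinear_def] by blast
  have lift: "clin (tensor_lift (\<lambda>Xs. tensor (?X # Xs)))" by (rule linear_tensor_lift[OF ml])
  have "piT x (tensor_lift (\<lambda>Xs. tensor (?X # Xs)) t) = gl_act \<omega> V ?X (piT x t)" for x
    by (rule clin_eq_on_span[OF clin_compose[OF lift clin_piT] clin_compose[OF clin_piT clin_gl_act] tensor_span])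
      (auto simp: piT_tensor tensor_lift_tensor[OF ml])
  then have "\<forall>x\<in>M. piT x (tensor_lift (\<lambda>Xs. tensor (?X # Xs)) t) = EE a c (f x)"
    using t UU_EE.hyps by (metis gl_act_munit piT_mem)
  then show ?case by blast
next
  case (UU_add f g)
  then obtain s t where "\<forall>x\<in>M. piT x s = f x" "\<forall>x\<in>M. piT x t = g x" by blast
  then have "\<forall>x\<in>M. piT x (s + t) = f x + g x" by (simp add: clin_add[OF clin_piT])
  then show ?case by blast
next
  case (UU_scale f k)
  then obtain t where "\<forall>x\<in>M. piT x t = f x" by blast
  then have "\<forall>x\<in>M. piT x (k *\<^sub>C t) = k *\<^sub>C f x" by (simp add: clin_scale[OF clin_piT])
  then show ?case by blast
qed

theorem End_Sym_eq: "End_Sym \<omega> V N = pi_rep \<omega> V N ` U_gl \<omega> V"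
  unfolding pi_rep_image
proof (intro equalityI subsetI)
  fix f assume f: "f \<in> End_Sym \<omega> V N"
  have fE: "f \<in> M \<rightarrow>\<^sub>E M" "linear_on M f"
    using f by (auto simp: End_Sym_def End_on_def M_tensor_power[symmetric])
  have comm: "f (nu p x) = nu p (f x)" if p: "p \<in> Sym N" and x: "x \<in> M" for p x
  proof -
    have "f (nu_sym \<omega> V N p x) = nu_sym \<omega> V N p (f x)"
      using f p x unfolding End_Sym_def M_tensor_power[symmetric] by blast
    moreover have "f x \<in> M" using fE(1) x by (auto simp: PiE_def)
    ultimately show ?thesis by (simp only: nu_sym_app[OF p x] nu_sym_app[OF p])
  qed
  \<comment> \<open>\<open>f\<close> is an extensional function on \<open>M\<close>;
    \<open>?g\<close> extends its restriction to a linear map on the whole type, as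
    \<open>commutant_UU\<close> requires.\<close>
  let ?g = "ext (\<lambda>w. f (tensor (map b w)))"
  have g: "?g x = f x" if "x \<in> M" for x by (rule linear_on_M_expand[OF fE(2) that, symmetric])
  have "\<exists>F\<in>UU. \<forall>x\<in>M. F x = ?g x"
  proof (rule commutant_UU[OF clin_ext])
    show "?g (tensor (map b w)) \<in> M" if "w \<in> W" for w
      using g[OF T_mem[OF that]] fE(1) T_mem[OF that] by (auto simp: PiE_def)
    show "?g (nu p x) = nu p (?g x)" if "p \<in> Sym N" "x \<in> M" for p x
      using g[OF that(2)] g[OF nu_mem[OF that(1)]] comm[OF that] by simp
  qed
  then obtain F where F: "F \<in> UU" "\<forall>x\<in>M. F x = ?g x" by blast
  then obtain t where t: "\<forall>x\<in>M. piT x t = F x" using UU_piT by blast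
  have "f = (\<lambda>x\<in>M. piT x t)"
  proof
    fix x
    show "f x = (\<lambda>x\<in>M. piT x t) x"
      using fE(1) t F(2) g by (cases "x \<in> M") (auto simp: PiE_def extensional_def)
  qed
  then show "f \<in> range (\<lambda>t. \<lambda>x\<in>M. piT x t)" by blast
next
  fix f assume "f \<in> range (\<lambda>t. \<lambda>x\<in>M. piT x t)"
  then obtain t where f: "f = (\<lambda>x\<in>M. piT x t)" by blast
  show "f \<in> End_Sym \<omega> V N"
    unfolding f End_Sym_def End_on_def M_tensor_power[symmetric]
    by (auto simp: linear_on_def piT_mem clin_add[OF piT_linear] clin_scale[OF piT_linear]
        cvec.subspace_add[OF M_subspace] cvec.subspace_scale[OF M_subspace] nu_sym_app nu_mem nu_piT)
qed

theorem End_gl_eq: "End_gl \<omega> V N = nu_rep \<omega> V N ` group_algebra N"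
proof (intro equalityI subsetI)
  fix f assume f: "f \<in> End_gl \<omega> V N"
  have fE: "f \<in> M \<rightarrow>\<^sub>E M" "linear_on M f"
    using f by (auto simp: End_gl_def End_on_def M_tensor_power[symmetric])
  have comm: "f (gl_act \<omega> V X x) = gl_act \<omega> V X (f x)" if "x \<in> M" for X x
    using f that by (simp add: End_gl_def M_tensor_power[symmetric])
  let ?g = "ext (\<lambda>w. f (tensor (map b w)))"
  have g: "?g x = f x" if "x \<in> M" for x by (rule linear_on_M_expand[OF fE(2) that, symmetric])
  have fM: "f x \<in> M" if "x \<in> M" for x using fE(1) that by (auto simp: PiE_def)
  have "\<exists>a\<in>group_algebra N. \<forall>x\<in>M. ?g x = nuA a x"
  proof (rule double_commutant[OF clin_ext])
    show "?g x \<in> M" if "x \<in> M" for x using g[OF that] fM[OF that] by simp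
    show "?g (EE a c x) = EE a c (?g x)" if ac: "a < D" "c < D" and x: "x \<in> M" for a c x
      using comm[OF x, of "munit_endo a c"] g[OF x] g[OF EE_mem[OF ac(1)]]
      by (simp add: gl_act_munit[OF ac] x fM)
  qed
  then obtain a where a: "a \<in> group_algebra N" "\<forall>x\<in>M. ?g x = nuA a x" by blast
  have "f = restrict (nuA a) M"
  proof
    fix x
    show "f x = restrict (nuA a) M x"
      using fE(1) a(2) g by (cases "x \<in> M") (auto simp: PiE_def extensional_def)
  qed
  then show "f \<in> nu_rep \<omega> V N ` group_algebra N"
    using a(1) nu_rep_eq[OF a(1)] by (intro image_eqI[of _ _ a]) auto
next
  fix f assume "f \<in> nu_rep \<omega> V N ` group_algebra N"
  then obtain a where a: "a \<in> group_algebra N" and f: "f = restrict (nuA a) M"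
    using nu_rep_eq by auto
  have "nuA a (gl_act \<omega> V X x) = gl_act \<omega> V X (nuA a x)" if "x \<in> M" for X x
    by (simp add: gl_act_expand that nuA_mem[OF a] clin_sum[OF clin_nuA] clin_scale[OF clin_nuA] nuA_EE[OF a])
  then show "f \<in> End_gl \<omega> V N"
    unfolding f End_gl_def End_on_def M_tensor_power[symmetric]
    by (auto simp: linear_on_def nuA_mem[OF a] clin_add[OF clin_nuA] clin_scale[OF clin_nuA]
        cvec.subspace_add[OF M_subspace] cvec.subspace_scale[OF M_subspace] gl_act_mem)
qed

end

section \<open>The decomposition\<close>

definition bilin_lift :: "('a::complex_vector \<Rightarrow> 'b::complex_vector \<Rightarrow> 'c::complex_vector) \<Rightarrow> ('a, 'b) tprod \<Rightarrow> 'c"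
  where "bilin_lift h z = lin_ext (\<lambda>(x, y). h x y) (rep_tprod z)"

context
  fixes h :: "'a::complex_vector \<Rightarrow> 'b::complex_vector \<Rightarrow> 'c::complex_vector"
  assumes left: "\<And>y. clin (\<lambda>x. h x y)" and right: "\<And>x. clin (h x)"
begin

lemma lin_ext_tprod_eq:
  assumes "tprod_eq p p'"
  shows "lin_ext (\<lambda>(x, y). h x y) p = lin_ext (\<lambda>(x, y). h x y) p'"
proof -
  note l = linear_lin_ext[of "\<lambda>(x, y). h x y"]
  have "lin_ext (\<lambda>(x, y). h x y) (p - p') = 0"
  proof (rule clin_eq_on_span[OF l clin_const_zero])
    show "p - p' \<in> cvec.span bilinear_relations" using assms by (simp add: tprod_eq_def)
    fix r :: "'a \<times> 'b \<Rightarrow>\<^sub>0 complex" assume "r \<in> bilinear_relations"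
    then show "lin_ext (\<lambda>(x, y). h x y) r = 0"
      by (auto simp: bilinear_relations_def clin_diff[OF l] clin_scale[OF l] lin_ext_single
          clin_add[OF left] clin_add[OF right] clin_scale[OF left] clin_scale[OF right])
  qed
  then show ?thesis by (simp add: clin_diff[OF l])
qed

lemma bilin_lift_abs: "bilin_lift h (abs_tprod p) = lin_ext (\<lambda>(x, y). h x y) p"
  unfolding bilin_lift_def
  by (rule lin_ext_tprod_eq)
    (rule Quotient3_rep_abs[OF Quotient3_tprod], simp add: tprod_eq_def cvec.span_zero)

lemma bilin_lift_pure: "bilin_lift h (x \<otimes> y) = h x y"
  by (simp add: pure_tensor.abs_eq bilin_lift_abs lin_ext_single)

lemma clin_bilin_lift: "clin (bilin_lift h)"
proof (rule clinI)
  fix z z' :: "('a, 'b) tprod" and c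
  obtain p p' where z: "z = abs_tprod p" "z' = abs_tprod p'"
    by (metis Quotient3_abs_rep[OF Quotient3_tprod])
  show "bilin_lift h (z + z') = bilin_lift h z + bilin_lift h z'"
    by (simp add: z plus_tprod.abs_eq bilin_lift_abs lin_ext_add)
  show "bilin_lift h (c *\<^sub>C z) = c *\<^sub>C bilin_lift h z"
    by (simp add: z scaleC_tprod.abs_eq bilin_lift_abs lin_ext_scale)
qed

end

lemma clin_pure_left: "clin (\<lambda>x. x \<otimes> y)"
proof (rule clinI)
  fix x x' c
  have "Poly_Mapping.single (x + x', y) 1 - Poly_Mapping.single (x, y) 1 - Poly_Mapping.single (x', y) 1
      \<in> cvec.span bilinear_relations"
    by (rule cvec.span_base) (unfold bilinear_relations_def, rule UnI1, rule UnI1, rule UnI1, rule CollectI, rule exI[of _ x], rule exI[of _ "x'"], rule exI[of _ y], rule conjI, rule refl, rule TrueI)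
  then show "(x + x') \<otimes> y = x \<otimes> y + x' \<otimes> y" 
    unfolding pure_tensor.abs_eq plus_tprod.abs_eq tprod.abs_eq_iff tprod_eq_def diff_diff_eq .
  have "Poly_Mapping.single (c *\<^sub>C x, y) 1 - c *\<^sub>C Poly_Mapping.single (x, y) 1 \<in> cvec.span bilinear_relations"
    by (rule cvec.span_base) (unfold bilinear_relations_def, rule UnI1, rule UnI2, rule CollectI, rule exI[of _ c], rule exI[of _ x], rule exI[of _ y], rule conjI, rule refl, rule TrueI)
  then show "(c *\<^sub>C x) \<otimes> y = c *\<^sub>C (x \<otimes> y)" 
    unfolding pure_tensor.abs_eq scaleC_tprod.abs_eq tprod.abs_eq_iff tprod_eq_def .
qed

lemma clin_pure_right: "clin (\<lambda>y. x \<otimes> y)"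
proof (rule clinI)
  fix y y' c
  have "Poly_Mapping.single (x, y + y') 1 - Poly_Mapping.single (x, y) 1 - Poly_Mapping.single (x, y') 1
      \<in> cvec.span bilinear_relations"
    by (rule cvec.span_base) (unfold bilinear_relations_def, rule UnI1, rule UnI1, rule UnI2, rule CollectI, rule exI[of _ x], rule exI[of _ y], rule exI[of _ "y'"], rule conjI, rule refl, rule TrueI)
  then show "x \<otimes> (y + y') = x \<otimes> y + x \<otimes> y'" 
    unfolding pure_tensor.abs_eq plus_tprod.abs_eq tprod.abs_eq_iff tprod_eq_def diff_diff_eq .
  have "Poly_Mapping.single (x, c *\<^sub>C y) 1 - c *\<^sub>C Poly_Mapping.single (x, y) 1 \<in> cvec.span bilinear_relations"
    by (rule cvec.span_base) (unfold bilinear_relations_def, rule UnI2, rule CollectI, rule exI[of _ c], rule exI[of _ x], rule exI[of _ y], rule conjI, rule refl, rule TrueI)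
  then show "x \<otimes> (c *\<^sub>C y) = c *\<^sub>C (x \<otimes> y)" 
    unfolding pure_tensor.abs_eq scaleC_tprod.abs_eq tprod.abs_eq_iff tprod_eq_def .
qed

context graded_basis
begin

text \<open>For \<open>x\<close> in \<open>LL lam\<close>, the map
  \<open>s \<mapsto> nuA s x\<close> is a homomorphism from the Specht module to tensor space;
  \<open>Phi\<close> is the corresponding evaluation map.\<close>

definition Phi :: "('v tensor, perm_algebra) tprod \<Rightarrow> 'v tensor"
  where "Phi = bilin_lift (\<lambda>x s. nuA s x)"

lemma Phi_pure: "Phi (x \<otimes> s) = nuA s x"
  unfolding Phi_def by (rule bilin_lift_pure[OF clin_nuA clin_nuA_left])

lemma clin_Phi: "clin Phi"
  unfolding Phi_def by (rule clin_bilin_lift[OF clin_nuA clin_nuA_left])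

abbreviation LS :: "(nat \<Rightarrow> nat) \<Rightarrow> ('v tensor, perm_algebra) tprod set"
  where "LS lam \<equiv> tensor_product (LL lam) (specht N lam)"

text \<open>The left inverse of \<open>\<Phi>\<close> on \<open>L\<^sub>\<lambda> \<otimes> S\<^sub>\<lambda>\<close>: the average that defines \<open>e\<^sub>\<lambda>\<close>, with its factors
  \<open>c\<^sub>\<lambda> p\<^sup>-\<^sup>1\<close> and \<open>p\<close> kept apart.\<close>

definition Psi :: "(nat \<Rightarrow> nat) \<Rightarrow> 'v tensor \<Rightarrow> ('v tensor, perm_algebra) tprod"
  where "Psi lam x = inverse ((yk N lam)\<^sup>2) *\<^sub>C (\<Sum>p\<in>Sym N. nuA (yc N lam \<star> sg (inv p)) x \<otimes> sg p)"

lemma clin_Psi: "clin (Psi lam)"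
  unfolding Psi_def by (intro clin_scaled clin_sums clin_compose[OF clin_nuA clin_pure_left])

text \<open>\<open>yc\<close> scales \<open>x\<close> by its action and \<open>s\<close> by right
  multiplication, so each term of \<open>Psi\<close> recovers \<open>x\<close> times the coefficient
  of \<open>s\<close> at \<open>p\<close>, and the sum reassembles \<open>s\<close>.\<close>

lemma Psi_Phi:
  assumes lam: "lam \<in> partitions N" and z: "z \<in> LS lam"
  shows "Psi lam (Phi z) = z"
proof (rule clin_eq_on_span[OF clin_compose[OF clin_Phi clin_Psi] clin_ident z[unfolded tensor_product_def]])
  let ?c = "yc N lam" and ?k = "yk N lam"
  have c: "?c \<in> group_algebra N" and k: "?k \<noteq> 0" by (rule yc_mem[OF lam] yk_nonzero[OF lam])+
  fix y assume "y \<in> {x \<otimes> s |x s. x \<in> LL lam \<and> s \<in> specht N lam}"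
  then obtain x s where y: "y = x \<otimes> s" and x: "x \<in> LL lam" and s: "s \<in> specht N lam" by blast
  have sA: "s \<in> group_algebra N" by (rule specht_mem[OF lam s])
  have "nuA (?c \<star> sg (inv p)) (nuA s x) = (?k\<^sup>2 * Poly_Mapping.lookup s p) *\<^sub>C x" if p: "p \<in> Sym N" for p
  proof -
    have pA: "sg (inv p) \<in> group_algebra N" by (intro sg_in Sym_inv p)
    have t: "sg (inv p) \<star> s \<in> group_algebra N" by (intro gmul_mem pA sA)
    have "tau (?c \<star> (sg (inv p) \<star> s)) = tau ((sg (inv p) \<star> s) \<star> ?c)" by (rule tau_commute[OF c t])
    also have "\<dots> = ?k * Poly_Mapping.lookup s p"
      by (simp add: gmul_assoc specht_yc[OF lam s] tau_inv_gmul[OF p sA])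
    finally have tau: "tau (?c \<star> (sg (inv p) \<star> s)) = ?k * Poly_Mapping.lookup s p" .
    have "?k *\<^sub>C nuA (?c \<star> sg (inv p)) (nuA s x) = nuA (?c \<star> sg (inv p)) (nuA s (nuA ?c x))"
      by (simp add: LL_yc[OF lam x] clin_scale[OF clin_nuA])
    also have "\<dots> = nuA (?c \<star> ((sg (inv p) \<star> s) \<star> ?c)) x"
      by (simp add: nuA_gmul[symmetric] gmul_mem c pA sA gmul_assoc)
    also have "\<dots> = ?k *\<^sub>C ((?k\<^sup>2 * Poly_Mapping.lookup s p) *\<^sub>C x)"
      unfolding yc_x_yc[OF lam t] tau
      by (simp add: clin_scale[OF clin_nuA_left] LL_yc[OF lam x] scaleC_scaleC power2_eq_square mult_ac)
    finally show ?thesis by (rule cvec.scale_left_imp_eq[OF k])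
  qed
  then have "Psi lam (Phi y) = inverse (?k\<^sup>2) *\<^sub>C (\<Sum>p\<in>Sym N. (?k\<^sup>2 * Poly_Mapping.lookup s p) *\<^sub>C (x \<otimes> sg p))"
    by (simp add: Psi_def y Phi_pure clin_scale[OF clin_pure_left])
  also have "\<dots> = (\<Sum>p\<in>Sym N. Poly_Mapping.lookup s p *\<^sub>C (x \<otimes> sg p))"
    using k by (simp add: cvec.scale_sum_right scaleC_scaleC mult.assoc[symmetric])
  also have "\<dots> = x \<otimes> (\<Sum>p\<in>Sym N. Poly_Mapping.lookup s p *\<^sub>C sg p)"
    by (simp add: clin_sum[OF clin_pure_right] clin_scale[OF clin_pure_right])
  also have "(\<Sum>p\<in>Sym N. Poly_Mapping.lookup s p *\<^sub>C sg p) = s"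
    by (rule group_algebra_expand[OF sA, symmetric])
  finally show "Psi lam (Phi y) = y" by (simp add: y)
qed

section \<open>The summands of tensor space under the joint action\<close>

abbreviation UL :: "(nat \<Rightarrow> nat) \<Rightarrow> 'v tensor set"
  where "UL lam \<equiv> Phi ` LS lam"

lemma UL_subspace: "cvec.subspace (UL lam)"
  unfolding tensor_product_def by (rule clin_subspace_image[OF clin_Phi cvec.subspace_span])

lemma UL_induct:
  assumes "y \<in> UL lam" "cvec.subspace K" "\<And>x s. x \<in> LL lam \<Longrightarrow> s \<in> specht N lam \<Longrightarrow> nuA s x \<in> K"
  shows "y \<in> K"
proof -
  obtain z where z: "z \<in> cvec.span {x \<otimes> s |x s. x \<in> LL lam \<and> s \<in> specht N lam}" "y = Phi z"
    using assms(1) by (auto simp: tensor_product_def)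
  show ?thesis
    unfolding z(2) by (rule clin_span_mem[OF clin_Phi z(1) assms(2)]) (use assms(3) in \<open>auto simp: Phi_pure\<close>)
qed

lemma UL_clin_eq:
  assumes "y \<in> UL lam" "clin f" "clin g"
    and "\<And>x s. x \<in> LL lam \<Longrightarrow> s \<in> specht N lam \<Longrightarrow> f (nuA s x) = g (nuA s x)"
  shows "f y = g y"
proof -
  have "cvec.subspace {y. f y = g y}"
    by (rule cvec.subspaceI)
      (simp_all add: clin_zero[OF assms(2)] clin_zero[OF assms(3)] clin_add[OF assms(2)] clin_add[OF assms(3)]
        clin_scale[OF assms(2)] clin_scale[OF assms(3)])
  then have "y \<in> {y. f y = g y}" by (rule UL_induct[OF assms(1)]) (simp add: assms(4))
  then show ?thesis by simp
qed

lemma UL_base: "x \<in> LL lam \<Longrightarrow> s \<in> specht N lam \<Longrightarrow> nuA s x \<in> UL lam"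
  by (rule image_eqI[of _ _ "x \<otimes> s"]) (auto simp: Phi_pure tensor_product_def intro!: cvec.span_base)

lemma UL_sub:
  assumes "lam \<in> partitions N"
  shows "UL lam \<subseteq> M"
  by (rule subsetI, erule UL_induct[OF _ M_subspace]) (rule nuA_mem[OF specht_mem[OF assms]])

lemma specht_left: "lam \<in> partitions N \<Longrightarrow> a \<in> group_algebra N \<Longrightarrow> s \<in> specht N lam \<Longrightarrow> a \<star> s \<in> specht N lam"
  unfolding specht_eq by (auto simp: gmul_assoc[symmetric] gmul_mem)

lemma UL_nuA:
  assumes lam: "lam \<in> partitions N" and a: "a \<in> group_algebra N" and y: "y \<in> UL lam"
  shows "nuA a y \<in> UL lam"
proof -
  have "nuA a (nuA s x) \<in> UL lam" if "x \<in> LL lam" "s \<in> specht N lam" for x s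
    using UL_base[OF that(1) specht_left[OF lam a that(2)]]
    by (simp only: nuA_gmul[OF a specht_mem[OF lam that(2)]])
  moreover have "cvec.subspace {y. nuA a y \<in> UL lam}"
    using UL_subspace[of lam]
    by (intro cvec.subspaceI)
      (simp_all add: clin_zero[OF clin_nuA] clin_add[OF clin_nuA] clin_scale[OF clin_nuA]
        cvec.subspace_0 cvec.subspace_add cvec.subspace_scale)
  ultimately have "y \<in> {y. nuA a y \<in> UL lam}" by (intro UL_induct[OF y]) auto
  then show ?thesis by simp
qed

lemma UL_stable:
  assumes lam: "lam \<in> partitions N"
  shows "stable (UL lam)"
  unfolding stable_def
proof (intro conjI allI impI ballI UL_subspace UL_sub[OF lam])
  fix a c y assume ac: "a < D" "c < D" and y: "y \<in> UL lam"
  have "EE a c (nuA s x) \<in> UL lam" if x: "x \<in> LL lam" and s: "s \<in> specht N lam" for x s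
  proof -
    have "EE a c x \<in> LL lam" using LL_stable[OF lam] x ac by (simp add: stable_def)
    then show ?thesis using UL_base s by (simp add: nuA_EE[OF specht_mem[OF lam s] ac, symmetric])
  qed
  moreover have "cvec.subspace {y. EE a c y \<in> UL lam}"
    using UL_subspace[of lam]
    by (intro cvec.subspaceI)
      (simp_all add: clin_zero[OF clin_EE] clin_add[OF clin_EE] clin_scale[OF clin_EE]
        cvec.subspace_0 cvec.subspace_add cvec.subspace_scale)
  ultimately have "y \<in> {y. EE a c y \<in> UL lam}" by (intro UL_induct[OF y]) auto
  then show "EE a c y \<in> UL lam" by simp
qed

lemma joint_submodule_iff:
  "joint_submodule \<omega> V N K \<longleftrightarrow> stable K \<and> (\<forall>p\<in>Sym N. \<forall>x\<in>K. nu p x \<in> K)"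
proof -
  have "(\<forall>p\<in>Sym N. \<forall>x\<in>K. nu_sym \<omega> V N p x \<in> K) \<longleftrightarrow> (\<forall>p\<in>Sym N. \<forall>x\<in>K. nu p x \<in> K)"
    if K: "K \<subseteq> M"
  proof (intro ball_cong refl)
    fix p x assume "p \<in> Sym N" "x \<in> K"
    then have "nu_sym \<omega> V N p x = nu p x" using K by (intro nu_sym_app) auto
    then show "nu_sym \<omega> V N p x \<in> K \<longleftrightarrow> nu p x \<in> K" by simp
  qed
  then show ?thesis
    unfolding joint_submodule_def stable_gl_iff M_tensor_power[symmetric] by blast
qed

lemma UL_joint: "lam \<in> partitions N \<Longrightarrow> joint_submodule \<omega> V N (UL lam)"
  unfolding joint_submodule_iff using UL_stable UL_nuA[OF _ sg_in] by auto

lemma ye_UL: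
  assumes lam: "lam \<in> partitions N" and y: "y \<in> UL lam"
  shows "nuA (ye N lam) y = y"
proof (rule UL_clin_eq[OF y clin_nuA clin_ident])
  fix x s assume x: "x \<in> LL lam" and s: "s \<in> specht N lam"
  have sA: "s \<in> group_algebra N" by (rule specht_mem[OF lam s])
  have "nuA (ye N lam) (nuA s x) = nuA s (nuA (ye N lam) x)"
    using ye_central[OF lam sA] by (simp add: nuA_gmul[symmetric] ye_mem[OF lam] sA)
  then show "nuA (ye N lam) (nuA s x) = nuA s x" by (simp add: ye_LL[OF lam x])
qed

lemma ye_UL_diff:
  assumes lam: "lam \<in> partitions N" and mu: "mu \<in> partitions N" and "mu \<noteq> lam" and y: "y \<in> UL lam"
  shows "nuA (ye N mu) y = 0"
proof -
  have "nuA (ye N mu) y = nuA (ye N mu) (nuA (ye N lam) y)" by (simp add: ye_UL[OF lam y])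
  also have "\<dots> = 0"
    using ye_ye_diff[OF mu lam] assms(3)
    by (simp add: nuA_gmul[symmetric] ye_mem lam mu clin_zero[OF clin_nuA_left])
  finally show ?thesis .
qed

lemma ye_in_UL:
  assumes lam: "lam \<in> partitions N" and x: "x \<in> M"
  shows "nuA (ye N lam) x \<in> UL lam"
proof -
  let ?c = "yc N lam" and ?k = "yk N lam"
  have c: "?c \<in> group_algebra N" by (rule yc_mem[OF lam])
  have "nuA (sg g \<star> (?c \<star> sg (inv g))) x \<in> UL lam" if g: "g \<in> Sym N" for g
  proof -
    have gA: "sg g \<in> group_algebra N" "sg (inv g) \<in> group_algebra N"
      using g by (auto intro: sg_in permutes_inv)
    have "nuA ?c (nuA (sg (inv g)) x) \<in> LL lam" unfolding LL_def by (intro imageI nuA_mem gA)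
    moreover have "sg g \<star> ?c \<in> specht N lam" unfolding specht_eq by (intro imageI gA)
    ultimately have "nuA (sg g \<star> ?c) (nuA ?c (nuA (sg (inv g)) x)) \<in> UL lam" by (rule UL_base)
    moreover have "(sg g \<star> ?c) \<star> (?c \<star> sg (inv g)) = ?k *\<^sub>C (sg g \<star> (?c \<star> sg (inv g)))"
      by (simp add: gmul_assoc yc_square[OF lam] del: sg_gmul_sg flip: gmul_assoc[of ?c ?c])
    then have "nuA (sg g \<star> ?c) (nuA ?c (nuA (sg (inv g)) x)) = ?k *\<^sub>C nuA (sg g \<star> (?c \<star> sg (inv g))) x"
      by (simp add: nuA_gmul[symmetric] gmul_mem c gA clin_scale[OF clin_nuA_left] del: nuA_sg)
    ultimately have "?k *\<^sub>C nuA (sg g \<star> (?c \<star> sg (inv g))) x \<in> UL lam" by simp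
    then have "inverse ?k *\<^sub>C (?k *\<^sub>C nuA (sg g \<star> (?c \<star> sg (inv g))) x) \<in> UL lam"
      by (rule cvec.subspace_scale[OF UL_subspace])
    then show ?thesis using yk_nonzero[OF lam] by (simp add: scaleC_scaleC scaleC_one)
  qed
  then show ?thesis
    unfolding ye_def clin_scale[OF clin_nuA_left] clin_sum[OF clin_nuA_left]
    by (intro cvec.subspace_scale cvec.subspace_sum UL_subspace)
qed

lemma UL_nonzero:
  assumes "lam \<in> Lam"
  shows "UL lam \<noteq> {0}"
proof
  assume 0: "UL lam = {0}"
  have lp: "lam \<in> partitions N" by (rule Lam_part[OF assms])
  have "yc N lam \<in> specht N lam" unfolding specht_eq using sg_in[OF Sym_id] by (metis gmul_one(1) imageI)
  then have "nuA (yc N lam) (hw lam) = 0" using UL_base[OF hw_LL[OF assms]] 0 by blast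
  then show False
    using LL_yc[OF lp hw_LL[OF assms]] yk_nonzero[OF lp] hw_hwv[OF assms] by (simp add: hwv_def)
qed

text \<open>For nonzero \<open>y\<close> in \<open>K\<close>, \<open>Psi lam y\<close> is nonzero
  because \<open>Psi\<close> inverts \<open>Phi\<close>. So some
  \<open>nuA (yc \<star> sg (inv p)) y\<close> is a nonzero vector of \<open>K\<close> in
  \<open>LL lam\<close>. As \<open>LL lam\<close> is simple it lies in \<open>K\<close>, and the
  group algebra spreads it over all of \<open>UL lam\<close>.\<close>

lemma UL_simple:
  assumes lam: "lam \<in> Lam" and K: "joint_submodule \<omega> V N K" "K \<subseteq> UL lam"
  shows "K = {0} \<or> K = UL lam"
proof (rule disjCI)
  assume "K \<noteq> UL lam"
  have lp: "lam \<in> partitions N" by (rule Lam_part[OF lam])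
  have st: "stable K" and Knu: "\<And>p x. p \<in> Sym N \<Longrightarrow> x \<in> K \<Longrightarrow> nu p x \<in> K"
    using K(1) by (auto simp: joint_submodule_iff)
  have Ksub: "cvec.subspace K" "K \<subseteq> M" using st by (auto simp: stable_def)
  have KA: "nuA a x \<in> K" if "a \<in> group_algebra N" "x \<in> K" for a x
    unfolding nuA_expand[OF that(1)]
    by (intro cvec.subspace_sum cvec.subspace_scale Ksub(1) Knu that(2))
  have "y = 0" if y: "y \<in> K" for y
  proof (rule ccontr)
    assume "y \<noteq> 0"
    obtain z where z: "z \<in> LS lam" "y = Phi z" using y K(2) by blast
    have "Psi lam y = z" using Psi_Phi[OF lp z(1)] z(2) by simp
    moreover have "z \<noteq> 0" using z(2) \<open>y \<noteq> 0\<close> clin_zero[OF clin_Phi] by auto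
    ultimately have "Psi lam y \<noteq> 0" by simp
    then have "\<exists>p\<in>Sym N. nuA (yc N lam \<star> sg (inv p)) y \<noteq> 0"
      unfolding Psi_def by (rule contrapos_np) (simp add: clin_zero[OF clin_pure_left])
    then obtain p where p: "p \<in> Sym N" and nz: "nuA (yc N lam \<star> sg (inv p)) y \<noteq> 0" by blast
    have pA: "sg (inv p) \<in> group_algebra N" by (intro sg_in Sym_inv p)
    have c: "yc N lam \<in> group_algebra N" by (rule yc_mem[OF lp])
    have "nuA (yc N lam \<star> sg (inv p)) y \<in> K" by (intro KA gmul_mem c pA y)
    moreover have "nuA (yc N lam \<star> sg (inv p)) y \<in> LL lam"
      unfolding nuA_gmul[OF c pA] LL_def by (intro imageI nuA_mem pA)
    ultimately have ne: "K \<inter> LL lam \<noteq> {0}" using nz by blast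
    have "stable (K \<inter> LL lam)"
      using st LL_stable[OF lp] by (auto simp: stable_def intro: cvec.subspace_inter)
    then have "K \<inter> LL lam = LL lam" by (rule LL_simple[OF lp]) (use ne in auto)
    then have sub: "LL lam \<subseteq> K" by blast
    have "UL lam \<subseteq> K"
    proof
      fix y assume "y \<in> UL lam"
      then show "y \<in> K"
        by (rule UL_induct[OF _ Ksub(1)]) (rule KA[OF specht_mem[OF lp]], use sub in auto)
    qed
    then show False using K(2) \<open>K \<noteq> UL lam\<close> by blast
  qed
  then show "K = {0}" using cvec.subspace_0[OF Ksub(1)] by blast
qed

text \<open>An isomorphism commutes with \<open>ye N lam\<close>, which is the identity on
  \<open>UL lam\<close> and zero on \<open>UL mu\<close>.\<close>

lemma UL_not_isomorphic:
  assumes lam: "lam \<in> Lam" and mu: "mu \<in> Lam" and ne: "lam \<noteq> mu"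
  shows "\<not> joint_isomorphic \<omega> V N (UL lam) (UL mu)"
proof
  assume "joint_isomorphic \<omega> V N (UL lam) (UL mu)"
  then obtain f where f': "linear_on (UL lam) f \<and> bij_betw f (UL lam) (UL mu) \<and>
      (\<forall>X. \<forall>x\<in>UL lam. f (gl_act \<omega> V X x) = gl_act \<omega> V X (f x)) \<and>
      (\<forall>p\<in>Sym N. \<forall>x\<in>UL lam. f (nu_sym \<omega> V N p x) = nu_sym \<omega> V N p (f x))"
    unfolding joint_isomorphic_def ..
  note f = f'[THEN conjunct1] f'[THEN conjunct2, THEN conjunct1]
    and comm = f'[THEN conjunct2, THEN conjunct2, THEN conjunct2, THEN bspec, THEN bspec]
  have lp: "lam \<in> partitions N" and mp: "mu \<in> partitions N" by (intro Lam_part lam mu)+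
  have img: "f x \<in> UL mu" if "x \<in> UL lam" for x using f(2) that by (auto simp: bij_betw_def)
  have "f x = 0" if x: "x \<in> UL lam" for x
  proof -
    have fx: "f x \<in> UL mu" by (rule img[OF x])
    have nuf: "f (nu p x) = nu p (f x)" if p: "p \<in> Sym N" for p
    proof -
      have "x \<in> M" "f x \<in> M" using x fx UL_sub[OF lp] UL_sub[OF mp] by auto
      then show ?thesis using comm[OF p x] by (simp only: nu_sym_app[OF p])
    qed
    let ?e = "ye N lam"
    have "f x = f (nuA ?e x)" by (simp add: ye_UL[OF lp x])
    also have "\<dots> = (\<Sum>p\<in>Sym N. Poly_Mapping.lookup ?e p *\<^sub>C f (nu p x))"
      unfolding nuA_expand[OF ye_mem[OF lp]]
    proof (rule linear_on_sum[OF UL_subspace f(1) finite_Sym])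
      show "nu p x \<in> UL lam" if "p \<in> Sym N" for p
        using UL_nuA[OF lp sg_in[OF that] x] by simp
    qed
    also have "\<dots> = nuA ?e (f x)"
      unfolding nuA_expand[OF ye_mem[OF lp]] by (intro sum.cong refl) (simp add: nuf)
    also have "\<dots> = 0" by (rule ye_UL_diff[OF mp lp ne fx])
    finally show ?thesis .
  qed
  moreover have "UL mu = f ` UL lam" using f(2) by (simp add: bij_betw_def)
  ultimately have "UL mu \<subseteq> {0}" by auto
  then have "UL mu = {0}" using cvec.subspace_0[OF UL_subspace] by blast
  then show False using UL_nonzero[OF mu] by blast
qed

text \<open>The elements \<open>ye N lam\<close> act as the projections onto the summands, and their
  sum \<open>eT\<close> acts as the identity.\<close>

lemma UL_direct_sum: "direct_sum Lam UL M"
  unfolding direct_sum_def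
proof (intro conjI ballI allI impI)
  show "cvec.subspace (UL lam)" for lam by (rule UL_subspace)
  show "M = cvec.span (\<Union>lam\<in>Lam. UL lam)"
  proof
    show "cvec.span (\<Union>lam\<in>Lam. UL lam) \<subseteq> M"
      by (rule cvec.span_minimal[OF _ M_subspace]) (use UL_sub Lam_part in blast)
    show "M \<subseteq> cvec.span (\<Union>lam\<in>Lam. UL lam)"
    proof
      fix x assume x: "x \<in> M"
      have "x = (\<Sum>lam\<in>Lam. nuA (ye N lam) x)"
        using nuA_eT[OF x] by (simp add: eT_def clin_sum[OF clin_nuA_left])
      also have "\<dots> \<in> cvec.span (\<Union>lam\<in>Lam. UL lam)"
      proof (intro cvec.span_sum cvec.span_base)
        fix lam assume lam: "lam \<in> Lam"
        show "nuA (ye N lam) x \<in> (\<Union>lam\<in>Lam. UL lam)"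
          using lam ye_in_UL[OF Lam_part[OF lam] x] by blast
      qed
      finally show "x \<in> cvec.span (\<Union>lam\<in>Lam. UL lam)" .
    qed
  qed
  fix J f lam
  assume J: "finite J \<and> J \<subseteq> Lam \<and> (\<forall>j\<in>J. f j \<in> UL j) \<and> (\<Sum>j\<in>J. f j) = 0" and lam: "lam \<in> J"
  have "0 = nuA (ye N lam) (\<Sum>j\<in>J. f j)" using J by (simp add: clin_zero[OF clin_nuA])
  also have "\<dots> = (\<Sum>j\<in>J. nuA (ye N lam) (f j))" by (rule clin_sum[OF clin_nuA])
  also have "\<dots> = (\<Sum>j\<in>J. if j = lam then f lam else 0)"
  proof (rule sum.cong[OF refl])
    fix j assume j: "j \<in> J"
    then have jp: "j \<in> partitions N" "lam \<in> partitions N" "f j \<in> UL j" using J lam Lam_part by blast+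
    show "nuA (ye N lam) (f j) = (if j = lam then f lam else 0)"
      using ye_UL[OF jp(1,3)] ye_UL_diff[OF jp(1,2) _ jp(3)] by auto
  qed
  also have "\<dots> = f lam" using J lam by simp
  finally show "f lam = 0" by simp
qed

lemma UL_multiplicity_free: "multiplicity_free_sum \<omega> V N Lam UL"
  unfolding multiplicity_free_sum_def M_tensor_power[symmetric]
proof (intro conjI ballI allI impI)
  show "direct_sum Lam UL M" by (rule UL_direct_sum)
  fix lam assume lam: "lam \<in> Lam"
  show "joint_submodule \<omega> V N (UL lam)" by (rule UL_joint[OF Lam_part[OF lam]])
  show "UL lam \<noteq> {0}" by (rule UL_nonzero[OF lam])
  show "K = {0} \<or> K = UL lam" if "K \<subseteq> UL lam" "joint_submodule \<omega> V N K" for K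
    by (rule UL_simple[OF lam that(2,1)])
  show "\<not> joint_isomorphic \<omega> V N (UL lam) (UL mu)" if "mu \<in> Lam" "lam \<noteq> mu" for mu
    by (rule UL_not_isomorphic[OF lam that])
qed

section \<open>Grading and highest weight of the simple modules\<close>

definition wdeg :: "nat list \<Rightarrow> 'g"
  where "wdeg w = sum_list (map d w)"

text \<open>Homogeneity is expressed by coordinates, so that the component maps are the projections
  \<open>dproj\<close>, which commute with the permutations and hence preserve
  \<open>LL lam\<close>.\<close>

definition Gr :: "(nat \<Rightarrow> nat) \<Rightarrow> 'g \<Rightarrow> 'v tensor set"
  where "Gr lam \<gamma> = {x \<in> LL lam. \<forall>w\<in>W. crdt w x \<noteq> 0 \<longrightarrow> wdeg w = \<gamma>}"

lemma wdeg_act: "p \<in> Sym N \<Longrightarrow> w \<in> W \<Longrightarrow> wdeg (act p w) = wdeg w"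
  unfolding wdeg_def using mset_act by (metis mset_map sum_mset_sum_list)

abbreviation dproj :: "'g \<Rightarrow> 'v tensor \<Rightarrow> 'v tensor"
  where "dproj \<gamma> \<equiv> proj (\<lambda>w. wdeg w = \<gamma>)"

lemma dproj_Gr: "lam \<in> partitions N \<Longrightarrow> x \<in> LL lam \<Longrightarrow> dproj \<gamma> x \<in> Gr lam \<gamma>"
  using proj_stable[OF LL_stable, of lam "\<lambda>w. wdeg w = \<gamma>" x]
  by (auto simp: Gr_def crd_proj wdeg_act)

lemma dproj_of_Gr:
  assumes "lam \<in> partitions N" "x \<in> Gr lam \<beta>"
  shows "dproj \<gamma> x = (if \<gamma> = \<beta> then x else 0)"
proof -
  have x: "x \<in> M" using assms LL_sub by (auto simp: Gr_def)
  have "dproj \<gamma> x = (\<Sum>w\<in>W. crdt w x *\<^sub>C (if \<gamma> = \<beta> then tensor (map b w) else 0))"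
    unfolding proj_def ext_def using assms(2) by (intro sum.cong refl) (auto simp: Gr_def)
  then show ?thesis using M_expand[OF x] by simp
qed

lemma Gr_subspace: "cvec.subspace (Gr lam \<gamma>)"
  by (rule cvec.subspaceI)
    (use LL_subspace[of lam] in \<open>auto simp: Gr_def clin_zero[OF clin_crd] clin_add[OF clin_crd]
      clin_scale[OF clin_crd] scaleC_complex_def cvec.subspace_0 cvec.subspace_add cvec.subspace_scale\<close>)

lemma Gr_direct_sum:
  assumes lam: "lam \<in> partitions N"
  shows "direct_sum UNIV (Gr lam) (LL lam)"
  unfolding direct_sum_def
proof (intro conjI ballI allI impI)
  show "cvec.subspace (Gr lam \<gamma>)" for \<gamma> by (rule Gr_subspace)
  show "LL lam = cvec.span (\<Union>\<gamma>. Gr lam \<gamma>)"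
  proof
    show "cvec.span (\<Union>\<gamma>. Gr lam \<gamma>) \<subseteq> LL lam"
      by (rule cvec.span_minimal[OF _ LL_subspace]) (auto simp: Gr_def)
    show "LL lam \<subseteq> cvec.span (\<Union>\<gamma>. Gr lam \<gamma>)"
    proof
      fix x assume x: "x \<in> LL lam"
      then have xM: "x \<in> M" using LL_sub[OF lam] by blast
      have "x = (\<Sum>\<gamma>\<in>wdeg ` W. dproj \<gamma> x)"
      proof (rule M_eqI[OF clin_ident clin_sums[OF clin_proj] xM])
        fix w assume w: "w \<in> W"
        have "(\<Sum>\<gamma>\<in>wdeg ` W. dproj \<gamma> (tensor (map b w)))
            = (\<Sum>\<gamma>\<in>wdeg ` W. if \<gamma> = wdeg w then tensor (map b w) else 0)"
          by (intro sum.cong refl) (auto simp: proj_T[OF w])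
        also have "\<dots> = tensor (map b w)" using w finite_words by simp
        finally show "tensor (map b w) = (\<Sum>\<gamma>\<in>wdeg ` W. dproj \<gamma> (tensor (map b w)))" by simp
      qed
      also have "\<dots> \<in> cvec.span (\<Union>\<gamma>. Gr lam \<gamma>)"
      proof (intro cvec.span_sum cvec.span_base)
        show "dproj \<gamma> x \<in> (\<Union>\<gamma>. Gr lam \<gamma>)" for \<gamma> using dproj_Gr[OF lam x] by blast
      qed
      finally show "x \<in> cvec.span (\<Union>\<gamma>. Gr lam \<gamma>)" .
    qed
  qed
  fix J f \<gamma>
  assume J: "finite J \<and> J \<subseteq> UNIV \<and> (\<forall>j\<in>J. f j \<in> Gr lam j) \<and> (\<Sum>j\<in>J. f j) = 0" and \<gamma>: "\<gamma> \<in> J"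
  have "0 = dproj \<gamma> (\<Sum>j\<in>J. f j)" using J by (simp add: clin_zero[OF clin_proj])
  also have "\<dots> = (\<Sum>j\<in>J. dproj \<gamma> (f j))" by (rule clin_sum[OF clin_proj])
  also have "\<dots> = (\<Sum>j\<in>J. if j = \<gamma> then f \<gamma> else 0)"
    using J by (intro sum.cong refl) (auto simp: dproj_of_Gr[OF lam])
  also have "\<dots> = f \<gamma>" using J \<gamma> by simp
  finally show "f \<gamma> = 0" by simp
qed

lemma sum_list_update_group:
  fixes xs :: "'g list"
  shows "i < length xs \<Longrightarrow> sum_list (xs[i := y]) = sum_list xs + y - xs ! i"
  by (induction xs arbitrary: i) (auto split: nat.split simp: algebra_simps)

lemma wdeg_update: "w \<in> W \<Longrightarrow> i < N \<Longrightarrow> wdeg (w[i := a]) = wdeg w + d a - d (w ! i)"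
  unfolding wdeg_def map_update by (subst sum_list_update_group) (auto simp: words_length)

lemma Gr_gl_act:
  assumes lam: "lam \<in> partitions N" and X: "X \<in> gl V \<alpha>" and x: "x \<in> Gr lam \<beta>"
  shows "gl_act \<omega> V X x \<in> Gr lam (\<alpha> + \<beta>)"
proof -
  have xL: "x \<in> LL lam" and xM: "x \<in> M" using x LL_sub[OF lam] by (auto simp: Gr_def)
  have "wdeg w = \<alpha> + \<beta>" if w: "w \<in> W" and nz: "crdt w (gl_act \<omega> V X x) \<noteq> 0" for w
  proof -
    have "\<exists>a<D. \<exists>c<D. co a (app_endo X (b c)) * crdt w (EE a c x) \<noteq> 0"
    proof (rule ccontr)
      assume "\<not> ?thesis"
      then have "crdt w (gl_act \<omega> V X x) = 0"
        unfolding gl_act_expand[OF xM] clin_sum[OF clin_crd] clin_scale[OF clin_crd] scaleC_complex_def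
        by (intro sum.neutral ballI) auto
      then show False using nz by simp
    qed
    then obtain a c where ac: "a < D" "c < D" and n1: "co a (app_endo X (b c)) \<noteq> 0"
      and n2: "crdt w (EE a c x) \<noteq> 0" by auto
    have \<alpha>: "d a - d c = \<alpha>" using gl_coeff_0[OF X ac] n1 by blast
    obtain w' i where w': "w' \<in> W" "crdt w' x \<noteq> 0" "i < N" "w' ! i = c" "w = w'[i := a]"
      using crd_EE[OF xM ac(1) w n2] by blast
    have "wdeg w' = \<beta>" using x w' by (simp add: Gr_def)
    then show ?thesis using wdeg_update[OF w'(1,3), of a] w'(4,5) \<alpha> by (simp add: algebra_simps)
  qed
  then show ?thesis using stable_gl_act[OF LL_stable[OF lam] xL] by (simp add: Gr_def)
qed

lemma LL_module:
  assumes lam: "lam \<in> partitions N"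
  shows "graded_gl_module \<omega> V (LL lam) (Gr lam) (gl_act \<omega> V)"
  unfolding graded_gl_module_def
proof (intro conjI allI ballI Gr_direct_sum[OF lam] Gr_gl_act[OF lam])
  show "linear_on (LL lam) (gl_act \<omega> V X)" for X by (rule clin_linear_on[OF clin_gl_act])
  show "gl_act \<omega> V X \<in> LL lam \<rightarrow> LL lam" for X using stable_gl_act[OF LL_stable[OF lam]] by blast
  show "gl_act \<omega> V (X + Y) x = gl_act \<omega> V X x + gl_act \<omega> V Y x" for X Y x by (rule clin_add[OF clin_gl_act_left])
  show "gl_act \<omega> V (c *\<^sub>C X) x = c *\<^sub>C gl_act \<omega> V X x" for c X x by (rule clin_scale[OF clin_gl_act_left])
  show "gl_act \<omega> V (bracket \<omega> \<alpha> \<beta> X Y) x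
      = gl_act \<omega> V X (gl_act \<omega> V Y x) - \<omega> \<alpha> \<beta> *\<^sub>C gl_act \<omega> V Y (gl_act \<omega> V X x)"
    if "X \<in> gl V \<alpha>" "Y \<in> gl V \<beta>" "x \<in> LL lam" for \<alpha> \<beta> X Y x
    using gl_act_bracket[OF that(1,2)] that(3) LL_sub[OF lam] by blast
qed

text \<open>\<open>LL_simple\<close> covers all stable subspaces, graded or not, so this yields both
  graded simplicity and generation by \<open>hw lam\<close>.\<close>

lemma LL_submodule:
  assumes lam: "lam \<in> partitions N" and "submodule (LL lam) (gl_act \<omega> V) K" and "K \<noteq> {0}"
  shows "K = LL lam"
proof (rule LL_simple[OF lam _ _ assms(3)])
  show "K \<subseteq> LL lam" using assms(2) by (simp add: submodule_def)
  then show "stable K"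
    using assms(2) LL_sub[OF lam] unfolding stable_gl_iff submodule_def by blast
qed

lemma LL_highest_weight:
  assumes lam: "lam \<in> Lam" and dim: "D = cvec.dim (UNIV :: 'v set)"
  shows "simple_highest_weight_module \<omega> V b (of_nat \<circ> sharp m lam) (LL lam) (Gr lam) (gl_act \<omega> V)"
  unfolding simple_highest_weight_module_def dim[symmetric]
proof (intro conjI bexI[of _ "hw lam"] allI impI)
  have lp: "lam \<in> partitions N" by (rule Lam_part[OF lam])
  have mu: "matrix_unit b a c = munit_endo a c" for a c
    unfolding matrix_unit_def munit_endo_def co_def dim[symmetric] by simp
  have hM: "hw lam \<in> M" using hw_LL[OF lam] LL_sub[OF lp] by blast
  note h = hw_hwv[OF lam, unfolded hwv_def]
  show "graded_gl_module \<omega> V (LL lam) (Gr lam) (gl_act \<omega> V)" by (rule LL_module[OF lp])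
  show nz: "hw lam \<noteq> 0" using h by blast
  show L: "hw lam \<in> LL lam" by (rule hw_LL[OF lam])
  then have "LL lam \<noteq> {0}" using nz by blast
  then show "graded_simple (LL lam) (Gr lam) (gl_act \<omega> V)"
    unfolding graded_simple_def using LL_submodule[OF lp] by blast
  show "gl_act \<omega> V (matrix_unit b a c) (hw lam) = 0" if "c < D" "a < c" for a c
    using h that hM by (simp add: mu gl_act_munit)
  show "gl_act \<omega> V (matrix_unit b a a) (hw lam) = (of_nat \<circ> sharp m lam) a *\<^sub>C hw lam" if "a < D" for a
    using EE_diag[of "mset (hword lam)" "hw lam" a] h that hM count_hword[OF lp, of a]
    by (simp add: mu gl_act_munit)
  show "K = LL lam" if "submodule (LL lam) (gl_act \<omega> V) K \<and> hw lam \<in> K" for K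
    using LL_submodule[OF lp] that nz by blast
qed

lemma nuA_Gr_tensor_grading:
  assumes lam: "lam \<in> partitions N" and s: "s \<in> group_algebra N" and x: "x \<in> Gr lam \<gamma>"
  shows "nuA s x \<in> tensor_grading V N \<gamma>"
proof -
  have xM: "x \<in> M" using x LL_sub[OF lam] by (auto simp: Gr_def)
  have "nuA s x = nuA s (dproj \<gamma> x)" by (simp add: dproj_of_Gr[OF lam x])
  also have "\<dots> = dproj \<gamma> (nuA s x)" by (rule proj_nuA[OF _ s xM]) (simp add: wdeg_act)
  also have "\<dots> \<in> tensor_grading V N \<gamma>"
    unfolding proj_def
  proof (rule ext_mem)
    show "cvec.subspace (tensor_grading V N \<gamma>)" by (simp add: tensor_grading_def cvec.subspace_span)
    fix w assume w: "w \<in> W"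
    have "tensor (map b w) \<in> tensor_grading V N \<gamma>" if "wdeg w = \<gamma>"
      unfolding tensor_grading_def
    proof (rule cvec.span_base, intro CollectI exI conjI)
      show "length (map b w) = N" using w by (simp add: words_length)
      show "sum_list (map d w) = \<gamma>" using that by (simp add: wdeg_def)
      show "list_all2 (\<lambda>v \<beta>. v \<in> V \<beta>) (map b w) (map d w)"
        using w words_nth[OF w] by (auto simp: list_all2_conv_all_nth words_length b_deg)
    qed simp
    then show "(if wdeg w = \<gamma> then tensor (map b w) else 0) \<in> tensor_grading V N \<gamma>"
      by (simp add: tensor_grading_def cvec.span_zero)
  qed
  finally show ?thesis .
qed

section \<open>Dimensions and the choice of an adapted basis\<close>

lemma even_iff: "a < D \<Longrightarrow> d a \<in> even_degrees \<omega> \<longleftrightarrow> a < m"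
  using even[of a] odd[of a] by (cases "a < m") (auto simp: even_degrees_def)

lemma odd_iff: "a < D \<Longrightarrow> d a \<in> odd_degrees \<omega> \<longleftrightarrow> m \<le> a"
  using even[of a] odd[of a] by (cases "a < m") (auto simp: odd_degrees_def)

lemma dim_degrees: "cvec.dim (cvec.span (\<Union>\<alpha>\<in>S. V \<alpha>)) = card {a\<in>{..<D}. d a \<in> S}"
proof -
  let ?A = "{a\<in>{..<D}. d a \<in> S}"
  have "cvec.span (\<Union>\<alpha>\<in>S. V \<alpha>) = cvec.span (b ` ?A)"
  proof
    show "cvec.span (\<Union>\<alpha>\<in>S. V \<alpha>) \<subseteq> cvec.span (b ` ?A)"
    proof (rule cvec.span_minimal[OF _ cvec.subspace_span], rule subsetI)
      fix v assume "v \<in> (\<Union>\<alpha>\<in>S. V \<alpha>)"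
      then obtain \<alpha> where \<alpha>: "\<alpha> \<in> S" "v \<in> V \<alpha>" by blast
      have "(\<Sum>a<D. co a v *\<^sub>C b a) \<in> cvec.span (b ` ?A)"
      proof (rule cvec.span_sum)
        fix a assume "a \<in> {..<D}"
        then show "co a v *\<^sub>C b a \<in> cvec.span (b ` ?A)"
          using co_homogeneous[OF \<alpha>(2), of a] \<alpha>(1)
          by (cases "d a = \<alpha>") (auto simp: cvec.span_zero intro: cvec.span_scale[OF cvec.span_base])
      qed
      then show "v \<in> cvec.span (b ` ?A)" by (simp only: v_expand[symmetric])
    qed
    show "cvec.span (b ` ?A) \<subseteq> cvec.span (\<Union>\<alpha>\<in>S. V \<alpha>)"
      by (rule cvec.span_mono) (use b_deg in blast)
  qed
  moreover have "\<not> cvec.dependent (b ` ?A)" by (rule cvec.independent_mono[OF b_indep]) auto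
  then have "cvec.dim (cvec.span (b ` ?A)) = card (b ` ?A)"
    by (rule cvec.dim_span_eq_card_independent)
  ultimately have "cvec.dim (cvec.span (\<Union>\<alpha>\<in>S. V \<alpha>)) = card (b ` ?A)" by simp
  also have "\<dots> = card ?A" by (rule card_image, rule inj_on_subset[OF b_inj]) auto
  finally show ?thesis .
qed

lemma even_dim_eq: "even_dim \<omega> V = m"
proof -
  have "{a\<in>{..<D}. d a \<in> even_degrees \<omega>} = {..<m}" using even_iff m_D by auto
  then show ?thesis unfolding even_dim_def dim_degrees by simp
qed

lemma odd_dim_eq: "odd_dim \<omega> V = D - m"
proof -
  have "{a\<in>{..<D}. d a \<in> odd_degrees \<omega>} = {m..<D}" using odd_iff by auto
  then show ?thesis unfolding odd_dim_def dim_degrees by simp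
qed

end

text \<open>A maximal independent set of homogeneous vectors is a basis, because such vectors span;
  its even members are listed first. Every degree is even or odd, since
  \<open>\<omega> \<alpha> \<alpha>\<close> is its own inverse.\<close>

lemma graded_basis_exists:
  fixes \<omega> :: "'g::ab_group_add \<Rightarrow> 'g \<Rightarrow> complex" and V :: "'g \<Rightarrow> 'v::complex_vector set"
  assumes cf: "commutative_factor \<omega>" and fd: "finite_dim_graded V"
  shows "\<exists>D m b d. graded_basis \<omega> V D m b d"
proof -
  have ds: "direct_sum UNIV V UNIV" using fd by (simp add: finite_dim_graded_def)
  obtain S :: "'v set" where S: "finite S" "cvec.span S = UNIV" using fd by (auto simp: finite_dim_graded_def)
  obtain B where B: "B \<subseteq> (\<Union>\<alpha>. V \<alpha>)" "\<not> cvec.dependent B" "(\<Union>\<alpha>. V \<alpha>) \<subseteq> cvec.span B"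
    using cvec.maximal_independent_subset by blast
  have fin: "finite B" using cvec.independent_span_bound[OF S(1) B(2)] S(2) by simp
  have "cvec.span (\<Union>\<alpha>. V \<alpha>) \<subseteq> cvec.span B" by (rule cvec.span_minimal[OF B(3) cvec.subspace_span])
  then have span: "cvec.span B = UNIV" using ds by (auto simp: direct_sum_def)
  have "\<forall>x\<in>B. \<exists>\<alpha>. x \<in> V \<alpha>" using B(1) by blast
  then obtain dg where dg: "\<And>x. x \<in> B \<Longrightarrow> x \<in> V (dg x)" by metis
  let ?even = "\<lambda>x. \<omega> (dg x) (dg x) = 1"
  obtain xs where xs: "set xs = {x\<in>B. ?even x}" "distinct xs"
    using finite_distinct_list[of "{x\<in>B. ?even x}"] fin by auto
  obtain ys where ys: "set ys = {x\<in>B. \<not> ?even x}" "distinct ys"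
    using finite_distinct_list[of "{x\<in>B. \<not> ?even x}"] fin by auto
  let ?zs = "xs @ ys"
  have zs: "set ?zs = B" "distinct ?zs" using xs ys by auto
  have img: "(!) ?zs ` {..<length ?zs} = B"
    unfolding zs(1)[symmetric] set_conv_nth by blast
  have sq: "\<omega> \<alpha> \<alpha> = 1 \<or> \<omega> \<alpha> \<alpha> = - 1" for \<alpha>
  proof -
    have "\<omega> \<alpha> \<alpha> = inverse (\<omega> \<alpha> \<alpha>)" "\<omega> \<alpha> \<alpha> \<noteq> 0" using cf unfolding commutative_factor_def by blast+
    then have "\<omega> \<alpha> \<alpha> * \<omega> \<alpha> \<alpha> = 1" by (metis right_inverse)
    then show ?thesis by (metis square_eq_1_iff)
  qed
  have "graded_basis \<omega> V (length ?zs) (length xs) ((!) ?zs) (\<lambda>i. dg (?zs ! i))"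
  proof (rule graded_basis.intro[OF cf ds])
    show "inj_on ((!) ?zs) {..<length ?zs}" using zs(2) by (auto simp: inj_on_def nth_eq_iff_index_eq)
    show "\<not> cvec.dependent ((!) ?zs ` {..<length ?zs})" unfolding img by (rule B(2))
    show "cvec.span ((!) ?zs ` {..<length ?zs}) = UNIV" unfolding img by (rule span)
    show "?zs ! a \<in> V (dg (?zs ! a))" if "a < length ?zs" for a using dg nth_mem[OF that] zs(1) by blast
    show "length xs \<le> length ?zs" by simp
    show "\<omega> (dg (?zs ! a)) (dg (?zs ! a)) = 1" if "a < length xs" for a
      using that nth_mem[OF that] xs(1) by (simp add: nth_append)
    show "\<omega> (dg (?zs ! a)) (dg (?zs ! a)) = - 1" if "length xs \<le> a" "a < length ?zs" for a
    proof -
      have "?zs ! a \<in> set ys" using that by (simp add: nth_append)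
      then show ?thesis using sq ys(1) by blast
    qed
  qed
  then show ?thesis by blast
qed

text \<open>Even degrees precede odd ones and the order is antisymmetric, so the indices of even
  degree form an initial segment; \<open>m\<close> is its length.\<close>

lemma graded_basis_ordered:
  fixes \<omega> :: "'g::ab_group_add \<Rightarrow> 'g \<Rightarrow> complex" and V :: "'g \<Rightarrow> 'v::complex_vector set"
  assumes cf: "commutative_factor \<omega>" and fd: "finite_dim_graded V"
    and ob: "ordered_homogeneous_basis \<omega> V r b"
  shows "\<exists>m d. graded_basis \<omega> V (cvec.dim (UNIV :: 'v set)) m b d"
proof -
  let ?D = "cvec.dim (UNIV :: 'v set)"
  have ds: "direct_sum UNIV V UNIV" using fd by (simp add: finite_dim_graded_def)
  note ob' = ob[unfolded ordered_homogeneous_basis_def]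
  note lin = ob'[THEN conjunct1]
  have eo: "(\<alpha>, \<beta>) \<in> r" if "\<alpha> \<in> degs V \<inter> even_degrees \<omega>" "\<beta> \<in> degs V \<inter> odd_degrees \<omega>" for \<alpha> \<beta>
    by (rule ob'[THEN conjunct2, THEN conjunct1, rule_format, OF that])
  note b = ob'[THEN conjunct2, THEN conjunct2, THEN conjunct1]
    ob'[THEN conjunct2, THEN conjunct2, THEN conjunct2, THEN conjunct1]
    ob'[THEN conjunct2, THEN conjunct2, THEN conjunct2, THEN conjunct2, THEN conjunct1]
  note ob'[THEN conjunct2, THEN conjunct2, THEN conjunct2, THEN conjunct2, THEN conjunct2]
  then obtain d where d: "\<And>a. a < ?D \<Longrightarrow> b a \<in> V (d a)" "\<And>c a. c < ?D \<Longrightarrow> a \<le> c \<Longrightarrow> (d a, d c) \<in> r"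
    by blast
  have sq: "\<alpha> \<in> even_degrees \<omega> \<or> \<alpha> \<in> odd_degrees \<omega>" for \<alpha>
  proof -
    have "\<omega> \<alpha> \<alpha> = inverse (\<omega> \<alpha> \<alpha>)" "\<omega> \<alpha> \<alpha> \<noteq> 0" using cf unfolding commutative_factor_def by blast+
    then have "\<omega> \<alpha> \<alpha> * \<omega> \<alpha> \<alpha> = 1" by (metis right_inverse)
    then have "\<omega> \<alpha> \<alpha> = 1 \<or> \<omega> \<alpha> \<alpha> = - 1" by (metis square_eq_1_iff)
    then show ?thesis by (simp add: even_degrees_def odd_degrees_def)
  qed
  have disj: "\<not> (\<alpha> \<in> even_degrees \<omega> \<and> \<alpha> \<in> odd_degrees \<omega>)" for \<alpha>
    by (simp add: even_degrees_def odd_degrees_def)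
  have degs: "d a \<in> degs V" if "a < ?D" for a
  proof -
    have "b a \<noteq> 0" using b(2) that by (metis cvec.dependent_zero imageI lessThan_iff)
    then show ?thesis using d(1)[OF that] by (auto simp: degs_def)
  qed
  let ?E = "{a\<in>{..<?D}. d a \<in> even_degrees \<omega>}"
  have down: "a \<in> ?E" if "a \<le> c" "c \<in> ?E" for a c
  proof (rule ccontr)
    assume "a \<notin> ?E"
    then have a: "a < ?D" "d a \<in> odd_degrees \<omega>" using that sq by auto
    have c: "c < ?D" "d c \<in> even_degrees \<omega>" using that by auto
    have "(d c, d a) \<in> r" using eo degs a c by blast
    moreover have "(d a, d c) \<in> r" by (rule d(2)[OF c(1) that(1)])
    ultimately have "d a = d c"
      using lin by (auto simp: linear_order_on_def partial_order_on_def antisym_def)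
    then show False using disj a c by metis
  qed
  define m where "m = card ?E"
  have "?E = {..<m}"
  proof -
    have "a < m" if "a \<in> ?E" for a
    proof -
      have "{..a} \<subseteq> ?E" using down that by blast
      then have "card {..a} \<le> m" unfolding m_def by (intro card_mono) auto
      then show ?thesis by simp
    qed
    then have "?E \<subseteq> {..<m}" by blast
    then show ?thesis by (rule card_subset_eq[rotated]) (simp_all add: m_def)
  qed
  then have E: "a < ?D \<and> d a \<in> even_degrees \<omega> \<longleftrightarrow> a < m" for a by blast
  have "m \<le> ?D" unfolding m_def using card_mono[of "{..<?D}" ?E] by auto
  have "graded_basis \<omega> V ?D m b d"
  proof (rule graded_basis.intro[OF cf ds b d(1) \<open>m \<le> ?D\<close>])
    show "\<omega> (d a) (d a) = 1" if "a < m" for a using E[of a] that by (simp add: even_degrees_def)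
    show "\<omega> (d a) (d a) = - 1" if "m \<le> a" "a < ?D" for a
      using E[of a] that sq[of "d a"] by (auto simp: odd_degrees_def)
  qed
  then show ?thesis by blast
qed

theorem theorem4p15:
  fixes \<omega> :: "'g::ab_group_add \<Rightarrow> 'g \<Rightarrow> complex"
    and V :: "'g \<Rightarrow> 'v::complex_vector set"
    and N :: nat
  assumes "commutative_factor \<omega>"
    and "finite_dim_graded V"
    and "N > 0"
  shows "(\<forall>r b. ordered_homogeneous_basis \<omega> V r b \<longrightarrow>
      (\<exists>(L :: (nat \<Rightarrow> nat) \<Rightarrow> 'v tensor set) G \<rho> \<Phi>.
         let \<Lambda> = {lam \<in> partitions N. lam (even_dim \<omega> V) \<le> odd_dim \<omega> V} in
         (\<forall>lam\<in>\<Lambda>.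
            simple_highest_weight_module \<omega> V b (of_nat \<circ> sharp (even_dim \<omega> V) lam)
              (L lam) (G lam) (\<rho> lam) \<and>
            sym_simple N (specht N lam) \<and>
            linear_on (tensor_product (L lam) (specht N lam)) (\<Phi> lam) \<and>
            inj_on (\<Phi> lam) (tensor_product (L lam) (specht N lam)) \<and>
            (\<forall>x\<in>L lam. \<forall>s\<in>specht N lam.
               (\<forall>X. \<Phi> lam (\<rho> lam X x \<otimes> s) = gl_act \<omega> V X (\<Phi> lam (x \<otimes> s))) \<and>
               (\<forall>p\<in>Sym N. \<Phi> lam (x \<otimes> left_mult p s) = nu_sym \<omega> V N p (\<Phi> lam (x \<otimes> s))) \<and>
               (\<forall>\<gamma>. x \<in> G lam \<gamma> \<longrightarrow> \<Phi> lam (x \<otimes> s) \<in> tensor_grading V N \<gamma>))) \<and>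
         multiplicity_free_sum \<omega> V N \<Lambda>
           (\<lambda>lam. \<Phi> lam ` tensor_product (L lam) (specht N lam)))) \<and>
    End_Sym \<omega> V N = pi_rep \<omega> V N ` U_gl \<omega> V \<and>
    End_gl \<omega> V N = nu_rep \<omega> V N ` group_algebra N"
proof (intro conjI allI impI)
  \<comment> \<open>These two equations mention no basis, so any adapted one may be used.\<close>
  obtain D m b d where "graded_basis \<omega> V D m b d" using graded_basis_exists[OF assms(1,2)] by blast
  then interpret graded_basis \<omega> V N D m b d .
  show "End_Sym \<omega> V N = pi_rep \<omega> V N ` U_gl \<omega> V" by (rule End_Sym_eq)
  show "End_gl \<omega> V N = nu_rep \<omega> V N ` group_algebra N" by (rule End_gl_eq)
next
  fix r b assume "ordered_homogeneous_basis \<omega> V r b"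
  then obtain m d where "graded_basis \<omega> V (cvec.dim (UNIV :: 'v set)) m b d"
    using graded_basis_ordered[OF assms(1,2)] by blast
  then interpret graded_basis \<omega> V N "cvec.dim (UNIV :: 'v set)" m b d .
  have Lam: "{lam \<in> partitions N. lam (even_dim \<omega> V) \<le> odd_dim \<omega> V} = Lam"
    by (simp add: Lam_def even_dim_eq odd_dim_eq)
  show "\<exists>(L :: (nat \<Rightarrow> nat) \<Rightarrow> 'v tensor set) G \<rho> \<Phi>.
         let \<Lambda> = {lam \<in> partitions N. lam (even_dim \<omega> V) \<le> odd_dim \<omega> V} in
         (\<forall>lam\<in>\<Lambda>.
            simple_highest_weight_module \<omega> V b (of_nat \<circ> sharp (even_dim \<omega> V) lam)
              (L lam) (G lam) (\<rho> lam) \<and>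
            sym_simple N (specht N lam) \<and>
            linear_on (tensor_product (L lam) (specht N lam)) (\<Phi> lam) \<and>
            inj_on (\<Phi> lam) (tensor_product (L lam) (specht N lam)) \<and>
            (\<forall>x\<in>L lam. \<forall>s\<in>specht N lam.
               (\<forall>X. \<Phi> lam (\<rho> lam X x \<otimes> s) = gl_act \<omega> V X (\<Phi> lam (x \<otimes> s))) \<and>
               (\<forall>p\<in>Sym N. \<Phi> lam (x \<otimes> left_mult p s) = nu_sym \<omega> V N p (\<Phi> lam (x \<otimes> s))) \<and>
               (\<forall>\<gamma>. x \<in> G lam \<gamma> \<longrightarrow> \<Phi> lam (x \<otimes> s) \<in> tensor_grading V N \<gamma>))) \<and>
         multiplicity_free_sum \<omega> V N \<Lambda>
           (\<lambda>lam. \<Phi> lam ` tensor_product (L lam) (specht N lam))"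
    unfolding Let_def Lam unfolding even_dim_eq
  proof (intro exI[of _ LL] exI[of _ Gr] exI[of _ "\<lambda>_. gl_act \<omega> V"] exI[of _ "\<lambda>_. Phi"]
      conjI ballI allI impI)
    fix lam assume lam: "lam \<in> Lam"
    have lp: "lam \<in> partitions N" by (rule Lam_part[OF lam])
    show "simple_highest_weight_module \<omega> V b (of_nat \<circ> sharp m lam) (LL lam) (Gr lam) (gl_act \<omega> V)"
      by (rule LL_highest_weight[OF lam refl])
    show "sym_simple N (specht N lam)" by (rule specht_simple[OF lp])
    show "linear_on (LS lam) Phi" by (rule clin_linear_on[OF clin_Phi])
    show "inj_on Phi (LS lam)" by (rule inj_on_inverseI[of _ "Psi lam"]) (rule Psi_Phi[OF lp])
    fix x s assume x: "x \<in> LL lam" and s: "s \<in> specht N lam"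
    have xM: "x \<in> M" and sA: "s \<in> group_algebra N" using x s LL_sub[OF lp] specht_mem[OF lp] by auto
    show "Phi (gl_act \<omega> V X x \<otimes> s) = gl_act \<omega> V X (Phi (x \<otimes> s))" for X
      by (simp add: Phi_pure gl_act_expand xM nuA_mem[OF sA] clin_sum[OF clin_nuA] clin_scale[OF clin_nuA]
          nuA_EE[OF sA])
    show "Phi (x \<otimes> left_mult p s) = nu_sym \<omega> V N p (Phi (x \<otimes> s))" if "p \<in> Sym N" for p
      using nuA_gmul[OF sg_in[OF that] sA, of x]
      by (simp add: Phi_pure nu_sym_app[OF that nuA_mem[OF sA]] sg_gmul)
    show "Phi (x \<otimes> s) \<in> tensor_grading V N \<gamma>" if "x \<in> Gr lam \<gamma>" for \<gamma>
      unfolding Phi_pure by (rule nuA_Gr_tensor_grading[OF lp sA that])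
  next
    show "multiplicity_free_sum \<omega> V N Lam UL" by (rule UL_multiplicity_free)
  qed
qed

end
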